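(* Let $\varepsilon>0$ and $\delta>0$ be fixed. Suppose that $\varepsilon\le\zeta\le\frac\pi2-\varepsilon$ ($<\frac\pi2$) and let $\alpha,\beta\in\mathbb C$ be bounded. For non-negative integers $n,\ell$ define $$\zeta^{(3)}_{\nu,n,\ell}=(2\nu+\alpha+\beta+n+1)\zeta-\left(\alpha+\ell+\tfrac12\right)\tfrac\pi2,\qquad \zeta^{(4)}_{\nu,n,\ell}=(2\nu+\alpha+\beta+n+1)\zeta+\left(\alpha-\ell+\tfrac12\right)\tfrac\pi2 .$$ Then, as $\nu\to\infty$ in the sector $|\arg\nu|\le\pi-\delta$ ($<\pi$), $$\frac{\pi P_\nu^{(\alpha,\beta)}(\cos(2\zeta))}{2^{2\nu+\alpha+\beta+1}B(\nu+\alpha+1,\nu+\beta+1)}\sim\frac{1}{\sin^{\alpha+1/2}\zeta\cos^{\beta+1/2}\zeta}\sum_{n=0}^\infty(-1)^n\left(\sum_{\ell=0}^n\frac{a_\ell(\alpha)a_{n-\ell}(\beta)}{\sin^\ell\zeta\cos^{n-\ell}\zeta}\cos\left(\zeta^{(3)}_{\nu,n,\ell}\right)\right)\frac{\Gamma(2\nu+\alpha+\beta+2)}{\Gamma(2\nu+\alpha+\beta+n+2)},$$ $$\frac{\mathrm Q_\nu^{(\alpha,\beta)}(\cos(2\zeta))}{2^{2\nu+\alpha+\beta}B(\nu+\alpha+1,\nu+\beta+1)}\sim\frac{1}{\sin^{\alpha+1/2}\zeta\cos^{\beta+1/2}\zeta}\sum_{n=0}^\infty(-1)^n\left(\sum_{\ell=0}^n\frac{a_\ell(\alpha)a_{n-\ell}(\beta)}{\sin^\ell\zeta\cos^{n-\ell}\zeta}\cos\left(\zeta^{(4)}_{\nu,n,\ell}\right)\right)\frac{\Gamma(2\nu+\alpha+\beta+2)}{\Gamma(2\nu+\alpha+\beta+n+2)},$$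 $$\frac{\mathsf Q_\nu^{(\alpha,\beta)}(\cos(2\zeta))}{2^{2\nu+\alpha+\beta}B(\nu+\alpha+1,\nu+\beta+1)}\sim\frac{-1}{\sin^{\alpha+1/2}\zeta\cos^{\beta+1/2}\zeta}\sum_{n=0}^\infty(-1)^n\left(\sum_{\ell=0}^n\frac{a_\ell(\alpha)a_{n-\ell}(\beta)}{\sin^\ell\zeta\cos^{n-\ell}\zeta}\sin\left(\zeta^{(3)}_{\nu,n,\ell}\right)\right)\frac{\Gamma(2\nu+\alpha+\beta+2)}{\Gamma(2\nu+\alpha+\beta+n+2)}.$$
   Context: $\mathbf F\left({a,b\atop c};x\right)$ is the regularised hypergeometric function, $\sum_{n\ge0}\frac{(a)_n(b)_n}{\Gamma(c+n)\,n!}x^n$ for $|x|<1$, continued analytically to $x\in\mathbb C\setminus[1,\infty)$; $(w)_n=w(w+1)\cdots(w+n-1)$, $(w)_0=1$; $B$ is the beta function; $\mathbb Z^-=\{-1,-2,\dots\}$. The Jacobi functions are $$P_\nu^{(\alpha,\beta)}(z)=\frac{\Gamma(\nu+\alpha+1)}{\Gamma(\nu+1)}\mathbf F\left({-\nu,\nu+\alpha+\beta+1\atop \alpha+1};\frac{1-z}{2}\right),\quad z\in\mathbb C\setminus(-\infty,-1],\ \nu+\alpha\notin\mathbb Z^-,$$ $$Q_\nu^{(\alpha,\beta)}(z)=\frac{2^{\nu+\alpha+\beta}\Gamma(\nu+\alpha+1)\Gamma(\nu+\beta+1)}{(z-1)^{\nu+\alpha+1}(z+1)^\beta}\mathbf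 F\left({\nu+1,\nu+\alpha+1\atop 2\nu+\alpha+\beta+2};\frac{2}{1-z}\right),\quad z\in\mathbb C\setminus(-\infty,1],\ \nu+\alpha,\nu+\beta\notin\mathbb Z^-,$$ with principal powers. For $-1<x<1$ and $\nu+\alpha,\nu+\beta\notin\mathbb Z^-$ the associated functions are $$\mathrm Q_\nu^{(\alpha,\beta)}(x)=\lim_{\eta\to0^+}\tfrac12\left(Q_\nu^{(\alpha,\beta)}(x+i\eta)+Q_\nu^{(\alpha,\beta)}(x-i\eta)\right),$$ $$\mathsf Q_\nu^{(\alpha,\beta)}(x)=\lim_{\eta\to0^+}\tfrac12\left(e^{\pi\alpha i}Q_\nu^{(\alpha,\beta)}(x+i\eta)+e^{-\pi\alpha i}Q_\nu^{(\alpha,\beta)}(x-i\eta)\right).$$ Also $a_n(\mu)=\frac{(\frac12+\mu)_n(\frac12-\mu)_n}{(-2)^n n!}$. Meaning of $\sim$: for every non-negative integer $N$, the left-hand side equals the prefactor $\pm\sin^{-\alpha-1/2}\zeta\,\cos^{-\beta-1/2}\zeta$ times the sum of the first $N$ terms of the series plus an error term which is $O\left(|\nu|^{-N}e^{2\zeta|\Im\nu|}\right)$ as $\nu\to\infty$ in the stated sector, uniformly for $\zeta,\alpha,\beta$ in the stated ranges. *)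

theory Defs
  imports "HOL-Complex_Analysis.Complex_Analysis"
begin

text \<open>All functions below are total; their values carry meaning only for the arguments for which
  the respective notion is defined: \<open>x \<in> \<complex> \<setminus> [1,\<infinity>)\<close> for \<open>hyp_F\<close>,
  \<open>z \<in> \<complex> \<setminus> (-\<infinity>,-1]\<close> and \<open>\<nu> + \<alpha> \<notin> {-1,-2,\<dots>}\<close> for \<open>jacobi_P\<close>,
  \<open>z \<in> \<complex> \<setminus> (-\<infinity>,1]\<close> and \<open>\<nu> + \<alpha>, \<nu> + \<beta> \<notin> {-1,-2,\<dots>}\<close> for \<open>jacobi_Q\<close>, and
  \<open>-1 < x < 1\<close> with the same condition on the parameters for the two functions on the cut.\<close>

text \<open>The regularised hypergeometric function is the analytic continuation of its power series to
  the slit plane. By the identity theorem the function chosen is unique on the slit plane.\<close>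

definition hyp_F_series :: "complex \<Rightarrow> complex \<Rightarrow> complex \<Rightarrow> complex \<Rightarrow> complex" where
  "hyp_F_series a b c x =
     (\<Sum>n. pochhammer a n * pochhammer b n * rGamma (c + of_nat n) / fact n * x ^ n)"

definition hyp_F :: "complex \<Rightarrow> complex \<Rightarrow> complex \<Rightarrow> complex \<Rightarrow> complex" where
  "hyp_F a b c = (SOME f. f holomorphic_on (- complex_of_real ` {1..}) \<and>
                     (\<forall>x. norm x < 1 \<longrightarrow> f x = hyp_F_series a b c x))"

text \<open>The factor \<open>rGamma (\<nu> + 1)\<close> is \<open>1 / \<Gamma>(\<nu> + 1)\<close>, read as \<open>0\<close> at the poles of \<open>\<Gamma>\<close>.\<close>

definition jacobi_P :: "complex \<Rightarrow> complex \<Rightarrow> complex \<Rightarrow> complex \<Rightarrow> complex" where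
  "jacobi_P \<nu> \<alpha> \<beta> z =
     Gamma (\<nu> + \<alpha> + 1) * rGamma (\<nu> + 1) *
       hyp_F (- \<nu>) (\<nu> + \<alpha> + \<beta> + 1) (\<alpha> + 1) ((1 - z) / 2)"

definition jacobi_Q :: "complex \<Rightarrow> complex \<Rightarrow> complex \<Rightarrow> complex \<Rightarrow> complex" where
  "jacobi_Q \<nu> \<alpha> \<beta> z =
     2 powr (\<nu> + \<alpha> + \<beta>) * Gamma (\<nu> + \<alpha> + 1) * Gamma (\<nu> + \<beta> + 1) /
       ((z - 1) powr (\<nu> + \<alpha> + 1) * (z + 1) powr \<beta>) *
       hyp_F (\<nu> + 1) (\<nu> + \<alpha> + 1) (2 * \<nu> + \<alpha> + \<beta> + 2) (2 / (1 - z))"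

text \<open>The two associated functions on the cut: \<open>jacobi_Q_cut\<close> is the upright \<open>Q\<close>, the plain average
  of the two boundary values, and \<open>jacobi_Q_cut_phase\<close> is the sans-serif \<open>Q\<close>, the average
  weighted with \<open>e\<^sup>\<plusminus>\<^sup>\<pi>\<^sup>\<alpha>\<^sup>i\<close>.\<close>

definition jacobi_Q_cut :: "complex \<Rightarrow> complex \<Rightarrow> complex \<Rightarrow> real \<Rightarrow> complex" where
  "jacobi_Q_cut \<nu> \<alpha> \<beta> x =
     Lim (at_right 0) (\<lambda>\<eta>::real.
       1/2 * (jacobi_Q \<nu> \<alpha> \<beta> (of_real x + \<i> * of_real \<eta>) +
              jacobi_Q \<nu> \<alpha> \<beta> (of_real x - \<i> * of_real \<eta>)))"

definition jacobi_Q_cut_phase :: "complex \<Rightarrow> complex \<Rightarrow> complex \<Rightarrow> real \<Rightarrow> complex" where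
  "jacobi_Q_cut_phase \<nu> \<alpha> \<beta> x =
     Lim (at_right 0) (\<lambda>\<eta>::real.
       1/2 * (exp (of_real pi * \<alpha> * \<i>) * jacobi_Q \<nu> \<alpha> \<beta> (of_real x + \<i> * of_real \<eta>) +
              exp (- (of_real pi * \<alpha> * \<i>)) * jacobi_Q \<nu> \<alpha> \<beta> (of_real x - \<i> * of_real \<eta>)))"

definition jacobi_coeff :: "nat \<Rightarrow> complex \<Rightarrow> complex" where
  "jacobi_coeff n \<mu> = pochhammer (1/2 + \<mu>) n * pochhammer (1/2 - \<mu>) n / ((-2) ^ n * fact n)"

definition zeta3 :: "complex \<Rightarrow> complex \<Rightarrow> complex \<Rightarrow> real \<Rightarrow> nat \<Rightarrow> nat \<Rightarrow> complex" where
  "zeta3 \<nu> \<alpha> \<beta> \<zeta> n l =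
     (2 * \<nu> + \<alpha> + \<beta> + of_nat n + 1) * of_real \<zeta> - (\<alpha> + of_nat l + 1/2) * (of_real pi / 2)"

definition zeta4 :: "complex \<Rightarrow> complex \<Rightarrow> complex \<Rightarrow> real \<Rightarrow> nat \<Rightarrow> nat \<Rightarrow> complex" where
  "zeta4 \<nu> \<alpha> \<beta> \<zeta> n l =
     (2 * \<nu> + \<alpha> + \<beta> + of_nat n + 1) * of_real \<zeta> + (\<alpha> - of_nat l + 1/2) * (of_real pi / 2)"

text \<open>\<open>uniform_expansion \<epsilon> \<delta> M L A T\<close> is the relation \<open>L \<sim> A \<cdot> (\<Sum>n. T n)\<close> as \<open>\<nu> \<rightarrow> \<infinity>\<close> in the
  sector \<open>\<bar>arg \<nu>\<bar> \<le> \<pi> - \<delta>\<close>: for every \<open>N\<close>, truncating after \<open>N\<close> terms leaves an error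
  \<open>O(\<bar>\<nu>\<bar>\<^sup>-\<^sup>N e\<^sup>2\<^sup>\<zeta>\<^sup>\<bar>\<^sup>I\<^sup>m\<^sup>\<nu>\<^sup>\<bar>)\<close>, uniformly for \<open>\<epsilon> \<le> \<zeta> \<le> \<pi>/2 - \<epsilon>\<close> and
  \<open>\<bar>\<alpha>\<bar>, \<bar>\<beta>\<bar> \<le> M\<close>; here \<open>C\<close> and \<open>R\<close> may depend on \<open>N, \<epsilon>, \<delta>, M\<close> only.\<close>

definition uniform_expansion ::
  "real \<Rightarrow> real \<Rightarrow> real \<Rightarrow>
   (complex \<Rightarrow> complex \<Rightarrow> complex \<Rightarrow> real \<Rightarrow> complex) \<Rightarrow>
   (complex \<Rightarrow> complex \<Rightarrow> real \<Rightarrow> complex) \<Rightarrow>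
   (nat \<Rightarrow> complex \<Rightarrow> complex \<Rightarrow> complex \<Rightarrow> real \<Rightarrow> complex) \<Rightarrow> bool" where
  "uniform_expansion \<epsilon> \<delta> M L A T \<longleftrightarrow>
     (\<forall>N. \<exists>C R. \<forall>\<nu> \<alpha> \<beta> \<zeta>.
        norm \<nu> \<ge> R \<and> \<bar>Arg \<nu>\<bar> \<le> pi - \<delta> \<and> norm \<alpha> \<le> M \<and> norm \<beta> \<le> M \<and>
        \<epsilon> \<le> \<zeta> \<and> \<zeta> \<le> pi / 2 - \<epsilon> \<longrightarrow>
        norm (L \<nu> \<alpha> \<beta> \<zeta> - A \<alpha> \<beta> \<zeta> * (\<Sum>n<N. T n \<nu> \<alpha> \<beta> \<zeta>))
          \<le> C * (exp (2 * \<zeta> * \<bar>Im \<nu>\<bar>) / norm \<nu> ^ N))"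

end

theory Submission
  imports Defs
begin

text \<open>Put \<open>q = e\<^sup>2\<^sup>i\<^sup>z\<close> and \<open>\<lambda> = 2 \<nu> + \<alpha> + \<beta> + 1\<close>. Up to elementary factors \<open>Q\<^sub>\<nu>(cos 2z)\<close> is \<open>q\<^sup>\<lambda>\<^sup>/\<^sup>2 G(q)\<close>,
  where \<open>G\<close> is the solution, regular at \<open>0\<close>, of the Fuchsian equation \<open>\<theta>\<^sup>2 G + \<lambda> \<theta> G = v G\<close>, \<open>\<theta> = q d/dq\<close>;
  this is the Koebe substitution \<open>x = -4 q / (1 - q)\<^sup>2\<close> in the hypergeometric function, and it makes \<open>G\<close>
  holomorphic in the whole unit disc. The functions \<open>C\<^sub>n\<close> formed from the coefficients \<open>a\<^sub>l(\<alpha>) a\<^sub>n\<^sub>-\<^sub>l(\<beta>)\<close> satisfy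
  \<open>(\<theta>\<^sup>2 + \<lambda> \<theta> - v) C\<^sub>n = (\<lambda> + n) \<theta> C\<^sub>n + \<theta> C\<^sub>n\<^sub>+\<^sub>1\<close>, so the sums \<open>(\<Sum>n<N. (-1)\<^sup>n C\<^sub>n / (\<lambda> + 1)\<^sub>n)\<close> solve the
  equation up to a single term. Integrating along spirals \<open>q e\<^sup>-\<^sup>\<omega>\<^sup>s\<close> into the origin bounds the remainder by
  \<open>O(\<bar>\<lambda>\<bar>\<^sup>-\<^sup>N)\<close>, uniformly up to the unit circle away from \<open>\<plusminus>1\<close>; the boundary values on the circle give both
  associated functions on the cut. For \<open>\<alpha> \<notin> \<int>\<close> the connection formula
  \<open>e\<^sup>i\<^sup>\<pi>\<^sup>\<alpha> Q\<^sub>+ - e\<^sup>-\<^sup>i\<^sup>\<pi>\<^sup>\<alpha> Q\<^sub>- = - i \<pi> P\<close> then yields \<open>P\<close>. Its coefficient comes from constancy of Wronskians and Gauss's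
  summation when \<open>Re \<alpha> < 0\<close>, and from differentiation otherwise; integer \<open>\<alpha>\<close> follow by continuity.\<close>

section \<open>A Fuchsian equation in the unit disc\<close>

text \<open>The defining series of \<open>jacobi_Q\<close> lives in the variable 2 / (1 - z), and -1
  < z < 1 lands exactly on the slit [1, \<infinity>) where its continuation stops. The Koebe map
  opens this slit: its two sides become the two open unit semicircles, on which the equation for G
  is regular. Only q = 1 and q = -1 stay singular, that is \<zeta> = 0 and \<zeta> = pi/2, whence
  the margin \<epsilon>. Since v vanishes at q = 0, the perturbation decays exponentially in s and
  is integrable down to the origin, uniformly in bounded \<alpha> and \<beta>. The obstacle is the
  sector. For Re \<nu> < 0 the kernel e^(-\<lambda> s) of a radial path grows; turning the path by
  half the argument of \<nu> keeps both \<omega> and \<lambda> \<omega> in the right half-plane, at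
  the price of a decay rate sin (\<delta>/2). The same rotation keeps \<lambda> away from the
  negative integers, where the recursion for G breaks down. The connection coefficient has poles at
  integer \<alpha>, but the constants of the error bound do not depend on \<alpha>; so the bound
  survives a limit through non-integer parameters, taken inside the larger range M + 1.\<close>

definition theta_op :: "(complex \<Rightarrow> complex) \<Rightarrow> complex \<Rightarrow> complex" where
  "theta_op f q = q * deriv f q"

text \<open>With q = e^(2iz) this is -1/4 times (\<alpha>^2 - 1/4) / sin^2 z + (\<beta>^2 - 1/4) /
  cos^2 z, the Poeschl-Teller potential of Jacobi's equation in Liouville normal form.\<close>

definition jac_v :: "complex \<Rightarrow> complex \<Rightarrow> complex \<Rightarrow> complex" where
  "jac_v \<alpha> \<beta> q = (\<alpha>\<^sup>2 - 1/4) * q / (1 - q)\<^sup>2 + (1/4 - \<beta>\<^sup>2) * q / (1 + q)\<^sup>2"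

definition jac_v_fps :: "complex \<Rightarrow> complex \<Rightarrow> complex fps" where
  "jac_v_fps \<alpha> \<beta> = Abs_fps (\<lambda>k. ((\<alpha>\<^sup>2 - 1/4) - (1/4 - \<beta>\<^sup>2) * (-1) ^ k) * of_nat k)"

text \<open>Comparing coefficients in \<open>\<theta>\<^sup>2 G + l \<theta> G = v G\<close>, where \<open>\<theta> = q d/dq\<close>, gives
  \<open>n (n + l) g\<^sub>n = (\<Sum>k<n. v\<^sub>n\<^sub>-\<^sub>k g\<^sub>k)\<close>. The recursion is meaningless for negative integers \<open>l\<close>.\<close>

fun fuchs_coeff :: "complex \<Rightarrow> (nat \<Rightarrow> complex) \<Rightarrow> nat \<Rightarrow> complex" where
  "fuchs_coeff l v n = (if n = 0 then 1 else
     (\<Sum>k<n. v (n - k) * fuchs_coeff l v k) / (of_nat n * (of_nat n + l)))"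

declare fuchs_coeff.simps [simp del]

definition jac_fps :: "complex \<Rightarrow> complex \<Rightarrow> complex \<Rightarrow> complex fps" where
  "jac_fps l \<alpha> \<beta> = Abs_fps (fuchs_coeff l (fps_nth (jac_v_fps \<alpha> \<beta>)))"

definition jac_G :: "complex \<Rightarrow> complex \<Rightarrow> complex \<Rightarrow> complex \<Rightarrow> complex" where
  "jac_G l \<alpha> \<beta> = eval_fps (jac_fps l \<alpha> \<beta>)"

abbreviation neg_ints :: "complex set" where
  "neg_ints \<equiv> {- of_nat n |n. n > (0::nat)}"

lemma fps_conv_radius_ge_1I:
  fixes f :: "complex fps"
  assumes "\<And>r. 0 < r \<Longrightarrow> r < 1 \<Longrightarrow> \<exists>K. \<forall>n. norm (fps_nth f n) * r ^ n \<le> K"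
  shows "fps_conv_radius f \<ge> 1"
  unfolding fps_conv_radius_def
proof (rule conv_radius_geI_ex)
  fix r :: real assume r: "r > 0" "ereal r < 1"
  hence r1: "r < 1" by simp
  obtain K where K: "\<And>n. norm (fps_nth f n) * ((r + 1) / 2) ^ n \<le> K"
    using assms[of "(r + 1) / 2"] r r1 by auto
  have "summable (\<lambda>n. norm (fps_nth f n) * r ^ n)"
    by (rule Abel_lemma[of r "(r + 1) / 2" _ K]) (use r r1 K in auto)
  hence "summable (\<lambda>n. norm (fps_nth f n * of_real r ^ n))"
    using r by (simp add: norm_mult norm_power)
  hence "summable (\<lambda>n. fps_nth f n * of_real r ^ n)" by (rule summable_norm_cancel)
  thus "\<exists>z. norm z = r \<and> summable (\<lambda>n. fps_nth f n * z ^ n)"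
    using r by (intro exI[of _ "of_real r"]) auto
qed

text \<open>With S the sum of k r^k, the convolution is at most c S times a bound for the earlier
  terms. Beyond n0 the divisor n (n + l) has modulus at least c S + 1, so no later term can exceed
  the sum K of the terms up to n0.\<close>

lemma fuchs_coeff_bound:
  assumes v: "\<And>k. norm (v k) \<le> c * of_nat k" and r: "0 < r" "r < 1"
  shows "\<exists>K. \<forall>n. norm (fuchs_coeff l v n) * r ^ n \<le> K"
proof -
  let ?g = "fuchs_coeff l v"
  have c: "c \<ge> 0" using order_trans[OF norm_ge_zero v[of 1]] by simp
  define S where "S = (\<Sum>k. of_nat k * r ^ k)"
  have smry: "summable (\<lambda>k. of_nat (Suc k) * r ^ k)"
    using geometric_deriv_sums[of r] r by (auto simp: sums_iff)
  have "summable (\<lambda>k. of_nat k * r ^ k)"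
    by (rule summable_comparison_test'[OF smry, of 0])
       (use r in \<open>auto simp: algebra_simps\<close>)
  hence sumle: "(\<Sum>k\<in>A. of_nat k * r ^ k) \<le> S" if "finite A" for A
    unfolding S_def by (intro sum_le_suminf) (use that r in auto)
  have S0: "S \<ge> 0" using sumle[of "{}"] by simp
  obtain n0 where n0: "real n0 \<ge> c * S + norm l + 1" using real_arch_simple by blast
  define K where "K = (\<Sum>k\<le>n0. norm (?g k) * r ^ k)"
  have K0: "K \<ge> 0" unfolding K_def using r by (intro sum_nonneg) auto
  have "norm (?g n) * r ^ n \<le> K" for n
  proof (induction n rule: less_induct)
    case (less n)
    show ?case
    proof (cases "n \<le> n0")
      case True
      thus ?thesis unfolding K_def using r
        by (intro member_le_sum[of n _ "\<lambda>k. norm (?g k) * r ^ k"]) auto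
    next
      case False
      hence n: "n > n0" "n > 0" by auto
      have nn: "norm (of_nat n + l) \<ge> c * S + 1"
      proof -
        have "norm (of_nat n + l) \<ge> real n - norm l"
          using norm_diff_ineq[of "of_nat n" l] by simp
        moreover have "real n > real n0" using n by simp
        ultimately show ?thesis using n0 by linarith
      qed
      have cS: "c * S \<ge> 0" using c S0 by simp
      have den: "norm (of_nat n * (of_nat n + l)) \<ge> c * S + 1"
      proof -
        have "1 * (c * S + 1) \<le> real n * norm (of_nat n + l)"
          by (rule mult_mono) (use n nn cS in auto)
        thus ?thesis by (simp add: norm_mult)
      qed
      have "norm (\<Sum>k<n. v (n - k) * ?g k) * r ^ n \<le> (\<Sum>k<n. norm (v (n - k) * ?g k)) * r ^ n"
        by (intro mult_right_mono norm_sum) (use r in auto)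
      also have "\<dots> = (\<Sum>k<n. (norm (v (n - k)) * r ^ (n - k)) * (norm (?g k) * r ^ k))"
        unfolding sum_distrib_right
      proof (rule sum.cong[OF refl])
        fix k assume "k \<in> {..<n}"
        hence "r ^ n = r ^ (n - k) * r ^ k" by (simp flip: power_add)
        thus "norm (v (n - k) * ?g k) * r ^ n
              = (norm (v (n - k)) * r ^ (n - k)) * (norm (?g k) * r ^ k)"
          by (simp add: norm_mult)
      qed
      also have "\<dots> \<le> (\<Sum>k<n. (c * (of_nat (n - k) * r ^ (n - k))) * K)"
      proof (rule sum_mono)
        fix k assume "k \<in> {..<n}"
        hence gk: "norm (?g k) * r ^ k \<le> K" using less.IH[of k] by simp
        have "norm (v (n - k)) * r ^ (n - k) \<le> c * of_nat (n - k) * r ^ (n - k)"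
          by (intro mult_right_mono v) (use r in auto)
        hence vk: "norm (v (n - k)) * r ^ (n - k) \<le> c * (of_nat (n - k) * r ^ (n - k))"
          by (simp only: mult.assoc)
        show "(norm (v (n - k)) * r ^ (n - k)) * (norm (?g k) * r ^ k)
              \<le> (c * (of_nat (n - k) * r ^ (n - k))) * K"
          by (rule mult_mono[OF vk gk]) (use c r in auto)
      qed
      also have "\<dots> = c * K * (\<Sum>k<n. of_nat (n - k) * r ^ (n - k))"
        by (simp add: sum_distrib_left mult_ac)
      also have "(\<Sum>k<n. of_nat (n - k) * r ^ (n - k)) = (\<Sum>k\<in>{1..n}. of_nat k * r ^ k)"
        by (rule sum.reindex_bij_witness[of _ "\<lambda>k. n - k" "\<lambda>k. n - k"]) auto
      also have "c * K * \<dots> \<le> c * K * S"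
        by (intro mult_left_mono sumle) (use c K0 in auto)
      also have "\<dots> \<le> K * (c * S + 1)" using K0 by (simp add: algebra_simps)
      also have "\<dots> \<le> K * norm (of_nat n * (of_nat n + l))"
        by (intro mult_left_mono den K0)
      finally have "norm (\<Sum>k<n. v (n - k) * ?g k) * r ^ n
           \<le> K * norm (of_nat n * (of_nat n + l))" .
      moreover have "norm (of_nat n * (of_nat n + l)) > 0" using den cS by linarith
      ultimately show ?thesis
        using n by (subst fuchs_coeff.simps) (simp add: norm_divide divide_simps)
    qed
  qed
  thus ?thesis by blast
qed

lemma jac_v_fps_bound:
  "norm (fps_nth (jac_v_fps \<alpha> \<beta>) k) \<le> (norm (\<alpha>\<^sup>2 - 1/4) + norm (1/4 - \<beta>\<^sup>2)) * of_nat k"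
  unfolding jac_v_fps_def fps_nth_Abs_fps norm_mult
  by (rule mult_mono) (auto intro: order.trans[OF norm_triangle_ineq4] simp: norm_mult norm_power)

lemma conv_radius_jac_fps: "fps_conv_radius (jac_fps l \<alpha> \<beta>) \<ge> 1"
  by (rule fps_conv_radius_ge_1I)
     (auto simp: jac_fps_def intro!: fuchs_coeff_bound jac_v_fps_bound)

lemma in_eball_conv_radius_ge_1:
  assumes "norm (z::complex) < 1" "R \<ge> (1::ereal)"
  shows "ereal (norm z) < R"
  using assms by (metis ereal_less(3) less_ereal.simps(1) one_ereal_def order_less_le_trans)

lemma norm_lt_conv_radius_jac: "norm (q :: complex) < 1 \<Longrightarrow> ereal (norm q) < fps_conv_radius (jac_fps l \<alpha> \<beta>)"
  using conv_radius_jac_fps in_eball_conv_radius_ge_1 by blast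

lemma jac_v_sums:
  assumes "norm q < 1"
  shows "(\<lambda>k. fps_nth (jac_v_fps \<alpha> \<beta>) k * q ^ k) sums jac_v \<alpha> \<beta> q"
proof -
  have *: "(\<lambda>k. of_nat k * z ^ k) sums (z / (1 - z)\<^sup>2)" if "norm z < 1" for z :: complex
  proof -
    have "(\<lambda>k. z * (of_nat (Suc k) * z ^ k)) sums (z * (1 / (1 - z)\<^sup>2))"
      by (intro sums_mult geometric_deriv_sums that)
    hence "(\<lambda>k. of_nat (Suc k) * z ^ (Suc k)) sums (z / (1 - z)\<^sup>2)"
      by (simp add: mult_ac)
    thus ?thesis by (subst (asm) sums_Suc_iff) simp
  qed
  have "(\<lambda>k. (\<alpha>\<^sup>2 - 1/4) * (of_nat k * q ^ k) - (1/4 - \<beta>\<^sup>2) * (of_nat k * (-q) ^ k))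
     sums ((\<alpha>\<^sup>2 - 1/4) * (q / (1 - q)\<^sup>2) - (1/4 - \<beta>\<^sup>2) * ((-q) / (1 - (-q))\<^sup>2))"
    by (intro sums_diff sums_mult *) (use assms in auto)
  moreover have "(\<alpha>\<^sup>2 - 1/4) * (of_nat k * q ^ k) - (1/4 - \<beta>\<^sup>2) * (of_nat k * (-q) ^ k) =
     fps_nth (jac_v_fps \<alpha> \<beta>) k * q ^ k" for k
    by (subst power_minus) (simp add: jac_v_fps_def algebra_simps)
  moreover have "(\<alpha>\<^sup>2 - 1/4) * (q / (1 - q)\<^sup>2) - (1/4 - \<beta>\<^sup>2) * ((-q) / (1 - (-q))\<^sup>2) = jac_v \<alpha> \<beta> q"
    by (simp add: jac_v_def)
  ultimately show ?thesis by simp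
qed

lemma jac_v_has_fps_expansion: "jac_v \<alpha> \<beta> has_fps_expansion jac_v_fps \<alpha> \<beta>"
proof (rule has_fps_expansionI)
  have "eventually (\<lambda>q::complex. q \<in> ball 0 1) (nhds 0)"
    by (intro eventually_nhds_in_open) auto
  thus "eventually (\<lambda>q. (\<lambda>n. fps_nth (jac_v_fps \<alpha> \<beta>) n * q ^ n) sums jac_v \<alpha> \<beta> q) (nhds 0)"
    by eventually_elim (use jac_v_sums in auto)
qed

lemma conv_radius_jac_v_fps: "fps_conv_radius (jac_v_fps \<alpha> \<beta>) \<ge> 1"
  unfolding fps_conv_radius_def
proof (rule conv_radius_geI_ex)
  fix r :: real assume r: "r > 0" "ereal r < 1"
  thus "\<exists>z. norm z = r \<and> summable (\<lambda>n. fps_nth (jac_v_fps \<alpha> \<beta>) n * z ^ n)"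
    using jac_v_sums[of "of_real r" \<alpha> \<beta>]
    by (intro exI[of _ "of_real r"]) (auto simp: sums_iff)
qed

lemma eval_jac_v_fps: "norm q < 1 \<Longrightarrow> eval_fps (jac_v_fps \<alpha> \<beta>) q = jac_v \<alpha> \<beta> q"
  using jac_v_sums[of q \<alpha> \<beta>] by (simp add: eval_fps_def sums_iff)

lemma fps_conv_radius_XD: 
  fixes f :: "complex fps" shows "fps_conv_radius (fps_XD f) \<ge> fps_conv_radius f"
  unfolding fps_XD_def o_def
  using fps_conv_radius_mult[of fps_X "fps_deriv f"] fps_conv_radius_deriv[of f] by simp

lemma eval_fps_XD:
  assumes "ereal (norm q) < fps_conv_radius (f :: complex fps)"
  shows "eval_fps (fps_XD f) q = theta_op (eval_fps f) q"
proof -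
  have "eval_fps (fps_XD f) q = q * eval_fps (fps_deriv f) q"
    unfolding fps_XD_def o_def
    by (subst eval_fps_mult) (use assms fps_conv_radius_deriv[of f] in \<open>auto intro: less_le_trans\<close>)
  also have "eval_fps (fps_deriv f) q = deriv (eval_fps f) q"
    using assms by (intro eval_fps_deriv) 
  finally show ?thesis by (simp add: theta_op_def)
qed

lemma theta_op_cong:
  assumes "open S" "q \<in> S" "\<And>z. z \<in> S \<Longrightarrow> f z = g z"
  shows "theta_op f q = theta_op g q"
  unfolding theta_op_def
  by (intro arg_cong2[where f="(*)"] refl deriv_cong_ev)
     (use assms in \<open>auto intro: eventually_mono[OF eventually_nhds_in_open]\<close>)

lemma holomorphic_theta_op:
  assumes "open S" "f holomorphic_on S" shows "theta_op f holomorphic_on S"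
proof -
  have "(\<lambda>q. q * deriv f q) holomorphic_on S"
    by (intro holomorphic_intros assms holomorphic_deriv)
  moreover have "theta_op f = (\<lambda>q. q * deriv f q)" by (auto simp: theta_op_def)
  ultimately show ?thesis by simp
qed

lemma eval_fps_XD_XD:
  assumes "ereal (norm q) < fps_conv_radius (f :: complex fps)"
  shows "eval_fps (fps_XD (fps_XD f)) q = theta_op (theta_op (eval_fps f)) q"
proof -
  have "eval_fps (fps_XD (fps_XD f)) q = theta_op (eval_fps (fps_XD f)) q"
    using assms fps_conv_radius_XD[of f] by (intro eval_fps_XD) (auto intro: less_le_trans)
  also have "\<dots> = theta_op (theta_op (eval_fps f)) q"
    by (rule theta_op_cong[OF open_eball[of 0 "fps_conv_radius f"]])
       (use assms in \<open>auto simp: eval_fps_XD\<close>)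
  finally show ?thesis .
qed

lemma jac_fps_ode:
  fixes \<alpha> \<beta> :: complex
  assumes "l \<notin> neg_ints"
  defines "g \<equiv> jac_fps l \<alpha> \<beta>"
  shows "fps_XD (fps_XD g) + fps_const l * fps_XD g = jac_v_fps \<alpha> \<beta> * g"
proof (rule fps_ext)
  fix n
  let ?v = "fps_nth (jac_v_fps \<alpha> \<beta>)"
  have v0: "?v 0 = 0" by (simp add: jac_v_fps_def)
  show "fps_nth (fps_XD (fps_XD g) + fps_const l * fps_XD g) n = fps_nth (jac_v_fps \<alpha> \<beta> * g) n"
  proof (cases "n = 0")
    case False
    have "of_nat n + l \<noteq> 0" using assms(1) False by (auto simp: add_eq_0_iff)
    hence "of_nat n * (of_nat n + l) * fps_nth g n = (\<Sum>k<n. ?v (n - k) * fps_nth g k)"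
      using False unfolding g_def jac_fps_def
      by (subst (1) fps_nth_Abs_fps, subst fuchs_coeff.simps) simp
    also have "\<dots> = (\<Sum>k\<le>n. ?v (n - k) * fps_nth g k)"
      by (simp add: v0 flip: lessThan_Suc_atMost)
    also have "\<dots> = (\<Sum>k\<le>n. ?v k * fps_nth g (n - k))"
      by (rule sum.reindex_bij_witness[of _ "\<lambda>k. n - k" "\<lambda>k. n - k"]) auto
    finally have "of_nat n * (of_nat n + l) * fps_nth g n = fps_nth (jac_v_fps \<alpha> \<beta> * g) n"
      by (simp add: fps_mult_nth atLeast0AtMost)
    moreover have "fps_nth (fps_XD (fps_XD g) + fps_const l * fps_XD g) n
        = of_nat n * (of_nat n + l) * fps_nth g n"
      by (simp only: fps_add_nth fps_mult_left_const_nth fps_XD_nth) (simp add: algebra_simps)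
    ultimately show ?thesis by simp
  qed (simp add: v0)
qed

lemma jac_G_holomorphic: "jac_G l \<alpha> \<beta> holomorphic_on ball 0 1"
  unfolding jac_G_def
  by (intro holomorphic_intros) (use conv_radius_jac_fps in \<open>auto simp: in_eball_conv_radius_ge_1\<close>)

lemma jac_G_0 [simp]: "jac_G l \<alpha> \<beta> 0 = 1"
  by (simp add: jac_G_def eval_fps_at_0 jac_fps_def fuchs_coeff.simps)

lemma jac_G_ode:
  fixes \<alpha> \<beta> :: complex
  assumes "l \<notin> neg_ints" "norm q < 1"
  defines "G \<equiv> jac_G l \<alpha> \<beta>"
  shows "theta_op (theta_op G) q + l * theta_op G q = jac_v \<alpha> \<beta> q * G q"
proof -
  let ?g = "jac_fps l \<alpha> \<beta>"
  note c = norm_lt_conv_radius_jac[OF assms(2), of l \<alpha> \<beta>]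
  note c1 = less_le_trans[OF c fps_conv_radius_XD]
  note c2 = less_le_trans[OF c1 fps_conv_radius_XD]
  have cv: "ereal (norm q) < fps_conv_radius (jac_v_fps \<alpha> \<beta>)"
    using conv_radius_jac_v_fps assms(2) in_eball_conv_radius_ge_1 by blast
  have "eval_fps (fps_XD (fps_XD ?g) + fps_const l * fps_XD ?g) q =
        eval_fps (fps_XD (fps_XD ?g)) q + l * eval_fps (fps_XD ?g) q"
    using c c1 c2 fps_conv_radius_mult[of "fps_const l" "fps_XD ?g"]
    by (subst eval_fps_add) (auto simp: eval_fps_mult intro: less_le_trans)
  hence "eval_fps (fps_XD (fps_XD ?g) + fps_const l * fps_XD ?g) q =
        theta_op (theta_op G) q + l * theta_op G q"
    unfolding eval_fps_XD_XD[OF c] eval_fps_XD[OF c] by (simp add: G_def jac_G_def)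
  moreover have "eval_fps (jac_v_fps \<alpha> \<beta> * ?g) q = jac_v \<alpha> \<beta> q * G q"
    by (subst eval_fps_mult) (use c cv assms(2) in \<open>auto simp: eval_jac_v_fps G_def jac_G_def\<close>)
  ultimately show ?thesis using jac_fps_ode[OF assms(1), of \<alpha> \<beta>] by simp
qed

lemma has_fps_expansion_theta_op:
  assumes "f has_fps_expansion F" shows "theta_op f has_fps_expansion fps_XD F"
proof -
  have "(\<lambda>q. q * deriv f q) has_fps_expansion fps_X * fps_deriv F"
    by (intro fps_expansion_intros assms)
  thus ?thesis by (simp add: theta_op_def[abs_def] fps_XD_def)
qed

text \<open>The exponents at q = 0 are 0 and -l. Comparing coefficients of a holomorphic solution
  gives n (n + l) times the n-th one as a combination of earlier ones, and n + l never vanishes for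
  n > 0; so a zero constant term annihilates all others.\<close>

lemma fuchs_ode_unique:
  assumes l: "l \<notin> neg_ints" and r: "r > 0" and H: "H holomorphic_on ball 0 r" and H0: "H 0 = 0"
    and ode: "\<And>q. norm q < r \<Longrightarrow> theta_op (theta_op H) q + l * theta_op H q = jac_v \<alpha> \<beta> q * H q"
    and q: "norm q < r"
  shows "H q = 0"
proof -
  define h where "h = fps_expansion H 0"
  have h: "H has_fps_expansion h"
    unfolding h_def using r H by (intro has_fps_expansion_fps_expansion[of "ball 0 r"]) auto
  have "(\<lambda>q. theta_op (theta_op H) q + l * theta_op H q) has_fps_expansion
          fps_XD (fps_XD h) + fps_const l * fps_XD h"
    by (intro fps_expansion_intros has_fps_expansion_theta_op h)
  moreover have "(\<lambda>q. jac_v \<alpha> \<beta> q * H q) has_fps_expansion jac_v_fps \<alpha> \<beta> * h"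
    by (intro fps_expansion_intros jac_v_has_fps_expansion h)
  moreover have "eventually (\<lambda>q. q \<in> ball 0 r) (nhds (0::complex))"
    using r by (intro eventually_nhds_in_open) auto
  hence "eventually (\<lambda>q. theta_op (theta_op H) q + l * theta_op H q = jac_v \<alpha> \<beta> q * H q) (nhds 0)"
    by eventually_elim (use ode in auto)
  ultimately have "(\<lambda>q. theta_op (theta_op H) q + l * theta_op H q) has_fps_expansion jac_v_fps \<alpha> \<beta> * h"
    and *: "(\<lambda>q. theta_op (theta_op H) q + l * theta_op H q) has_fps_expansion
          fps_XD (fps_XD h) + fps_const l * fps_XD h"
    by (auto cong: has_fps_expansion_cong)
  hence eq: "fps_XD (fps_XD h) + fps_const l * fps_XD h = jac_v_fps \<alpha> \<beta> * h"
    using fps_expansion_unique_complex by blast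
  have "fps_nth h n = 0" for n
  proof (induction n rule: less_induct)
    case (less n)
    show ?case
    proof (cases "n = 0")
      case True
      have "fps_nth h 0 = H 0" using h by (simp add: has_fps_expansion_imp_0_eq_fps_nth_0)
      thus ?thesis using H0 True by simp
    next
      case False
      have "of_nat n * (of_nat n + l) * fps_nth h n = fps_nth (jac_v_fps \<alpha> \<beta> * h) n"
        unfolding eq[symmetric]
        by (simp only: fps_add_nth fps_mult_left_const_nth fps_XD_nth) (simp add: algebra_simps)
      also have "\<dots> = (\<Sum>i=0..n. fps_nth (jac_v_fps \<alpha> \<beta>) i * fps_nth h (n - i))"
        by (simp add: fps_mult_nth)
      also have "\<dots> = 0"
      proof (rule sum.neutral, rule ballI)
        fix i assume "i \<in> {0..n}"
        thus "fps_nth (jac_v_fps \<alpha> \<beta>) i * fps_nth h (n - i) = 0"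
          using less.IH[of "n - i"] False by (cases "i = 0") (auto simp: jac_v_fps_def)
      qed
      moreover have "of_nat n + l \<noteq> 0" using l False by (auto simp: add_eq_0_iff)
      ultimately show ?thesis using False by simp
    qed
  qed
  hence "h = 0" by (simp add: fps_eq_iff)
  have holo: "H holomorphic_on eball 0 (ereal r)" using H by simp
  have "eval_fps h q = H q"
    using eval_fps_expansion'[OF holo, of q] q by (simp add: h_def)
  thus ?thesis using \<open>h = 0\<close> by simp
qed

section \<open>The hypergeometric series and its Koebe transform\<close>

definition hyp_fps :: "complex \<Rightarrow> complex \<Rightarrow> complex \<Rightarrow> complex fps" where
  "hyp_fps a b c = Abs_fps (\<lambda>n. pochhammer a n * pochhammer b n * rGamma (c + of_nat n) / fact n)"

lemma hyp_F_series_eq: "hyp_F_series a b c = eval_fps (hyp_fps a b c)"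
  by (simp add: fun_eq_iff hyp_F_series_def eval_fps_def hyp_fps_def)

text \<open>The form without division stays true at c + n = 0, where the regularised coefficient of
  index n vanishes.\<close>

lemma hyp_fps_Suc:
  "(of_nat n + 1) * (c + of_nat n) * fps_nth (hyp_fps a b c) (Suc n) =
     (a + of_nat n) * (b + of_nat n) * fps_nth (hyp_fps a b c) n"
proof -
  have "rGamma (c + of_nat n) = (c + of_nat n) * rGamma (c + of_nat (Suc n))"
    using rGamma_plus1[of "c + of_nat n"] by (simp add: add_ac)
  thus ?thesis
    by (simp add: hyp_fps_def pochhammer_Suc divide_simps del: of_nat_Suc) (simp add: algebra_simps)
qed

lemma conv_radius_hyp_fps: "fps_conv_radius (hyp_fps a b c) \<ge> 1"
  unfolding fps_conv_radius_def
proof (rule conv_radius_geI_ex)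
  fix r :: real assume r: "r > 0" "ereal r < 1"
  hence r1: "r < 1" by simp
  let ?f = "fps_nth (hyp_fps a b c)"
  define \<rho> where "\<rho> = (\<lambda>n. (a + of_nat n) * (b + of_nat n) / ((of_nat n + 1) * (c + of_nat n)))"
  have lim: "(\<lambda>n. (d + of_nat n) / of_nat n) \<longlonglongrightarrow> (1::complex)" for d
  proof -
    have "(\<lambda>n. d / of_nat n + 1) \<longlonglongrightarrow> 0 + 1"
      by (intro tendsto_intros lim_const_over_n)
    moreover have "eventually (\<lambda>n. d / of_nat n + 1 = (d + of_nat n) / of_nat n) sequentially"
      using eventually_gt_at_top[of 0] by eventually_elim (simp add: field_simps)
    ultimately show ?thesis by (auto dest: Lim_transform_eventually)
  qed
  have "(\<lambda>n. ((a + of_nat n) / of_nat n) * ((b + of_nat n) / of_nat n) /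
          (((1 + of_nat n) / of_nat n) * ((c + of_nat n) / of_nat n))) \<longlonglongrightarrow> 1 * 1 / (1 * 1)"
    by (intro tendsto_intros lim) auto
  moreover have "eventually (\<lambda>n. ((a + of_nat n) / of_nat n) * ((b + of_nat n) / of_nat n) /
          (((1 + of_nat n) / of_nat n) * ((c + of_nat n) / of_nat n)) = \<rho> n) sequentially"
    using eventually_gt_at_top[of 0]
    by eventually_elim (simp add: \<rho>_def divide_simps add_ac)
  ultimately have "\<rho> \<longlonglongrightarrow> 1" by (auto dest: Lim_transform_eventually)
  hence "(\<lambda>n. norm (\<rho> n) * r) \<longlonglongrightarrow> norm (1::complex) * r" by (intro tendsto_intros)
  hence "eventually (\<lambda>n. norm (\<rho> n) * r < (1 + r) / 2) sequentially"
    by (rule order_tendstoD) (use r1 in auto)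
  moreover have "eventually (\<lambda>n. norm c < real n) sequentially"
    using filterlim_real_sequentially by (simp add: filterlim_at_top_dense)
  ultimately have "eventually (\<lambda>n. norm (?f (Suc n) * of_real r ^ Suc n) \<le>
       (1 + r) / 2 * norm (?f n * of_real r ^ n)) sequentially"
  proof eventually_elim
    case (elim n)
    have "c + of_nat n \<noteq> 0"
    proof
      assume "c + of_nat n = 0"
      hence "c = - of_nat n" by (simp add: eq_neg_iff_add_eq_0)
      thus False using elim(2) by simp
    qed
    moreover have "(of_nat n + 1 :: complex) \<noteq> 0" by (metis of_nat_Suc of_nat_neq_0 add.commute)
    ultimately have "?f (Suc n) = \<rho> n * ?f n"
      using hyp_fps_Suc[of n c a b] by (simp add: \<rho>_def divide_simps mult_ac)
    hence "norm (?f (Suc n) * of_real r ^ Suc n) = (norm (\<rho> n) * r) * norm (?f n * of_real r ^ n)"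
      using r by (simp add: norm_mult norm_power)
    also have "\<dots> \<le> (1 + r) / 2 * norm (?f n * of_real r ^ n)"
      by (intro mult_right_mono) (use elim in auto)
    finally show ?case .
  qed
  then obtain N where "\<And>n. n \<ge> N \<Longrightarrow> norm (?f (Suc n) * of_real r ^ Suc n) \<le>
       (1 + r) / 2 * norm (?f n * of_real r ^ n)" by (auto simp: eventually_at_top_linorder)
  hence "summable (\<lambda>n. ?f n * of_real r ^ n)"
    by (intro summable_ratio_test[of "(1 + r) / 2" N]) (use r1 in auto)
  thus "\<exists>z. norm z = r \<and> summable (\<lambda>n. ?f n * z ^ n)"
    using r by (intro exI[of _ "of_real r"]) auto
qed

lemma norm_lt_conv_radius_hyp:
  "norm (x :: complex) < 1 \<Longrightarrow> ereal (norm x) < fps_conv_radius (hyp_fps a b c)"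
  using conv_radius_hyp_fps in_eball_conv_radius_ge_1 by blast

lemma hyp_F_series_holomorphic: "hyp_F_series a b c holomorphic_on ball 0 1"
  unfolding hyp_F_series_eq
  by (intro holomorphic_intros) (use conv_radius_hyp_fps in \<open>auto simp: in_eball_conv_radius_ge_1\<close>)

lemma hyp_F_series_0 [simp]: "hyp_F_series a b c 0 = rGamma c"
  by (simp add: hyp_F_series_eq eval_fps_at_0 hyp_fps_def)

lemma hyp_F_series_has_deriv:
  assumes "norm x < 1"
  shows "(hyp_F_series a b c has_field_derivative a * b * hyp_F_series (a + 1) (b + 1) (c + 1) x) (at x)"
proof -
  have "fps_deriv (hyp_fps a b c) = fps_const (a * b) * hyp_fps (a + 1) (b + 1) (c + 1)"
  proof (rule fps_ext)
    fix n
    show "fps_nth (fps_deriv (hyp_fps a b c)) n =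
          fps_nth (fps_const (a * b) * hyp_fps (a + 1) (b + 1) (c + 1)) n"
      by (simp add: hyp_fps_def pochhammer_rec add_ac del: of_nat_Suc) (simp add: add_ac)
  qed
  moreover have "eval_fps (fps_const (a * b) * hyp_fps (a + 1) (b + 1) (c + 1)) x
      = a * b * hyp_F_series (a + 1) (b + 1) (c + 1) x"
    by (subst eval_fps_mult) (use assms norm_lt_conv_radius_hyp in \<open>auto simp: hyp_F_series_eq\<close>)
  moreover have "(eval_fps (hyp_fps a b c) has_field_derivative eval_fps (fps_deriv (hyp_fps a b c)) x) (at x)"
    by (rule has_field_derivative_eval_fps) (rule norm_lt_conv_radius_hyp[OF assms])
  ultimately show ?thesis by (simp add: hyp_F_series_eq)
qed

lemma hyp_F_series_ode:
  fixes a b c :: complex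
  assumes "norm x < 1"
  defines "F \<equiv> hyp_F_series a b c"
  shows "(1 - x) * theta_op (theta_op F) x = ((a + b) * x - (c - 1)) * theta_op F x + a * b * x * F x"
proof -
  let ?f = "hyp_fps a b c"
  have id: "fps_XD (fps_XD ?f) + fps_const (c - 1) * fps_XD ?f =
     fps_X * (fps_XD (fps_XD ?f) + fps_const (a + b) * fps_XD ?f + fps_const (a * b) * ?f)"
  proof (rule fps_ext)
    fix n
    show "fps_nth (fps_XD (fps_XD ?f) + fps_const (c - 1) * fps_XD ?f) n =
      fps_nth (fps_X * (fps_XD (fps_XD ?f) + fps_const (a + b) * fps_XD ?f + fps_const (a * b) * ?f)) n"
    proof (cases n)
      case (Suc m)
      have "fps_nth (fps_XD (fps_XD ?f) + fps_const (c - 1) * fps_XD ?f) (Suc m)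
         = (of_nat m + 1) * (c + of_nat m) * fps_nth ?f (Suc m)"
        by (simp only: fps_add_nth fps_mult_left_const_nth fps_XD_nth of_nat_Suc) (simp add: algebra_simps)
      also have "\<dots> = fps_nth (fps_XD (fps_XD ?f) + fps_const (a + b) * fps_XD ?f + fps_const (a * b) * ?f) m"
        by (simp only: hyp_fps_Suc fps_add_nth fps_mult_left_const_nth fps_XD_nth of_nat_Suc)
           (simp add: algebra_simps)
      finally show ?thesis using Suc by simp
    qed (simp only: fps_add_nth fps_mult_left_const_nth fps_XD_nth, simp)
  qed
  note c = norm_lt_conv_radius_hyp[OF assms(1), of a b c]
  note c1 = less_le_trans[OF c fps_conv_radius_XD]
  note c2 = less_le_trans[OF c1 fps_conv_radius_XD]
  have cc: "ereal (norm x) < fps_conv_radius (fps_const k * g)"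
    if "ereal (norm x) < fps_conv_radius g" for k and g :: "complex fps"
    using that fps_conv_radius_mult[of "fps_const k" g] by (auto intro: less_le_trans)
  have ca: "ereal (norm x) < fps_conv_radius (g + h)"
    if "ereal (norm x) < fps_conv_radius g" "ereal (norm x) < fps_conv_radius h" for g h :: "complex fps"
    by (rule less_le_trans[OF _ fps_conv_radius_add]) (use that in auto)
  have E: "eval_fps (fps_XD ?f) x = theta_op F x" "eval_fps (fps_XD (fps_XD ?f)) x = theta_op (theta_op F) x"
    "eval_fps ?f x = F x"
    using eval_fps_XD[OF c] eval_fps_XD_XD[OF c] by (simp_all add: F_def hyp_F_series_eq)
  have "eval_fps (fps_XD (fps_XD ?f) + fps_const (c - 1) * fps_XD ?f) x =
      theta_op (theta_op F) x + (c - 1) * theta_op F x"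
    using c c1 c2 E by (simp add: eval_fps_add eval_fps_mult cc)
  moreover have "eval_fps (fps_X * (fps_XD (fps_XD ?f) + fps_const (a + b) * fps_XD ?f + fps_const (a * b) * ?f)) x
     = x * (theta_op (theta_op F) x + (a + b) * theta_op F x + a * b * F x)"
    using c c1 c2 E by (simp add: eval_fps_add eval_fps_mult cc ca)
  ultimately show ?thesis using id by (simp add: algebra_simps)
qed

text \<open>The gauge factor (1 - q)^(a+b-1/2) (1 + q)^(c-a-b-1/2) in principal branches. Dividing
  by it reduces the first-order part of the pulled-back hypergeometric equation to the constant
  multiple (c - 1) \<theta>.\<close>

definition koebe_fac :: "complex \<Rightarrow> complex \<Rightarrow> complex \<Rightarrow> complex \<Rightarrow> complex" where
  "koebe_fac a b c q = exp ((a + b - 1/2) * Ln (1 - q) + (c - a - b - 1/2) * Ln (1 + q))"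

lemma theta_op_eqI: "(f has_field_derivative D) (at q) \<Longrightarrow> theta_op f q = q * D"
  by (simp add: theta_op_def DERIV_imp_deriv)

lemma norm_lt_1_imp:
  assumes "norm (q::complex) < 1"
  shows "Re (1 - q) > 0" "Re (1 + q) > 0" "1 - q \<noteq> 0" "1 + q \<noteq> 0" "1 - q \<notin> \<real>\<^sub>\<le>\<^sub>0" "1 + q \<notin> \<real>\<^sub>\<le>\<^sub>0"
proof -
  have "\<bar>Re q\<bar> < 1" using abs_Re_le_cmod[of q] assms by linarith
  thus "Re (1 - q) > 0" "Re (1 + q) > 0" by auto
  thus "1 - q \<noteq> 0" "1 + q \<noteq> 0" "1 - q \<notin> \<real>\<^sub>\<le>\<^sub>0" "1 + q \<notin> \<real>\<^sub>\<le>\<^sub>0" 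
    by (auto simp: complex_nonpos_Reals_iff simp del: minus_complex.simps) (auto simp: complex_eq_iff)
qed

text \<open>Pulled back by the Koebe map and divided by the gauge factor, the series solves the
  Fuchsian equation with l = c - 1, so \<open>fuchs_ode_unique\<close> identifies it with a multiple
  of \<open>jac_G\<close>. The radius 1/8 keeps the argument inside the unit disc, because 4/8 <
  (7/8)^2.\<close>

lemma hyp_F_series_koebe_local:
  assumes c: "c - 1 \<notin> neg_ints" and q: "norm q < 1/8"
  shows "hyp_F_series a b c (- 4 * q / (1 - q)\<^sup>2) =
           rGamma c * koebe_fac a b c q * jac_G (c - 1) (a - b) (c - a - b) q"
proof -
  define F where "F = hyp_F_series a b c"
  define p s where "p = a + b - 1/2" and "s = c - a - b - 1/2"
  define x where "x = (\<lambda>q::complex. - 4 * q / (1 - q)\<^sup>2)"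
  \<comment> \<open>\<open>\<tau>\<close> is the logarithmic derivative \<theta> x / x of the Koebe
    map, and \<open>e\<close> is \<theta> P / P. The relation \<tau>^2 = 1 - x is what matches the
    leading coefficient of the hypergeometric equation.\<close>
  define \<tau> where "\<tau> = (\<lambda>q::complex. (1 + q) / (1 - q))"
  define e where "e = (\<lambda>q. p * q / (1 - q) - s * q / (1 + q))"
  define P where "P = (\<lambda>q. exp (- p * Ln (1 - q) - s * Ln (1 + q)))"
  define H1 H2 H3 where "H1 = (\<lambda>q. F (x q))" and "H2 = (\<lambda>q. theta_op F (x q))"
    and "H3 = (\<lambda>q. theta_op (theta_op F) (x q))"
  define K where "K = (\<lambda>q. P q * H1 q)"
  define K1 where "K1 = (\<lambda>q. P q * (e q * H1 q + \<tau> q * H2 q))"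
  define B where "B = ball (0::complex) (1/8)"
  have B: "open B" by (simp add: B_def)
  have nb: "norm z < 1/8" "norm z < 1" "1 - z \<noteq> 0" "1 + z \<noteq> 0" "1 - z \<notin> \<real>\<^sub>\<le>\<^sub>0" "1 + z \<notin> \<real>\<^sub>\<le>\<^sub>0"
    if "z \<in> B" for z using that norm_lt_1_imp[of z] by (auto simp: B_def)
  have xB: "norm (x z) < 1" if "z \<in> B" for z
  proof -
    have z: "norm z < 1/8" using nb[OF that] by auto
    have "norm (1 - z) \<ge> 7/8" using norm_triangle_ineq2[of 1 z] z by simp
    hence "norm (1 - z) ^ 2 \<ge> (7/8)^2" by (intro power_mono) auto
    hence "4 * norm z < norm (1 - z) ^ 2" using z by (simp add: power2_eq_square)
    thus ?thesis using nb[OF that] by (simp add: x_def norm_divide norm_mult norm_power)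
  qed
  have holF: "F holomorphic_on ball 0 1" unfolding F_def by (rule hyp_F_series_holomorphic)
  have dx: "(x has_field_derivative - 4 * (1 + z) / (1 - z) ^ 3) (at z)" if "z \<in> B" for z
    unfolding x_def using nb[OF that]
    by (auto intro!: derivative_eq_intros simp: divide_simps) (simp add: power2_eq_square power3_eq_cube
        power4_eq_xxxx algebra_simps)?
  have zx: "z * (- 4 * (1 + z) / (1 - z) ^ 3) = \<tau> z * x z" if "z \<in> B" for z
    using nb[OF that] by (simp add: \<tau>_def x_def divide_simps power2_eq_square power3_eq_cube)
      (simp add: algebra_simps)
  have comp: "((\<lambda>z. f (x z)) has_field_derivative deriv f (x z) * (- 4 * (1 + z) / (1 - z) ^ 3)) (at z)"
    if "z \<in> B" "f holomorphic_on ball 0 1" for f z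
    using DERIV_chain2[OF holomorphic_derivI[OF that(2), of "x z"] dx[OF that(1)]] xB[OF that(1)] by simp
  have thcomp: "z * (deriv f (x z) * (- 4 * (1 + z) / (1 - z) ^ 3)) = \<tau> z * theta_op f (x z)"
    if "z \<in> B" for f z
  proof -
    have "z * (deriv f (x z) * (- 4 * (1 + z) / (1 - z) ^ 3)) = deriv f (x z) * (z * (- 4 * (1 + z) / (1 - z) ^ 3))"
      by (simp only: mult_ac)
    thus ?thesis unfolding zx[OF that] by (simp add: theta_op_def)
  qed
  have hol1: "theta_op F holomorphic_on ball 0 1" by (intro holomorphic_theta_op holF) auto
  have dP: "(P has_field_derivative P z * (p / (1 - z) - s / (1 + z))) (at z)" if "z \<in> B" for z
    unfolding P_def using nb[OF that]
    by (auto intro!: derivative_eq_intros simp: divide_simps) (simp add: algebra_simps)?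
  have dK: "(K has_field_derivative P z * (p / (1 - z) - s / (1 + z)) * H1 z +
       (deriv F (x z) * (- 4 * (1 + z) / (1 - z) ^ 3)) * P z) (at z)" if "z \<in> B" for z
    unfolding K_def H1_def by (intro DERIV_mult dP comp that holF)
  have thK: "theta_op K z = K1 z" if "z \<in> B" for z
    unfolding theta_op_eqI[OF dK[OF that]] K1_def H2_def thcomp[OF that, symmetric]
    by (simp add: e_def algebra_simps)
  have dK1: "(K1 has_field_derivative P z * (p / (1 - z) - s / (1 + z)) * (e z * H1 z + \<tau> z * H2 z) +
      (((p / (1 - z)^2 - s / (1 + z)^2) * H1 z + deriv F (x z) * (- 4 * (1 + z) / (1 - z) ^ 3) * e z)
      + (2 / (1 - z)^2 * H2 z + deriv (theta_op F) (x z) * (- 4 * (1 + z) / (1 - z) ^ 3) * \<tau> z)) * P z) (at z)"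
    if "z \<in> B" for z
  proof -
    have "((\<lambda>q. q / (1 - q)) has_field_derivative 1 / (1 - z)^2) (at z)"
      "((\<lambda>q. q / (1 + q)) has_field_derivative 1 / (1 + z)^2) (at z)"
      using nb[OF that] by (auto intro!: derivative_eq_intros simp: divide_simps power2_eq_square)
    hence "((\<lambda>q. p * (q / (1 - q)) - s * (q / (1 + q))) has_field_derivative
        p * (1 / (1 - z)^2) - s * (1 / (1 + z)^2)) (at z)"
      by (intro DERIV_diff DERIV_cmult)
    hence de: "(e has_field_derivative (p / (1 - z)^2 - s / (1 + z)^2)) (at z)"
      by (simp add: e_def)
    have dt: "(\<tau> has_field_derivative 2 / (1 - z)^2) (at z)"
      unfolding \<tau>_def using nb[OF that]
      by (auto intro!: derivative_eq_intros simp: divide_simps power2_eq_square) (simp add: algebra_simps)?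
    show ?thesis unfolding K1_def H1_def H2_def
      by (intro DERIV_mult DERIV_add dP de dt comp that holF hol1)
  qed
  have odeK: "theta_op (theta_op K) z + (c - 1) * theta_op K z = jac_v (a - b) (c - a - b) z * K z"
    if "z \<in> B" for z
  proof -
    note n = nb[OF that]
    have "theta_op (theta_op K) z = theta_op K1 z"
      by (rule theta_op_cong[OF B that]) (rule thK)
    also have "\<dots> = P z * (e z * (e z * H1 z + \<tau> z * H2 z) + (z * (p / (1 - z)^2 - s / (1 + z)^2)) * H1 z
        + e z * (z * (deriv F (x z) * (- 4 * (1 + z) / (1 - z) ^ 3))) + 2 * z / (1 - z)^2 * H2 z
        + \<tau> z * (z * (deriv (theta_op F) (x z) * (- 4 * (1 + z) / (1 - z) ^ 3))))"
      unfolding theta_op_eqI[OF dK1[OF that]]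
      by (simp add: e_def algebra_simps)
    also have "\<dots> = P z * (e z * (e z * H1 z + \<tau> z * H2 z) + (z * (p / (1 - z)^2 - s / (1 + z)^2)) * H1 z
        + e z * (\<tau> z * H2 z) + 2 * z / (1 - z)^2 * H2 z + (\<tau> z)\<^sup>2 * H3 z)"
      unfolding thcomp[OF that] by (simp add: H2_def H3_def power2_eq_square)
    also have "(\<tau> z)\<^sup>2 = 1 - x z"
      using n by (simp add: \<tau>_def x_def divide_simps power2_eq_square) (simp add: algebra_simps)
    also have "(1 - x z) * H3 z = ((a + b) * x z - (c - 1)) * H2 z + a * b * x z * H1 z"
      using hyp_F_series_ode[OF xB[OF that], of a b c] by (simp add: H3_def H2_def H1_def F_def)
    finally have *: "theta_op (theta_op K) z + (c - 1) * theta_op K z - jac_v (a - b) (c - a - b) z * K z =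
      P z * (((e z)\<^sup>2 + z * (p / (1 - z)^2 - s / (1 + z)^2) + a * b * x z + (c - 1) * e z
              - jac_v (a - b) (c - a - b) z) * H1 z
           + (2 * e z * \<tau> z + 2 * z / (1 - z)^2 + (a + b) * x z - (c - 1) + (c - 1) * \<tau> z) * H2 z)"
      unfolding thK[OF that] by (simp add: K1_def K_def algebra_simps power2_eq_square)
    have n2: "2 + z * 2 \<noteq> 0"
    proof
      assume "2 + z * 2 = 0"
      hence "2 * (1 + z) = 0" by (simp only: distrib_left mult.commute[of z] mult_1_right)
      thus False using n(4) unfolding mult_eq_0_iff by simp
    qed
    \<comment> \<open>The vanishing of this coefficient of \<open>H2\<close> is the condition that
      fixes the exponents p and s of the gauge factor.\<close>
    have "2 * e z * \<tau> z + 2 * z / (1 - z)^2 + (a + b) * x z - (c - 1) + (c - 1) * \<tau> z = 0"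
      using n(3,4) n2 unfolding e_def \<tau>_def x_def p_def s_def
      by (simp add: divide_simps power2_eq_square) (simp add: algebra_simps)?
    moreover have "(e z)\<^sup>2 + z * (p / (1 - z)^2 - s / (1 + z)^2) + a * b * x z + (c - 1) * e z
              - jac_v (a - b) (c - a - b) z = 0"
    proof -
      \<comment> \<open>In i and j everything is polynomial. After z i = i - 1 and z j = 1 - j the
        remainder is p s (2 i j - i - j), which vanishes by partial fractions.\<close>
      define i j where "i = 1 / (1 - z)" and "j = 1 / (1 + z)"
      have ij: "i * (1 - z) = 1" "j * (1 + z) = 1" using n by (simp_all add: i_def j_def)
      have "(e z)\<^sup>2 + z * (p / (1 - z)^2 - s / (1 + z)^2) + a * b * x z + (c - 1) * e z
              - jac_v (a - b) (c - a - b) z =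
        (p * z * i - s * z * j)\<^sup>2 + z * (p * i^2 - s * j^2) + a * b * (- 4 * z * i^2)
          + (c - 1) * (p * z * i - s * z * j)
          - (((a - b)\<^sup>2 - 1/4) * z * i^2 + (1/4 - (c - a - b)\<^sup>2) * z * j^2)"
        (is "_ = ?rhs")
      proof -
        have "e z = p * z * i - s * z * j" "x z = - 4 * z * i^2" "p / (1 - z)^2 = p * i^2" "s / (1 + z)^2 = s * j^2"
          "jac_v (a - b) (c - a - b) z = ((a - b)\<^sup>2 - 1/4) * z * i^2 + (1/4 - (c - a - b)\<^sup>2) * z * j^2"
          by (simp_all only: e_def x_def jac_v_def i_def j_def power_one_over)
             (simp_all only: times_divide_eq_right mult_1_right)
        thus ?thesis by (simp only:)
      qed
      moreover have "?rhs = 0"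
      proof -
        have h: "z * i = i - 1" "z * j = 1 - j" using ij by (simp_all add: algebra_simps)
        have h3: "2 * (i * j) = i + j"
        proof -
          have "2 * (i * j) = j * (i * (1 - z)) + i * (j * (1 + z))" by (simp add: algebra_simps)
          thus ?thesis using ij by simp
        qed
        have "?rhs = (p * (z * i) - s * (z * j))\<^sup>2 + (p * ((z * i) * i) - s * ((z * j) * j))
          + a * b * (- 4 * ((z * i) * i)) + (c - 1) * (p * (z * i) - s * (z * j))
          - (((a - b)\<^sup>2 - 1/4) * ((z * i) * i) + (1/4 - (c - a - b)\<^sup>2) * ((z * j) * j))"
          by (simp only: power2_eq_square mult_ac right_diff_distrib[of z])
        also have "\<dots> = p * s * (2 * (i * j) - (i + j))"
          unfolding h p_def s_def by (simp add: power2_eq_square field_simps)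
        finally show ?thesis unfolding h3 by simp
      qed
      ultimately show ?thesis by simp
    qed
    ultimately show ?thesis using * by simp
  qed
  define G where "G = jac_G (c - 1) (a - b) (c - a - b)"
  define H where "H = (\<lambda>z. K z - rGamma c * G z)"
  have BG: "B \<subseteq> ball 0 1" by (auto simp: B_def)
  have GB: "G holomorphic_on B" "theta_op G holomorphic_on B"
    unfolding G_def using holomorphic_on_subset[OF jac_G_holomorphic BG]
      holomorphic_theta_op[OF B] by auto
  have KB: "K holomorphic_on B" "theta_op K holomorphic_on B"
  proof -
    show "K holomorphic_on B" using dK unfolding holomorphic_on_open[OF B] by blast
    thus "theta_op K holomorphic_on B" by (rule holomorphic_theta_op[OF B])
  qed
  have thD: "theta_op (\<lambda>z. f z - k * g z) z = theta_op f z - k * theta_op g z"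
    if "f holomorphic_on B" "g holomorphic_on B" "z \<in> B" for f g k z
  proof -
    have "((\<lambda>z. f z - k * g z) has_field_derivative (deriv f z - k * deriv g z)) (at z)"
      by (intro derivative_intros holomorphic_derivI[OF _ B] that DERIV_cmult)
    from theta_op_eqI[OF this] show ?thesis by (simp add: theta_op_def algebra_simps)
  qed
  have "H q = 0"
  proof (rule fuchs_ode_unique[OF c, of "1/8" H "a - b" "c - a - b" q])
    show "H holomorphic_on ball 0 (1/8)" unfolding H_def using KB GB 
      by (intro holomorphic_intros) (auto simp: B_def)
    show "H 0 = 0" by (simp add: H_def K_def P_def H1_def x_def F_def G_def)
    fix z :: complex assume "norm z < 1/8"
    then have z: "z \<in> B" by (simp add: B_def)
    have t1: "theta_op H y = theta_op K y - rGamma c * theta_op G y" if "y \<in> B" for y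
      unfolding H_def by (rule thD[OF KB(1) GB(1) that])
    have t2: "theta_op (theta_op H) z = theta_op (theta_op K) z - rGamma c * theta_op (theta_op G) z"
      using theta_op_cong[OF B z t1] thD[OF KB(2) GB(2) z] by simp
    have odeG: "theta_op (theta_op G) z + (c - 1) * theta_op G z = jac_v (a - b) (c - a - b) z * G z"
      unfolding G_def by (rule jac_G_ode[OF c]) (use nb[OF z] in auto)
    have "theta_op (theta_op H) z + (c - 1) * theta_op H z =
      (theta_op (theta_op K) z + (c - 1) * theta_op K z)
        - rGamma c * (theta_op (theta_op G) z + (c - 1) * theta_op G z)"
      unfolding t2 t1[OF z] by (simp add: algebra_simps)
    also have "\<dots> = jac_v (a - b) (c - a - b) z * H z"
      unfolding odeG odeK[OF z] H_def by (simp add: algebra_simps)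
    finally show "theta_op (theta_op H) z + (c - 1) * theta_op H z = jac_v (a - b) (c - a - b) z * H z" .
  qed (use q in auto)
  hence "P q * F (x q) = rGamma c * G q" by (simp add: H_def K_def H1_def)
  moreover have "koebe_fac a b c q * P q = 1"
    unfolding koebe_fac_def P_def p_def s_def by (simp flip: exp_add add: algebra_simps)
  ultimately have "F (x q) = koebe_fac a b c q * (rGamma c * G q)"
    by (metis mult.assoc mult_1)
  thus ?thesis by (simp add: F_def G_def x_def mult_ac)
qed

section \<open>The Koebe map and the slit plane\<close>

abbreviation slit :: "complex set" where "slit \<equiv> - complex_of_real ` {1..}"

lemma one_minus_slit: "x \<in> slit \<longleftrightarrow> 1 - x \<notin> \<real>\<^sub>\<le>\<^sub>0"
proof
  assume x: "x \<in> slit"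
  show "1 - x \<notin> \<real>\<^sub>\<le>\<^sub>0"
  proof
    assume "1 - x \<in> \<real>\<^sub>\<le>\<^sub>0"
    hence "x = of_real (Re x)" "Re x \<ge> 1" by (auto simp: complex_nonpos_Reals_iff complex_eq_iff)
    thus False using x by (metis ComplD atLeast_iff image_eqI)
  qed
next
  assume "1 - x \<notin> \<real>\<^sub>\<le>\<^sub>0"
  thus "x \<in> slit" by (auto simp: complex_nonpos_Reals_iff)
qed

lemma open_slit: "open slit"
proof -
  have "slit = (\<lambda>x. 1 - x) -` (- \<real>\<^sub>\<le>\<^sub>0)" using one_minus_slit by blast
  moreover have "open ((\<lambda>x::complex. 1 - x) -` (- \<real>\<^sub>\<le>\<^sub>0))"
    by (intro open_vimage open_Compl closed_nonpos_Reals_complex continuous_intros)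
  ultimately show ?thesis by simp
qed

lemma ball_subset_slit: "ball 0 1 \<subseteq> slit"
  by auto

text \<open>On the slit plane r = sqrt (1 - x) lies in the right half-plane, which the Cayley
  transform (r - 1) / (r + 1) sends into the disc. It inverts the Koebe map because there 1 - x =
  ((1 + q) / (1 - q))^2.\<close>

lemma csqrt_slit:
  assumes "x \<in> slit" 
  defines "q \<equiv> (csqrt (1 - x) - 1) / (csqrt (1 - x) + 1)"
  shows "norm q < 1" "- 4 * q / (1 - q)\<^sup>2 = x"
proof -
  define r where "r = csqrt (1 - x)"
  have "r \<noteq> 0 \<and> Re r > 0"
    using assms(1) one_minus_slit Re_csqrt[of "1 - x"] csqrt_principal[of "1 - x"]
    unfolding r_def complex_nonpos_Reals_iff
    by (metis Re_csqrt csqrt_eq_0 csqrt_principal complex_nonpos_Reals_iff zero_complex.sel order_less_le 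
        csqrt_inverse Re_power2 power2_csqrt diff_ge_0_iff_ge Im_power2 mult_zero_left mult_zero_right
            power_zero_numeral zero_le_power2 diff_0 neg_le_0_iff_le)
  hence r: "Re r > 0" by simp
  have n: "norm (r - 1) < norm (r + 1)"
    using r by (simp add: cmod_def power2_eq_square algebra_simps)
  moreover have rp: "r + 1 \<noteq> 0" using r by (auto simp: complex_eq_iff)
  ultimately show "norm q < 1" unfolding q_def r_def[symmetric] by (simp add: norm_divide)
  have "1 - q = 2 / (r + 1)" using rp by (simp add: q_def r_def[symmetric] field_simps)
  hence "- 4 * q / (1 - q)\<^sup>2 = (1 - r) * (1 + r)"
    using rp by (simp add: q_def r_def[symmetric] divide_simps power2_eq_square) (simp add: algebra_simps)
  also have "\<dots> = 1 - r\<^sup>2" by (simp add: power2_eq_square algebra_simps)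
  also have "\<dots> = x" by (simp add: r_def)
  finally show "- 4 * q / (1 - q)\<^sup>2 = x" .
qed

text \<open>1 - x is the square of t = (1 + q) / (1 - q), and Re t > 0 on the disc; such a square is
  never a nonpositive real.\<close>

lemma koebe_in_slit:
  assumes "norm q < 1" shows "- 4 * q / (1 - q)\<^sup>2 \<in> slit"
proof -
  note n = norm_lt_1_imp[OF assms]
  define t where "t = (1 + q) / (1 - q)"
  have t: "1 - - 4 * q / (1 - q)\<^sup>2 = t\<^sup>2"
    using n by (simp add: t_def divide_simps power2_eq_square) (simp add: algebra_simps)
  have "(Re q)\<^sup>2 + (Im q)\<^sup>2 < 1" using assms by (simp add: cmod_def)
  moreover have "0 < (1 - Re q) * (1 - Re q)" using n by (intro mult_pos_pos) auto
  hence "Re q * 2 < 1 + Re q * Re q" by (simp add: algebra_simps)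
  hence "Re q * 2 < 1 + (Im q * Im q + Re q * Re q)"
    using zero_le_square[of "Im q"] by linarith
  ultimately have "Re t > 0" using n unfolding t_def
    by (subst Re_divide) (auto intro!: divide_pos_pos simp: power2_eq_square algebra_simps
        complex_eq_iff add_pos_nonneg add_nonneg_pos)
  hence "t\<^sup>2 \<notin> \<real>\<^sub>\<le>\<^sub>0"
    by (auto simp: complex_nonpos_Reals_iff power2_eq_square mult_le_0_iff)
  thus ?thesis using t one_minus_slit by metis
qed

lemma koebe_fac_holomorphic: "koebe_fac a b c holomorphic_on ball 0 1"
  unfolding koebe_fac_def[abs_def]
  by (intro holomorphic_intros) (use norm_lt_1_imp in auto)

text \<open>The right-hand side of the Koebe identity, composed with the inverse Koebe map, is
  already holomorphic on the whole slit plane. Near 0 it agrees with the series by the local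
  identity, hence on the unit disc by the identity theorem.\<close>

lemma hyp_F_exists_generic:
  assumes c: "c - 1 \<notin> neg_ints"
  shows "\<exists>f. f holomorphic_on slit \<and> (\<forall>x. norm x < 1 \<longrightarrow> f x = hyp_F_series a b c x)"
proof -
  define q where "q = (\<lambda>x. (csqrt (1 - x) - 1) / (csqrt (1 - x) + 1))"
  define f where "f = (\<lambda>x. rGamma c * koebe_fac a b c (q x) * jac_G (c - 1) (a - b) (c - a - b) (q x))"
  have rp: "csqrt (1 - x) + 1 \<noteq> 0" for x
  proof
    assume "csqrt (1 - x) + 1 = 0"
    hence "csqrt (1 - x) = - 1" by (simp only: eq_neg_iff_add_eq_0)
    hence "Re (csqrt (1 - x)) = - 1" by (simp only: uminus_complex.sel one_complex.sel)
    thus False using Re_csqrt[of "1 - x"] by linarith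
  qed
  have qh: "q holomorphic_on slit"
    unfolding q_def by (intro holomorphic_intros) (use rp one_minus_slit in auto)
  have qb: "q ` slit \<subseteq> ball 0 1" using csqrt_slit(1) by (auto simp: q_def)
  have fh: "f holomorphic_on slit"
    unfolding f_def
    by (intro holomorphic_intros holomorphic_on_compose_gen[OF qh koebe_fac_holomorphic qb, unfolded o_def]
         holomorphic_on_compose_gen[OF qh jac_G_holomorphic qb, unfolded o_def])
  have "isCont q 0" using qh open_slit 
    by (metis Compl_iff ball_subset_slit centre_in_ball continuous_on_eq_continuous_at
        holomorphic_on_imp_continuous_on subsetD zero_less_one)
  moreover have "q 0 = 0" by (simp add: q_def)
  ultimately have "\<forall>\<^sub>F x in nhds 0. dist (q x) 0 < 1/8"
    using tendstoD[of q 0 "nhds 0" "1/8"] by (simp add: isCont_def tendsto_nhds_iff)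
  then obtain d where d: "d > 0" "\<And>x. norm x < d \<Longrightarrow> norm (q x) < 1/8"
    by (auto simp: eventually_nhds_metric)
  have "f x = hyp_F_series a b c x" if x: "norm x < 1" for x
  proof (rule analytic_continuation_open[of "ball 0 (min d 1)" "ball 0 1" f "hyp_F_series a b c" x])
    show "f holomorphic_on ball 0 1" using fh ball_subset_slit holomorphic_on_subset by blast
    show "hyp_F_series a b c holomorphic_on ball 0 1" by (rule hyp_F_series_holomorphic)
    show "ball 0 (min d 1) \<noteq> ({}::complex set)" using d by auto
    fix y :: complex assume y: "y \<in> ball 0 (min d 1)"
    have "y \<in> slit" using y ball_subset_slit by auto
    hence "- 4 * q y / (1 - q y)\<^sup>2 = y" using csqrt_slit(2)[of y] by (simp add: q_def)
    moreover have "norm (q y) < 1/8" using d(2)[of y] y by auto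
    ultimately show "f y = hyp_F_series a b c y"
      using hyp_F_series_koebe_local[OF c, of "q y" a b] by (simp add: f_def)
  qed (use x in auto)
  with fh show ?thesis by blast
qed

text \<open>At c = -m the factor 1/\<Gamma>(c + n) kills the first m + 1 terms; shifting the index
  leads to the lower parameter m + 2, for which the recursion behind \<open>jac_G\<close> is
  sound.\<close>

lemma hyp_F_series_nonpos_int:
  assumes x: "norm x < 1"
  shows "hyp_F_series a b (- of_nat m) x = pochhammer a (Suc m) * pochhammer b (Suc m) * x ^ Suc m *
           hyp_F_series (a + of_nat (Suc m)) (b + of_nat (Suc m)) (of_nat m + 2) x"
proof -
  let ?f = "fps_nth (hyp_fps a b (- of_nat m))"
  let ?g = "fps_nth (hyp_fps (a + of_nat (Suc m)) (b + of_nat (Suc m)) (of_nat m + 2))"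
  have z: "?f n = 0" if "n < Suc m" for n
  proof -
    have "- of_nat m + of_nat n = - (of_nat (m - n) :: complex)" using that by (simp add: of_nat_diff)
    thus ?thesis by (simp add: hyp_fps_def rGamma_eq_zero_iff)
  qed
  have s: "?f (k + Suc m) = pochhammer a (Suc m) * pochhammer b (Suc m) * ?g k" for k
  proof -
    have p: "pochhammer d (k + Suc m) = pochhammer d (Suc m) * pochhammer (d + of_nat (Suc m)) k" for d :: complex
      by (subst add.commute) (rule pochhammer_product')
    have e1: "- of_nat m + of_nat (k + Suc m) = (1 + of_nat k :: complex)" by simp
    have e2: "of_nat m + 2 + of_nat k = (1 + of_nat (k + Suc m) :: complex)" by simp
    have rg: "rGamma (1 + of_nat n) = inverse (fact n :: complex)" for n
      by (simp add: rGamma_inverse_Gamma Gamma_fact)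
    show ?thesis unfolding hyp_fps_def fps_nth_Abs_fps e1 e2 rg p
      by (simp add: field_simps del: of_nat_Suc)
  qed
  have sf: "summable (\<lambda>n. ?f n * x ^ n)"
    using summable_fps norm_lt_conv_radius_hyp[OF x] by blast
  have "hyp_F_series a b (- of_nat m) x = (\<Sum>n. ?f n * x ^ n)"
    by (simp add: hyp_F_series_eq eval_fps_def)
  also have "\<dots> = (\<Sum>k. ?f (k + Suc m) * x ^ (k + Suc m)) + (\<Sum>n<Suc m. ?f n * x ^ n)"
    by (rule suminf_split_initial_segment[OF sf])
  also have "(\<Sum>n<Suc m. ?f n * x ^ n) = 0" by (rule sum.neutral) (use z in auto)
  also have "(\<lambda>k. ?f (k + Suc m) * x ^ (k + Suc m)) =
      (\<lambda>k. pochhammer a (Suc m) * pochhammer b (Suc m) * x ^ Suc m * (?g k * x ^ k))"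
    unfolding s power_add by (simp add: mult_ac)
  also have "(\<Sum>k. pochhammer a (Suc m) * pochhammer b (Suc m) * x ^ Suc m * (?g k * x ^ k)) =
     pochhammer a (Suc m) * pochhammer b (Suc m) * x ^ Suc m * (\<Sum>k. ?g k * x ^ k)"
    by (rule suminf_mult) (use summable_fps norm_lt_conv_radius_hyp[OF x] in blast)
  finally show ?thesis by (simp only: hyp_F_series_eq eval_fps_def add_0_right)
qed

text \<open>\<open>hyp_F\<close> is a choice, so it satisfies its specification only once a
  continuation is known to exist. All c are covered, since \<open>jacobi_P\<close> at a negative
  integer \<alpha> has the nonpositive integer c = \<alpha> + 1.\<close>

lemma hyp_F_exists:
  "\<exists>f. f holomorphic_on slit \<and> (\<forall>x. norm x < 1 \<longrightarrow> f x = hyp_F_series a b c x)"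
proof (cases "c - 1 \<in> neg_ints")
  case True
  then obtain n where n: "n > 0" "c - 1 = - of_nat n" by auto
  then obtain m where "n = Suc m" by (cases n) auto
  hence c: "c = - of_nat m" using n by (simp add: algebra_simps eq_neg_iff_add_eq_0)
  have "complex_of_nat m + 2 - 1 \<notin> neg_ints"
  proof
    assume "complex_of_nat m + 2 - 1 \<in> neg_ints"
    then obtain k where "complex_of_nat m + 2 - 1 = - of_nat k" by auto
    hence "complex_of_nat (m + 1 + k) = 0" by (simp add: algebra_simps eq_neg_iff_add_eq_0)
    thus False by (subst (asm) of_nat_eq_0_iff) simp
  qed
  from hyp_F_exists_generic[OF this] obtain f where f: "f holomorphic_on slit"
    "\<And>x. norm x < 1 \<Longrightarrow> f x = hyp_F_series (a + of_nat (Suc m)) (b + of_nat (Suc m)) (of_nat m + 2) x"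
    by metis
  show ?thesis
    by (rule exI[of _ "\<lambda>x. pochhammer a (Suc m) * pochhammer b (Suc m) * x ^ Suc m * f x"])
       (auto intro!: holomorphic_intros f(1) simp: c hyp_F_series_nonpos_int f(2) simp del: of_nat_Suc power_Suc)
qed (use hyp_F_exists_generic in blast)

lemma hyp_F_holomorphic: "hyp_F a b c holomorphic_on slit"
  and hyp_F_eq_series: "norm x < 1 \<Longrightarrow> hyp_F a b c x = hyp_F_series a b c x"
  using someI_ex[OF hyp_F_exists[of a b c]] unfolding hyp_F_def by auto

lemma hyp_F_koebe:
  assumes c: "c - 1 \<notin> neg_ints" and q: "norm q < 1"
  shows "hyp_F a b c (- 4 * q / (1 - q)\<^sup>2) =
           rGamma c * koebe_fac a b c q * jac_G (c - 1) (a - b) (c - a - b) q"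
proof (rule analytic_continuation_open[of "ball 0 (1/8)" "ball 0 1"
     "\<lambda>q. hyp_F a b c (- 4 * q / (1 - q)\<^sup>2)"
     "\<lambda>q. rGamma c * koebe_fac a b c q * jac_G (c - 1) (a - b) (c - a - b) q"])
  have kh: "(\<lambda>q. - 4 * q / (1 - q)\<^sup>2) holomorphic_on ball 0 1"
    by (intro holomorphic_intros) (use norm_lt_1_imp(3) in auto)
  have kb: "(\<lambda>q. - 4 * q / (1 - q)\<^sup>2) ` ball 0 1 \<subseteq> slit"
  proof (rule image_subsetI)
    fix z :: complex assume "z \<in> ball 0 1"
    thus "- 4 * z / (1 - z)\<^sup>2 \<in> slit" using koebe_in_slit[of z] by (simp only: mem_ball dist_0_norm)
  qed
  show "(\<lambda>q. hyp_F a b c (- 4 * q / (1 - q)\<^sup>2)) holomorphic_on ball 0 1"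
    using holomorphic_on_compose_gen[OF kh hyp_F_holomorphic kb] by (simp add: o_def)
  show "(\<lambda>q. rGamma c * koebe_fac a b c q * jac_G (c - 1) (a - b) (c - a - b) q) holomorphic_on ball 0 1"
    by (intro holomorphic_intros koebe_fac_holomorphic jac_G_holomorphic)
  fix z :: complex assume "z \<in> ball 0 (1/8)"
  hence z: "norm z < 1/8" by simp
  have "norm (1 - z) \<ge> 7/8" using norm_triangle_ineq2[of 1 z] z by simp
  hence "norm (1 - z) ^ 2 \<ge> (7/8)^2" by (intro power_mono) auto
  hence "4 * norm z < norm (1 - z) ^ 2" using z by (simp add: power2_eq_square)
  moreover have "1 - z \<noteq> 0" using z by auto
  ultimately have "norm (- 4 * z / (1 - z)\<^sup>2) < 1" by (simp add: norm_divide norm_mult norm_power)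
  thus "hyp_F a b c (- 4 * z / (1 - z)\<^sup>2) =
     rGamma c * koebe_fac a b c z * jac_G (c - 1) (a - b) (c - a - b) z"
    using hyp_F_series_koebe_local[OF c z, of a b] hyp_F_eq_series by metis
qed (use q in auto)

section \<open>Jacobi functions of the second kind in the disc\<close>

lemma jac_G_minus [simp]: "jac_G l (-\<alpha>) \<beta> = jac_G l \<alpha> \<beta>" "jac_G l \<alpha> (-\<beta>) = jac_G l \<alpha> \<beta>"
  by (simp_all add: jac_G_def jac_fps_def jac_v_fps_def)

lemma Im_Ln_right_half: "Re z > 0 \<Longrightarrow> \<bar>Im (Ln z)\<bar> < pi / 2"
  using Re_Ln_pos_lt[of z] by (cases "z = 0") auto

lemma Re_minus_i_sin_pos:
  assumes "Im z > 0" "\<bar>Re z\<bar> < pi / 2" shows "Re (- \<i> * sin z) > 0"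
  using assms cos_gt_zero_pi[of "Re z"] by (simp add: Im_sin)

lemma Re_cos_pos:
  assumes "\<bar>Re z\<bar> < pi / 2" shows "Re (cos z) > 0"
  using assms cos_gt_zero_pi[of "Re z"] by (simp add: Re_cos add_pos_pos)

lemma Beta_eq_rGamma: "Beta a (b::complex) = Gamma a * Gamma b * rGamma (a + b)"
  by (simp add: Beta_def rGamma_inverse_Gamma divide_inverse)

lemma exp_2iz_eq:
  fixes z :: complex
  defines "q \<equiv> exp (2 * \<i> * z)"
  shows "1 - q = 2 * exp (\<i> * z) * (- \<i> * sin z)" "1 + q = 2 * exp (\<i> * z) * cos z"
proof -
  have q: "q = exp (\<i> * z) * exp (\<i> * z)" by (simp add: q_def mult.assoc flip: exp_add)
  have e: "exp (\<i> * z) * exp (- (\<i> * z)) = 1" by (simp flip: exp_add)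
  have "\<i> * (exp (\<i> * z) - exp (- (\<i> * z))) / (2 * \<i>) = (exp (\<i> * z) - exp (- (\<i> * z))) / 2" by simp
  hence s: "- \<i> * sin z = (exp (- (\<i> * z)) - exp (\<i> * z)) / 2"
    unfolding sin_exp_eq by (simp add: field_simps)
  show "1 - q = 2 * exp (\<i> * z) * (- \<i> * sin z)"
    unfolding s q using e by (simp add: algebra_simps)
  show "1 + q = 2 * exp (\<i> * z) * cos z"
    unfolding cos_exp_eq q using e by (simp add: algebra_simps)
qed

lemma cos_2z_eq:
  fixes z :: complex
  shows "cos (2 * z) - 1 = 2 * (- \<i> * sin z)\<^sup>2" "cos (2 * z) + 1 = 2 * (cos z)\<^sup>2"
  by (simp add: cos_double_sin power_mult_distrib) (simp add: cos_double_cos)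

abbreviation (input) jac_scale :: "complex \<Rightarrow> complex \<Rightarrow> complex \<Rightarrow> complex" where
  "jac_scale \<nu> \<alpha> \<beta> \<equiv> 2 powr (2 * \<nu> + \<alpha> + \<beta>) * Beta (\<nu> + \<alpha> + 1) (\<nu> + \<beta> + 1)"

text \<open>From 1 - q = 2 e^(iz) (-i sin z) the argument 2 / (1 - cos 2z) is the Koebe image of q =
  e^(2iz). On the half-strip both -i sin z and cos z lie in the right half-plane, so each principal
  logarithm splits additively without crossing its cut, and all powers combine into one
  exponential.\<close>

lemma jacobi_Q_eq_jac_G:
  assumes z: "Im z > 0" "\<bar>Re z\<bar> < pi / 2" and l: "2 * \<nu> + \<alpha> + \<beta> + 1 \<notin> neg_ints"
  shows "jacobi_Q \<nu> \<alpha> \<beta> (cos (2 * z)) =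
    jac_scale \<nu> \<alpha> \<beta> *
    exp (- (\<alpha> + 1/2) * Ln (- \<i> * sin z) - (\<beta> + 1/2) * Ln (cos z) + \<i> * (2 * \<nu> + \<alpha> + \<beta> + 1) * z) *
    jac_G (2 * \<nu> + \<alpha> + \<beta> + 1) \<alpha> \<beta> (exp (2 * \<i> * z))"
proof -
  define S where "S = - \<i> * sin z"
  define L where "L = Ln (2::complex)"
  define u w where "u = Ln S" and "w = Ln (cos z)"
  define q where "q = exp (2 * \<i> * z)"
  have S: "Re S > 0" unfolding S_def by (rule Re_minus_i_sin_pos[OF z])
  have K: "Re (cos z) > 0" by (rule Re_cos_pos[OF z(2)])
  have nz: "S \<noteq> 0" "cos z \<noteq> 0" using S K by (auto simp del: Re_cos)
  have L: "exp L = 2" unfolding L_def by (rule exp_Ln) simp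
  have L0: "Im L = 0" unfolding L_def using Ln_of_real[of 2] by simp
  have uw: "exp u = S" "exp w = cos z" using nz by (simp_all add: u_def w_def)
  have b: "\<bar>Im u\<bar> < pi / 2" "\<bar>Im w\<bar> < pi / 2" using Im_Ln_right_half S K by (auto simp: u_def w_def)
  have nq: "norm q < 1" using z by (simp add: q_def)
  have q1: "1 - q = exp (L + \<i> * z + u)" "1 + q = exp (L + \<i> * z + w)"
    unfolding exp_add L uw using exp_2iz_eq[of z] by (simp_all add: q_def S_def)
  have c1: "cos (2 * z) - 1 = exp (L + 2 * u)" "cos (2 * z) + 1 = exp (L + 2 * w)"
    unfolding exp_add L exp_double uw using cos_2z_eq[of z] by (simp_all add: S_def)
  have lnq: "Ln (1 - q) = L + \<i> * z + u" "Ln (1 + q) = L + \<i> * z + w"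
    unfolding q1 by (rule Ln_exp; use b z L0 in auto)+
  have lnc: "Ln (cos (2 * z) - 1) = L + 2 * u" "Ln (cos (2 * z) + 1) = L + 2 * w"
    unfolding c1 by (rule Ln_exp; use b L0 in auto)+
  have nc: "cos (2 * z) - 1 \<noteq> 0" "cos (2 * z) + 1 \<noteq> 0" unfolding c1 by auto
  have "2 / (1 - cos (2 * z)) = - 4 * q / (1 - q)\<^sup>2"
  proof -
    have qq: "q = exp (\<i> * z) ^ 2" by (simp add: q_def power2_eq_square mult.assoc flip: exp_add)
    have a1: "(1 - q)\<^sup>2 = 4 * q * S\<^sup>2" using exp_2iz_eq(1)[of z] unfolding q_def[symmetric] S_def[symmetric]
      by (simp add: qq power_mult_distrib)
    have a2: "1 - cos (2 * z) = - 2 * S\<^sup>2" using cos_2z_eq(1)[of z] unfolding S_def[symmetric]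
      by (simp add: algebra_simps)
    have "q \<noteq> 0" by (simp add: q_def)
    thus ?thesis unfolding a1 a2 using nz by simp
  qed
  moreover have l2: "(2 * \<nu> + \<alpha> + \<beta> + 2) - 1 \<notin> neg_ints"
  proof -
    have "(2 * \<nu> + \<alpha> + \<beta> + 2) - 1 = 2 * \<nu> + \<alpha> + \<beta> + 1" by simp
    thus ?thesis using l by (simp only:) simp
  qed
  ultimately have "hyp_F (\<nu> + 1) (\<nu> + \<alpha> + 1) (2 * \<nu> + \<alpha> + \<beta> + 2) (2 / (1 - cos (2 * z)))
      = rGamma (2 * \<nu> + \<alpha> + \<beta> + 2) * koebe_fac (\<nu> + 1) (\<nu> + \<alpha> + 1) (2 * \<nu> + \<alpha> + \<beta> + 2) q *
        jac_G (2 * \<nu> + \<alpha> + \<beta> + 2 - 1) (\<nu> + 1 - (\<nu> + \<alpha> + 1)) (2 * \<nu> + \<alpha> + \<beta> + 2 - (\<nu> + 1) - (\<nu> + \<alpha> + 1)) q"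
    using hyp_F_koebe[OF l2 nq, of "\<nu> + 1" "\<nu> + \<alpha> + 1"] by (simp only:)
  also have "2 * \<nu> + \<alpha> + \<beta> + 2 - 1 = 2 * \<nu> + \<alpha> + \<beta> + 1" by simp
  also have "\<nu> + 1 - (\<nu> + \<alpha> + 1) = - \<alpha>" by simp
  also have "2 * \<nu> + \<alpha> + \<beta> + 2 - (\<nu> + 1) - (\<nu> + \<alpha> + 1) = \<beta>" by simp
  also have "koebe_fac (\<nu> + 1) (\<nu> + \<alpha> + 1) (2 * \<nu> + \<alpha> + \<beta> + 2) q =
     exp ((2 * \<nu> + \<alpha> + 3/2) * (L + \<i> * z + u) + (\<beta> - 1/2) * (L + \<i> * z + w))"
    unfolding koebe_fac_def lnq by (simp add: algebra_simps)
  finally have F: "hyp_F (\<nu> + 1) (\<nu> + \<alpha> + 1) (2 * \<nu> + \<alpha> + \<beta> + 2) (2 / (1 - cos (2 * z))) =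
     rGamma (2 * \<nu> + \<alpha> + \<beta> + 2) *
     exp ((2 * \<nu> + \<alpha> + 3/2) * (L + \<i> * z + u) + (\<beta> - 1/2) * (L + \<i> * z + w)) *
     jac_G (2 * \<nu> + \<alpha> + \<beta> + 1) \<alpha> \<beta> q" by simp
  have den: "2 powr (\<nu> + \<alpha> + \<beta>) / ((cos (2 * z) - 1) powr (\<nu> + \<alpha> + 1) * (cos (2 * z) + 1) powr \<beta>)
     = exp ((\<nu> + \<alpha> + \<beta>) * L - (\<nu> + \<alpha> + 1) * (L + 2 * u) - \<beta> * (L + 2 * w))"
    using nc unfolding powr_def lnc by (simp add: L_def[symmetric] exp_diff)
  have p2: "2 powr (2 * \<nu> + \<alpha> + \<beta>) = exp ((2 * \<nu> + \<alpha> + \<beta>) * L)" by (simp add: powr_def L_def)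
  have B: "Beta (\<nu> + \<alpha> + 1) (\<nu> + \<beta> + 1) =
     Gamma (\<nu> + \<alpha> + 1) * Gamma (\<nu> + \<beta> + 1) * rGamma (2 * \<nu> + \<alpha> + \<beta> + 2)"
    unfolding Beta_eq_rGamma by (simp add: algebra_simps)
  have ex: "exp ((\<nu> + \<alpha> + \<beta>) * L - (\<nu> + \<alpha> + 1) * (L + 2 * u) - \<beta> * (L + 2 * w)) *
     exp ((2 * \<nu> + \<alpha> + 3/2) * (L + \<i> * z + u) + (\<beta> - 1/2) * (L + \<i> * z + w)) =
     exp ((2 * \<nu> + \<alpha> + \<beta>) * L) *
     exp (- (\<alpha> + 1/2) * u - (\<beta> + 1/2) * w + \<i> * (2 * \<nu> + \<alpha> + \<beta> + 1) * z)"
    unfolding exp_add[symmetric] by (rule arg_cong[where f = exp]) (simp add: field_simps)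
  have "jacobi_Q \<nu> \<alpha> \<beta> (cos (2 * z)) =
     Gamma (\<nu> + \<alpha> + 1) * Gamma (\<nu> + \<beta> + 1) * rGamma (2 * \<nu> + \<alpha> + \<beta> + 2) *
     (2 powr (\<nu> + \<alpha> + \<beta>) / ((cos (2 * z) - 1) powr (\<nu> + \<alpha> + 1) * (cos (2 * z) + 1) powr \<beta>) *
     exp ((2 * \<nu> + \<alpha> + 3/2) * (L + \<i> * z + u) + (\<beta> - 1/2) * (L + \<i> * z + w))) *
     jac_G (2 * \<nu> + \<alpha> + \<beta> + 1) \<alpha> \<beta> q"
    unfolding jacobi_Q_def F by (simp add: mult_ac)
  also have "\<dots> = jac_scale \<nu> \<alpha> \<beta> *
    exp (- (\<alpha> + 1/2) * u - (\<beta> + 1/2) * w + \<i> * (2 * \<nu> + \<alpha> + \<beta> + 1) * z) *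
    jac_G (2 * \<nu> + \<alpha> + \<beta> + 1) \<alpha> \<beta> q"
    unfolding den ex B p2 by (simp only: mult_ac)
  finally show ?thesis unfolding u_def w_def S_def q_def .
qed

section \<open>Boundary values on the unit circle\<close>

text \<open>Mere boundedness suffices: the equation turns a bound on G into a bound on the
  derivative of q^l \<theta> G, hence on G'. So G is Lipschitz near q0 inside the disc and extends
  continuously.\<close>

lemma jac_G_boundary_limit_exists:
  assumes l: "l \<notin> neg_ints" and q0: "norm q0 = 1" "q0 \<noteq> 1" "q0 \<noteq> -1"
    and bd: "d > 0" "\<And>q. norm q < 1 \<Longrightarrow> dist q0 q < d \<Longrightarrow> norm (jac_G l \<alpha> \<beta> q) \<le> C"
  shows "\<exists>L. (jac_G l \<alpha> \<beta> \<longlongrightarrow> L) (at q0 within ball 0 1)"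
proof -
  let ?G = "jac_G l \<alpha> \<beta>"
  have im: "Im q0 \<noteq> 0"
  proof
    assume "Im q0 = 0"
    hence "\<bar>Re q0\<bar> = 1" using q0(1) by (simp add: cmod_def)
    thus False using q0 \<open>Im q0 = 0\<close> by (auto simp: complex_eq_iff abs_if split: if_splits)
  qed
  \<comment> \<open>A radius below |Im q0| keeps the closed ball off the real axis, and with it away
    from 0, 1, -1 and the branch cut of \<open>Ln\<close>.\<close>
  define e where "e = min (d / 2) (\<bar>Im q0\<bar> / 2)"
  have e: "e > 0" "e < d" "e < \<bar>Im q0\<bar>" using im bd(1) by (auto simp: e_def)
  define K where "K = cball q0 e"
  have Kim: "Im q \<noteq> 0" if "q \<in> K" for q
    using that abs_Im_le_cmod[of "q0 - q"] e(3) by (auto simp: K_def dist_norm)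
  have Kn: "q \<noteq> 0" "1 - q \<noteq> 0" "1 + q \<noteq> 0" "q \<notin> \<real>\<^sub>\<le>\<^sub>0" if "q \<in> K" for q
    using Kim[OF that] by (auto simp: complex_eq_iff complex_nonpos_Reals_iff)
  have bdK: "\<exists>B. \<forall>q\<in>K. norm (f q) \<le> B" if "continuous_on K f" for f :: "complex \<Rightarrow> complex"
    using compact_imp_bounded[OF compact_continuous_image[OF that]] by (auto simp: K_def bounded_iff)
  have "continuous_on K (\<lambda>q. exp ((l - 1) * Ln q) * jac_v \<alpha> \<beta> q)"
    unfolding jac_v_def by (intro continuous_intros) (use Kn in auto)
  from bdK[OF this] obtain B1 where B1: "\<And>q. q \<in> K \<Longrightarrow> norm (exp ((l - 1) * Ln q) * jac_v \<alpha> \<beta> q) \<le> B1" by blast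
  have "continuous_on K (\<lambda>q. exp (- (l + 1) * Ln q))"
    by (intro continuous_intros) (use Kn in auto)
  from bdK[OF this] obtain B2 where B2: "\<And>q. q \<in> K \<Longrightarrow> norm (exp (- (l + 1) * Ln q)) \<le> B2" by blast
  define S where "S = ball q0 e \<inter> ball 0 1"
  have SK: "q \<in> K" "norm q < 1" "dist q0 q < d" if "q \<in> S" for q using that e(2) by (auto simp: S_def K_def)
  have S: "open S" "convex S" by (auto simp: S_def intro: convex_Int)
  have GS: "?G holomorphic_on S" by (rule holomorphic_on_subset[OF jac_G_holomorphic]) (auto simp: S_def)
  have TS: "theta_op ?G holomorphic_on S" by (rule holomorphic_theta_op[OF S(1) GS])
  \<comment> \<open>Multiplication by the integrating factor q^l absorbs the term l \<theta> G: the
    derivative of \<open>m\<close> is q^(l-1) v G.\<close>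
  define m where "m = (\<lambda>q. exp (l * Ln q) * theta_op ?G q)"
  have dm: "(m has_field_derivative exp ((l - 1) * Ln q) * jac_v \<alpha> \<beta> q * ?G q) (at q)" if q: "q \<in> S" for q
  proof -
    note n = Kn[OF SK(1)[OF q]]
    have eq: "exp (l * Ln q) = exp ((l - 1) * Ln q) * q"
      using n(1) by (simp add: algebra_simps exp_diff)
    have d1: "((\<lambda>q. exp (l * Ln q)) has_field_derivative l * exp ((l - 1) * Ln q)) (at q)"
      using n by (auto intro!: derivative_eq_intros simp: eq)
    have "(m has_field_derivative l * exp ((l - 1) * Ln q) * theta_op ?G q + deriv (theta_op ?G) q * exp
        (l * Ln q)) (at q)"
      unfolding m_def by (intro DERIV_mult d1 holomorphic_derivI[OF TS S(1) q])
    also have "l * exp ((l - 1) * Ln q) * theta_op ?G q + deriv (theta_op ?G) q * exp (l * Ln q)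
       = exp ((l - 1) * Ln q) * (theta_op (theta_op ?G) q + l * theta_op ?G q)"
      unfolding eq by (simp add: theta_op_def[of "theta_op ?G"] algebra_simps)
    also have "\<dots> = exp ((l - 1) * Ln q) * jac_v \<alpha> \<beta> q * ?G q"
      by (simp add: jac_G_ode[OF l SK(2)[OF q]])
    finally show ?thesis .
  qed
  have C0: "S \<noteq> {}"
  proof -
    define t where "t = min (e / 2) (1/2)"
    have t: "0 < t" "t < e" "t < 1" using e by (auto simp: t_def)
    have "1 - complex_of_real t = of_real (1 - t)" by simp
    hence "norm ((1 - of_real t) * q0) = 1 - t" using t q0 by (simp only: norm_mult norm_of_real) simp
    moreover have "dist q0 ((1 - of_real t) * q0) = t" using t q0
      by (simp add: dist_norm algebra_simps norm_mult)
    ultimately have "(1 - of_real t) * q0 \<in> S" using t by (simp add: S_def)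
    thus ?thesis by blast
  qed
  then obtain q1 where q1: "q1 \<in> S" by blast
  have C: "C \<ge> 0" using bd(2)[of q1] SK[OF q1] norm_ge_zero order_trans by blast
  have B10: "B1 \<ge> 0" using B1[OF SK(1)[OF q1]] norm_ge_zero order_trans by blast
  have mL: "norm (m q - m q1) \<le> B1 * C * norm (q - q1)" if "q \<in> S" for q
  proof (rule field_differentiable_bound[OF S(2), of m "\<lambda>q. exp ((l - 1) * Ln q) * jac_v \<alpha> \<beta> q * ?G q"])
    fix z assume z: "z \<in> S"
    show "(m has_field_derivative exp ((l - 1) * Ln z) * jac_v \<alpha> \<beta> z * ?G z) (at z within S)"
      using dm[OF z] by (rule has_field_derivative_at_within)
    show "norm (exp ((l - 1) * Ln z) * jac_v \<alpha> \<beta> z * ?G z) \<le> B1 * C"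
      unfolding norm_mult[of "_ * _" "?G z"]
      by (intro mult_mono B1 bd(2) SK z B10) auto
  qed (use that q1 in auto)
  define B3 where "B3 = norm (m q1) + B1 * C * 2"
  have mB: "norm (m q) \<le> B3" if q: "q \<in> S" for q
  proof -
    have "norm (q - q1) \<le> 2" using SK(2)[OF q] SK(2)[OF q1] norm_triangle_ineq4[of q q1] by linarith
    hence "B1 * C * norm (q - q1) \<le> B1 * C * 2" using B10 C by (intro mult_left_mono) auto
    thus ?thesis using mL[OF q] norm_triangle_ineq2[of "m q" "m q1"] by (simp add: B3_def)
  qed
  have GB: "norm (deriv ?G q) \<le> B2 * B3" if q: "q \<in> S" for q
  proof -
    note n = Kn[OF SK(1)[OF q]]
    have "exp (- (l + 1) * Ln q) * m q = exp (- Ln q) * theta_op ?G q"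
      unfolding m_def mult.assoc[symmetric] exp_add[symmetric] by (simp add: algebra_simps)
    also have "\<dots> = deriv ?G q" using n(1) by (simp add: theta_op_def exp_minus)
    finally have "deriv ?G q = exp (- (l + 1) * Ln q) * m q" by simp
    moreover have "B2 \<ge> 0" using B2[OF SK(1)[OF q1]] norm_ge_zero order_trans by blast
    ultimately show ?thesis unfolding norm_mult
      by (simp only: norm_mult) (intro mult_mono B2 SK(1)[OF q] mB q norm_ge_zero)
  qed
  have GL: "norm (?G x - ?G y) \<le> B2 * B3 * norm (x - y)" if "x \<in> S" "y \<in> S" for x y
    by (rule field_differentiable_bound[OF S(2), of ?G "deriv ?G"])
       (use that GB in \<open>auto intro: has_field_derivative_at_within holomorphic_derivI[OF GS S(1)]\<close>)
  have uc: "uniformly_continuous_on S ?G"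
    unfolding uniformly_continuous_on_def
  proof (intro allI impI)
    fix r :: real assume r: "r > 0"
    define D where "D = \<bar>B2 * B3\<bar> + 1"
    have D: "D > 0" "B2 * B3 \<le> D" by (auto simp: D_def)
    show "\<exists>d>0. \<forall>x\<in>S. \<forall>x'\<in>S. dist x' x < d \<longrightarrow> dist (?G x') (?G x) < r"
    proof (intro exI[of _ "r / D"] conjI ballI impI)
      fix x x' assume x: "x \<in> S" "x' \<in> S" "dist x' x < r / D"
      have "norm (?G x' - ?G x) \<le> B2 * B3 * norm (x' - x)" by (rule GL[OF x(2,1)])
      also have "\<dots> \<le> D * norm (x' - x)" by (intro mult_right_mono D) auto
      also have "\<dots> < r" using x(3) D by (simp add: dist_norm field_simps)
      finally show "dist (?G x') (?G x) < r" by (simp add: dist_norm)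
    qed (use r D in auto)
  qed
  have cl: "q0 \<in> closure S"
  proof (rule closure_approachable[THEN iffD2], intro allI impI)
    fix r :: real assume r: "r > 0"
    define t where "t = min (min (e / 2) (1/2)) (r / 2)"
    have t: "0 < t" "t < e" "t < 1" "t < r" using e r by (auto simp: t_def)
    have "1 - complex_of_real t = of_real (1 - t)" by simp
    hence "norm ((1 - of_real t) * q0) = 1 - t" using t q0 by (simp only: norm_mult norm_of_real) simp
    moreover have dd: "dist q0 ((1 - of_real t) * q0) = t" using t q0
      by (simp add: dist_norm algebra_simps norm_mult)
    ultimately have "(1 - of_real t) * q0 \<in> S" using t by (simp add: S_def)
    thus "\<exists>y\<in>S. dist y q0 < r" using dd t by (metis dist_commute)
  qed
  obtain L where "(?G \<longlongrightarrow> L) (at q0 within S)"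
    using uniformly_continuous_on_extension_at_closure[OF uc cl] by blast
  moreover have "at q0 within S = at q0 within ball 0 1"
    by (rule at_within_nhd[of _ "ball q0 e"]) (use e in \<open>auto simp: S_def\<close>)
  ultimately show ?thesis by auto
qed

section \<open>The large-parameter expansion of the Fuchsian solution\<close>

text \<open>With q = e^(2iz), \<open>jac_X\<close> is e^(iz) / (i sin z) and \<open>jac_Y\<close> is
  e^(iz) / cos z. On the unit circle their powers produce the denominators and the phase shifts of
  the expansion.\<close>

definition jac_X :: "complex \<Rightarrow> complex" where "jac_X q = - 2 * q / (1 - q)"
definition jac_Y :: "complex \<Rightarrow> complex" where "jac_Y q = 2 * q / (1 + q)"

definition jac_C :: "complex \<Rightarrow> complex \<Rightarrow> nat \<Rightarrow> complex \<Rightarrow> complex" where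
  "jac_C \<alpha> \<beta> n q = (\<Sum>l=0..n. jacobi_coeff l \<alpha> * jacobi_coeff (n - l) \<beta> *
      (jac_X q ^ l * jac_Y q ^ (n - l)))"

text \<open>This is \<theta> applied to \<open>jac_C\<close>, written out with \<theta> X = (1 -
  X/2) X and the same rule for Y.\<close>

definition jac_C1 :: "complex \<Rightarrow> complex \<Rightarrow> nat \<Rightarrow> complex \<Rightarrow> complex" where
  "jac_C1 \<alpha> \<beta> n q = (\<Sum>l=0..n. jacobi_coeff l \<alpha> * jacobi_coeff (n - l) \<beta> *
      ((of_nat l * (1 - jac_X q / 2) + of_nat (n - l) * (1 - jac_Y q / 2)) *
        (jac_X q ^ l * jac_Y q ^ (n - l))))"

definition jac_S :: "complex \<Rightarrow> complex \<Rightarrow> complex \<Rightarrow> nat \<Rightarrow> complex \<Rightarrow> complex" where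
  "jac_S l \<alpha> \<beta> N q = (\<Sum>n<N. (-1) ^ n * jac_C \<alpha> \<beta> n q / pochhammer (l + 1) n)"

definition jac_S1 :: "complex \<Rightarrow> complex \<Rightarrow> complex \<Rightarrow> nat \<Rightarrow> complex \<Rightarrow> complex" where
  "jac_S1 l \<alpha> \<beta> N q = (\<Sum>n<N. (-1) ^ n * jac_C1 \<alpha> \<beta> n q / pochhammer (l + 1) n)"

lemma two_plus_neq_0: "1 + z \<noteq> 0 \<Longrightarrow> 2 + z * 2 \<noteq> (0::complex)"
  by (metis mult_eq_0_iff distrib_right mult.left_neutral zero_neq_numeral mult_2_right one_add_one)

text \<open>In the variable w = log q the operator \<theta> becomes d/dw, so composing with
  \<open>exp\<close> replaces iterated \<open>theta_op\<close> by ordinary derivatives.\<close>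

lemma deriv_jac_XY_power:
  assumes "exp w \<noteq> 1" "exp w \<noteq> -1"
  shows "((\<lambda>w. jac_X (exp w) ^ l * jac_Y (exp w) ^ m) has_field_derivative
     (of_nat l * (1 - jac_X (exp w) / 2) + of_nat m * (1 - jac_Y (exp w) / 2)) *
       (jac_X (exp w) ^ l * jac_Y (exp w) ^ m)) (at w)"
proof -
  have nz: "1 - exp w \<noteq> 0" "1 + exp w \<noteq> 0" using assms by (auto simp: add_eq_0_iff)
  note nz = nz two_plus_neq_0[OF nz(2)]
  have X: "((\<lambda>w. jac_X (exp w)) has_field_derivative (1 - jac_X (exp w) / 2) * jac_X (exp w)) (at w)"
    unfolding jac_X_def using nz
    by (auto intro!: derivative_eq_intros simp: divide_simps) (auto simp: algebra_simps power2_eq_square)?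
  have Y: "((\<lambda>w. jac_Y (exp w)) has_field_derivative (1 - jac_Y (exp w) / 2) * jac_Y (exp w)) (at w)"
    unfolding jac_Y_def using nz
    by (auto intro!: derivative_eq_intros simp: divide_simps) (auto simp: algebra_simps power2_eq_square)?
  have P: "((\<lambda>w. f w ^ k) has_field_derivative of_nat k * (1 - f w / 2) * f w ^ k) (at w)"
    if "(f has_field_derivative (1 - f w / 2) * f w) (at w)" for f :: "complex \<Rightarrow> complex" and k
  proof (cases k)
    case (Suc j)
    show ?thesis unfolding Suc
      by (rule DERIV_cong[OF DERIV_power_Suc[OF that]]) (simp add: algebra_simps)
  qed auto
  show ?thesis
    by (rule DERIV_cong[OF DERIV_mult[OF P[OF X] P[OF Y]]]) (simp add: algebra_simps)
qed

lemma deriv_jac_C: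
  assumes "exp w \<noteq> 1" "exp w \<noteq> -1"
  shows "((\<lambda>w. jac_C \<alpha> \<beta> n (exp w)) has_field_derivative jac_C1 \<alpha> \<beta> n (exp w)) (at w)"
  unfolding jac_C_def jac_C1_def
  by (intro DERIV_sum DERIV_cmult deriv_jac_XY_power assms)

lemma jacobi_coeff_Suc:
  "(of_nat l + 1) * jacobi_coeff (Suc l) \<mu> = - (1/2) * ((of_nat l + 1/2)\<^sup>2 - \<mu>\<^sup>2) * jacobi_coeff l \<mu>"
proof -
  have "(of_nat l + 1 :: complex) \<noteq> 0" by (metis of_nat_Suc of_nat_neq_0 add.commute)
  moreover have "jacobi_coeff (Suc l) \<mu> = jacobi_coeff l \<mu> * (((1/2 + \<mu> + of_nat l) * (1/2 - \<mu> + of_nat l))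
      / (- 2 * (of_nat l + 1)))"
  proof -
    have den: "(- 2 :: complex) ^ Suc l * fact (Suc l) = ((- 2) ^ l * fact l) * (- 2 * (of_nat l + 1))"
      by (simp add: algebra_simps)
    have num: "pochhammer (1/2 + \<mu>) (Suc l) * pochhammer (1/2 - \<mu>) (Suc l) =
       (pochhammer (1/2 + \<mu>) l * pochhammer (1/2 - \<mu>) l) * ((1/2 + \<mu> + of_nat l) * (1/2 - \<mu> + of_nat l))"
      by (simp add: pochhammer_Suc mult_ac)
    show ?thesis by (simp only: jacobi_coeff_def den num times_divide_times_eq)
  qed
  moreover have "d * (J * (u / (- 2 * d))) = J * (u / (- 2))" if "d \<noteq> 0" for d J u :: complex
    using that by (simp add: field_simps)
  ultimately have "(of_nat l + 1) * jacobi_coeff (Suc l) \<mu> =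
      jacobi_coeff l \<mu> * (((1/2 + \<mu> + of_nat l) * (1/2 - \<mu> + of_nat l)) / (- 2))"
    by (simp only:)
  thus ?thesis by (simp add: power2_eq_square field_simps)
qed

text \<open>Each of the two weights l and n + 1 - l removes one end of the sum; the ratio of
  consecutive \<open>jacobi_coeff\<close> then rewrites \<theta> C of index n + 1 with the
  coefficient products of index n, ready for comparison with the second derivative.\<close>

lemma jac_C1_Suc:
  fixes q :: complex and n :: nat
  defines "X \<equiv> jac_X q" and "Y \<equiv> jac_Y q"
  shows "jac_C1 \<alpha> \<beta> (Suc n) q = - (1/2) * (\<Sum>l=0..n. jacobi_coeff l \<alpha> * jacobi_coeff (n - l) \<beta> *
     ((((of_nat l + 1/2)\<^sup>2 - \<alpha>\<^sup>2) * X * (1 - X / 2) + ((of_nat (n - l) + 1/2)\<^sup>2 - \<beta>\<^sup>2) * Y * (1 - Y / 2))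
       * (X ^ l * Y ^ (n - l))))"
proof -
  let ?a = "\<lambda>l. jacobi_coeff l \<alpha>" and ?b = "\<lambda>l. jacobi_coeff l \<beta>"
  have E: "jac_C1 \<alpha> \<beta> (Suc n) q =
    (\<Sum>l=0..Suc n. of_nat l * ?a l * ?b (Suc n - l) * (1 - X / 2) * X ^ l * Y ^ (Suc n - l)) +
    (\<Sum>l=0..Suc n. ?a l * (of_nat (Suc n - l) * ?b (Suc n - l)) * (1 - Y / 2) * X ^ l * Y ^ (Suc n - l))"
    unfolding jac_C1_def X_def Y_def sum.distrib[symmetric]
    by (intro sum.cong refl) (simp add: algebra_simps)
  have s1: "(\<Sum>l=0..Suc n. of_nat l * ?a l * ?b (Suc n - l) * (1 - X / 2) * X ^ l * Y ^ (Suc n - l)) =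
    (\<Sum>l=0..n. ((of_nat l + 1) * ?a (Suc l)) * ?b (n - l) * (1 - X / 2) * X ^ Suc l * Y ^ (n - l))"
    by (subst sum.atLeast0_atMost_Suc_shift) (simp add: add.commute)
  have s2: "(\<Sum>l=0..Suc n. ?a l * (of_nat (Suc n - l) * ?b (Suc n - l)) * (1 - Y / 2) * X ^ l * Y ^ (Suc n - l)) =
    (\<Sum>l=0..n. ?a l * ((of_nat (n - l) + 1) * ?b (Suc (n - l))) * (1 - Y / 2) * X ^ l * Y ^ Suc (n - l))"
    by (simp add: Suc_diff_le algebra_simps)
  have gen: "- (1/2) * u * a * b * x * X ^ Suc l * Y ^ m + a * (- (1/2) * w * b) * y * X ^ l * Y ^ Suc m
      = - (1/2) * (a * b * ((u * X * x + w * Y * y) * (X ^ l * Y ^ m)))" for a b u w x y and l m :: nat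
    by (simp add: algebra_simps)
  show ?thesis
    unfolding E s1 s2 jacobi_coeff_Suc sum.distrib[symmetric] sum_distrib_left
    by (intro sum.cong refl gen)
qed

text \<open>The cross terms with factor \<open>l * (n - l)\<close> cancel because \<open>X + Y = X * Y\<close>.\<close>

lemma jac_C1_deriv:
  assumes "exp w \<noteq> 1" "exp w \<noteq> -1"
  defines "q \<equiv> exp w"
  shows "((\<lambda>w. jac_C1 \<alpha> \<beta> n (exp w)) has_field_derivative
     of_nat n * jac_C1 \<alpha> \<beta> n q + jac_v \<alpha> \<beta> q * jac_C \<alpha> \<beta> n q + jac_C1 \<alpha> \<beta> (Suc n) q) (at w)"
proof -
  let ?k = "\<lambda>l. jacobi_coeff l \<alpha> * jacobi_coeff (n - l) \<beta>"
  define X Y where "X = jac_X q" and "Y = jac_Y q"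
  define T where "T = (\<lambda>l m. X ^ l * Y ^ m)"
  have nz: "1 - q \<noteq> 0" "1 + q \<noteq> 0" using assms by (auto simp: add_eq_0_iff)
  note nz = nz two_plus_neq_0[OF nz(2)]
  have XY: "X + Y = X * Y"
    using nz unfolding X_def Y_def jac_X_def jac_Y_def by (simp add: divide_simps) (simp add: algebra_simps)
  have v: "jac_v \<alpha> \<beta> q = - (1/2) * ((\<alpha>\<^sup>2 - 1/4) * (X * (1 - X / 2)) + (\<beta>\<^sup>2 - 1/4) * (Y * (1 - Y / 2)))"
  proof -
    define a b where "a = q / (1 - q)\<^sup>2" and "b = q / (1 + q)\<^sup>2"
    have e1: "X * (1 - X / 2) = - 2 * a" "Y * (1 - Y / 2) = 2 * b"
      using nz unfolding X_def Y_def jac_X_def jac_Y_def a_def b_def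
      by (simp_all add: divide_simps power2_eq_square) (simp_all add: algebra_simps)?
    have e2: "jac_v \<alpha> \<beta> q = (\<alpha>\<^sup>2 - 1/4) * a + (1/4 - \<beta>\<^sup>2) * b"
      by (simp add: jac_v_def a_def b_def)
    show ?thesis unfolding e1 e2 by (simp add: algebra_simps)
  qed
  define d where "d = (\<lambda>l m. of_nat l * (1 - X / 2) + of_nat m * (1 - Y / 2))"
  \<comment> \<open>Since l + (n - l) = n, the weight l (1 - X/2) + (n - l) (1 - Y/2) equals n minus
    half of l X + (n - l) Y.\<close>
  have e: "jac_C1 \<alpha> \<beta> n (exp w) = of_nat n * jac_C \<alpha> \<beta> n (exp w) - (1/2) * (\<Sum>l=0..n. ?k l *
     (of_nat l * (jac_X (exp w) ^ Suc l * jac_Y (exp w) ^ (n - l)) +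
      of_nat (n - l) * (jac_X (exp w) ^ l * jac_Y (exp w) ^ Suc (n - l))))" for w
    unfolding jac_C1_def jac_C_def sum_distrib_left sum_subtractf[symmetric]
    by (intro sum.cong refl) (auto simp: of_nat_diff field_simps)
  have D1: "((\<lambda>w. of_nat n * jac_C \<alpha> \<beta> n (exp w) - (1/2) * (\<Sum>l=0..n. ?k l *
     (of_nat l * (jac_X (exp w) ^ Suc l * jac_Y (exp w) ^ (n - l)) +
      of_nat (n - l) * (jac_X (exp w) ^ l * jac_Y (exp w) ^ Suc (n - l))))) has_field_derivative
     (of_nat n * jac_C1 \<alpha> \<beta> n q - (1/2) * (\<Sum>l=0..n. ?k l *
        (of_nat l * (d (Suc l) (n - l) * T (Suc l) (n - l)) +
         of_nat (n - l) * (d l (Suc (n - l)) * T l (Suc (n - l))))))) (at w)"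
    unfolding q_def d_def T_def X_def Y_def
    by (intro DERIV_diff DERIV_cmult DERIV_sum DERIV_add deriv_jac_C deriv_jac_XY_power assms)
  have S2: "- (1/2) * (\<Sum>l=0..n. ?k l *
        (of_nat l * (d (Suc l) (n - l) * T (Suc l) (n - l)) +
         of_nat (n - l) * (d l (Suc (n - l)) * T l (Suc (n - l)))))
     = jac_v \<alpha> \<beta> q * jac_C \<alpha> \<beta> n q + jac_C1 \<alpha> \<beta> (Suc n) q"
  proof -
    have tw: "?k l * (of_nat l * (d (Suc l) m * T (Suc l) m) + of_nat m * (d l (Suc m) * T l (Suc m)))
      = ?k l * (((\<alpha>\<^sup>2 - 1/4) * (X * (1 - X / 2)) + (\<beta>\<^sup>2 - 1/4) * (Y * (1 - Y / 2))) * T l m) +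
        ?k l * ((((of_nat l + 1/2)\<^sup>2 - \<alpha>\<^sup>2) * X * (1 - X / 2) + ((of_nat m + 1/2)\<^sup>2 - \<beta>\<^sup>2) * Y * (1 - Y / 2))
           * T l m)" for l m
    proof -
      have "of_nat l * (d (Suc l) m * T (Suc l) m) + of_nat m * (d l (Suc m) * T l (Suc m))
        = ((((\<alpha>\<^sup>2 - 1/4) * (X * (1 - X / 2)) + (\<beta>\<^sup>2 - 1/4) * (Y * (1 - Y / 2)))) +
          (((of_nat l + 1/2)\<^sup>2 - \<alpha>\<^sup>2) * X * (1 - X / 2) + ((of_nat m + 1/2)\<^sup>2 - \<beta>\<^sup>2) * Y * (1 - Y / 2))
          + of_nat l * of_nat m * (X + Y - X * Y)) * T l m"
        unfolding d_def T_def by (simp add: field_simps power2_eq_square)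
      thus ?thesis unfolding XY by (simp add: distrib_left distrib_right)
    qed
    have "(\<Sum>l=0..n. ?k l * (A * T l (n - l))) = A * (\<Sum>l=0..n. ?k l * T l (n - l))" for A
      by (simp add: sum_distrib_left mult_ac)
    thus ?thesis
      unfolding tw sum.distrib v jac_C1_Suc jac_C_def X_def[symmetric] Y_def[symmetric]
      by (simp only: T_def) (simp add: algebra_simps)
  qed
  have gen: "a - (1/2) * z = a + (- (1/2)) * z" for a z :: complex by simp
  show ?thesis unfolding e by (rule DERIV_cong[OF D1]) (simp only: gen S2 add.assoc)
qed

lemma jac_S_deriv:
  assumes "exp w \<noteq> 1" "exp w \<noteq> -1"
  shows "((\<lambda>w. jac_S l \<alpha> \<beta> N (exp w)) has_field_derivative jac_S1 l \<alpha> \<beta> N (exp w)) (at w)"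
  unfolding jac_S_def jac_S1_def
  by (intro DERIV_sum DERIV_cdivide DERIV_cmult deriv_jac_C assms)

text \<open>By \<open>jac_C1_deriv\<close> the n-th term leaves the defect (l + n) \<theta> C of
  index n plus \<theta> C of index n + 1. As (l + n) / (l + 1)_n is 1 / (l + 1)_(n-1), the
  alternating signs make the defects telescope to the last one; the sum starts cleanly because
  \<theta> C of index 0 is 0.\<close>

lemma jac_S1_deriv:
  assumes w: "exp w \<noteq> 1" "exp w \<noteq> -1" and l: "l \<notin> neg_ints"
  defines "q \<equiv> exp w"
  shows "((\<lambda>w. jac_S1 l \<alpha> \<beta> (Suc N) (exp w)) has_field_derivative
     - l * jac_S1 l \<alpha> \<beta> (Suc N) q + jac_v \<alpha> \<beta> q * jac_S l \<alpha> \<beta> (Suc N) q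
       + (-1) ^ N * jac_C1 \<alpha> \<beta> (Suc N) q / pochhammer (l + 1) N) (at w)"
proof -
  let ?p = "pochhammer (l + 1)"
  have p: "?p n \<noteq> 0" for n
  proof
    assume "?p n = 0"
    then obtain k where "k < n" "l + 1 = - of_nat k" by (auto simp: pochhammer_eq_0_iff)
    hence "l = - of_nat (Suc k)" by (simp add: algebra_simps eq_neg_iff_add_eq_0)
    thus False using l by blast
  qed
  have "((\<lambda>w. jac_S1 l \<alpha> \<beta> (Suc N) (exp w)) has_field_derivative
     (\<Sum>n<Suc N. (-1) ^ n * (of_nat n * jac_C1 \<alpha> \<beta> n q + jac_v \<alpha> \<beta> q * jac_C \<alpha> \<beta> n q + jac_C1 \<alpha> \<beta> (Suc n) q)
         / ?p n)) (at w)"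
    unfolding jac_S1_def q_def by (intro DERIV_sum DERIV_cdivide DERIV_cmult jac_C1_deriv w)
  moreover have "(\<Sum>n<Suc N. (-1) ^ n * (of_nat n * jac_C1 \<alpha> \<beta> n q + jac_v \<alpha> \<beta> q * jac_C \<alpha> \<beta> n q + jac_C1 \<alpha> \<beta>
      (Suc n) q) / ?p n)
     = - l * jac_S1 l \<alpha> \<beta> (Suc N) q + jac_v \<alpha> \<beta> q * jac_S l \<alpha> \<beta> (Suc N) q
       + (-1) ^ N * jac_C1 \<alpha> \<beta> (Suc N) q / ?p N"
  proof -
    have T: "(\<Sum>n<Suc N. (-1) ^ n * ((l + of_nat n) * jac_C1 \<alpha> \<beta> n q + jac_C1 \<alpha> \<beta> (Suc n) q) / ?p n)
       = (-1) ^ N * jac_C1 \<alpha> \<beta> (Suc N) q / ?p N"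
    proof (induction N)
      case 0
      show ?case by (simp add: jac_C1_def)
    next
      case (Suc N)
      have "?p (Suc N) = ?p N * (l + of_nat (Suc N))" by (simp add: pochhammer_Suc add_ac)
      moreover have "l + of_nat (Suc N) \<noteq> 0" using p[of "Suc N"] calculation by auto
      ultimately have "(l + of_nat (Suc N)) * c / ?p (Suc N) = c / ?p N" for c
        using p[of N] by simp
      hence "(-1) ^ Suc N * ((l + of_nat (Suc N)) * jac_C1 \<alpha> \<beta> (Suc N) q + jac_C1 \<alpha> \<beta> (Suc (Suc N)) q) / ?p (Suc N)
         = (-1) ^ Suc N * (jac_C1 \<alpha> \<beta> (Suc N) q / ?p N) + (-1) ^ Suc N * jac_C1 \<alpha> \<beta> (Suc (Suc N)) q / ?p (Suc N)"
        by (simp only: distrib_left add_divide_distrib times_divide_eq_right[symmetric])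
      thus ?case by (subst sum.lessThan_Suc, subst Suc.IH) simp
    qed
    show ?thesis unfolding T[symmetric] jac_S1_def jac_S_def sum_distrib_left sum.distrib[symmetric]
      by (intro sum.cong refl) (simp add: divide_inverse algebra_simps)
  qed
  ultimately show ?thesis by simp
qed

text \<open>In the combination \<open>h - k h1\<close> along \<open>w = w0 - \<omega> s\<close> with \<open>k = (e\<^sup>-\<^sup>l\<^sup>\<omega>\<^sup>s - 1) / l\<close> the derivative
  \<open>h1\<close> cancels on differentiation, and \<open>Re (l \<omega>) \<ge> 0\<close> keeps \<open>k\<close> of size \<open>2 / \<bar>l\<bar>\<close>.\<close>

lemma spiral_bound:
  fixes h h1 u :: "complex \<Rightarrow> complex"
  assumes h: "\<And>w. Re w < 0 \<Longrightarrow> (h has_field_derivative h1 w) (at w)"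
    and h1: "\<And>w. Re w < 0 \<Longrightarrow> (h1 has_field_derivative - l * h1 w + u w) (at w)"
    and w0: "Re w0 < 0" and om: "norm \<omega> = 1" "0 < \<kappa>" "\<kappa> \<le> Re \<omega>" "0 \<le> Re (l * \<omega>)" "l \<noteq> 0"
    and lim: "((\<lambda>s. h (w0 - \<omega> * of_real s)) \<longlongrightarrow> 0) at_top"
      "((\<lambda>s. h1 (w0 - \<omega> * of_real s)) \<longlongrightarrow> 0) at_top"
    and u: "\<And>s. s \<ge> 0 \<Longrightarrow> norm (u (w0 - \<omega> * of_real s)) \<le> B * exp (- \<kappa> * s)"
  shows "norm (h w0) \<le> 2 * B / (\<kappa> * norm l)"
proof -
  define W where "W = (\<lambda>s::real. w0 - \<omega> * of_real s)"
  define k where "k = (\<lambda>s::real. (exp (- (l * \<omega>) * of_real s) - 1) / l)"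
  define \<Phi> where "\<Phi> = (\<lambda>s. h (W s) - k s * h1 (W s))"
  have W: "Re (W s) < 0" if "s \<ge> 0" for s
  proof -
    have "Re \<omega> * s \<ge> 0" using om that by (intro mult_nonneg_nonneg) auto
    thus ?thesis using w0 by (simp add: W_def)
  qed
  have B: "B \<ge> 0" using order_trans[OF norm_ge_zero u[of 0]] by simp
  have kb: "norm (k s) \<le> 2 / norm l" if "s \<ge> 0" for s
  proof -
    have "norm (exp (- (l * \<omega>) * of_real s)) \<le> 1"
      using om that by (simp add: mult_nonneg_nonneg)
    hence "norm (exp (- (l * \<omega>) * of_real s) - 1) \<le> 2"
      using norm_triangle_ineq4[of "exp (- (l * \<omega>) * of_real s)" 1] unfolding norm_one by linarith
    thus ?thesis unfolding k_def norm_divide by (intro divide_right_mono) auto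
  qed
  have dW: "(W has_vector_derivative - \<omega>) (at s)" for s
    unfolding W_def by (auto intro!: derivative_eq_intros)
  have dk: "(k has_vector_derivative - \<omega> * exp (- (l * \<omega>) * of_real s)) (at s)" for s
  proof -
    have "((\<lambda>z. (exp (- (l * \<omega>) * z) - 1) / l) has_field_derivative - \<omega> * exp (- (l * \<omega>) * of_real s)) (at (of_real s))"
      using om by (auto intro!: derivative_eq_intros)
    from has_vector_derivative_real_field[OF this] show ?thesis by (simp add: k_def)
  qed
  have d\<Phi>: "(\<Phi> has_vector_derivative \<omega> * k s * u (W s)) (at s)" if s: "s \<ge> 0" for s
  proof -
    have a: "((\<lambda>s. h (W s)) has_vector_derivative - \<omega> * h1 (W s)) (at s)"
      using field_vector_diff_chain_at[OF dW h[OF W[OF s]]] by (simp add: o_def mult.commute)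
    have b: "((\<lambda>s. h1 (W s)) has_vector_derivative - \<omega> * (- l * h1 (W s) + u (W s))) (at s)"
      using field_vector_diff_chain_at[OF dW h1[OF W[OF s]]] by (simp add: o_def mult.commute)
    have "(\<Phi> has_vector_derivative (- \<omega> * h1 (W s) -
       (k s * (- \<omega> * (- l * h1 (W s) + u (W s))) + (- \<omega> * exp (- (l * \<omega>) * of_real s)) * h1 (W s)))) (at s)"
      unfolding \<Phi>_def
      by (intro has_vector_derivative_diff a has_vector_derivative_mult b dk)
    also have "(- \<omega> * h1 (W s) -
       (k s * (- \<omega> * (- l * h1 (W s) + u (W s))) + (- \<omega> * exp (- (l * \<omega>) * of_real s)) * h1 (W s)))
       = \<omega> * k s * u (W s)"
    proof -
      have "exp (- (l * \<omega>) * of_real s) = l * k s + 1" using om by (simp add: k_def)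
      thus ?thesis by (simp only:) (simp add: algebra_simps)
    qed
    finally show ?thesis .
  qed
  \<comment> \<open>An antiderivative of the bound for the derivative of \<open>\<Phi>\<close>; its
    total increase on the half-line is 2 B / (\<kappa> |l|).\<close>
  define b where "b = (\<lambda>s. - (2 * B / (norm l * \<kappa>)) * exp (- \<kappa> * s))"
  have db: "(b has_vector_derivative 2 / norm l * (B * exp (- \<kappa> * s))) (at s)" for s
    unfolding b_def using om
    by (auto intro!: derivative_eq_intros simp flip: has_real_derivative_iff_has_vector_derivative)
  have mvt: "norm (\<Phi> T - \<Phi> 0) \<le> 2 * B / (\<kappa> * norm l)" if T: "T > 0" for T
  proof -
    have "norm (\<Phi> T - \<Phi> 0) \<le> b T - b 0"
    proof (rule differentiable_bound_general[OF T, of \<Phi> b "\<lambda>s. \<omega> * k s * u (W s)" "\<lambda>s. 2 / norm l * (B * exp (- \<kappa> * s))"])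
      show "continuous_on {0..T} \<Phi>"
        by (intro continuous_at_imp_continuous_on ballI has_vector_derivative_continuous[OF d\<Phi>]) auto
      show "continuous_on {0..T} b" unfolding b_def by (intro continuous_intros)
    next
      fix s assume s: "0 < s" "s < T"
      show "(\<Phi> has_vector_derivative \<omega> * k s * u (W s)) (at s)" using d\<Phi> s by simp
      show "(b has_vector_derivative 2 / norm l * (B * exp (- \<kappa> * s))) (at s)" by (rule db)
      have "norm (\<omega> * k s * u (W s)) = norm (k s) * norm (u (W s))" by (simp add: norm_mult om)
      also have "\<dots> \<le> 2 / norm l * (B * exp (- \<kappa> * s))"
        using s kb[of s] u[of s] by (intro mult_mono) (auto simp: W_def)
      finally show "norm (\<omega> * k s * u (W s)) \<le> 2 / norm l * (B * exp (- \<kappa> * s))" .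
    qed
    also have "\<dots> \<le> - b 0" using B om by (simp add: b_def)
    also have "\<dots> = 2 * B / (\<kappa> * norm l)" by (simp add: b_def mult.commute)
    finally show ?thesis .
  qed
  have "(\<Phi> \<longlongrightarrow> 0) at_top"
  proof -
    have "((\<lambda>s. k s * h1 (W s)) \<longlongrightarrow> 0) at_top"
    proof (rule Lim_null_comparison)
      show "eventually (\<lambda>s. norm (k s * h1 (W s)) \<le> 2 / norm l * norm (h1 (W s))) at_top"
        unfolding norm_mult
        by (rule eventually_mono[OF eventually_ge_at_top[of 0]]) (intro mult_right_mono kb norm_ge_zero)
      show "((\<lambda>s. 2 / norm l * norm (h1 (W s))) \<longlongrightarrow> 0) at_top"
        unfolding W_def by (rule tendsto_mult_right_zero[OF tendsto_norm_zero[OF lim(2)]])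
    qed
    from tendsto_diff[OF lim(1)[folded W_def] this] show ?thesis
      by (simp add: \<Phi>_def[abs_def] W_def)
  qed
  hence "((\<lambda>T. norm (\<Phi> T - \<Phi> 0)) \<longlongrightarrow> norm (0 - \<Phi> 0)) at_top"
    by (intro tendsto_intros)
  hence "norm (0 - \<Phi> 0) \<le> 2 * B / (\<kappa> * norm l)"
    by (rule tendsto_upperbound)
       (use mvt in \<open>auto intro: eventually_mono[OF eventually_gt_at_top[of 0]]\<close>)
  \<comment> \<open>k vanishes at s = 0, so \<open>\<Phi> 0\<close> is h at the starting
    point.\<close>
  thus ?thesis by (simp add: \<Phi>_def k_def W_def)
qed

text \<open>The inhomogeneity contains h itself. With m the supremum of |h| along the spiral,
  \<open>spiral_bound\<close> gives m \<le> 2 (V m + \<rho>) / (\<kappa> |l|), and 4 V \<le>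
  \<kappa> |l| lets half of m be absorbed on the left.\<close>

lemma spiral_bound_selfref:
  fixes h h1 v r :: "complex \<Rightarrow> complex"
  assumes h: "\<And>w. Re w < 0 \<Longrightarrow> (h has_field_derivative h1 w) (at w)"
    and h1: "\<And>w. Re w < 0 \<Longrightarrow> (h1 has_field_derivative - l * h1 w + (v w * h w - r w)) (at w)"
    and w0: "Re w0 < 0" and om: "norm \<omega> = 1" "0 < \<kappa>" "\<kappa> \<le> Re \<omega>" "0 \<le> Re (l * \<omega>)" "l \<noteq> 0"
    and lim: "((\<lambda>s. h (w0 - \<omega> * of_real s)) \<longlongrightarrow> 0) at_top"
      "((\<lambda>s. h1 (w0 - \<omega> * of_real s)) \<longlongrightarrow> 0) at_top"
    and v: "\<And>s. s \<ge> 0 \<Longrightarrow> norm (v (w0 - \<omega> * of_real s)) \<le> V * exp (- \<kappa> * s)"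
    and r: "\<And>s. s \<ge> 0 \<Longrightarrow> norm (r (w0 - \<omega> * of_real s)) \<le> \<rho> * exp (- \<kappa> * s)"
    and l: "4 * V \<le> \<kappa> * norm l"
  shows "norm (h w0) \<le> 4 * \<rho> / (\<kappa> * norm l)"
proof -
  define W where "W = (\<lambda>s::real. w0 - \<omega> * of_real s)"
  have V: "V \<ge> 0" "\<rho> \<ge> 0" using order_trans[OF norm_ge_zero v[of 0]] order_trans[OF norm_ge_zero r[of 0]] by auto
  have W: "Re (W s) < 0" if "s \<ge> 0" for s
  proof -
    have "Re \<omega> * s \<ge> 0" using om that by (intro mult_nonneg_nonneg) auto
    thus ?thesis using w0 by (simp add: W_def)
  qed
  have contW: "continuous_on {0..} (\<lambda>s. norm (h (W s)))"
  proof (rule continuous_on_norm, rule continuous_on_compose2[where g = h and t = "{w. Re w < 0}"])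
    show "continuous_on {w. Re w < 0} h"
      by (intro continuous_at_imp_continuous_on ballI) (use h in \<open>auto intro: DERIV_isCont\<close>)
    show "continuous_on {0..} W" unfolding W_def by (intro continuous_intros)
  qed (use W in auto)
  \<comment> \<open>The supremum is finite: h tends to 0 at the end of the spiral and is continuous
    on the compact initial piece. Without finiteness the absorption would prove nothing.\<close>
  obtain T where T: "\<And>s. s \<ge> T \<Longrightarrow> norm (h (W s)) < 1"
    using tendstoD[OF lim(1), of 1] by (auto simp: eventually_at_top_linorder W_def)
  have "compact ((\<lambda>s. norm (h (W s))) ` {0..max 0 T})"
    by (intro compact_continuous_image continuous_on_subset[OF contW]) auto
  then obtain b where "\<forall>s\<in>{0..max 0 T}. norm (h (W s)) \<le> b"
    by (auto dest!: compact_imp_bounded simp: bounded_iff)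
  hence b: "\<And>s. 0 \<le> s \<Longrightarrow> s \<le> max 0 T \<Longrightarrow> norm (h (W s)) \<le> b" by simp
  have bd: "norm (h (W s)) \<le> max b 1" if "s \<ge> 0" for s
    using b[of s] T[of s] that by (cases "s \<le> max 0 T") (auto simp: max_def split: if_splits)
  define m where "m = (SUP s\<in>{0..}. norm (h (W s)))"
  have bdd: "bdd_above ((\<lambda>s. norm (h (W s))) ` {0..})" using bd by (auto simp: bdd_above_def)
  have m: "norm (h (W s)) \<le> m" if "s \<ge> 0" for s
    unfolding m_def using bdd that by (intro cSUP_upper) auto
  have m0: "m \<ge> 0" using order_trans[OF norm_ge_zero m[of 0]] by simp
  have kl: "\<kappa> * norm l > 0" using om by simp
  \<comment> \<open>The tail of a spiral is a spiral with the same direction, so the bound holds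
    from every point of the path and thus for the supremum.\<close>
  have step: "norm (h (W s0)) \<le> 2 * (V * m + \<rho>) / (\<kappa> * norm l)" if s0: "s0 \<ge> 0" for s0
  proof (rule spiral_bound[of h h1 l "\<lambda>w. v w * h w - r w" "W s0" \<omega> \<kappa>])
    have sh: "W s0 - \<omega> * of_real s = W (s0 + s)" for s by (simp add: W_def algebra_simps)
    have fl: "filterlim (\<lambda>s. s0 + s) at_top at_top" by (rule filterlim_tendsto_add_at_top[OF tendsto_const
        filterlim_ident])
    show "((\<lambda>s. h (W s0 - \<omega> * of_real s)) \<longlongrightarrow> 0) at_top"
      unfolding sh using filterlim_compose[OF lim(1) fl] by (simp add: W_def)
    show "((\<lambda>s. h1 (W s0 - \<omega> * of_real s)) \<longlongrightarrow> 0) at_top"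
      unfolding sh using filterlim_compose[OF lim(2) fl] by (simp add: W_def)
    fix s :: real assume s: "s \<ge> 0"
    let ?w = "W (s0 + s)"
    have "norm (v ?w * h ?w - r ?w) \<le> norm (v ?w) * norm (h ?w) + norm (r ?w)"
      using norm_triangle_ineq4[of "v ?w * h ?w" "r ?w"] by (simp add: norm_mult)
    also have "\<dots> \<le> V * exp (- \<kappa> * (s0 + s)) * m + \<rho> * exp (- \<kappa> * (s0 + s))"
      using v[of "s0 + s"] r[of "s0 + s"] m[of "s0 + s"] s s0 V
      by (intro add_mono mult_mono) (auto simp: W_def)
    also have "\<dots> = (V * m + \<rho>) * exp (- \<kappa> * (s0 + s))" by (simp add: algebra_simps)
    also have "\<dots> \<le> (V * m + \<rho>) * exp (- \<kappa> * s)"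
      using s0 om V m0 by (intro mult_left_mono) auto
    finally show "norm (v (W s0 - \<omega> * of_real s) * h (W s0 - \<omega> * of_real s) - r (W s0 - \<omega> * of_real s))
       \<le> (V * m + \<rho>) * exp (- \<kappa> * s)" unfolding sh .
  qed (use h h1 W[OF s0] om in auto)
  have "m \<le> 2 * (V * m + \<rho>) / (\<kappa> * norm l)"
    unfolding m_def by (rule cSUP_least) (use step in \<open>auto simp: m_def\<close>)
  hence "m * (\<kappa> * norm l) \<le> 2 * V * m + 2 * \<rho>" using kl by (simp add: field_simps)
  moreover have "4 * V * m \<le> (\<kappa> * norm l) * m" by (intro mult_right_mono l m0)
  ultimately have "m * (\<kappa> * norm l) \<le> 4 * \<rho>" by (simp add: algebra_simps)
  hence "m \<le> 4 * \<rho> / (\<kappa> * norm l)" using kl by (simp add: field_simps)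
  thus ?thesis using m[of 0] by (simp add: W_def)
qed

section \<open>Uniform bounds along the spirals\<close>

text \<open>The points 1 and -1 have distance |sin \<theta>| from the line through 0 in direction
  \<theta> = Im w, on which e^w lies.\<close>

lemma norm_one_pm_exp_ge:
  "\<bar>sin (Im w)\<bar> \<le> norm (1 - exp w)" "\<bar>sin (Im w)\<bar> \<le> norm (1 + exp w)"
proof -
  define \<rho> \<theta> where "\<rho> = exp (Re w)" and "\<theta> = Im w"
  have gen: "(1 - r * c)\<^sup>2 + (r * s)\<^sup>2 = (r - c)\<^sup>2 + s\<^sup>2" if "s\<^sup>2 + c\<^sup>2 = 1" for r c s :: real
    using that by algebra
  have a: "(norm (1 - exp w))\<^sup>2 = (\<rho> - cos \<theta>)\<^sup>2 + (sin \<theta>)\<^sup>2"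
    using gen[of "sin \<theta>" "cos \<theta>" \<rho>] by (simp add: cmod_power2 Re_exp Im_exp \<rho>_def \<theta>_def)
  have b: "(norm (1 + exp w))\<^sup>2 = (\<rho> + cos \<theta>)\<^sup>2 + (sin \<theta>)\<^sup>2"
    using gen[of "sin \<theta>" "- cos \<theta>" \<rho>] by (simp add: cmod_power2 Re_exp Im_exp \<rho>_def \<theta>_def)
  show "\<bar>sin (Im w)\<bar> \<le> norm (1 - exp w)" "\<bar>sin (Im w)\<bar> \<le> norm (1 + exp w)"
    by (rule power2_le_imp_le; simp add: a b \<theta>_def)+
qed

lemma abs_sin_ge:
  assumes "0 \<le> e" "e \<le> \<bar>x\<bar>" "\<bar>x\<bar> \<le> pi - e"
  shows "sin e \<le> \<bar>sin x\<bar>"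
proof -
  have "sin e \<le> sin \<bar>x\<bar>"
  proof (cases "\<bar>x\<bar> \<le> pi / 2")
    case True
    thus ?thesis using assms by (intro sin_monotone_2pi_le) auto
  next
    case False
    have "sin e \<le> sin (pi - \<bar>x\<bar>)" using assms False by (intro sin_monotone_2pi_le) auto
    thus ?thesis by simp
  qed
  thus ?thesis by (simp add: abs_if split: if_splits)
qed

text \<open>The path is split at s = e/2. Up to there the argument has turned by at most e/2, as |Im
  \<omega>| \<le> 1, and the sine bound applies; afterwards the modulus has dropped to exp (-
  \<kappa> e/2).\<close>

lemma spiral_away_from_pm_1:
  assumes e: "0 < e" "e \<le> \<bar>Im w\<bar>" "\<bar>Im w\<bar> \<le> pi - e" and w: "Re w < 0"
    and om: "norm \<omega> = 1" "0 < \<kappa>" "\<kappa> \<le> Re \<omega>" and s: "s \<ge> 0"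
  defines "c \<equiv> min (sin (e / 2)) (1 - exp (- \<kappa> * (e / 2)))" and "q \<equiv> exp (w - \<omega> * of_real s)"
  shows "c \<le> norm (1 - q)" "c \<le> norm (1 + q)" "norm q \<le> exp (- \<kappa> * s)"
proof -
  have "\<kappa> * s \<le> Re \<omega> * s" by (intro mult_right_mono om s)
  thus q: "norm q \<le> exp (- \<kappa> * s)" using w by (simp add: q_def)
  have "c \<le> norm (1 - q) \<and> c \<le> norm (1 + q)"
  proof (cases "s \<le> e / 2")
    case True
    have "\<bar>Im \<omega>\<bar> \<le> 1" using abs_Im_le_cmod[of \<omega>] om by simp
    hence "\<bar>Im \<omega>\<bar> * s \<le> 1 * s" by (intro mult_right_mono s)
    hence "\<bar>Im \<omega> * s\<bar> \<le> e / 2" using True s by (simp add: abs_mult)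
    moreover have "\<bar>Im w\<bar> - \<bar>Im \<omega> * s\<bar> \<le> \<bar>Im w - Im \<omega> * s\<bar>" "\<bar>Im w - Im \<omega> * s\<bar> \<le> \<bar>Im w\<bar> + \<bar>Im \<omega> * s\<bar>"
      by (rule abs_triangle_ineq2 abs_triangle_ineq4)+
    moreover have "Im (w - \<omega> * of_real s) = Im w - Im \<omega> * s" by simp
    ultimately have "e / 2 \<le> \<bar>Im (w - \<omega> * of_real s)\<bar>" "\<bar>Im (w - \<omega> * of_real s)\<bar> \<le> pi - e / 2" using e by linarith+
    hence "sin (e / 2) \<le> \<bar>sin (Im (w - \<omega> * of_real s))\<bar>" using e by (intro abs_sin_ge) auto
    thus ?thesis using norm_one_pm_exp_ge[of "w - \<omega> * of_real s"] by (auto simp: c_def q_def)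
  next
    case False
    hence "exp (- \<kappa> * s) \<le> exp (- \<kappa> * (e / 2))" using om by simp
    hence "norm q \<le> exp (- \<kappa> * (e / 2))" using q by linarith
    moreover have "1 - norm q \<le> norm (1 - q)" "1 - norm q \<le> norm (1 + q)"
      using norm_triangle_ineq2[of 1 q] norm_diff_ineq[of 1 q] by auto
    ultimately show ?thesis by (auto simp: c_def)
  qed
  thus "c \<le> norm (1 - q)" "c \<le> norm (1 + q)" by auto
qed

lemma jacobi_coeff_bounded: "\<exists>K. \<forall>\<mu>. norm \<mu> \<le> M \<longrightarrow> norm (jacobi_coeff n \<mu>) \<le> K"
proof -
  have "continuous_on (cball 0 M) (jacobi_coeff n)"
    unfolding jacobi_coeff_def pochhammer_prod by (intro continuous_intros) auto
  hence "bounded (jacobi_coeff n ` cball 0 M)"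
    by (intro compact_imp_bounded compact_continuous_image) auto
  then obtain a where "\<forall>x\<in>jacobi_coeff n ` cball 0 M. norm x \<le> a" unfolding bounded_iff by blast
  hence "\<forall>\<mu>. norm \<mu> \<le> M \<longrightarrow> norm (jacobi_coeff n \<mu>) \<le> a" by simp
  thus ?thesis by blast
qed

lemma jacobi_coeff_bounded_upto:
  "\<exists>K\<ge>0. \<forall>n\<le>N. \<forall>\<mu>. norm \<mu> \<le> M \<longrightarrow> norm (jacobi_coeff n \<mu>) \<le> K"
proof -
  obtain K where K: "\<And>n \<mu>. norm \<mu> \<le> M \<Longrightarrow> norm (jacobi_coeff n \<mu>) \<le> K n"
    using jacobi_coeff_bounded[of M] by metis
  define B where "B = (\<Sum>n\<le>N. \<bar>K n\<bar>)"
  have "norm (jacobi_coeff n \<mu>) \<le> B" if "n \<le> N" "norm \<mu> \<le> M" for n \<mu>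
  proof -
    have "\<bar>K n\<bar> \<le> B" unfolding B_def using that by (intro member_le_sum) auto
    thus ?thesis using K[OF that(2), of n] by linarith
  qed
  moreover have "B \<ge> 0" unfolding B_def by (intro sum_nonneg) auto
  ultimately show ?thesis by blast
qed

text \<open>At positive index every summand carries at least one factor X or Y, hence a factor q;
  along the spiral that factor supplies the decay e^(-\<kappa> s).\<close>

lemma jac_C1_bound:
  assumes c: "c > 0"
  shows "\<exists>K\<ge>0. \<forall>\<alpha> \<beta> q. norm \<alpha> \<le> M \<longrightarrow> norm \<beta> \<le> M \<longrightarrow> norm q \<le> 1 \<longrightarrow> c \<le> norm (1 - q) \<longrightarrow> c \<le> norm (1 + q)
     \<longrightarrow> norm (jac_C1 \<alpha> \<beta> (Suc n) q) \<le> K * norm q"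
proof -
  obtain A where A: "A \<ge> 0" "\<And>k \<mu>. k \<le> Suc n \<Longrightarrow> norm \<mu> \<le> M \<Longrightarrow> norm (jacobi_coeff k \<mu>) \<le> A"
    using jacobi_coeff_bounded_upto[of "Suc n" M] by blast
  define K where "K = (\<Sum>l=0..Suc n. A * A * (2 * real (Suc n) / c * (2 / c) ^ Suc n))"
  have "norm (jac_C1 \<alpha> \<beta> (Suc n) q) \<le> K * norm q"
    if ab: "norm \<alpha> \<le> M" "norm \<beta> \<le> M" and q: "norm q \<le> 1" "c \<le> norm (1 - q)" "c \<le> norm (1 + q)" for \<alpha> \<beta> q
  proof -
    have nz: "1 - q \<noteq> 0" "1 + q \<noteq> 0" using q c by auto
    have X: "norm (jac_X q) \<le> 2 / c * norm q" "norm (jac_Y q) \<le> 2 / c * norm q"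
      unfolding jac_X_def jac_Y_def norm_divide norm_mult using q c
      by (simp_all add: frac_le mult_mono)
    have "1 - jac_X q / 2 = 1 / (1 - q)" "1 - jac_Y q / 2 = 1 / (1 + q)"
      using nz two_plus_neq_0[OF nz(2)] by (simp_all add: jac_X_def jac_Y_def field_simps)
    hence X2: "norm (1 - jac_X q / 2) \<le> 1 / c" "norm (1 - jac_Y q / 2) \<le> 1 / c"
      using q c by (simp_all add: norm_divide frac_le)
    have "norm (jac_C1 \<alpha> \<beta> (Suc n) q) \<le> (\<Sum>l=0..Suc n. A * A * (2 * real (Suc n) / c * ((2 / c) ^ Suc n * norm q)))"
      unfolding jac_C1_def
    proof (rule sum_norm_le)
      fix l assume "l \<in> {0..Suc n}"
      hence l: "l \<le> Suc n" "Suc n - l \<le> Suc n" "l + (Suc n - l) = Suc n" by auto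
      have e0: "0 \<le> 2 / c * norm q" using c by simp
      have "norm (jac_X q ^ l * jac_Y q ^ (Suc n - l)) \<le> (2 / c * norm q) ^ l * (2 / c * norm q) ^ (Suc n - l)"
        unfolding norm_mult norm_power using X e0 by (intro mult_mono power_mono) auto
      also have "\<dots> = (2 / c * norm q) ^ Suc n" by (simp only: power_add[symmetric] l(3))
      also have "\<dots> = (2 / c) ^ Suc n * norm q ^ Suc n" by (rule power_mult_distrib)
      also have "\<dots> \<le> (2 / c) ^ Suc n * norm q"
        using q c power_decreasing[of 1 "Suc n" "norm q"] by (intro mult_left_mono) auto
      finally have a: "norm (jac_X q ^ l * jac_Y q ^ (Suc n - l)) \<le> (2 / c) ^ Suc n * norm q" .
      have "norm (of_nat l * (1 - jac_X q / 2) + of_nat (Suc n - l) * (1 - jac_Y q / 2)) \<le>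
         real l * norm (1 - jac_X q / 2) + real (Suc n - l) * norm (1 - jac_Y q / 2)"
        by (rule order.trans[OF norm_triangle_ineq]) (simp only: norm_mult norm_of_nat order_refl)
      also have "\<dots> \<le> real (Suc n) * (1 / c) + real (Suc n) * (1 / c)"
        using X2 l c by (intro add_mono mult_mono) auto
      finally have b: "norm (of_nat l * (1 - jac_X q / 2) + of_nat (Suc n - l) * (1 - jac_Y q / 2)) \<le> 2 *
          real (Suc n) / c"
        by simp
      show "norm (jacobi_coeff l \<alpha> * jacobi_coeff (Suc n - l) \<beta> *
        ((of_nat l * (1 - jac_X q / 2) + of_nat (Suc n - l) * (1 - jac_Y q / 2)) *
          (jac_X q ^ l * jac_Y q ^ (Suc n - l)))) \<le> A * A * (2 * real (Suc n) / c * ((2 / c) ^ Suc n * norm q))"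
        unfolding norm_mult[of "_ * _" "_ * (_ * _)"] norm_mult[of "_ + _"] norm_mult[of "jacobi_coeff l \<alpha>"]
        using A(1) c by (intro mult_mono A(2) l ab a b) auto
    qed
    also have "\<dots> = K * norm q" unfolding K_def sum_distrib_right by (simp add: mult_ac)
    finally show ?thesis .
  qed
  moreover have "K \<ge> 0" unfolding K_def using A c by (intro sum_nonneg) auto
  ultimately show ?thesis by blast
qed

lemma jac_v_bound:
  assumes c: "c > 0" and ab: "norm \<alpha> \<le> M" "norm \<beta> \<le> M" and q: "c \<le> norm (1 - q)" "c \<le> norm (1 + q)"
  shows "norm (jac_v \<alpha> \<beta> q) \<le> 2 * (M\<^sup>2 + 1/4) / c\<^sup>2 * norm q"
proof -
  have M: "M \<ge> 0" using ab norm_ge_zero order_trans by blast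
  have b: "norm (\<alpha>\<^sup>2 - 1/4) \<le> M\<^sup>2 + 1/4" "norm (1/4 - \<beta>\<^sup>2) \<le> M\<^sup>2 + 1/4"
  proof -
    have "norm (\<alpha>\<^sup>2) \<le> M\<^sup>2" "norm (\<beta>\<^sup>2) \<le> M\<^sup>2" unfolding norm_power by (intro power_mono ab; simp)+
    thus "norm (\<alpha>\<^sup>2 - 1/4) \<le> M\<^sup>2 + 1/4" "norm (1/4 - \<beta>\<^sup>2) \<le> M\<^sup>2 + 1/4"
      using norm_triangle_ineq4[of "\<alpha>\<^sup>2" "1/4"] norm_triangle_ineq4[of "1/4" "\<beta>\<^sup>2"] by auto
  qed
  have i: "norm (1 / (1 - q)\<^sup>2) \<le> 1 / c\<^sup>2" "norm (1 / (1 + q)\<^sup>2) \<le> 1 / c\<^sup>2"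
    unfolding norm_divide norm_power using c q by (auto intro!: frac_le power_mono)
  have "jac_v \<alpha> \<beta> q = (\<alpha>\<^sup>2 - 1/4) * (1 / (1 - q)\<^sup>2) * q + (1/4 - \<beta>\<^sup>2) * (1 / (1 + q)\<^sup>2) * q"
    by (simp add: jac_v_def)
  also have "norm \<dots> \<le> norm (\<alpha>\<^sup>2 - 1/4) * norm (1 / (1 - q)\<^sup>2) * norm q + norm (1/4 - \<beta>\<^sup>2) * norm (1 / (1 + q)\<^sup>2) * norm q"
    by (rule order.trans[OF norm_triangle_ineq]) (simp only: norm_mult order_refl)
  also have "\<dots> \<le> (M\<^sup>2 + 1/4) * (1 / c\<^sup>2) * norm q + (M\<^sup>2 + 1/4) * (1 / c\<^sup>2) * norm q"
    using M by (intro add_mono mult_mono b i) auto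
  also have "A * (1 / c\<^sup>2) * y + A * (1 / c\<^sup>2) * y = 2 * A / c\<^sup>2 * y" for A y :: real by simp
  finally show ?thesis .
qed

lemma norm_pochhammer_ge:
  assumes "2 * real N \<le> norm (l::complex)"
  shows "(norm l / 2) ^ N \<le> norm (pochhammer (l + 1) N)"
proof -
  have "(norm l / 2) ^ N = (\<Prod>i=0..<N. norm l / 2)" by simp
  also have "\<dots> \<le> (\<Prod>i=0..<N. norm (l + 1 + of_nat i))"
  proof (rule prod_mono)
    fix i assume i: "i \<in> {0..<N}"
    have a1: "norm l - norm (of_nat (Suc i) :: complex) \<le> norm (l + of_nat (Suc i))"
      by (rule norm_diff_ineq)
    have a2: "norm (of_nat (Suc i) :: complex) \<le> real N" using i unfolding norm_of_nat by simp
    have a3: "l + 1 + of_nat i = l + of_nat (Suc i)" by simp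
    show "0 \<le> norm l / 2 \<and> norm l / 2 \<le> norm (l + 1 + of_nat i)"
      unfolding a3 using a1 a2 assms norm_ge_zero[of l] by (intro conjI) linarith+
  qed
  also have "\<dots> = norm (pochhammer (l + 1) N)" unfolding pochhammer_prod prod_norm ..
  finally show ?thesis .
qed

lemma isCont_jac_S:
  assumes "q \<noteq> 1" "q \<noteq> -1"
  shows "isCont (jac_S l \<alpha> \<beta> N) q" "isCont (jac_S1 l \<alpha> \<beta> N) q"
proof -
  have nz: "1 - q \<noteq> 0" "1 + q \<noteq> 0" using assms by (auto simp: add_eq_0_iff)
  define A where "A = {q::complex. 1 - q \<noteq> 0 \<and> 1 + q \<noteq> 0}"
  have A: "open A" unfolding A_def by (intro open_Collect_conj open_Collect_neq continuous_intros)
  have XY: "continuous_on A jac_X" "continuous_on A jac_Y"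
    unfolding jac_X_def[abs_def] jac_Y_def[abs_def] by (auto intro!: continuous_intros simp: A_def)
  have "continuous_on A (jac_S l \<alpha> \<beta> N)" "continuous_on A (jac_S1 l \<alpha> \<beta> N)"
    unfolding jac_S_def[abs_def] jac_S1_def[abs_def] jac_C_def jac_C1_def divide_inverse[of _ "pochhammer _ _"]
      divide_inverse[of _ 2]
    by (intro continuous_intros XY)+
  thus "isCont (jac_S l \<alpha> \<beta> N) q" "isCont (jac_S1 l \<alpha> \<beta> N) q"
    using nz unfolding continuous_on_eq_continuous_at[OF A] by (simp_all add: A_def)
qed

lemma jac_C_0: "jac_C \<alpha> \<beta> n 0 = (if n = 0 then 1 else 0)"
proof (cases n)
  case (Suc m)
  have "jacobi_coeff l \<alpha> * jacobi_coeff (n - l) \<beta> * (jac_X 0 ^ l * jac_Y 0 ^ (n - l)) = 0" for l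
    using Suc by (cases l) (auto simp: jac_X_def jac_Y_def)
  hence "jac_C \<alpha> \<beta> n 0 = (\<Sum>l=0..n. 0)" unfolding jac_C_def by (intro sum.cong refl)
  thus ?thesis using Suc by simp
qed (simp add: jac_C_def jacobi_coeff_def)

lemma jac_C1_0: "jac_C1 \<alpha> \<beta> n 0 = 0"
  unfolding jac_C1_def
proof (rule sum.neutral, rule ballI)
  fix l assume "l \<in> {0..n}"
  thus "jacobi_coeff l \<alpha> * jacobi_coeff (n - l) \<beta> *
      ((of_nat l * (1 - jac_X 0 / 2) + of_nat (n - l) * (1 - jac_Y 0 / 2)) *
        (jac_X 0 ^ l * jac_Y 0 ^ (n - l))) = 0"
    by (cases "l = 0"; cases "n - l = 0") (auto simp: jac_X_def jac_Y_def zero_power)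
qed

lemma jac_S_0: "jac_S l \<alpha> \<beta> (Suc N) 0 = 1" "jac_S1 l \<alpha> \<beta> N 0 = 0"
proof -
  have "jac_S l \<alpha> \<beta> (Suc N) 0 = (\<Sum>n<Suc N. if n = 0 then 1 else 0)"
    unfolding jac_S_def by (intro sum.cong refl) (simp add: jac_C_0)
  thus "jac_S l \<alpha> \<beta> (Suc N) 0 = 1" by (simp add: sum.delta)
  show "jac_S1 l \<alpha> \<beta> N 0 = 0" by (simp add: jac_S1_def jac_C1_0)
qed

text \<open>Here w is a logarithm of q. The predicate gathers what makes the estimates uniform: the
  constants below depend on e, \<kappa>, M and the order alone.\<close>

definition jac_admissible :: "real \<Rightarrow> real \<Rightarrow> real \<Rightarrow> complex \<Rightarrow> complex \<Rightarrow> complex \<Rightarrow> complex \<Rightarrow> complex \<Rightarrow> bool" where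
  "jac_admissible e \<kappa> M l \<alpha> \<beta> \<omega> w \<longleftrightarrow> norm \<omega> = 1 \<and> \<kappa> \<le> Re \<omega> \<and> 0 \<le> Re (l * \<omega>) \<and>
     norm \<alpha> \<le> M \<and> norm \<beta> \<le> M \<and> Re w < 0 \<and> e \<le> \<bar>Im w\<bar> \<and> \<bar>Im w\<bar> \<le> pi - e"

text \<open>The half-plane Re (l \<omega>) \<ge> 0 misses the negative real axis whenever Re
  \<omega> > 0.\<close>

lemma not_neg_ints_rotated:
  assumes "0 \<le> Re (l * \<omega>)" "0 < Re \<omega>" shows "l \<notin> neg_ints"
proof
  assume "l \<in> neg_ints"
  then obtain n where "n > 0" "l = - of_nat n" by auto
  hence "Re (l * \<omega>) = - (real n * Re \<omega>)" by simp
  moreover have "real n * Re \<omega> > 0" using \<open>n > 0\<close> assms by simp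
  ultimately show False using assms by linarith
qed

text \<open>The difference of G and the partial sum solves the equation up to the inhomogeneity
  \<open>r\<close>, of order |l|^(-N). It vanishes at q = 0 together with its \<theta>-derivative,
  since both functions start with 1, and \<open>spiral_bound_selfref\<close> adds the last factor
  1/|l|.\<close>

lemma jac_G_expansion_Suc:
  assumes e: "0 < e" "e < pi" and \<kappa>: "0 < \<kappa>"
  shows "\<exists>C R. \<forall>l \<alpha> \<beta> \<omega> w. jac_admissible e \<kappa> M l \<alpha> \<beta> \<omega> w \<longrightarrow> R \<le> norm l \<longrightarrow>
     norm (jac_G l \<alpha> \<beta> (exp w) - jac_S l \<alpha> \<beta> (Suc N) (exp w)) \<le> C / norm l ^ Suc N"
proof -
  define c where "c = min (sin (e / 2)) (1 - exp (- \<kappa> * (e / 2)))"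
  have c: "c > 0" using e \<kappa> by (auto simp: c_def intro!: sin_gt_zero mult_pos_pos)
  obtain K where K: "K \<ge> 0" "\<And>\<alpha> \<beta> q. norm \<alpha> \<le> M \<Longrightarrow> norm \<beta> \<le> M \<Longrightarrow> norm q \<le> 1 \<Longrightarrow> c \<le> norm (1 - q) \<Longrightarrow> c \<le> norm (1 + q)
     \<Longrightarrow> norm (jac_C1 \<alpha> \<beta> (Suc N) q) \<le> K * norm q"
    using jac_C1_bound[OF c, of M N] by blast
  define V where "V = 2 * (M\<^sup>2 + 1/4) / c\<^sup>2"
  have V: "V \<ge> 0" unfolding V_def by (intro divide_nonneg_nonneg) auto
  \<comment> \<open>The summand 2 N serves the lower bound of the Pochhammer symbol, 4 V / \<kappa>
    the absorption in \<open>spiral_bound_selfref\<close>, and 1 keeps l away from 0.\<close>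
  define R where "R = 1 + 2 * real N + 4 * V / \<kappa>"
  have "norm (jac_G l \<alpha> \<beta> (exp w) - jac_S l \<alpha> \<beta> (Suc N) (exp w)) \<le> (4 * K * 2 ^ N / \<kappa>) / norm l ^ Suc N"
    if adm: "jac_admissible e \<kappa> M l \<alpha> \<beta> \<omega> w" and R: "R \<le> norm l" for l \<alpha> \<beta> \<omega> w
  proof -
    have om: "norm \<omega> = 1" "\<kappa> \<le> Re \<omega>" "0 \<le> Re (l * \<omega>)" and ab: "norm \<alpha> \<le> M" "norm \<beta> \<le> M"
      and w: "Re w < 0" "e \<le> \<bar>Im w\<bar>" "\<bar>Im w\<bar> \<le> pi - e"
      using adm by (auto simp: jac_admissible_def)
    have V4: "4 * V / \<kappa> \<ge> 0" using V \<kappa> by simp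
    have l1: "norm l \<ge> 1" "2 * real N \<le> norm l" "4 * V / \<kappa> \<le> norm l" using R V4 by (auto simp: R_def)
    have l: "l \<noteq> 0" using l1 by auto
    have ln: "l \<notin> neg_ints" by (rule not_neg_ints_rotated[OF om(3)]) (use om \<kappa> in auto)
    define G where "G = jac_G l \<alpha> \<beta>"
    define h where "h = (\<lambda>w. G (exp w) - jac_S l \<alpha> \<beta> (Suc N) (exp w))"
    define h1 where "h1 = (\<lambda>w. theta_op G (exp w) - jac_S1 l \<alpha> \<beta> (Suc N) (exp w))"
    define r where "r = (\<lambda>w. (-1) ^ N * jac_C1 \<alpha> \<beta> (Suc N) (exp w) / pochhammer (l + 1) N)"
    have Gh: "G holomorphic_on ball 0 1" "theta_op G holomorphic_on ball 0 1"
      unfolding G_def by (auto intro!: jac_G_holomorphic holomorphic_theta_op)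
    have ne: "exp w \<noteq> 1" "exp w \<noteq> -1" "norm (exp w) < 1" if "Re w < 0" for w :: complex
      using that norm_exp_eq_Re[of w] by (auto dest: arg_cong[where f = norm])
    have ch: "((\<lambda>w. f (exp w)) has_field_derivative theta_op f (exp w)) (at w)"
      if "f holomorphic_on ball 0 1" "Re w < 0" for f w
    proof -
      have "(f has_field_derivative deriv f (exp w)) (at (exp w))"
        using ne[OF that(2)] by (intro holomorphic_derivI[OF that(1)]) auto
      from DERIV_chain2[OF this DERIV_exp] show ?thesis by (simp add: theta_op_def mult.commute)
    qed
    have "norm (h w) \<le> 4 * (K * (2 / norm l) ^ N) / (\<kappa> * norm l)"
    proof (rule spiral_bound_selfref[of h h1 l "\<lambda>w. jac_v \<alpha> \<beta> (exp w)" r w \<omega> \<kappa> V])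
      fix w :: complex assume w: "Re w < 0"
      show "(h has_field_derivative h1 w) (at w)"
        unfolding h_def h1_def by (intro DERIV_diff ch Gh jac_S_deriv ne w)
      have o: "theta_op (theta_op G) (exp w) = - l * theta_op G (exp w) + jac_v \<alpha> \<beta> (exp w) * G (exp w)"
        using jac_G_ode[OF ln ne(3)[OF w], of \<alpha> \<beta>] by (simp add: G_def algebra_simps eq_diff_eq)
      have "(h1 has_field_derivative theta_op (theta_op G) (exp w) - (- l * jac_S1 l \<alpha> \<beta> (Suc N) (exp w)
           + jac_v \<alpha> \<beta> (exp w) * jac_S l \<alpha> \<beta> (Suc N) (exp w) + r w)) (at w)"
        unfolding h1_def r_def by (intro DERIV_diff ch Gh jac_S1_deriv ne w ln)
      also have "theta_op (theta_op G) (exp w) - (- l * jac_S1 l \<alpha> \<beta> (Suc N) (exp w)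
           + jac_v \<alpha> \<beta> (exp w) * jac_S l \<alpha> \<beta> (Suc N) (exp w) + r w)
          = - l * h1 w + (jac_v \<alpha> \<beta> (exp w) * h w - r w)"
        unfolding o by (simp add: h_def h1_def algebra_simps)
      finally show "(h1 has_field_derivative - l * h1 w + (jac_v \<alpha> \<beta> (exp w) * h w - r w)) (at w)" .
    next
      have ex0: "((\<lambda>s. exp (w - \<omega> * of_real s)) \<longlongrightarrow> 0) at_top"
      proof (rule Lim_null_comparison)
        show "eventually (\<lambda>s. norm (exp (w - \<omega> * of_real s)) \<le> exp (- \<kappa> * s)) at_top"
          by (rule eventually_mono[OF eventually_ge_at_top[of 0]])
             (rule spiral_away_from_pm_1(3)[OF e(1) w(2,3,1) om(1) \<kappa> om(2)])
        have "filterlim (\<lambda>s. \<kappa> * s) at_top at_top"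
          using \<kappa> by (intro filterlim_tendsto_pos_mult_at_top[OF tendsto_const _ filterlim_ident])
        hence "filterlim (\<lambda>s. - \<kappa> * s) at_bot at_top" by (simp add: filterlim_uminus_at_bot)
        thus "((\<lambda>s. exp (- \<kappa> * s)) \<longlongrightarrow> 0) at_top" by (rule filterlim_compose[OF exp_at_bot])
      qed
      have lf: "((\<lambda>s. f (exp (w - \<omega> * of_real s))) \<longlongrightarrow> f 0) at_top" if "isCont f 0" for f :: "complex \<Rightarrow> complex"
        using isCont_tendsto_compose[OF that ex0] .
      have ic: "isCont f 0" if "f holomorphic_on ball 0 1" for f
        using holomorphic_on_imp_continuous_on[OF that] continuous_on_eq_continuous_at[of "ball (0::complex) 1" f] by auto
      have "((\<lambda>s. h (w - \<omega> * of_real s)) \<longlongrightarrow> G 0 - jac_S l \<alpha> \<beta> (Suc N) 0) at_top"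
        unfolding h_def by (intro tendsto_diff lf ic Gh isCont_jac_S) auto
      thus "((\<lambda>s. h (w - \<omega> * of_real s)) \<longlongrightarrow> 0) at_top" by (simp add: G_def jac_S_0)
      have "((\<lambda>s. h1 (w - \<omega> * of_real s)) \<longlongrightarrow> theta_op G 0 - jac_S1 l \<alpha> \<beta> (Suc N) 0) at_top"
        unfolding h1_def by (intro tendsto_diff lf ic Gh isCont_jac_S) auto
      thus "((\<lambda>s. h1 (w - \<omega> * of_real s)) \<longlongrightarrow> 0) at_top" by (simp add: theta_op_def jac_S_0)
    next
      fix s :: real assume s: "s \<ge> 0"
      note sp = spiral_away_from_pm_1[OF e(1) w(2,3,1) om(1) \<kappa> om(2) s, folded c_def]
      have le1: "norm (exp (w - \<omega> * of_real s)) \<le> 1"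
      proof -
        have "exp (- \<kappa> * s) \<le> 1" using \<kappa> s by simp
        thus ?thesis using sp(3) by linarith
      qed
      show "norm (jac_v \<alpha> \<beta> (exp (w - \<omega> * of_real s))) \<le> V * exp (- \<kappa> * s)"
        using jac_v_bound[OF c ab sp(1,2)] mult_left_mono[OF sp(3) V] unfolding V_def by linarith
      have p: "(norm l / 2) ^ N \<le> norm (pochhammer (l + 1) N)" by (rule norm_pochhammer_ge[OF l1(2)])
      have p0: "(norm l / 2) ^ N > 0" using l by simp
      have "norm (r (w - \<omega> * of_real s)) = norm (jac_C1 \<alpha> \<beta> (Suc N) (exp (w - \<omega> * of_real s))) / norm
          (pochhammer (l + 1) N)"
        by (simp add: r_def norm_mult norm_divide norm_power)
      also have "\<dots> \<le> (K * exp (- \<kappa> * s)) / (norm l / 2) ^ N"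
        using K(2)[OF ab le1 sp(1,2)] mult_left_mono[OF sp(3) K(1)] K(1) p p0
        by (intro frac_le) auto
      also have "\<dots> = K * (2 / norm l) ^ N * exp (- \<kappa> * s)" using l by (simp add: power_divide field_simps)
      finally show "norm (r (w - \<omega> * of_real s)) \<le> K * (2 / norm l) ^ N * exp (- \<kappa> * s)" .
    next
      show "4 * V \<le> \<kappa> * norm l" using l1(3) \<kappa> by (simp add: field_simps)
    qed (use w om \<kappa> l in auto)
    also have "\<dots> = (4 * K * 2 ^ N / \<kappa>) / norm l ^ Suc N" using l \<kappa> by (simp add: power_divide field_simps)
    finally show ?thesis by (simp add: h_def G_def)
  qed
  thus ?thesis by blast
qed

text \<open>The case N = 0 says that G is bounded. It follows from order 1, whose partial sum is the
  constant 1, and later guarantees the boundary limits.\<close>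

lemma jac_G_expansion:
  assumes e: "0 < e" "e < pi" and \<kappa>: "0 < \<kappa>"
  shows "\<exists>C R. \<forall>l \<alpha> \<beta> \<omega> w. jac_admissible e \<kappa> M l \<alpha> \<beta> \<omega> w \<longrightarrow> R \<le> norm l \<longrightarrow>
     norm (jac_G l \<alpha> \<beta> (exp w) - jac_S l \<alpha> \<beta> N (exp w)) \<le> C / norm l ^ N"
proof (cases N)
  case 0
  obtain C R where CR: "\<And>l \<alpha> \<beta> \<omega> w. jac_admissible e \<kappa> M l \<alpha> \<beta> \<omega> w \<Longrightarrow> R \<le> norm l \<Longrightarrow>
     norm (jac_G l \<alpha> \<beta> (exp w) - jac_S l \<alpha> \<beta> (Suc 0) (exp w)) \<le> C / norm l ^ Suc 0"
    using jac_G_expansion_Suc[OF e \<kappa>, of M 0] by blast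
  have "norm (jac_G l \<alpha> \<beta> (exp w) - jac_S l \<alpha> \<beta> N (exp w)) \<le> (\<bar>C\<bar> + 1) / norm l ^ N"
    if "jac_admissible e \<kappa> M l \<alpha> \<beta> \<omega> w" "max R 1 \<le> norm l" for l \<alpha> \<beta> \<omega> w
  proof -
    have "jac_S l \<alpha> \<beta> (Suc 0) (exp w) = 1" by (simp add: jac_S_def jac_C_def jacobi_coeff_def)
    hence "norm (jac_G l \<alpha> \<beta> (exp w) - 1) \<le> C / norm l" using CR[OF that(1)] that(2) by simp
    also have "\<dots> \<le> \<bar>C\<bar> / 1" using that(2) by (intro frac_le) auto
    finally have "norm (jac_G l \<alpha> \<beta> (exp w)) \<le> \<bar>C\<bar> + 1"
      using norm_triangle_ineq2[of "jac_G l \<alpha> \<beta> (exp w)" 1] by simp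
    thus ?thesis by (simp add: 0 jac_S_def)
  qed
  thus ?thesis by blast
qed (use jac_G_expansion_Suc[OF e \<kappa>] in blast)

section \<open>Gauss's summation theorem\<close>

lemma nonpos_Ints_iff_neg_ints: "c - 1 \<in> neg_ints \<longleftrightarrow> c \<in> \<int>\<^sub>\<le>\<^sub>0"
proof
  assume "c - 1 \<in> neg_ints"
  then obtain n where n: "n > 0" "c - 1 = - of_nat n" by auto
  then obtain m where "n = Suc m" by (cases n) auto
  hence "c = - of_nat m" using n by (simp add: algebra_simps eq_neg_iff_add_eq_0)
  thus "c \<in> \<int>\<^sub>\<le>\<^sub>0" by simp
next
  assume "c \<in> \<int>\<^sub>\<le>\<^sub>0"
  then obtain m where "c = - of_nat m" by (auto elim: nonpos_Ints_cases')
  hence "c - 1 = - of_nat (Suc m)" by simp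
  thus "c - 1 \<in> neg_ints" by blast
qed

text \<open>Euler's transformation. Passing to c - b, c - a only flips the sign of c - a - b, which
  \<open>jac_G\<close> does not see; the gauge factors differ by the power 2 (c - a - b) of (1 + p)
  / (1 - p) = sqrt (1 - y).\<close>

lemma hyp_F_euler_real:
  assumes c: "c \<notin> \<int>\<^sub>\<le>\<^sub>0" and y: "0 < y" "y < 1"
  shows "hyp_F_series a b c (of_real y) =
     exp ((c - a - b) * of_real (ln (1 - y))) * hyp_F_series (c - b) (c - a) c (of_real y)"
proof -
  define r where "r = sqrt (1 - y)"
  have r: "0 < r" "r < 1" "r\<^sup>2 = 1 - y" using y by (auto simp: r_def)
  define p where "p = (r - 1) / (r + 1)"
  have p: "1 - p = 2 / (r + 1)" "1 + p = 2 * r / (r + 1)" using r by (simp_all add: p_def field_simps)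
  have pp: "1 - p > 0" "1 + p > 0" unfolding p using r by auto
  have q: "norm (complex_of_real p) < 1" using pp by (simp add: abs_less_iff)
  have x: "- 4 * complex_of_real p / (1 - complex_of_real p)\<^sup>2 = of_real y"
  proof -
    have "- 4 * p / (1 - p)\<^sup>2 = (1 - r) * (1 + r)"
      unfolding p(1) p_def using r by (simp add: divide_simps power2_eq_square) (simp add: algebra_simps)
    also have "\<dots> = y" using r(3) by (simp add: power2_eq_square algebra_simps)
    finally have "complex_of_real (- 4 * p / (1 - p)\<^sup>2) = of_real y" by (simp only:)
    thus ?thesis by simp
  qed
  have ny: "norm (complex_of_real y) < 1" using y by simp
  have c1: "c - 1 \<notin> neg_ints" using c nonpos_Ints_iff_neg_ints by blast
  have L: "Ln (1 - complex_of_real p) = of_real (ln (1 - p))" "Ln (1 + complex_of_real p) = of_real (ln (1 + p))"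
    using Ln_of_real[OF pp(1)] Ln_of_real[OF pp(2)] by simp_all
  have lny: "ln (1 - y) = 2 * (ln (1 + p) - ln (1 - p))"
  proof -
    have "ln (1 + p) - ln (1 - p) = ln ((1 + p) / (1 - p))" using pp by (simp add: ln_div)
    also have "(1 + p) / (1 - p) = r" unfolding p using r by simp
    finally show ?thesis using r(1) r(3)[symmetric] by (simp add: ln_realpow)
  qed
  have k: "koebe_fac a b c (of_real p) = exp ((c - a - b) * of_real (ln (1 - y))) * koebe_fac (c - b)
      (c - a) c (of_real p)"
    unfolding koebe_fac_def L lny exp_add[symmetric] by (rule arg_cong[where f = exp]) (simp add: field_simps)
  have "c - b - (c - a) = a - b" "c - (c - b) - (c - a) = - (c - a - b)" by simp_all
  hence g: "jac_G (c - 1) (c - b - (c - a)) (c - (c - b) - (c - a)) = jac_G (c - 1) (a - b) (c - a - b)"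
    by (simp only: jac_G_minus(2))
  have "hyp_F a b c (of_real y) = exp ((c - a - b) * of_real (ln (1 - y))) * hyp_F (c - b) (c - a) c (of_real y)"
    using hyp_F_koebe[OF c1 q, of a b, unfolded x k] hyp_F_koebe[OF c1 q, of "c - b" "c - a", unfolded x g]
    by (simp only: mult_ac)
  thus ?thesis using hyp_F_eq_series[OF ny] by simp
qed

text \<open>A quotient of Gauss's limits for 1/\<Gamma>: the factorials cancel in pairs, and so do
  the powers of n because A + B = c + \<tau>.\<close>

lemma pochhammer_ratio_tendsto:
  fixes A B c \<tau> :: complex
  assumes eq: "A + B = c + \<tau>" and c: "c \<notin> \<int>\<^sub>\<le>\<^sub>0" and \<tau>: "\<tau> \<notin> \<int>\<^sub>\<le>\<^sub>0"
  shows "(\<lambda>n. pochhammer A n * pochhammer B n / (pochhammer c n * pochhammer \<tau> n))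
           \<longlonglongrightarrow> rGamma A * rGamma B / (rGamma c * rGamma \<tau>)"
proof -
  have "(\<lambda>n. rGamma_series A n * rGamma_series B n / (rGamma_series c n * rGamma_series \<tau> n))
     \<longlonglongrightarrow> rGamma A * rGamma B / (rGamma c * rGamma \<tau>)"
    using c \<tau> by (intro tendsto_intros rGamma_series_LIMSEQ) (simp_all add: rGamma_eq_zero_iff)
  moreover have "eventually (\<lambda>n. rGamma_series A n * rGamma_series B n / (rGamma_series c n * rGamma_series \<tau> n)
      = pochhammer A (Suc n) * pochhammer B (Suc n) / (pochhammer c (Suc n) * pochhammer \<tau> (Suc n))) sequentially"
    using eventually_gt_at_top[of 0]
  proof eventually_elim
    case (elim n)
    have "exp (A * of_real (ln (real n))) * exp (B * of_real (ln (real n))) =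
      exp (c * of_real (ln (real n))) * exp (\<tau> * of_real (ln (real n)))"
      unfolding exp_add[symmetric] distrib_right[symmetric] eq ..
    moreover have "(a / (f * e1)) * (b / (f * e2)) / ((c' / (f * e3)) * (t / (f * e4))) = a * b / (c' * t)"
      if "e1 * e2 = e3 * e4" "f \<noteq> 0" "e1 \<noteq> 0" "e2 \<noteq> 0" "e3 \<noteq> 0" "e4 \<noteq> 0" for a b c' t f e1 e2 e3 e4 :: complex
    proof -
      have "(a / (f * e1)) * (b / (f * e2)) = a * b / (f * f * (e1 * e2))"
        "(c' / (f * e3)) * (t / (f * e4)) = c' * t / (f * f * (e3 * e4))" by (simp_all add: mult_ac)
      thus ?thesis using that by simp
    qed
    ultimately show ?case unfolding rGamma_series_def by (simp only: fact_nonzero exp_not_eq_zero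
        not_False_eq_True Suc_eq_plus1)
  qed
  ultimately have "(\<lambda>n. pochhammer A (Suc n) * pochhammer B (Suc n) / (pochhammer c (Suc n) * pochhammer \<tau> (Suc n)))
     \<longlonglongrightarrow> rGamma A * rGamma B / (rGamma c * rGamma \<tau>)"
    by (rule Lim_transform_eventually)
  thus ?thesis by (rule LIMSEQ_imp_Suc[of "\<lambda>n. pochhammer A n * pochhammer B n / (pochhammer c n * pochhammer \<tau> n)"])
qed

text \<open>The powers n^\<tau> and n^(Re \<tau>) have equal modulus, so the quotient of the two
  symbols is, in modulus, a quotient of convergent sequences with nonzero limit below, hence
  bounded.\<close>

lemma pochhammer_norm_bound:
  assumes "Re \<tau> > 0"
  shows "\<exists>K>0. \<forall>n. norm (pochhammer \<tau> n) \<le> K * pochhammer (Re \<tau>) n"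
proof -
  have nz: "complex_of_real (Re \<tau>) \<notin> \<int>\<^sub>\<le>\<^sub>0" using assms
    by (auto elim!: nonpos_Ints_cases' simp: complex_eq_iff)
  have "(\<lambda>n. norm (rGamma_series \<tau> n / rGamma_series (of_real (Re \<tau>)) n)) \<longlonglongrightarrow> norm (rGamma \<tau> / rGamma
      (complex_of_real (Re \<tau>)))"
    using nz by (intro tendsto_intros rGamma_series_LIMSEQ) (simp add: rGamma_eq_zero_iff)
  hence "Bseq (\<lambda>n. norm (rGamma_series \<tau> n / rGamma_series (complex_of_real (Re \<tau>)) n))"
    by (intro convergent_imp_Bseq) (auto simp: convergent_def)
  then obtain K where K: "K > 0" "\<And>n. norm (rGamma_series \<tau> n / rGamma_series (complex_of_real (Re \<tau>)) n) \<le> K"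
    unfolding Bseq_def by auto
  have pos: "pochhammer (Re \<tau>) n > 0" for n using assms by (rule pochhammer_pos)
  have pc: "norm (pochhammer (complex_of_real (Re \<tau>)) n) = pochhammer (Re \<tau>) n" for n
    using pos[of n] by (simp add: pochhammer_of_real)
  have b: "norm (pochhammer \<tau> (Suc n)) \<le> K * pochhammer (Re \<tau>) (Suc n)" if "n > 0" for n
  proof -
    have "norm (exp (\<tau> * of_real (ln (real n)))) = norm (exp (complex_of_real (Re \<tau>) * of_real (ln (real n))))"
      by simp
    hence E: "norm (rGamma_series \<tau> n / rGamma_series (complex_of_real (Re \<tau>)) n)
       = norm (pochhammer \<tau> (Suc n)) / pochhammer (Re \<tau>) (Suc n)"
      unfolding rGamma_series_def norm_divide norm_mult pc by simp
    show ?thesis using K(2)[of n] unfolding E by (simp only: pos_divide_le_eq[OF pos])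
  qed
  \<comment> \<open>The limit formula controls lengths from 2 on; the summands 1 and |\<tau>| / Re
    \<tau> take care of lengths 0 and 1.\<close>
  define K' where "K' = K + 1 + norm \<tau> / Re \<tau>"
  have "norm (pochhammer \<tau> n) \<le> K' * pochhammer (Re \<tau>) n" for n
  proof -
    show ?thesis
    proof (cases "n \<le> 1")
      case True
      hence "n = 0 \<or> n = 1" by linarith
      thus ?thesis using K(1) assms by (auto simp: K'_def field_simps)
    next
      case False
      then obtain m where m: "n = Suc m" "m > 0" by (cases n) auto
      have "K * pochhammer (Re \<tau>) n \<le> K' * pochhammer (Re \<tau>) n"
        using less_imp_le[OF pos[of n]] assms by (intro mult_right_mono) (auto simp: K'_def)
      thus ?thesis using b[OF m(2)] m(1) by simp
    qed
  qed
  moreover have "K' > 0" using K(1) assms by (auto simp: K'_def intro!: add_pos_nonneg)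
  ultimately show ?thesis by blast
qed

lemma binomial_pochhammer_sums:
  assumes "norm (y::complex) < 1"
  shows "(\<lambda>n. pochhammer \<tau> n / fact n * y ^ n) sums exp (- \<tau> * Ln (1 - y))"
proof -
  have "(\<lambda>n. (- \<tau> gchoose n) * (- y) ^ n) sums (1 + (- y)) powr (- \<tau>)"
    by (rule gen_binomial_complex) (use assms in simp)
  moreover have "(- \<tau> gchoose n) * (- y) ^ n = pochhammer \<tau> n / fact n * y ^ n" for n
    by (subst gbinomial_pochhammer, subst (2) power_minus) (simp add: mult_ac flip: power_mult_distrib)
  moreover have "(1 + (- y)) powr (- \<tau>) = exp (- \<tau> * Ln (1 - y))"
    using norm_lt_1_imp(3)[OF assms] by (simp add: powr_def)
  ultimately show ?thesis by simp
qed

text \<open>An Abelian argument: the coefficients of the series are asymptotically proportional to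
  those of \<open>(1 - y)\<^sup>-\<^sup>\<tau>\<close>.\<close>

lemma hyp_F_series_abel:
  assumes c: "c \<notin> \<int>\<^sub>\<le>\<^sub>0" and \<tau>: "A + B - c = \<tau>" "Re \<tau> > 0"
  shows "((\<lambda>y. exp (\<tau> * of_real (ln (1 - y))) * hyp_F_series A B c (of_real y))
           \<longlongrightarrow> Gamma \<tau> * rGamma A * rGamma B) (at_left 1)"
proof -
  define \<rho> where "\<rho> = Re \<tau>"
  have \<rho>: "\<rho> > 0" using \<tau> by (simp add: \<rho>_def)
  have \<tau>n: "\<tau> \<notin> \<int>\<^sub>\<le>\<^sub>0" using \<tau>(2) by (auto elim!: nonpos_Ints_cases')
  \<comment> \<open>\<open>e n\<close> is the quotient of the n-th coefficient by that of (1 -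
    y)^(-\<tau>); it tends to the claimed limit \<open>L\<close>.\<close>
  define e where "e = (\<lambda>n. pochhammer A n * pochhammer B n / (pochhammer c n * pochhammer \<tau> n) * rGamma c)"
  define L where "L = Gamma \<tau> * rGamma A * rGamma B"
  have pcn: "pochhammer c n \<noteq> 0" "pochhammer \<tau> n \<noteq> 0" for n
    using c \<tau>n by (auto simp: pochhammer_eq_0_iff)
  have "e \<longlonglongrightarrow> rGamma A * rGamma B / (rGamma c * rGamma \<tau>) * rGamma c"
    unfolding e_def using c \<tau>n \<tau>(1) by (intro tendsto_mult pochhammer_ratio_tendsto tendsto_const)
        (auto simp: algebra_simps)
  also have "rGamma A * rGamma B / (rGamma c * rGamma \<tau>) * rGamma c = L"
    using c by (simp add: L_def Gamma_def rGamma_eq_zero_iff field_simps)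
  finally have eL: "e \<longlonglongrightarrow> L" .
  have d: "fps_nth (hyp_fps A B c) n = e n * (pochhammer \<tau> n / fact n)" for n
  proof -
    have "rGamma c = pochhammer c n * rGamma (c + of_nat n)" using pochhammer_rGamma[of c n] by simp
    thus ?thesis using pcn[of n] by (simp add: hyp_fps_def e_def)
  qed
  obtain K where K: "K > 0" "\<And>n. norm (pochhammer \<tau> n) \<le> K * pochhammer \<rho> n"
    using pochhammer_norm_bound[OF \<tau>(2)] unfolding \<rho>_def by blast
  have pos: "pochhammer \<rho> n > 0" for n using \<rho> by (rule pochhammer_pos)
  have bs: "(\<lambda>n. pochhammer \<rho> n / fact n * y ^ n) sums exp (- \<rho> * ln (1 - y))" if y: "0 < y" "y < 1" for y
  proof -
    have "(\<lambda>n. pochhammer (complex_of_real \<rho>) n / fact n * of_real y ^ n) sums exp (- of_real \<rho> * Ln (1 - of_real y))"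
      by (rule binomial_pochhammer_sums) (use y in simp)
    moreover have "pochhammer (complex_of_real \<rho>) n / fact n * of_real y ^ n = of_real (pochhammer \<rho> n /
        fact n * y ^ n)" for n
      by (simp add: pochhammer_of_real)
    moreover have "exp (- of_real \<rho> * Ln (1 - of_real y)) = complex_of_real (exp (- \<rho> * ln (1 - y)))"
      using Ln_of_real[of "1 - y"] y by (simp flip: exp_of_real)
    ultimately have "(\<lambda>n. complex_of_real (pochhammer \<rho> n / fact n * y ^ n)) sums of_real (exp (- \<rho> * ln (1 - y)))"
      by (simp only:)
    thus ?thesis unfolding sums_of_real_iff .
  qed
  \<comment> \<open>Terms from N on contribute at most \<epsilon> K after multiplication by (1 -
    y)^\<rho>, because the majorant sums to (1 - y)^(-\<rho>). The finitely many earlier ones keep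
    the factor (1 - y)^\<rho>, which tends to 0.\<close>
  have main: "norm (exp (\<tau> * of_real (ln (1 - y))) * hyp_F_series A B c (of_real y) - L)
      \<le> \<epsilon> * K + exp (\<rho> * ln (1 - y)) * (\<Sum>n<N. norm (e n - L) * (K * pochhammer \<rho> n / fact n))"
    if y: "0 < y" "y < 1" and N: "\<And>n. n \<ge> N \<Longrightarrow> norm (e n - L) \<le> \<epsilon>" and \<epsilon>: "\<epsilon> > 0" for y N \<epsilon>
  proof -
    have ny: "norm (complex_of_real y) < 1" using y by simp
    have Ly: "Ln (1 - complex_of_real y) = of_real (ln (1 - y))" using Ln_of_real[of "1 - y"] y by simp
    have s1: "(\<lambda>n. e n * (pochhammer \<tau> n / fact n) * of_real y ^ n) sums hyp_F_series A B c (of_real y)"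
      using sums_eval_fps[OF norm_lt_conv_radius_hyp[OF ny], of A B c] by (simp add: d hyp_F_series_eq)
    have s2: "(\<lambda>n. L * (pochhammer \<tau> n / fact n * of_real y ^ n)) sums (L * exp (- \<tau> * of_real (ln (1 - y))))"
      using binomial_pochhammer_sums[OF ny, of \<tau>] unfolding Ly by (intro sums_mult)
    define g where "g = (\<lambda>n. (e n - L) * (pochhammer \<tau> n / fact n * of_real y ^ n))"
    have s3: "g sums (hyp_F_series A B c (of_real y) - L * exp (- \<tau> * of_real (ln (1 - y))))"
      using sums_diff[OF s1 s2] unfolding g_def left_diff_distrib by (simp only: mult.assoc)
    define G where "G = (\<lambda>n. norm (e n - L) * (K * pochhammer \<rho> n / fact n))"
    have G0: "G n \<ge> 0" for n using K(1) less_imp_le[OF pos[of n]] by (simp add: G_def)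
    define m where "m = (\<lambda>n. \<epsilon> * K * (pochhammer \<rho> n / fact n * y ^ n) + (if n < N then G n else 0))"
    have ms: "m sums (\<epsilon> * K * exp (- \<rho> * ln (1 - y)) + (\<Sum>n<N. G n))"
    proof -
      have "(\<lambda>n. if n \<in> {..<N} then G n else 0) sums (\<Sum>n<N. G n)" by (rule sums_If_finite_set) simp
      thus ?thesis unfolding m_def by (intro sums_add sums_mult bs y) simp
    qed
    have gm: "norm (g n) \<le> m n" for n
    proof -
      have b: "norm (pochhammer \<tau> n / fact n * of_real y ^ n) \<le> K * (pochhammer \<rho> n / fact n * y ^ n)"
      proof -
        have "norm (pochhammer \<tau> n / fact n * of_real y ^ n) = norm (pochhammer \<tau> n) * (y ^ n / fact n)"
          using y by (simp add: norm_mult norm_divide norm_power)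
        also have "\<dots> \<le> K * pochhammer \<rho> n * (y ^ n / fact n)" using y by (intro mult_right_mono K) auto
        finally show ?thesis by (simp add: mult_ac)
      qed
      have p0: "0 \<le> pochhammer \<rho> n / fact n * y ^ n" using less_imp_le[OF pos[of n]] y by simp
      show ?thesis
      proof (cases "n < N")
        case False
        have "norm (g n) \<le> \<epsilon> * (K * (pochhammer \<rho> n / fact n * y ^ n))"
          unfolding g_def norm_mult[of "e n - L"] using N[of n] False b \<epsilon> by (intro mult_mono) auto
        thus ?thesis using False by (simp add: m_def)
      next
        case True
        have "norm (g n) \<le> norm (e n - L) * (K * (pochhammer \<rho> n / fact n * y ^ n))"
          unfolding g_def norm_mult[of "e n - L"] using b by (intro mult_left_mono) auto
        also have "\<dots> = G n * y ^ n" by (simp add: G_def mult_ac)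
        also have "\<dots> \<le> G n * 1" using y G0 by (intro mult_left_mono power_le_one) auto
        also have "\<dots> \<le> m n"
        proof -
          have "0 \<le> \<epsilon> * K * (pochhammer \<rho> n / fact n * y ^ n)"
            by (rule mult_nonneg_nonneg[OF _ p0]) (use \<epsilon> K(1) in simp)
          thus ?thesis using True unfolding m_def by simp
        qed
        finally show ?thesis .
      qed
    qed
    have sm: "summable m" by (rule sums_summable[OF ms])
    have sg: "summable (\<lambda>n. norm (g n))" 
      by (rule summable_comparison_test'[OF sm, of 0]) (simp add: gm)
    have "norm (suminf g) \<le> (\<Sum>n. norm (g n))" by (rule summable_norm[OF sg])
    also have "\<dots> \<le> suminf m" by (rule suminf_le[OF gm sg sm])
    finally have S: "norm (hyp_F_series A B c (of_real y) - L * exp (- \<tau> * of_real (ln (1 - y))))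
      \<le> \<epsilon> * K * exp (- \<rho> * ln (1 - y)) + (\<Sum>n<N. G n)"
      unfolding sums_unique[OF s3] sums_unique[OF ms] .
    have ee: "exp (\<tau> * of_real (ln (1 - y))) * exp (- \<tau> * of_real (ln (1 - y))) = 1"
      "exp (\<rho> * ln (1 - y)) * exp (- \<rho> * ln (1 - y)) = 1"
      unfolding exp_add[symmetric] by simp_all
    have g1: "u * f - L = u * (f - L * v)" if "u * v = 1" for u v f :: complex
      using that by (simp add: right_diff_distrib mult.left_commute)
    have g2: "u * (\<epsilon> * K * v + s) = \<epsilon> * K * (u * v) + u * s" for u v s :: real
      by (simp add: distrib_left mult_ac)
    have "norm (exp (\<tau> * of_real (ln (1 - y))) * hyp_F_series A B c (of_real y) - L)
      = norm (exp (\<tau> * of_real (ln (1 - y)))) *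
        norm (hyp_F_series A B c (of_real y) - L * exp (- \<tau> * of_real (ln (1 - y))))"
      unfolding g1[OF ee(1)] norm_mult ..
    also have "norm (exp (\<tau> * of_real (ln (1 - y)))) = exp (\<rho> * ln (1 - y))"
      by (simp add: \<rho>_def)
    also have "exp (\<rho> * ln (1 - y)) * norm (hyp_F_series A B c (of_real y) - L * exp (- \<tau> * of_real (ln (1 - y))))
      \<le> exp (\<rho> * ln (1 - y)) * (\<epsilon> * K * exp (- \<rho> * ln (1 - y)) + (\<Sum>n<N. G n))"
      by (intro mult_left_mono S) simp
    also have "\<dots> = \<epsilon> * K * (exp (\<rho> * ln (1 - y)) * exp (- \<rho> * ln (1 - y))) + exp (\<rho> * ln (1 - y)) * (\<Sum>n<N. G n)"
      by (rule g2)
    finally show ?thesis unfolding ee(2) G_def by simp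
  qed
  have ex0: "((\<lambda>y. exp (\<rho> * ln (1 - y))) \<longlongrightarrow> 0) (at_left (1::real))"
  proof -
    have "filterlim (\<lambda>y::real. 1 - y) (at_right 0) (at_left 1)"
      unfolding filterlim_at
    proof
      have "((\<lambda>y::real. 1 - y) \<longlongrightarrow> 1 - 1) (at_left 1)" by (intro tendsto_intros)
      thus "((\<lambda>y::real. 1 - y) \<longlongrightarrow> 0) (at_left 1)" by simp
      show "eventually (\<lambda>y::real. 1 - y \<in> {0<..} \<and> 1 - y \<noteq> 0) (at_left 1)"
        unfolding eventually_at_left_field by (intro exI[of _ 0]) auto
    qed
    hence "filterlim (\<lambda>y::real. ln (1 - y)) at_bot (at_left 1)" by (rule filterlim_compose[OF ln_at_0])
    hence "filterlim (\<lambda>y::real. \<rho> * ln (1 - y)) at_bot (at_left 1)"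
      by (rule filterlim_tendsto_pos_mult_at_bot[OF tendsto_const \<rho>])
    thus ?thesis by (rule filterlim_compose[OF exp_at_bot])
  qed
  show ?thesis unfolding L_def[symmetric]
  proof (rule tendstoI)
    fix \<eta> :: real assume \<eta>: "\<eta> > 0"
    define \<epsilon> where "\<epsilon> = \<eta> / (2 * K)"
    have \<epsilon>: "\<epsilon> > 0" "\<epsilon> * K = \<eta> / 2" using \<eta> K(1) by (auto simp: \<epsilon>_def)
    obtain N where N: "\<And>n. n \<ge> N \<Longrightarrow> norm (e n - L) \<le> \<epsilon>"
      using eL \<epsilon>(1) unfolding LIMSEQ_iff by (meson less_imp_le)
    define C where "C = (\<Sum>n<N. norm (e n - L) * (K * pochhammer \<rho> n / fact n))"
    have "((\<lambda>y. exp (\<rho> * ln (1 - y)) * C) \<longlongrightarrow> 0 * C) (at_left 1)" by (intro tendsto_mult ex0 tendsto_const)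
    hence "eventually (\<lambda>y. exp (\<rho> * ln (1 - y)) * C < \<eta> / 2) (at_left 1)"
      by (rule order_tendstoD) (use \<eta> in simp)
    moreover have "eventually (\<lambda>y::real. 0 < y \<and> y < 1) (at_left 1)"
      unfolding eventually_at_left_field by (intro exI[of _ 0]) auto
    ultimately show "eventually (\<lambda>y. dist (exp (\<tau> * of_real (ln (1 - y))) * hyp_F_series A B c (of_real y))
        L < \<eta>) (at_left 1)"
    proof eventually_elim
      case (elim y)
      thus ?case using main[of y N \<epsilon>] N \<epsilon> unfolding C_def[symmetric] dist_norm by auto
    qed
  qed
qed

text \<open>Euler's transformation trades the convergent series for the divergent one with
  parameters c - b, c - a and \<tau> = c - a - b, to which the Abelian lemma applies.\<close>

lemma hyp_F_series_gauss:
  assumes c: "c \<notin> \<int>\<^sub>\<le>\<^sub>0" and re: "Re (c - a - b) > 0"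
  shows "((\<lambda>y. hyp_F_series a b c (of_real y)) \<longlongrightarrow> Gamma (c - a - b) * rGamma (c - a) * rGamma (c - b)) (at_left 1)"
proof -
  have "((\<lambda>y. exp ((c - a - b) * of_real (ln (1 - y))) * hyp_F_series (c - b) (c - a) c (of_real y))
     \<longlongrightarrow> Gamma (c - a - b) * rGamma (c - b) * rGamma (c - a)) (at_left 1)"
    by (rule hyp_F_series_abel[OF c]) (use re in auto)
  moreover have "eventually (\<lambda>y. exp ((c - a - b) * of_real (ln (1 - y))) * hyp_F_series (c - b) (c - a) c (of_real y) =
      hyp_F_series a b c (of_real y)) (at_left 1)"
    unfolding eventually_at_left_field
    by (intro exI[of _ 0] conjI allI impI hyp_F_euler_real[OF c, symmetric]) simp_all
  ultimately have "((\<lambda>y. hyp_F_series a b c (of_real y)) \<longlongrightarrow> Gamma (c - a - b) * rGamma (c - b) * rGamma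
      (c - a)) (at_left 1)"
    by (rule Lim_transform_eventually)
  thus ?thesis by (simp add: mult_ac)
qed

section \<open>Connection formula between infinity and zero\<close>

definition hyp_sol :: "complex \<Rightarrow> complex \<Rightarrow> complex \<Rightarrow> complex set \<Rightarrow> (complex \<Rightarrow> complex) \<Rightarrow> bool" where
  "hyp_sol p q g S f \<longleftrightarrow> f holomorphic_on S \<and>
     (\<forall>t\<in>S. t * (1 - t) * deriv (deriv f) t + (g - (p + q + 1) * t) * deriv f t - p * q * f t = 0)"

lemma hyp_solI:
  assumes S: "open S" and f: "\<And>t. t \<in> S \<Longrightarrow> (f has_field_derivative f1 t) (at t)"
    "\<And>t. t \<in> S \<Longrightarrow> (f1 has_field_derivative f2 t) (at t)"
    and ode: "\<And>t. t \<in> S \<Longrightarrow> t * (1 - t) * f2 t + (g - (p + q + 1) * t) * f1 t - p * q * f t = 0"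
  shows "hyp_sol p q g S f"
proof -
  have d1: "deriv f t = f1 t" if "t \<in> S" for t using f(1)[OF that] by (rule DERIV_imp_deriv)
  have d2: "deriv (deriv f) t = f2 t" if "t \<in> S" for t
  proof -
    have "deriv (deriv f) t = deriv f1 t"
      by (rule deriv_cong_ev[OF _ refl]) (use d1 in \<open>rule eventually_mono[OF eventually_nhds_in_open[OF S that]]\<close>)
    thus ?thesis using DERIV_imp_deriv[OF f(2)[OF that]] by simp
  qed
  have "f holomorphic_on S" unfolding holomorphic_on_open[OF S] using f(1) by blast
  thus ?thesis unfolding hyp_sol_def using d1 d2 ode by simp
qed

lemma hyp_F_series_second_deriv:
  fixes a b c :: complex
  assumes "norm t < 1" "t \<noteq> 0"
  defines "F \<equiv> hyp_F_series a b c"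
  shows "t * (1 - t) * deriv (deriv F) t + (c - (a + b + 1) * t) * deriv F t - a * b * F t = 0"
proof -
  have h: "F holomorphic_on ball 0 1" "deriv F holomorphic_on ball 0 1"
    unfolding F_def by (intro hyp_F_series_holomorphic holomorphic_deriv open_ball)+
  have t: "t \<in> ball 0 1" using assms by simp
  have "((\<lambda>t. t * deriv F t) has_field_derivative 1 * deriv F t + deriv (deriv F) t * t) (at t)"
    by (intro DERIV_mult DERIV_ident holomorphic_derivI[OF h(2) open_ball t])
  from theta_op_eqI[OF this] have "theta_op (theta_op F) t = t * (deriv F t + deriv (deriv F) t * t)"
    by (simp add: theta_op_def[abs_def])
  hence "t * ((1 - t) * (deriv F t + deriv (deriv F) t * t)) = t * (((a + b) * t - (c - 1)) * deriv F t + a * b * F t)"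
    using hyp_F_series_ode[OF assms(1), of a b c] by (simp add: F_def theta_op_def algebra_simps)
  hence "(1 - t) * (deriv F t + deriv (deriv F) t * t) = ((a + b) * t - (c - 1)) * deriv F t + a * b * F t"
    using assms(2) by simp
  thus ?thesis by (simp add: algebra_simps)
qed

text \<open>On this half-disc all three solutions are given by convergent series: both |t| and |1 /
  (1 - t)| are below 1, while -t and 1 - t avoid the cut of \<open>Ln\<close>.\<close>

definition left_half :: "complex set" where "left_half = {t. norm t < 1 \<and> Re t < 0}"

lemma left_half: "open left_half" "convex left_half"
proof -
  have e: "left_half = ball 0 1 \<inter> {t. Re t < 0}" by (auto simp: left_half_def)
  show "open left_half" unfolding e by (intro open_Int open_ball open_halfspace_Re_lt)
  show "convex left_half" unfolding e by (intro convex_Int convex_ball convex_halfspace_Re_lt)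
qed

lemma left_half_D:
  assumes "t \<in> left_half"
  shows "norm t < 1" "Re t < 0" "t \<noteq> 0" "- t \<notin> \<real>\<^sub>\<le>\<^sub>0" "1 - t \<noteq> 0" "1 - t \<notin> \<real>\<^sub>\<le>\<^sub>0" "norm (1 / (1 - t)) < 1"
proof -
  show "norm t < 1" "Re t < 0" using assms by (auto simp: left_half_def)
  hence "Re (1 - t) > 1" by simp
  thus "t \<noteq> 0" "- t \<notin> \<real>\<^sub>\<le>\<^sub>0" "1 - t \<noteq> 0" "1 - t \<notin> \<real>\<^sub>\<le>\<^sub>0"
    using \<open>Re t < 0\<close> by (auto simp: complex_nonpos_Reals_iff)
  have "norm (1 - t) > 1" using \<open>Re (1 - t) > 1\<close> complex_Re_le_cmod[of "1 - t"] by linarith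
  thus "norm (1 / (1 - t)) < 1" by (auto simp: norm_divide divide_less_eq_1)
qed

text \<open>Three of Kummer's solutions of one hypergeometric equation: \<open>conn_f\<close>
  belongs to t = \<infinity>, \<open>conn_1\<close> and \<open>conn_2\<close> to the exponents 0 and
  c - a - b at t = 0.\<close>

definition conn_f :: "complex \<Rightarrow> complex \<Rightarrow> complex \<Rightarrow> complex \<Rightarrow> complex" where
  "conn_f a b c t = exp (- a * Ln (1 - t)) * hyp_F a b c (1 / (1 - t))"

definition conn_1 :: "complex \<Rightarrow> complex \<Rightarrow> complex \<Rightarrow> complex \<Rightarrow> complex" where
  "conn_1 a b c t = hyp_F_series a (a - c + 1) (a + b - c + 1) t"

definition conn_2 :: "complex \<Rightarrow> complex \<Rightarrow> complex \<Rightarrow> complex \<Rightarrow> complex" where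
  "conn_2 a b c t = exp ((c - a - b) * Ln (- t)) * hyp_F_series (c - b) (1 - b) (c - a - b + 1) t"

text \<open>For non-integer \<sigma> = a + b - c this is \<Gamma>(-\<sigma>) \<Gamma>(\<sigma> + 1)
  / (\<Gamma>(c - a) \<Gamma>(c - b)) by reflection; the factor \<Gamma>(\<sigma> + 1) undoes the
  regularisation of \<open>conn_1\<close>.\<close>

definition conn_A :: "complex \<Rightarrow> complex \<Rightarrow> complex \<Rightarrow> complex" where
  "conn_A a b c = - of_real pi / sin (of_real pi * (a + b - c)) * rGamma (c - a) * rGamma (c - b)"

text \<open>The derivative has the same shape, with a raised to a + 1 and K replaced by a K +
  \<theta> K; applying the rule twice gives the second derivative of \<open>conn_f\<close>.\<close>

lemma exp_Ln_mult_deriv: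
  assumes "1 - t \<noteq> 0" "1 - t \<notin> \<real>\<^sub>\<le>\<^sub>0" "norm (1 / (1 - t)) < 1" and K: "K holomorphic_on ball 0 1"
  shows "((\<lambda>t. exp (- a * Ln (1 - t)) * K (1 / (1 - t))) has_field_derivative
     exp (- (a + 1) * Ln (1 - t)) * (a * K (1 / (1 - t)) + theta_op K (1 / (1 - t)))) (at t)"
proof -
  have d1: "((\<lambda>t. exp (- a * Ln (1 - t))) has_field_derivative exp (- a * Ln (1 - t)) * (a / (1 - t))) (at t)"
    using assms by (auto intro!: derivative_eq_intros simp: field_simps)
  have "((\<lambda>t. 1 / (1 - t)) has_field_derivative 1 / (1 - t)\<^sup>2) (at t)"
    using assms by (auto intro!: derivative_eq_intros simp: field_simps power2_eq_square)
  from DERIV_chain2[OF holomorphic_derivI[OF K open_ball] this] assms(3)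
  have d2: "((\<lambda>t. K (1 / (1 - t))) has_field_derivative deriv K (1 / (1 - t)) * (1 / (1 - t)\<^sup>2)) (at t)" by simp
  have e: "exp (- (a + 1) * Ln (1 - t)) = exp (- a * Ln (1 - t)) * (1 / (1 - t))"
  proof -
    have "- (a + 1) * Ln (1 - t) = - a * Ln (1 - t) - Ln (1 - t)" by (simp add: algebra_simps)
    thus ?thesis using assms by (simp only: exp_diff exp_Ln) simp
  qed
  show ?thesis
    by (rule DERIV_cong[OF DERIV_mult[OF d1 d2]])
       (simp only: e theta_op_def divide_inverse power2_eq_square inverse_mult_distrib mult_1_left,
        simp only: algebra_simps)
qed

lemma conn_f_left_half:
  assumes "t \<in> left_half"
  shows "conn_f a b c t = exp (- a * Ln (1 - t)) * hyp_F_series a b c (1 / (1 - t))"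
  unfolding conn_f_def by (subst hyp_F_eq_series) (use left_half_D[OF assms] in auto)

lemma has_field_derivative_cong_open:
  assumes "open S" "t \<in> S" "\<And>x. x \<in> S \<Longrightarrow> f x = g x" "(g has_field_derivative D) (at t)"
  shows "(f has_field_derivative D) (at t)"
  by (rule has_field_derivative_transform_within_open[OF assms(4,1,2)]) (simp add: assms(3))

lemma eval_fps_const_plus_XD:
  assumes "norm y < 1"
  shows "eval_fps (fps_const k * hyp_fps a b c + fps_XD (hyp_fps a b c)) y =
    k * hyp_F_series a b c y + theta_op (hyp_F_series a b c) y"
proof -
  note n = norm_lt_conv_radius_hyp[OF assms]
  have "ereal (norm y) < fps_conv_radius (fps_const k * hyp_fps a b c)"
    by (rule less_le_trans[OF _ fps_conv_radius_mult]) (use n in simp)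
  thus ?thesis
    using n less_le_trans[OF n fps_conv_radius_XD]
    by (simp add: eval_fps_add eval_fps_mult eval_fps_XD hyp_F_series_eq)
qed

text \<open>A contiguity relation, coming from (a + n) (a)_n = a (a + 1)_n.\<close>

lemma hyp_F_series_upper_shift:
  assumes "norm y < 1"
  shows "a * hyp_F_series a b c y + theta_op (hyp_F_series a b c) y = a * hyp_F_series (a + 1) b c y"
proof -
  have g: "u * (P * Q * R / f) + v * (P * Q * R / f) = (u * P + v * P) * (Q * R / f)" for u v P Q R f :: complex
    by (simp add: algebra_simps add_divide_distrib)
  have "fps_const a * hyp_fps a b c + fps_XD (hyp_fps a b c) = fps_const a * hyp_fps (a + 1) b c"
  proof (rule fps_ext)
    fix n
    have e: "a * pochhammer a n + of_nat n * pochhammer a n = a * pochhammer (a + 1) n"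
      using pochhammer_rec[of a n] pochhammer_Suc[of a n] by (simp add: algebra_simps)
    show "fps_nth (fps_const a * hyp_fps a b c + fps_XD (hyp_fps a b c)) n = fps_nth (fps_const a * hyp_fps
        (a + 1) b c) n"
      by (simp only: fps_add_nth fps_mult_left_const_nth fps_XD_nth hyp_fps_def fps_nth_Abs_fps g e)
         (simp add: mult_ac)
  qed
  from arg_cong[OF this, of "\<lambda>f. eval_fps f y"] show ?thesis
    unfolding eval_fps_const_plus_XD[OF assms]
    using norm_lt_conv_radius_hyp[OF assms] by (simp add: eval_fps_mult hyp_F_series_eq)
qed

lemma hyp_F_series_lower_shift:
  assumes "norm y < 1"
  shows "(c - 1) * hyp_F_series a b c y + theta_op (hyp_F_series a b c) y = hyp_F_series a b (c - 1) y"
proof -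
  have g: "u * (P * Q * R / f) + v * (P * Q * R / f) = P * Q * ((u + v) * R) / f" for u v P Q R f :: complex
    by (simp add: algebra_simps add_divide_distrib)
  have "fps_const (c - 1) * hyp_fps a b c + fps_XD (hyp_fps a b c) = hyp_fps a b (c - 1)"
  proof (rule fps_ext)
    fix n
    have e: "(c - 1 + of_nat n) * rGamma (c + of_nat n) = rGamma (c - 1 + of_nat n)"
      using rGamma_plus1[of "c - 1 + of_nat n"] by simp
    show "fps_nth (fps_const (c - 1) * hyp_fps a b c + fps_XD (hyp_fps a b c)) n = fps_nth (hyp_fps a b (c - 1)) n"
      by (simp only: fps_add_nth fps_mult_left_const_nth fps_XD_nth hyp_fps_def fps_nth_Abs_fps g e)
  qed
  from arg_cong[OF this, of "\<lambda>f. eval_fps f y"] show ?thesis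
    unfolding eval_fps_const_plus_XD[OF assms] by (simp only: hyp_F_series_eq)
qed

text \<open>Differentiation only raises a, which is what the induction in
  \<open>conn_holds_general\<close> runs on.\<close>

lemma conn_f_deriv:
  assumes t: "t \<in> left_half"
  shows "(conn_f a b c has_field_derivative a * conn_f (a + 1) b c t) (at t)"
proof (rule has_field_derivative_cong_open[OF left_half(1) t conn_f_left_half])
  note d = left_half_D[OF t]
  show "((\<lambda>t. exp (- a * Ln (1 - t)) * hyp_F_series a b c (1 / (1 - t))) has_field_derivative a * conn_f
      (a + 1) b c t) (at t)"
    by (rule DERIV_cong[OF exp_Ln_mult_deriv[OF d(5,6,7) hyp_F_series_holomorphic]])
       (simp only: hyp_F_series_upper_shift[OF d(7)] conn_f_left_half[OF t], simp)
qed

lemma conn_f_sol: "hyp_sol a (a - c + 1) (a + b - c + 1) left_half (conn_f a b c)"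
proof -
  let ?F = "hyp_F_series a b c"
  define K1 where "K1 = (\<lambda>y. a * ?F y + theta_op ?F y)"
  have hF: "?F holomorphic_on ball 0 1" "theta_op ?F holomorphic_on ball 0 1"
    by (intro hyp_F_series_holomorphic holomorphic_theta_op open_ball)+
  have hK: "K1 holomorphic_on ball 0 1" unfolding K1_def by (intro holomorphic_intros hF)
  show ?thesis
  proof (rule hyp_solI[OF left_half(1)])
    fix t assume t: "t \<in> left_half"
    note d = left_half_D[OF t]
    show "(conn_f a b c has_field_derivative exp (- (a + 1) * Ln (1 - t)) * K1 (1 / (1 - t))) (at t)"
      unfolding K1_def
      by (rule has_field_derivative_cong_open[OF left_half(1) t conn_f_left_half exp_Ln_mult_deriv[OF d(5,6,7) hF(1)]])
    show "((\<lambda>t. exp (- (a + 1) * Ln (1 - t)) * K1 (1 / (1 - t))) has_field_derivative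
       exp (- (a + 1 + 1) * Ln (1 - t)) * ((a + 1) * K1 (1 / (1 - t)) + theta_op K1 (1 / (1 - t)))) (at t)"
      by (rule exp_Ln_mult_deriv[OF d(5,6,7) hK])
    define y where "y = 1 / (1 - t)"
    have y: "norm y < 1" "y \<noteq> 0" using d by (auto simp: y_def)
    have ty: "t = (y - 1) / y" "1 - t = 1 / y" using d by (simp_all add: y_def field_simps)
    define E where "E = exp (- a * Ln (1 - t))"
    have e1: "exp (- (a' + 1) * Ln (1 - t)) = exp (- a' * Ln (1 - t)) * y" for a'
    proof -
      have "- (a' + 1) * Ln (1 - t) = - a' * Ln (1 - t) - Ln (1 - t)" by (simp add: algebra_simps)
      thus ?thesis using d by (simp only: exp_diff exp_Ln) (simp add: y_def)
    qed
    have "((\<lambda>y. a * ?F y + theta_op ?F y) has_field_derivative a * deriv ?F y + deriv (theta_op ?F) y) (at y)"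
      using y by (intro DERIV_add DERIV_cmult holomorphic_derivI[OF hF(1) open_ball] holomorphic_derivI[OF
          hF(2) open_ball]) auto
    from theta_op_eqI[OF this] have tK: "theta_op K1 y = a * theta_op ?F y + theta_op (theta_op ?F) y"
      by (simp add: K1_def theta_op_def algebra_simps)
    define f0 f1 f2 where "f0 = ?F y" and "f1 = theta_op ?F y" and "f2 = theta_op (theta_op ?F) y"
    have ode: "(1 - y) * f2 = ((a + b) * y - (c - 1)) * f1 + a * b * y * f0"
      unfolding f0_def f1_def f2_def by (rule hyp_F_series_ode[OF y(1)])
    have "t * (1 - t) * (E * y * y * ((a + 1) * (a * f0 + f1) + (a * f1 + f2)))
      + (a + b - c + 1 - (a + (a - c + 1) + 1) * t) * (E * y * (a * f0 + f1)) - a * (a - c + 1) * (E * f0)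
      = E * ((y - 1) * ((a + 1) * (a * f0 + f1) + a * f1) + (y - 1) * f2
         + ((a + b - c + 1) * y - (a + (a - c + 1) + 1) * (y - 1)) * (a * f0 + f1) - a * (a - c + 1) * f0)"
      unfolding ty using y(2) by (simp add: field_simps)
    also have "(y - 1) * f2 = - (((a + b) * y - (c - 1)) * f1 + a * b * y * f0)"
      using ode by (simp add: algebra_simps)
    also have "E * ((y - 1) * ((a + 1) * (a * f0 + f1) + a * f1) + - (((a + b) * y - (c - 1)) * f1 + a * b * y * f0)
         + ((a + b - c + 1) * y - (a + (a - c + 1) + 1) * (y - 1)) * (a * f0 + f1) - a * (a - c + 1) * f0) = 0"
      by (simp add: algebra_simps)
    finally show "t * (1 - t) * (exp (- (a + 1 + 1) * Ln (1 - t)) * ((a + 1) * K1 (1 / (1 - t)) + theta_op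
        K1 (1 / (1 - t))))
      + (a + b - c + 1 - (a + (a - c + 1) + 1) * t) * (exp (- (a + 1) * Ln (1 - t)) * K1 (1 / (1 - t)))
      - a * (a - c + 1) * conn_f a b c t = 0"
      unfolding conn_f_left_half[OF t] e1 y_def[symmetric] E_def[symmetric] tK
      by (simp only: K1_def f0_def f1_def f2_def)
  qed
qed

lemma conn_1_sol: "hyp_sol a (a - c + 1) (a + b - c + 1) left_half (conn_1 a b c)"
proof -
  have e: "conn_1 a b c = hyp_F_series a (a - c + 1) (a + b - c + 1)" by (simp add: fun_eq_iff conn_1_def)
  have "left_half \<subseteq> ball 0 1" by (auto simp: left_half_def)
  thus ?thesis unfolding e hyp_sol_def
    using hyp_F_series_second_deriv left_half_D(1,3) holomorphic_on_subset[OF hyp_F_series_holomorphic] by blast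
qed

text \<open>Differentiation lowers the exponent c - a - b and the last parameter of the series
  together by one, and both are the effect of replacing a by a + 1.\<close>

lemma conn_2_deriv:
  assumes t: "t \<in> left_half"
  shows "(conn_2 a b c has_field_derivative - conn_2 (a + 1) b c t) (at t)"
proof -
  note d = left_half_D[OF t]
  let ?g = "hyp_F_series (c - b) (1 - b) (c - a - b + 1)"
  let ?s = "c - a - b"
  have d1: "((\<lambda>t. exp (?s * Ln (- t))) has_field_derivative exp (?s * Ln (- t)) * (?s / t)) (at t)"
    using d by (auto intro!: derivative_eq_intros simp: field_simps)
  have "(conn_2 a b c has_field_derivative exp (?s * Ln (- t)) * (?s / t) * ?g t + deriv ?g t * exp
      (?s * Ln (- t))) (at t)"
    unfolding conn_2_def[abs_def]
    by (intro DERIV_mult d1 holomorphic_derivI[OF hyp_F_series_holomorphic open_ball]) (use d in auto)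
  also have "exp (?s * Ln (- t)) * (?s / t) * ?g t + deriv ?g t * exp (?s * Ln (- t)) =
     exp (?s * Ln (- t)) / t * ((?s + 1 - 1) * ?g t + theta_op ?g t)"
    using d(3) by (simp add: theta_op_def field_simps)
  also have "\<dots> = exp (?s * Ln (- t)) / t * hyp_F_series (c - b) (1 - b) (?s + 1 - 1) t"
    by (subst hyp_F_series_lower_shift[OF d(1)]) simp
  also have "exp (?s * Ln (- t)) / t = - exp ((c - (a + 1) - b) * Ln (- t))"
  proof -
    have e: "(c - (a + 1) - b) * Ln (- t) = ?s * Ln (- t) - Ln (- t)" by (simp add: algebra_simps)
    have nz: "- t \<noteq> 0" using d by simp
    show ?thesis unfolding e exp_diff exp_Ln[OF nz] by simp
  qed
  finally have "(conn_2 a b c has_field_derivative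
     - exp ((c - (a + 1) - b) * Ln (- t)) * hyp_F_series (c - b) (1 - b) (?s + 1 - 1) t) (at t)" .
  moreover have "?s + 1 - 1 = c - (a + 1) - b + 1" by simp
  ultimately show ?thesis by (simp only: conn_2_def minus_mult_left)
qed

lemma conn_2_sol: "hyp_sol a (a - c + 1) (a + b - c + 1) left_half (conn_2 a b c)"
proof (rule hyp_solI[OF left_half(1) conn_2_deriv])
  fix t assume t: "t \<in> left_half"
  note d = left_half_D[OF t]
  show "((\<lambda>t. - conn_2 (a + 1) b c t) has_field_derivative conn_2 (a + 1 + 1) b c t) (at t)"
    using DERIV_minus[OF conn_2_deriv[OF t, of "a + 1" b c]] by simp
  define s where "s = c - a - b"
  define E where "E = exp (s * Ln (- t))"
  have e1: "exp ((s' - 1) * Ln (- t)) = - exp (s' * Ln (- t)) / t" for s'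
  proof -
    have e: "(s' - 1) * Ln (- t) = s' * Ln (- t) - Ln (- t)" by (simp add: algebra_simps)
    have nz: "- t \<noteq> 0" using d by simp
    show ?thesis unfolding e exp_diff exp_Ln[OF nz] by simp
  qed
  define g where "g = (\<lambda>k. hyp_F_series (c - b) (1 - b) k t)"
  let ?F = "hyp_F_series (c - b) (1 - b) (s + 1)"
  have th1: "theta_op ?F t = g s - s * g (s + 1)"
    using hyp_F_series_lower_shift[OF d(1), of "s + 1" "c - b" "1 - b"] by (simp add: g_def algebra_simps)
  have th1': "theta_op ?F z = hyp_F_series (c - b) (1 - b) s z - s * ?F z" if "z \<in> ball 0 1" for z
    using hyp_F_series_lower_shift[of z "s + 1" "c - b" "1 - b"] that by (simp add: algebra_simps)
  have th2: "theta_op (theta_op ?F) t = theta_op (hyp_F_series (c - b) (1 - b) s) t - s * theta_op ?F t"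
  proof -
    have "theta_op (theta_op ?F) t = theta_op (\<lambda>z. hyp_F_series (c - b) (1 - b) s z - s * ?F z) t"
      by (rule theta_op_cong[OF open_ball, of t 0 1]) (use d th1' in auto)
    also have "((\<lambda>z. hyp_F_series (c - b) (1 - b) s z - s * ?F z) has_field_derivative
       deriv (hyp_F_series (c - b) (1 - b) s) t - s * deriv ?F t) (at t)"
      by (intro DERIV_diff DERIV_cmult holomorphic_derivI[OF hyp_F_series_holomorphic open_ball]) (use d in auto)
    note theta_op_eqI[OF this]
    finally show ?thesis by (simp add: theta_op_def algebra_simps)
  qed
  have th3: "theta_op (hyp_F_series (c - b) (1 - b) s) t = g (s - 1) - (s - 1) * g s"
    using hyp_F_series_lower_shift[OF d(1), of s "c - b" "1 - b"] by (simp add: g_def algebra_simps)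
  have ode: "(1 - t) * theta_op (theta_op ?F) t = ((c - b + (1 - b)) * t - s) * theta_op ?F t + (c - b) *
      (1 - b) * t * g (s + 1)"
    using hyp_F_series_ode[OF d(1), of "c - b" "1 - b" "s + 1"] by (simp add: g_def)
  have "t * (1 - t) * (E / t / t * g (s - 1)) + (a + b - c + 1 - (a + (a - c + 1) + 1) * t) * (E / t * g s)
     - a * (a - c + 1) * (E * g (s + 1))
     = E / t * ((1 - t) * g (s - 1) + (1 - s - (a + (a - c + 1) + 1) * t) * g s - a * (a - c + 1) * t * g (s + 1))"
    using d(3) by (simp add: s_def field_simps)
  also have "(1 - t) * g (s - 1) = ((c - b + (1 - b)) * t - s) * (g s - s * g (s + 1)) + (c - b) * (1 - b) * t * g (s + 1)
      + (1 - t) * (s * (g s - s * g (s + 1)) + (s - 1) * g s)"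
    using ode unfolding th2 th3 th1 by (simp add: algebra_simps)
  also have "E / t * (\<dots> + (1 - s - (a + (a - c + 1) + 1) * t) * g s - a * (a - c + 1) * t * g (s + 1)) = 0"
    unfolding s_def by (simp add: algebra_simps)
  finally have *: "t * (1 - t) * (E / t / t * g (s - 1)) + (a + b - c + 1 - (a + (a - c + 1) + 1) * t) * (E / t * g s)
     - a * (a - c + 1) * (E * g (s + 1)) = 0" .
  have c0: "conn_2 a b c t = E * g (s + 1)" by (simp add: conn_2_def E_def g_def s_def)
  have c1: "- conn_2 (a + 1) b c t = E / t * g s"
  proof -
    have "c - (a + 1) - b = s - 1" by (simp add: s_def)
    thus ?thesis unfolding conn_2_def by (simp only: e1) (simp add: E_def g_def)
  qed
  have c2: "conn_2 (a + 1 + 1) b c t = E / t / t * g (s - 1)"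
  proof -
    have "c - (a + 1 + 1) - b = s - 1 - 1" by (simp add: s_def)
    thus ?thesis unfolding conn_2_def by (simp only: e1) (simp add: E_def g_def)
  qed
  show "t * (1 - t) * conn_2 (a + 1 + 1) b c t + (a + b - c + 1 - (a + (a - c + 1) + 1) * t) * (- conn_2 (a + 1) b c t)
     - a * (a - c + 1) * conn_2 a b c t = 0"
    unfolding c0 c1 c2 by (rule *)
qed

text \<open>Abel's identity: the weight (-t)^g (1 - t)^(p+q+1-g) is the integrating factor of the
  first-order equation satisfied by the Wronskian.\<close>

lemma wronskian_const:
  assumes f: "hyp_sol p q g left_half f1" "hyp_sol p q g left_half f2"
  shows "\<exists>k. \<forall>t\<in>left_half. exp (g * Ln (- t) + (p + q + 1 - g) * Ln (1 - t)) *
           (f1 t * deriv f2 t - deriv f1 t * f2 t) = k"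
proof (rule has_field_derivative_zero_constant[OF left_half(2)])
  fix t assume t: "t \<in> left_half"
  note d = left_half_D[OF t]
  let ?R = "\<lambda>t. exp (g * Ln (- t) + (p + q + 1 - g) * Ln (1 - t))"
  have h: "f1 holomorphic_on left_half" "f2 holomorphic_on left_half" using f by (auto simp: hyp_sol_def)
  have h': "deriv f1 holomorphic_on left_half" "deriv f2 holomorphic_on left_half"
    by (intro holomorphic_deriv h left_half)+
  have o: "t * (1 - t) * deriv (deriv f1) t = p * q * f1 t - (g - (p + q + 1) * t) * deriv f1 t"
    "t * (1 - t) * deriv (deriv f2) t = p * q * f2 t - (g - (p + q + 1) * t) * deriv f2 t"
    using f t by (auto simp: hyp_sol_def algebra_simps)
  have dR: "(?R has_field_derivative ?R t * (g / t - (p + q + 1 - g) / (1 - t))) (at t)"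
  proof -
    have "((\<lambda>t. Ln (- t)) has_field_derivative 1 / t) (at t)" "((\<lambda>t. Ln (1 - t)) has_field_derivative -
        (1 / (1 - t))) (at t)"
      using d by (auto intro!: derivative_eq_intros simp: field_simps)
    hence "((\<lambda>t. g * Ln (- t) + (p + q + 1 - g) * Ln (1 - t)) has_field_derivative
       g * (1 / t) + (p + q + 1 - g) * - (1 / (1 - t))) (at t)"
      by (intro DERIV_add DERIV_cmult)
    thus ?thesis using DERIV_fun_exp by (force simp: divide_inverse)
  qed
  let ?W' = "(f1 t * deriv (deriv f2) t + deriv f1 t * deriv f2 t) - (deriv f1 t * deriv f2 t + deriv
      (deriv f1) t * f2 t)"
  have dW: "((\<lambda>t. f1 t * deriv f2 t - deriv f1 t * f2 t) has_field_derivative ?W') (at t)"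
    by (rule DERIV_cong[OF DERIV_diff[OF DERIV_mult[OF holomorphic_derivI[OF h(1) left_half(1) t]
        holomorphic_derivI[OF h'(2) left_half(1) t]]
          DERIV_mult[OF holomorphic_derivI[OF h'(1) left_half(1) t] holomorphic_derivI[OF h(2) left_half(1)
              t]]]]) (simp add: algebra_simps)
  define W where "W = f1 t * deriv f2 t - deriv f1 t * f2 t"
  have "t * (1 - t) * ?W' = f1 t * (t * (1 - t) * deriv (deriv f2) t) - (t * (1 - t) * deriv (deriv f1) t) * f2 t"
    by (simp add: algebra_simps)
  also have "\<dots> = - (g - (p + q + 1) * t) * W" unfolding o W_def by (simp add: algebra_simps)
  finally have W': "t * (1 - t) * ?W' = - (g - (p + q + 1) * t) * W" .
  have "t * (1 - t) * ((g / t - (p + q + 1 - g) / (1 - t)) * W + ?W') = 0"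
  proof -
    have "t * (1 - t) * (g / t - (p + q + 1 - g) / (1 - t)) = g * (1 - t) - (p + q + 1 - g) * t"
      using d by (simp add: divide_simps) (simp add: algebra_simps)?
    hence "t * (1 - t) * ((g / t - (p + q + 1 - g) / (1 - t)) * W) = (g * (1 - t) - (p + q + 1 - g) * t) * W"
      by (metis mult.assoc)
    thus ?thesis unfolding distrib_left[of "t * (1 - t)"] W' by (simp add: algebra_simps)
  qed
  hence z: "(g / t - (p + q + 1 - g) / (1 - t)) * W + ?W' = 0" using d by simp
  have "((\<lambda>t. ?R t * (f1 t * deriv f2 t - deriv f1 t * f2 t)) has_field_derivative
     ?R t * ((g / t - (p + q + 1 - g) / (1 - t)) * W + ?W')) (at t)"
    by (rule DERIV_cong[OF DERIV_mult[OF dR dW]]) (simp only: W_def distrib_left mult_ac)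
  thus "((\<lambda>t. ?R t * (f1 t * deriv f2 t - deriv f1 t * f2 t)) has_field_derivative 0) (at t within left_half)"
    unfolding z by (simp add: has_field_derivative_at_within)
qed

lemma wronskian_zero_imp_proportional:
  assumes S: "open S" "convex S" and h: "f holomorphic_on S" "g holomorphic_on S"
    and nz: "\<And>t. t \<in> S \<Longrightarrow> g t \<noteq> 0" and W: "\<And>t. t \<in> S \<Longrightarrow> f t * deriv g t - deriv f t * g t = 0"
  shows "\<exists>A. \<forall>t\<in>S. f t = A * g t"
proof -
  have "\<exists>A. \<forall>t\<in>S. f t / g t = A"
  proof (rule has_field_derivative_zero_constant[OF S(2)])
    fix t assume t: "t \<in> S"
    have "((\<lambda>t. f t / g t) has_field_derivative (deriv f t * g t - f t * deriv g t) / (g t * g t)) (at t)"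
      by (intro DERIV_divide holomorphic_derivI[OF _ S(1) t] h nz t)
    also have "deriv f t * g t - f t * deriv g t = 0" using W[OF t] by (simp add: algebra_simps)
    finally show "((\<lambda>t. f t / g t) has_field_derivative 0) (at t within S)"
      by (simp add: has_field_derivative_at_within)
  qed
  thus ?thesis using nz by (auto simp: field_simps)
qed

text \<open>The second coefficient \<open>B\<close> is never needed: \<open>conn_2\<close> drops out of the combination of boundary
  values that produces \<open>jacobi_P\<close>.\<close>

definition conn_holds :: "complex \<Rightarrow> complex \<Rightarrow> complex \<Rightarrow> bool" where
  "conn_holds a b c \<longleftrightarrow> (\<exists>r B. 0 < r \<and> r \<le> 1 \<and> (\<forall>t. norm t < r \<longrightarrow> Re t < 0 \<longrightarrow>
     conn_f a b c t = conn_A a b c * conn_1 a b c t + B * conn_2 a b c t))"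

lemma tendsto_minus_of_real_at_right_0:
  assumes "isCont f (0::complex)"
  shows "((\<lambda>x::real. f (- of_real x)) \<longlongrightarrow> f 0) (at_right 0)"
proof -
  have "((\<lambda>x::real. - complex_of_real x) \<longlongrightarrow> - of_real 0) (at_right 0)" by (intro tendsto_intros)
  thus ?thesis using isCont_tendsto_compose[OF assms] by simp
qed

lemma isCont_0_of_holomorphic_ball: "f holomorphic_on ball 0 1 \<Longrightarrow> isCont f (0::complex)"
  using holomorphic_on_imp_continuous_on[of f "ball 0 1"] continuous_on_eq_continuous_at[of "ball
      (0::complex) 1" f] by auto

text \<open>In the weighted Wronskian the powers of -t cancel, leaving the function
  \<open>Y\<close>, holomorphic at 0. Its value there is the product of 1/\<Gamma>(c - a - b) and
  1/\<Gamma>(a + b - c + 1), nonzero because a + b - c is no integer.\<close>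

lemma conn_12_wronskian:
  assumes s: "a + b - c \<notin> \<int>"
  shows "\<exists>k. k \<noteq> 0 \<and> (\<forall>t\<in>left_half. exp ((a + b - c + 1) * Ln (- t) + (a + (a - c + 1) + 1 -
      (a + b - c + 1)) * Ln (1 - t)) *
           (conn_2 a b c t * deriv (conn_1 a b c) t - deriv (conn_2 a b c) t * conn_1 a b c t) = k)"
proof -
  define e where "e = a + (a - c + 1) + 1 - (a + b - c + 1)"
  let ?R = "\<lambda>t. exp ((a + b - c + 1) * Ln (- t) + e * Ln (1 - t))"
  obtain k where k: "\<And>t. t \<in> left_half \<Longrightarrow> ?R t * (conn_2 a b c t * deriv (conn_1 a b c) t - deriv
      (conn_2 a b c) t * conn_1 a b c t) = k"
    using wronskian_const[OF conn_2_sol[of a c b] conn_1_sol[of a c b]] unfolding e_def by blast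
  define Y where "Y = (\<lambda>t. exp (e * Ln (1 - t)) *
     (- t * hyp_F_series (c - b) (1 - b) (c - a - b + 1) t * deriv (conn_1 a b c) t
      + hyp_F_series (c - b) (1 - b) (c - (a + 1) - b + 1) t * conn_1 a b c t))"
  have h1: "conn_1 a b c holomorphic_on ball 0 1"
    unfolding conn_1_def[abs_def] by (rule hyp_F_series_holomorphic)
  have "Y holomorphic_on ball 0 1"
    unfolding Y_def
    by (intro holomorphic_intros hyp_F_series_holomorphic h1 holomorphic_deriv open_ball)
       (use norm_lt_1_imp(5) in auto)
  from tendsto_minus_of_real_at_right_0[OF isCont_0_of_holomorphic_ball[OF this]]
  have lim: "((\<lambda>x::real. Y (- of_real x)) \<longlongrightarrow> Y 0) (at_right 0)" .
  have Yk: "Y t = k" if t: "t \<in> left_half" for t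
  proof -
    note d = left_half_D[OF t]
    have nz: "- t \<noteq> 0" using d by simp
    have e1: "?R t * exp ((c - a - b) * Ln (- t)) = - t * exp (e * Ln (1 - t))"
    proof -
      have "?R t * exp ((c - a - b) * Ln (- t)) = exp (Ln (- t)) * exp (e * Ln (1 - t))"
        unfolding exp_add[symmetric] by (rule arg_cong[where f = exp]) (simp add: algebra_simps)
      thus ?thesis unfolding exp_Ln[OF nz] .
    qed
    have e2: "?R t * exp ((c - (a + 1) - b) * Ln (- t)) = exp (e * Ln (1 - t))"
      unfolding exp_add[symmetric] by (rule arg_cong[where f = exp]) (simp add: algebra_simps)
    have dc: "deriv (conn_2 a b c) t = - conn_2 (a + 1) b c t" by (rule DERIV_imp_deriv[OF conn_2_deriv[OF t]])
    have g: "R * (E * x * y - - (E' * z) * w) = (R * E) * x * y + (R * E') * z * w" for R E E' x y z w :: complex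
      by (simp add: algebra_simps)
    show ?thesis
      unfolding k[OF t, symmetric] dc conn_2_def g e1 e2 Y_def by (simp add: algebra_simps)
  qed
  have "eventually (\<lambda>x::real. Y (- of_real x) = k) (at_right 0)"
    unfolding eventually_at_right_field by (intro exI[of _ 1]) (auto intro!: Yk simp: left_half_def)
  from tendsto_unique[OF _ lim tendsto_eventually[OF this]] have "k = Y 0" by simp
  also have "\<dots> = rGamma (c - a - b) * rGamma (a + b - c + 1)"
  proof -
    have q: "c - (a + 1) - b + 1 = c - a - b" by simp
    show ?thesis unfolding Y_def conn_1_def q by simp
  qed
  finally have k0: "k = rGamma (c - a - b) * rGamma (a + b - c + 1)" .
  have "c - a - b \<notin> \<int>"
  proof
    assume "c - a - b \<in> \<int>"
    hence "- (c - a - b) \<in> \<int>" by (rule Ints_minus)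
    thus False using s by (simp add: algebra_simps)
  qed
  moreover have "a + b - c + 1 \<notin> \<int>"
  proof
    assume "a + b - c + 1 \<in> \<int>"
    hence "a + b - c + 1 - 1 \<in> \<int>" by (intro Ints_diff Ints_1)
    thus False using s by simp
  qed
  ultimately have "k \<noteq> 0" unfolding k0 using nonpos_Ints_subset_Ints by (auto simp: rGamma_eq_zero_iff)
  with k show ?thesis unfolding e_def by blast
qed

text \<open>The coefficient A is read off as t tends to 0 from the left: there 1 / (1 - t) tends to
  1 and Gauss's sum gives the limit of \<open>conn_f\<close>, \<open>conn_2\<close> tends to 0
  because Re (c - a - b) > 0, and \<open>conn_1\<close> tends to 1/\<Gamma>(\<sigma> + 1).\<close>

lemma conn_holds_neg:
  assumes s: "a + b - c \<notin> \<int>" and re: "Re (a + b - c) < 0" and c: "c \<notin> \<int>\<^sub>\<le>\<^sub>0"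
  shows "conn_holds a b c"
proof -
  define \<sigma> where "\<sigma> = a + b - c"
  let ?R = "\<lambda>t. exp ((a + b - c + 1) * Ln (- t) + (a + (a - c + 1) + 1 - (a + b - c + 1)) * Ln (1 - t))"
  obtain k2 where k2: "k2 \<noteq> 0" "\<And>t. t \<in> left_half \<Longrightarrow>
      ?R t * (conn_2 a b c t * deriv (conn_1 a b c) t - deriv (conn_2 a b c) t * conn_1 a b c t) = k2"
    using conn_12_wronskian[OF s] by blast
  obtain k1 where k1: "\<And>t. t \<in> left_half \<Longrightarrow>
      ?R t * (conn_f a b c t * deriv (conn_1 a b c) t - deriv (conn_f a b c) t * conn_1 a b c t) = k1"
    using wronskian_const[OF conn_f_sol[of a c b] conn_1_sol[of a c b]] by blast
  \<comment> \<open>This choice makes the Wronskian of h and \<open>conn_1\<close> vanish, so h is a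
    multiple of \<open>conn_1\<close> wherever \<open>conn_1\<close> has no zero.\<close>
  define B where "B = k1 / k2"
  define h where "h = (\<lambda>t. conn_f a b c t - B * conn_2 a b c t)"
  have hol: "conn_f a b c holomorphic_on left_half" "conn_2 a b c holomorphic_on left_half" "conn_1 a b c
      holomorphic_on left_half"
    using conn_f_sol[of a c b] conn_2_sol[of a c b] conn_1_sol[of a c b] by (auto simp: hyp_sol_def)
  have Wh: "h t * deriv (conn_1 a b c) t - deriv h t * conn_1 a b c t = 0" if t: "t \<in> left_half" for t
  proof -
    have "(h has_field_derivative deriv (conn_f a b c) t - B * deriv (conn_2 a b c) t) (at t)"
      unfolding h_def by (intro DERIV_diff DERIV_cmult holomorphic_derivI[OF _ left_half(1) t] hol)
    from DERIV_imp_deriv[OF this]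
    have "?R t * (h t * deriv (conn_1 a b c) t - deriv h t * conn_1 a b c t)
      = ?R t * (conn_f a b c t * deriv (conn_1 a b c) t - deriv (conn_f a b c) t * conn_1 a b c t)
       - B * (?R t * (conn_2 a b c t * deriv (conn_1 a b c) t - deriv (conn_2 a b c) t * conn_1 a b c t))"
      by (simp only: h_def) (simp only: algebra_simps)
    also have "\<dots> = 0" unfolding k1[OF t] k2(2)[OF t] using k2(1) by (simp add: B_def)
    finally show ?thesis by simp
  qed
  have c1: "isCont (conn_1 a b c) 0"
    unfolding conn_1_def[abs_def] by (rule isCont_0_of_holomorphic_ball[OF hyp_F_series_holomorphic])
  have s1: "\<sigma> + 1 \<notin> \<int>"
  proof
    assume "\<sigma> + 1 \<in> \<int>"
    hence "\<sigma> + 1 - 1 \<in> \<int>" by (intro Ints_diff Ints_1)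
    thus False using s by (simp add: \<sigma>_def)
  qed
  hence nz0: "rGamma (\<sigma> + 1) \<noteq> 0" using nonpos_Ints_subset_Ints by (auto simp: rGamma_eq_zero_iff)
  have c10: "conn_1 a b c 0 = rGamma (\<sigma> + 1)" by (simp add: conn_1_def \<sigma>_def)
  obtain d where d: "d > 0" "\<And>t. norm t < d \<Longrightarrow> conn_1 a b c t \<noteq> 0"
    using continuous_at_avoid[OF c1, of 0] nz0 unfolding c10 by auto
  \<comment> \<open>The region shrinks to a neighbourhood of 0 without zeros of
    \<open>conn_1\<close>; this is why \<open>conn_holds\<close> allows a small radius.\<close>
  define r where "r = min d 1"
  define S where "S = ball 0 r \<inter> {t. Re t < 0}"
  have S: "open S" "convex S" "S \<subseteq> left_half" unfolding S_def
    by (auto intro!: open_Int convex_Int open_halfspace_Re_lt convex_halfspace_Re_lt simp: left_half_def r_def)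
  have hh: "h holomorphic_on S" "conn_1 a b c holomorphic_on S"
    unfolding h_def by (auto intro!: holomorphic_intros intro: holomorphic_on_subset[OF hol(1) S(3)]
       holomorphic_on_subset[OF hol(2) S(3)] holomorphic_on_subset[OF hol(3) S(3)])
  have "conn_1 a b c t \<noteq> 0" if "t \<in> S" for t using that d(2) by (simp add: S_def r_def)
  from wronskian_zero_imp_proportional[OF S(1,2) hh this Wh] S(3)
  obtain A where A: "\<And>t. t \<in> S \<Longrightarrow> h t = A * conn_1 a b c t" by blast
  have r: "0 < r" "r \<le> 1" using d by (auto simp: r_def)
  have inS: "eventually (\<lambda>x::real. - of_real x \<in> S) (at_right 0)"
    unfolding eventually_at_right_field S_def by (intro exI[of _ r]) (use r in auto)
  have limf: "((\<lambda>x::real. conn_f a b c (- of_real x)) \<longlongrightarrow> 1 * (Gamma (- \<sigma>) * rGamma (c - a) * rGamma (c - b))) (at_right 0)"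
  proof -
    have y: "filterlim (\<lambda>x::real. 1 / (1 + x)) (at_left 1) (at_right 0)"
      unfolding filterlim_at
    proof
      have "((\<lambda>x::real. 1 / (1 + x)) \<longlongrightarrow> 1 / (1 + 0)) (at_right 0)" by (intro tendsto_intros) simp
      thus "((\<lambda>x::real. 1 / (1 + x)) \<longlongrightarrow> 1) (at_right 0)" by simp
      show "eventually (\<lambda>x::real. 1 / (1 + x) \<in> {..<1} \<and> 1 / (1 + x) \<noteq> 1) (at_right 0)"
        unfolding eventually_at_right_field by (intro exI[of _ 1]) auto
    qed
    have cs: "c - a - b = - \<sigma>" by (simp add: \<sigma>_def)
    have "Re (c - a - b) > 0" using re by simp
    from filterlim_compose[OF hyp_F_series_gauss[OF c this] y]
    have l1: "((\<lambda>x. hyp_F_series a b c (of_real (1 / (1 + x)))) \<longlongrightarrow> Gamma (- \<sigma>) * rGamma (c - a) * rGamma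
        (c - b)) (at_right 0)"
      unfolding cs .
    have "isCont (\<lambda>t::complex. exp (- a * Ln (1 - t))) 0" by (intro continuous_intros) auto
    from tendsto_minus_of_real_at_right_0[OF this]
    have l2: "((\<lambda>x::real. exp (- a * Ln (1 - - of_real x))) \<longlongrightarrow> 1) (at_right 0)" by simp
    have "eventually (\<lambda>x::real. exp (- a * Ln (1 - - of_real x)) * hyp_F_series a b c (of_real (1 / (1 + x)))
        = conn_f a b c (- of_real x)) (at_right 0)"
      using inS
    proof eventually_elim
      case (elim x)
      hence "- of_real x \<in> left_half" using S(3) by blast
      from conn_f_left_half[OF this, of a b c] show ?case by simp
    qed
    thus ?thesis using tendsto_mult[OF l2 l1] by (rule Lim_transform_eventually[rotated])
  qed
  have lim2: "((\<lambda>x::real. conn_2 a b c (- of_real x)) \<longlongrightarrow> 0) (at_right 0)"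
  proof -
    have l1: "((\<lambda>x::real. hyp_F_series (c - b) (1 - b) (c - a - b + 1) (- of_real x)) \<longlongrightarrow>
        hyp_F_series (c - b) (1 - b) (c - a - b + 1) 0) (at_right 0)"
      by (rule tendsto_minus_of_real_at_right_0[OF isCont_0_of_holomorphic_ball[OF hyp_F_series_holomorphic]])
    have l2: "((\<lambda>x::real. exp ((c - a - b) * Ln (- (- of_real x)))) \<longlongrightarrow> 0) (at_right 0)"
    proof (rule Lim_null_comparison)
      show "eventually (\<lambda>x::real. norm (exp ((c - a - b) * Ln (- (- of_real x)))) \<le> exp (- Re \<sigma> * ln x)) (at_right 0)"
        unfolding eventually_at_right_field
        by (intro exI[of _ 1]) (auto simp: Ln_of_real \<sigma>_def algebra_simps)
      have "filterlim (\<lambda>x::real. - Re \<sigma> * ln x) at_bot (at_right 0)"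
        by (rule filterlim_tendsto_pos_mult_at_bot[OF tendsto_const _ ln_at_0]) (use re in \<open>simp add: \<sigma>_def\<close>)
      thus "((\<lambda>x::real. exp (- Re \<sigma> * ln x)) \<longlongrightarrow> 0) (at_right 0)" by (rule filterlim_compose[OF exp_at_bot])
    qed
    show ?thesis unfolding conn_2_def using tendsto_mult[OF l2 l1] by simp
  qed
  have lim1: "((\<lambda>x::real. A * conn_1 a b c (- of_real x)) \<longlongrightarrow> A * rGamma (\<sigma> + 1)) (at_right 0)"
    unfolding c10[symmetric] by (intro tendsto_mult tendsto_const tendsto_minus_of_real_at_right_0 c1)
  have "((\<lambda>x::real. h (- of_real x)) \<longlongrightarrow> 1 * (Gamma (- \<sigma>) * rGamma (c - a) * rGamma (c - b)) - B * 0) (at_right 0)"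
    unfolding h_def by (intro tendsto_diff limf tendsto_mult tendsto_const lim2)
  moreover have "eventually (\<lambda>x::real. h (- of_real x) = A * conn_1 a b c (- of_real x)) (at_right 0)"
    using inS by eventually_elim (rule A)
  ultimately have "((\<lambda>x::real. A * conn_1 a b c (- of_real x)) \<longlongrightarrow> 1 * (Gamma (- \<sigma>) * rGamma (c - a) * rGamma
      (c - b)) - B * 0) (at_right 0)"
    by (rule Lim_transform_eventually)
  from tendsto_unique[OF _ this lim1]
  have AG: "Gamma (- \<sigma>) * rGamma (c - a) * rGamma (c - b) = A * rGamma (\<sigma> + 1)" by simp
  have "A = conn_A a b c"
  proof -
    have "Gamma (- \<sigma>) * Gamma (1 - - \<sigma>) = of_real pi / sin (of_real pi * (- \<sigma>))" by (rule Gamma_reflection_complex)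
    hence r: "Gamma (- \<sigma>) * Gamma (\<sigma> + 1) = - of_real pi / sin (of_real pi * \<sigma>)" by (simp add: add.commute)
    have "A = A * rGamma (\<sigma> + 1) * Gamma (\<sigma> + 1)" using nz0 by (simp add: Gamma_def)
    also have "\<dots> = Gamma (- \<sigma>) * Gamma (\<sigma> + 1) * rGamma (c - a) * rGamma (c - b)" unfolding AG[symmetric] by
        (simp add: mult_ac)
    finally show ?thesis unfolding r unfolding conn_A_def \<sigma>_def .
  qed
  thus ?thesis unfolding conn_holds_def using r A
    by (intro exI[of _ r] exI[of _ B]) (auto simp: h_def S_def algebra_simps)
qed

text \<open>Differentiating the identity turns each of the three solutions into a multiple of itself
  at a + 1. The factor a on the left is divided out, and the recursion of 1/\<Gamma>(c - a) with the
  sign change of the sine yields \<open>conn_A\<close> at a + 1.\<close>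

lemma conn_holds_shift:
  assumes c: "conn_holds a b c" and a: "a \<noteq> 0"
  shows "conn_holds (a + 1) b c"
proof -
  obtain r B where r: "0 < r" "r \<le> 1" and e: "\<And>t. norm t < r \<Longrightarrow> Re t < 0 \<Longrightarrow>
     conn_f a b c t = conn_A a b c * conn_1 a b c t + B * conn_2 a b c t"
    using c unfolding conn_holds_def by blast
  have A: "conn_A (a + 1) b c = (a - c + 1) * conn_A a b c"
  proof -
    define u where "u = of_real pi * (a + b - c)"
    have rr: "rGamma (c - (a + 1)) = (c - a - 1) * rGamma (c - a)"
      using rGamma_plus1[of "c - (a + 1)"] by (simp add: algebra_simps)
    have "of_real pi * (a + 1 + b - c) = u + of_real pi" by (simp add: u_def algebra_simps)
    hence sn: "sin (of_real pi * (a + 1 + b - c)) = - sin u" by (simp only: sin_add sin_of_real cos_of_real) simp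
    show ?thesis unfolding conn_A_def sn rr u_def[symmetric] by (simp add: algebra_simps diff_divide_distrib
        add_divide_distrib)
  qed
  have "conn_f (a + 1) b c t = conn_A (a + 1) b c * conn_1 (a + 1) b c t + (- B / a) * conn_2 (a + 1) b c t"
    if t: "norm t < r" "Re t < 0" for t
  proof -
    define S where "S = ball 0 r \<inter> {t. Re t < 0}"
    have S: "open S" "t \<in> S" "t \<in> left_half" using t r by (auto simp: S_def left_half_def intro!: open_halfspace_Re_lt)
    have "(conn_1 a b c has_field_derivative a * (a - c + 1) * conn_1 (a + 1) b c t) (at t)"
    proof -
      have "a + 1 - c + 1 = a - c + 1 + 1" "a + 1 + b - c + 1 = a + b - c + 1 + 1" by (simp_all add: algebra_simps)
      thus ?thesis unfolding conn_1_def[abs_def] using hyp_F_series_has_deriv[of t a "a - c + 1" "a + b - c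
          + 1"] t r by simp
    qed
    hence d: "((\<lambda>t. conn_A a b c * conn_1 a b c t + B * conn_2 a b c t) has_field_derivative
       conn_A a b c * (a * (a - c + 1) * conn_1 (a + 1) b c t) + B * (- conn_2 (a + 1) b c t)) (at t)"
      by (intro DERIV_add DERIV_cmult conn_2_deriv S)
    have "(conn_f a b c has_field_derivative
       conn_A a b c * (a * (a - c + 1) * conn_1 (a + 1) b c t) + B * (- conn_2 (a + 1) b c t)) (at t)"
      by (rule has_field_derivative_cong_open[OF S(1,2) _ d]) (auto simp: S_def intro!: e)
    from DERIV_unique[OF this conn_f_deriv[OF S(3)]]
    have "a * conn_f (a + 1) b c t = conn_A a b c * (a * (a - c + 1) * conn_1 (a + 1) b c t) + B *
        (- conn_2 (a + 1) b c t)" by simp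
    hence "conn_f (a + 1) b c t = (conn_A a b c * (a * (a - c + 1) * conn_1 (a + 1) b c t) + B *
        (- conn_2 (a + 1) b c t)) / a"
      using a by (simp add: eq_divide_eq mult.commute)
    also have "\<dots> = (a - c + 1) * conn_A a b c * conn_1 (a + 1) b c t + (- B / a) * conn_2 (a + 1) b c t"
      using a by (simp add: field_simps)
    finally show ?thesis unfolding A .
  qed
  thus ?thesis using r unfolding conn_holds_def by blast
qed

text \<open>Lowering a by n makes Re (a + b - c) negative, the case settled by Gauss's sum. The
  condition |a| > n keeps a - 1, ..., a - n away from 0, so every upward shift is
  legitimate.\<close>

lemma conn_holds_general:
  assumes "a + b - c \<notin> \<int>" "Re (a + b - c) < real n" "norm a > real n" "c \<notin> \<int>\<^sub>\<le>\<^sub>0"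
  shows "conn_holds a b c"
  using assms
proof (induction n arbitrary: a)
  case 0
  thus ?case by (intro conn_holds_neg) auto
next
  case (Suc n)
  have "a - 1 + b - c \<notin> \<int>"
  proof
    assume "a - 1 + b - c \<in> \<int>"
    hence "a - 1 + b - c + 1 \<in> \<int>" by (intro Ints_add Ints_1)
    thus False using Suc.prems(1) by (simp add: algebra_simps)
  qed
  moreover have n: "norm (a - 1) > real n" using Suc.prems(3) norm_triangle_ineq2[of a 1] by simp
  ultimately have "conn_holds (a - 1) b c" using Suc.prems by (intro Suc.IH) auto
  moreover have "a - 1 \<noteq> 0" using n by auto
  ultimately show ?case using conn_holds_shift[of "a - 1" b c] by simp
qed

text \<open>Both sides are holomorphic on the disc cut along [0, 1), which is star-shaped about -1/2
  and hence connected; the identity spreads there from the small half-disc.\<close>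

lemma conn_formula:
  assumes c: "conn_holds a b c"
  shows "\<exists>B. \<forall>t. norm t < 1 \<longrightarrow> - t \<notin> \<real>\<^sub>\<le>\<^sub>0 \<longrightarrow>
     conn_f a b c t = conn_A a b c * conn_1 a b c t + B * conn_2 a b c t"
proof -
  obtain r B where r: "0 < r" "r \<le> 1" and e: "\<And>t. norm t < r \<Longrightarrow> Re t < 0 \<Longrightarrow>
     conn_f a b c t = conn_A a b c * conn_1 a b c t + B * conn_2 a b c t"
    using c unfolding conn_holds_def by blast
  define D where "D = ball 0 1 \<inter> {t::complex. - t \<notin> \<real>\<^sub>\<le>\<^sub>0}"
  have oD: "open D"
  proof -
    have D: "D = ball 0 1 \<inter> (\<lambda>t. - t) -` (- \<real>\<^sub>\<le>\<^sub>0)" by (auto simp: D_def)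
    show ?thesis unfolding D
      by (intro open_Int open_ball open_vimage open_Compl closed_nonpos_Reals_complex continuous_intros)
  qed
  have sD: "starlike D"
    unfolding starlike_def
  proof (intro bexI[of _ "- 1/2"] ballI subsetI)
    fix x y assume x: "x \<in> D" and y: "y \<in> closed_segment (- 1/2) x"
    have "y \<in> ball 0 1"
      using closed_segment_subset[of "- 1/2" "ball (0::complex) 1" x] x y by (auto simp: D_def)
    moreover obtain u where u: "0 \<le> u" "u \<le> 1" "y = (1 - u) *\<^sub>R (- 1/2) + u *\<^sub>R x"
      using y by (auto simp: in_segment)
    have "- y \<notin> \<real>\<^sub>\<le>\<^sub>0"
    proof
      assume "- y \<in> \<real>\<^sub>\<le>\<^sub>0"
      hence a: "Re y \<ge> 0" "Im y = 0" by (auto simp: complex_nonpos_Reals_iff)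
      have b: "Re y = - (1 - u) / 2 + u * Re x" "Im y = u * Im x" unfolding u(3) by (auto simp: field_simps)
      have "u \<noteq> 0" using a b by auto
      hence "Im x = 0" "u > 0" using a b u by auto
      moreover have "u * Re x \<ge> 0" using a b u by auto
      ultimately have "Re x \<ge> 0" by (simp add: zero_le_mult_iff)
      thus False using x \<open>Im x = 0\<close> by (auto simp: D_def complex_nonpos_Reals_iff)
    qed
    ultimately show "y \<in> D" by (simp add: D_def)
  qed (auto simp: D_def complex_nonpos_Reals_iff)
  have slit: "1 / (1 - t) \<in> slit" "1 - t \<notin> \<real>\<^sub>\<le>\<^sub>0" "1 - t \<noteq> 0" if t: "t \<in> D" for t
  proof -
    have n: "norm t < 1" using t by (simp add: D_def)
    show t1: "1 - t \<notin> \<real>\<^sub>\<le>\<^sub>0" "1 - t \<noteq> 0" using norm_lt_1_imp[OF n] by auto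
    show "1 / (1 - t) \<in> slit"
    proof
      assume "1 / (1 - t) \<in> complex_of_real ` {1..}"
      then obtain s where s: "s \<ge> 1" "1 / (1 - t) = of_real s" by auto
      hence "t = 1 - 1 / of_real s" using t1 by (auto simp: field_simps)
      hence "- t = of_real (- (1 - 1 / s))" by simp
      moreover have "- (1 - 1 / s) \<le> 0" using s by simp
      ultimately have "- t \<in> \<real>\<^sub>\<le>\<^sub>0" by (metis nonpos_Reals_of_real_iff)
      thus False using t by (simp add: D_def)
    qed
  qed
  have hf: "conn_f a b c holomorphic_on D"
    unfolding conn_f_def[abs_def]
    by (intro holomorphic_intros holomorphic_on_compose_gen[OF _ hyp_F_holomorphic, unfolded o_def]) (use slit in auto)
  have h1: "(\<lambda>t. conn_A a b c * conn_1 a b c t + B * conn_2 a b c t) holomorphic_on D"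
    unfolding conn_1_def conn_2_def
    by (intro holomorphic_intros holomorphic_on_subset[OF hyp_F_series_holomorphic]) (auto simp: D_def)
  have "conn_f a b c t = conn_A a b c * conn_1 a b c t + B * conn_2 a b c t" if t: "t \<in> D" for t
  proof (rule analytic_continuation_open[of "ball 0 r \<inter> {t. Re t < 0}" D "conn_f a b c" _ t])
    show "open (ball 0 r \<inter> {t::complex. Re t < 0})" by (intro open_Int open_ball open_halfspace_Re_lt)
    have "complex_of_real (- r / 2) \<in> ball 0 r \<inter> {t. Re t < 0}" using r by simp
    thus "ball 0 r \<inter> {t::complex. Re t < 0} \<noteq> {}" by blast
    show "ball 0 r \<inter> {t. Re t < 0} \<subseteq> D" using r by (auto simp: D_def complex_nonpos_Reals_iff)
  qed (use oD starlike_imp_connected[OF sD] hf h1 t e in auto)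
  thus ?thesis by (auto simp: D_def)
qed

section \<open>Boundary values on the cut\<close>

text \<open>The change z to z + pi/2 exchanges sin^2 and cos^2: replacing q by -q in v swaps
  \<alpha> and \<beta>, so the coefficients of the two solutions differ by the sign (-1)^n.\<close>

lemma jac_G_swap: "jac_G l \<beta> \<alpha> (- q) = jac_G l \<alpha> \<beta> q"
proof -
  let ?v = "fps_nth (jac_v_fps \<alpha> \<beta>)" and ?w = "fps_nth (jac_v_fps \<beta> \<alpha>)"
  have w: "?w k = (-1) ^ k * ?v k" for k
    by (cases "even k") (auto simp: jac_v_fps_def algebra_simps)
  have g: "fuchs_coeff l ?w n = (-1) ^ n * fuchs_coeff l ?v n" for n
  proof (induction n rule: less_induct)
    case (less n)
    have "(\<Sum>k<n. ?w (n - k) * fuchs_coeff l ?w k) = (\<Sum>k<n. (-1) ^ n * (?v (n - k) * fuchs_coeff l ?v k))"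
    proof (rule sum.cong[OF refl])
      fix k assume k: "k \<in> {..<n}"
      hence p: "(-1::complex) ^ n = (-1) ^ (n - k) * (-1) ^ k" by (simp flip: power_add)
      show "?w (n - k) * fuchs_coeff l ?w k = (-1) ^ n * (?v (n - k) * fuchs_coeff l ?v k)"
        unfolding p w[of "n - k"] less.IH[OF k[unfolded lessThan_iff]] by (simp only: mult_ac)
    qed
    thus ?case
      by (subst fuchs_coeff.simps, subst (2) fuchs_coeff.simps) (simp flip: sum_distrib_left)
  qed
  have "(\<lambda>n. fuchs_coeff l ?w n * (- q) ^ n) = (\<lambda>n. fuchs_coeff l ?v n * q ^ n)"
    unfolding g by (rule ext) (subst power_minus, simp add: mult_ac flip: power_mult_distrib)
  thus ?thesis by (simp add: jac_G_def eval_fps_def jac_fps_def)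
qed

text \<open>The solution of cos 2z = w in the upper half-plane. Im (Arccos w) has the sign opposite
  to Im w, so the sign s of the side of the cut is put in front.\<close>

definition cut_preimage :: "real \<Rightarrow> complex \<Rightarrow> complex" where
  "cut_preimage s w = - of_real s * Arccos w / 2"

lemma cut_preimage:
  assumes w: "\<bar>Re w\<bar> < 1" "s * Im w > 0" and s: "s = 1 \<or> s = -1"
  shows "cos (2 * cut_preimage s w) = w" "Im (cut_preimage s w) > 0" "\<bar>Re (cut_preimage s w)\<bar> < pi / 2"
proof -
  have "cos (2 * cut_preimage s w) = cos (Arccos w)" using s by (auto simp: cut_preimage_def)
  thus "cos (2 * cut_preimage s w) = w" by simp
  have b: "0 < Re (Arccos w)" "Re (Arccos w) < pi" using Arccos_bounds[OF w(1)] by auto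
  thus "\<bar>Re (cut_preimage s w)\<bar> < pi / 2" using s by (auto simp: cut_preimage_def)
  define v where "v = Im (Arccos w)"
  have "Im w = Im (cos (Arccos w))" by simp
  also have "\<dots> = - (sin (Re (Arccos w)) * ((exp v - exp (- v)) / 2))"
    unfolding Im_cos v_def by (simp add: field_simps)
  finally have "Im w = - (sin (Re (Arccos w)) * ((exp v - exp (- v)) / 2))" .
  moreover have "sin (Re (Arccos w)) > 0" using b by (intro sin_gt_zero)
  ultimately have "s * (exp v - exp (- v)) < 0"
    using w(2) s by (auto simp: mult_less_0_iff zero_less_mult_iff)
  hence "s * v < 0" using s by (auto simp: mult_less_0_iff)
  thus "Im (cut_preimage s w) > 0" using s by (auto simp: cut_preimage_def v_def)
qed

text \<open>An instance of Pfaff's transformation. The arguments 2 / (1 - w) and 2 / (1 + w) are the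
  Koebe images of q and -q, and \<open>jac_G_swap\<close> identifies the two regular
  solutions.\<close>

lemma jacobi_Q_eq_conn_f:
  assumes w: "\<bar>Re w\<bar> < 1" "Im w \<noteq> 0" and l: "2 * \<nu> + \<alpha> + \<beta> + 1 \<notin> neg_ints"
  shows "jacobi_Q \<nu> \<alpha> \<beta> w = 1/2 * (Gamma (\<nu> + \<alpha> + 1) * Gamma (\<nu> + \<beta> + 1)) *
     conn_f (\<nu> + \<alpha> + \<beta> + 1) (\<nu> + \<alpha> + 1) (2 * \<nu> + \<alpha> + \<beta> + 2) ((1 - w) / 2)"
proof -
  define s :: real where "s = (if Im w > 0 then 1 else -1)"
  have s: "s = 1 \<or> s = -1" "s * Im w > 0" using w(2) by (auto simp: s_def)
  define z where "z = cut_preimage s w"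
  have z: "cos (2 * z) = w" "Im z > 0" "\<bar>Re z\<bar> < pi / 2" unfolding z_def by (rule cut_preimage[OF w(1) s(2,1)])+
  define S where "S = - \<i> * sin z"
  define L where "L = Ln (2::complex)"
  define u v where "u = Ln S" and "v = Ln (cos z)"
  define q where "q = exp (2 * \<i> * z)"
  have S: "Re S > 0" unfolding S_def by (rule Re_minus_i_sin_pos[OF z(2,3)])
  have K: "Re (cos z) > 0" by (rule Re_cos_pos[OF z(3)])
  have nz: "S \<noteq> 0" "cos z \<noteq> 0" using S K by (auto simp del: Re_cos)
  have L: "exp L = 2" unfolding L_def by (rule exp_Ln) simp
  have L0: "Im L = 0" unfolding L_def using Ln_of_real[of 2] by simp
  have uv: "exp u = S" "exp v = cos z" using nz by (simp_all add: u_def v_def)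
  have b: "\<bar>Im u\<bar> < pi / 2" "\<bar>Im v\<bar> < pi / 2" using Im_Ln_right_half S K by (auto simp: u_def v_def)
  have nq: "norm (- q) < 1" using z by (simp add: q_def)
  have q1: "1 - q = exp (L + \<i> * z + u)" "1 + q = exp (L + \<i> * z + v)"
    unfolding exp_add L uv using exp_2iz_eq[of z] by (simp_all add: q_def S_def)
  have lnq: "Ln (1 + - q) = L + \<i> * z + u" "Ln (1 - - q) = L + \<i> * z + v"
  proof -
    have "Ln (1 - q) = L + \<i> * z + u" "Ln (1 + q) = L + \<i> * z + v"
      unfolding q1 by (rule Ln_exp; use b z L0 in auto)+
    thus "Ln (1 + - q) = L + \<i> * z + u" "Ln (1 - - q) = L + \<i> * z + v" by simp_all
  qed
  define t where "t = (1 - w) / 2"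
  have t1: "1 - t = exp (2 * v)"
    unfolding exp_double uv using cos_2z_eq(2)[of z] unfolding z(1) by (simp add: t_def field_simps)
  have lnt: "Ln (1 - t) = 2 * v" unfolding t1 by (rule Ln_exp) (use b in auto)
  have x: "1 / (1 - t) = - 4 * (- q) / (1 - - q)\<^sup>2"
  proof -
    have qq: "q = exp (\<i> * z) ^ 2" by (simp add: q_def power2_eq_square mult.assoc flip: exp_add)
    have "(1 - - q)\<^sup>2 = 4 * q * (cos z)\<^sup>2" using exp_2iz_eq(2)[of z] unfolding q_def[symmetric]
      by (simp add: qq power_mult_distrib)
    moreover have "1 - t = (cos z)\<^sup>2" unfolding t1 exp_double uv ..
    moreover have "q \<noteq> 0" by (simp add: q_def)
    ultimately show ?thesis using nz by simp
  qed
  define a b' c where "a = \<nu> + \<alpha> + \<beta> + 1" and "b' = \<nu> + \<alpha> + 1" and "c = 2 * \<nu> + \<alpha> + \<beta> + 2"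
  have c1: "c - 1 = 2 * \<nu> + \<alpha> + \<beta> + 1" "a - b' = \<beta>" "c - a - b' = - \<alpha>" by (simp_all add: a_def b'_def c_def)
  have G: "jac_G (c - 1) (a - b') (c - a - b') (- q) = jac_G (2 * \<nu> + \<alpha> + \<beta> + 1) \<alpha> \<beta> q"
    unfolding c1 jac_G_minus jac_G_swap ..
  have k: "koebe_fac a b' c (- q) = exp ((2 * \<nu> + 2 * \<alpha> + \<beta> + 3/2) * (L + \<i> * z + v) + (- \<alpha> - 1/2) * (L + \<i> * z + u))"
    unfolding koebe_fac_def lnq by (simp add: a_def b'_def c_def algebra_simps)
  have "conn_f a b' c t = exp (- a * (2 * v)) * (rGamma c * koebe_fac a b' c (- q) * jac_G (c - 1) (a - b')
      (c - a - b') (- q))"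
  proof -
    have lc: "c - 1 \<notin> neg_ints" unfolding c1(1) by (rule l)
    show ?thesis unfolding conn_f_def lnt x hyp_F_koebe[OF lc nq] ..
  qed
  also have "\<dots> = rGamma c * (exp (- a * (2 * v)) *
     exp ((2 * \<nu> + 2 * \<alpha> + \<beta> + 3/2) * (L + \<i> * z + v) + (- \<alpha> - 1/2) * (L + \<i> * z + u))) * jac_G (2 * \<nu> + \<alpha> + \<beta> + 1) \<alpha> \<beta> q"
    unfolding k G by (simp only: mult_ac)
  also have "exp (- a * (2 * v)) * exp ((2 * \<nu> + 2 * \<alpha> + \<beta> + 3/2) * (L + \<i> * z + v) + (- \<alpha> - 1/2) * (L + \<i> * z + u))
     = exp ((2 * \<nu> + \<alpha> + \<beta>) * L + L) * exp (- (\<alpha> + 1/2) * u - (\<beta> + 1/2) * v + \<i> * (2 * \<nu> + \<alpha> + \<beta> + 1) * z)"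
    unfolding exp_add[symmetric] by (rule arg_cong[where f = exp]) (simp add: a_def field_simps)
  also have "exp ((2 * \<nu> + \<alpha> + \<beta>) * L + L) = 2 * 2 powr (2 * \<nu> + \<alpha> + \<beta>)"
    unfolding exp_add L by (simp add: powr_def L_def)
  finally have F: "conn_f a b' c t = rGamma c * (2 * 2 powr (2 * \<nu> + \<alpha> + \<beta>) *
     exp (- (\<alpha> + 1/2) * u - (\<beta> + 1/2) * v + \<i> * (2 * \<nu> + \<alpha> + \<beta> + 1) * z)) * jac_G (2 * \<nu> + \<alpha> + \<beta> + 1) \<alpha> \<beta> q" .
  have B: "Beta (\<nu> + \<alpha> + 1) (\<nu> + \<beta> + 1) = Gamma (\<nu> + \<alpha> + 1) * Gamma (\<nu> + \<beta> + 1) * rGamma c"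
    unfolding Beta_eq_rGamma c_def by (simp add: algebra_simps)
  have "jacobi_Q \<nu> \<alpha> \<beta> w = jac_scale \<nu> \<alpha> \<beta> *
    exp (- (\<alpha> + 1/2) * u - (\<beta> + 1/2) * v + \<i> * (2 * \<nu> + \<alpha> + \<beta> + 1) * z) * jac_G (2 * \<nu> + \<alpha> + \<beta> + 1) \<alpha> \<beta> q"
    using jacobi_Q_eq_jac_G[OF z(2,3) l] unfolding z(1) u_def v_def S_def q_def .
  also have "\<dots> = 1/2 * (Gamma (\<nu> + \<alpha> + 1) * Gamma (\<nu> + \<beta> + 1)) * conn_f a b' c t"
    unfolding B F by simp
  finally show ?thesis unfolding a_def b'_def c_def t_def .
qed

text \<open>A boundary value taken from inside the disc; it is meaningful where
  \<open>jac_bounded_near\<close> holds, by \<open>jac_G_boundary_limit_exists\<close>.\<close>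

definition jac_Gb :: "complex \<Rightarrow> complex \<Rightarrow> complex \<Rightarrow> complex \<Rightarrow> complex" where
  "jac_Gb l \<alpha> \<beta> q = Lim (at q within ball 0 1) (jac_G l \<alpha> \<beta>)"

definition jac_bounded_near :: "complex \<Rightarrow> complex \<Rightarrow> complex \<Rightarrow> complex \<Rightarrow> bool" where
  "jac_bounded_near l \<alpha> \<beta> q0 \<longleftrightarrow>
     (\<exists>d>0. \<exists>C. \<forall>q. norm q < 1 \<longrightarrow> dist q0 q < d \<longrightarrow> norm (jac_G l \<alpha> \<beta> q) \<le> C)"

lemma at_within_ball_nontrivial:
  assumes "norm (q0::complex) = 1" shows "at q0 within ball 0 1 \<noteq> bot"
proof -
  have "q0 \<in> closure (ball 0 1)" using assms by (simp add: closure_ball)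
  moreover have "q0 \<notin> ball 0 1" using assms by simp
  ultimately have "q0 islimpt ball 0 1" unfolding closure_def by blast
  thus ?thesis by (simp add: trivial_limit_within)
qed

lemma jac_G_tendsto_jac_Gb:
  assumes "l \<notin> neg_ints" "norm q0 = 1" "q0 \<noteq> 1" "q0 \<noteq> -1" "jac_bounded_near l \<alpha> \<beta> q0"
  shows "(jac_G l \<alpha> \<beta> \<longlongrightarrow> jac_Gb l \<alpha> \<beta> q0) (at q0 within ball 0 1)"
proof -
  obtain d C where d: "d > 0" "\<And>q. norm q < 1 \<Longrightarrow> dist q0 q < d \<Longrightarrow> norm (jac_G l \<alpha> \<beta> q) \<le> C"
    using assms(5) unfolding jac_bounded_near_def by blast
  obtain L where L: "(jac_G l \<alpha> \<beta> \<longlongrightarrow> L) (at q0 within ball 0 1)"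
    using jac_G_boundary_limit_exists[OF assms(1-4) d] by blast
  moreover have "jac_Gb l \<alpha> \<beta> q0 = L"
    unfolding jac_Gb_def by (rule tendsto_Lim[OF at_within_ball_nontrivial[OF assms(2)] L])
  ultimately show ?thesis by simp
qed

text \<open>The side s = 1 is the upper side of the cut; it corresponds to z = -\<zeta> and so to
  the lower semicircle.\<close>

abbreviation (input) cut_point :: "real \<Rightarrow> real \<Rightarrow> complex" where
  "cut_point s \<zeta> \<equiv> exp (2 * \<i> * (- of_real s * of_real \<zeta>))"

text \<open>This is \<open>jacobi_Q_eq_jac_G\<close> continued to z = -s \<zeta>, where -i sin z = s
  i sin \<zeta> contributes the phase s pi/2.\<close>

definition jacobi_Q_bdry :: "complex \<Rightarrow> complex \<Rightarrow> complex \<Rightarrow> real \<Rightarrow> real \<Rightarrow> complex" where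
  "jacobi_Q_bdry \<nu> \<alpha> \<beta> \<zeta> s = jac_scale \<nu> \<alpha> \<beta> *
     exp (- (\<alpha> + 1/2) * (of_real (ln (sin \<zeta>)) + of_real s * \<i> * of_real (pi / 2)) - (\<beta> + 1/2) * of_real (ln (cos \<zeta>))
        + \<i> * (2 * \<nu> + \<alpha> + \<beta> + 1) * (- of_real s * of_real \<zeta>)) *
     jac_Gb (2 * \<nu> + \<alpha> + \<beta> + 1) \<alpha> \<beta> (cut_point s \<zeta>)"

lemma exp_2i_zeta_neq:
  assumes \<zeta>: "0 < \<zeta>" "\<zeta> < pi / 2" and s: "s = 1 \<or> s = -1"
  defines "q0 \<equiv> cut_point s \<zeta>"
  shows "norm q0 = 1" "q0 \<noteq> 1" "q0 \<noteq> -1"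
proof -
  show "norm q0 = 1" by (simp add: q0_def)
  have "Im q0 = - s * sin (2 * \<zeta>)" using s by (auto simp: q0_def Im_exp)
  moreover have "sin (2 * \<zeta>) > 0" using \<zeta> by (intro sin_gt_zero) auto
  ultimately have "Im q0 \<noteq> 0" using s by auto
  thus "q0 \<noteq> 1" "q0 \<noteq> -1" by auto
qed

lemma jacobi_Q_tendsto_bdry:
  assumes \<zeta>: "0 < \<zeta>" "\<zeta> < pi / 2" and s: "s = 1 \<or> s = -1" and l: "2 * \<nu> + \<alpha> + \<beta> + 1 \<notin> neg_ints"
    and bd: "jac_bounded_near (2 * \<nu> + \<alpha> + \<beta> + 1) \<alpha> \<beta> (cut_point s \<zeta>)"
  shows "((\<lambda>\<eta>::real. jacobi_Q \<nu> \<alpha> \<beta> (of_real (cos (2 * \<zeta>)) + of_real s * \<i> * of_real \<eta>))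
     \<longlongrightarrow> jacobi_Q_bdry \<nu> \<alpha> \<beta> \<zeta> s) (at_right 0)"
proof -
  let ?l = "2 * \<nu> + \<alpha> + \<beta> + 1"
  let ?w = "\<lambda>\<eta>::real. of_real (cos (2 * \<zeta>)) + of_real s * \<i> * of_real \<eta> :: complex"
  define x where "x = cos (2 * \<zeta>)"
  have x: "\<bar>x\<bar> < 1"
  proof -
    have "cos (2 * \<zeta>) < cos 0" "cos pi < cos (2 * \<zeta>)" using \<zeta> by (intro cos_monotone_0_pi; simp)+
    thus ?thesis by (auto simp: x_def)
  qed
  define z0 where "z0 = (- of_real s * of_real \<zeta> :: complex)"
  define q0 where "q0 = exp (2 * \<i> * z0)"
  have "Arccos (of_real x) = of_real (arccos x)" using x by (intro of_real_arccos[symmetric]) auto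
  also have "arccos x = 2 * \<zeta>" unfolding x_def using \<zeta> by (intro arccos_cos) auto
  finally have A: "Arccos (of_real x) = 2 * of_real \<zeta>" by simp
  have lw: "(?w \<longlongrightarrow> of_real x + of_real s * \<i> * of_real 0) (at_right 0)" unfolding x_def by (intro tendsto_intros)
  have "isCont Arccos (of_real x)" by (rule isCont_Arccos) (use x in auto)
  hence "isCont (cut_preimage s) (of_real x)" unfolding cut_preimage_def[abs_def] by (intro continuous_intros) auto
  from isCont_tendsto_compose[OF this] lw
  have lz: "((\<lambda>\<eta>. cut_preimage s (?w \<eta>)) \<longlongrightarrow> z0) (at_right 0)"
    by (simp add: cut_preimage_def A z0_def)
  have ev: "eventually (\<lambda>\<eta>. cos (2 * cut_preimage s (?w \<eta>)) = ?w \<eta> \<and> Im (cut_preimage s (?w \<eta>)) > 0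
      \<and> \<bar>Re (cut_preimage s (?w \<eta>))\<bar> < pi / 2) (at_right 0)"
    unfolding eventually_at_right_field
  proof (intro exI[of _ 1] conjI allI impI)
    fix \<eta> :: real assume \<eta>: "0 < \<eta>"
    have "\<bar>Re (?w \<eta>)\<bar> < 1" "s * Im (?w \<eta>) > 0" using x s \<eta> by (auto simp: x_def)
    note c = cut_preimage[OF this s]
    show "cos (2 * cut_preimage s (?w \<eta>)) = ?w \<eta>" "Im (cut_preimage s (?w \<eta>)) > 0" "\<bar>Re (cut_preimage s (?w \<eta>))\<bar> < pi / 2"
      by (rule c)+
  qed simp
  have q0: "norm q0 = 1" "q0 \<noteq> 1" "q0 \<noteq> -1" unfolding q0_def z0_def by (rule exp_2i_zeta_neq[OF \<zeta> s])+
  have lG: "((\<lambda>\<eta>. jac_G ?l \<alpha> \<beta> (exp (2 * \<i> * cut_preimage s (?w \<eta>)))) \<longlongrightarrow> jac_Gb ?l \<alpha> \<beta> q0) (at_right 0)"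
  proof (rule filterlim_compose[OF jac_G_tendsto_jac_Gb[OF l q0]])
    show "jac_bounded_near ?l \<alpha> \<beta> q0" using bd unfolding q0_def z0_def .
    show "filterlim (\<lambda>\<eta>. exp (2 * \<i> * cut_preimage s (?w \<eta>))) (at q0 within ball 0 1) (at_right 0)"
      unfolding filterlim_at
    proof
      show "((\<lambda>\<eta>. exp (2 * \<i> * cut_preimage s (?w \<eta>))) \<longlongrightarrow> q0) (at_right 0)"
        unfolding q0_def by (intro tendsto_intros lz)
      show "eventually (\<lambda>\<eta>. exp (2 * \<i> * cut_preimage s (?w \<eta>)) \<in> ball 0 1 \<and> exp (2 * \<i> * cut_preimage s
          (?w \<eta>)) \<noteq> q0) (at_right 0)"
        using ev
      proof eventually_elim
        case (elim \<eta>)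
        hence "norm (exp (2 * \<i> * cut_preimage s (?w \<eta>))) < 1" by simp
        thus ?case using q0(1) by auto
      qed
    qed
  qed
  define \<Phi> where "\<Phi> = (\<lambda>z. exp (- (\<alpha> + 1/2) * Ln (- \<i> * sin z) - (\<beta> + 1/2) * Ln (cos z) + \<i> * ?l * z))"
  have sc: "sin \<zeta> > 0" "cos \<zeta> > 0" using \<zeta> by (auto intro: sin_gt_zero cos_gt_zero_pi)
  have s0: "- \<i> * sin z0 = of_real s * \<i> * of_real (sin \<zeta>)" "cos z0 = of_real (cos \<zeta>)"
    using s by (auto simp: z0_def simp flip: sin_of_real cos_of_real)
  have Ls: "Ln (- \<i> * sin z0) = of_real (ln (sin \<zeta>)) + of_real s * \<i> * of_real (pi / 2)"
  proof -
    have "exp (of_real (ln (sin \<zeta>)) + of_real s * \<i> * of_real (pi / 2)) = complex_of_real (sin \<zeta>) * exp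
        (of_real s * \<i> * of_real (pi / 2))"
      unfolding exp_add using sc by (simp add: exp_of_real)
    also have "exp (of_real s * \<i> * of_real (pi / 2)) = of_real s * \<i>"
      using s by (auto simp: exp_eq_polar exp_minus cis_conv_exp[symmetric] complex_eq_iff Re_exp Im_exp)
    finally have e: "- \<i> * sin z0 = exp (of_real (ln (sin \<zeta>)) + of_real s * \<i> * of_real (pi / 2))"
      unfolding s0 by simp
    show ?thesis unfolding e by (rule Ln_exp) (use s in auto)
  qed
  have Lc: "Ln (cos z0) = of_real (ln (cos \<zeta>))" unfolding s0 using sc by (simp add: Ln_of_real)
  have "isCont \<Phi> z0" unfolding \<Phi>_def
  proof (intro continuous_intros)
    show "- \<i> * sin z0 \<notin> \<real>\<^sub>\<le>\<^sub>0" "cos z0 \<notin> \<real>\<^sub>\<le>\<^sub>0"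
      unfolding s0 using s sc by (auto simp: complex_nonpos_Reals_iff)
  qed
  from isCont_tendsto_compose[OF this lz]
  have l\<Phi>: "((\<lambda>\<eta>. \<Phi> (cut_preimage s (?w \<eta>))) \<longlongrightarrow> \<Phi> z0) (at_right 0)" .
  have "((\<lambda>\<eta>. jac_scale \<nu> \<alpha> \<beta> * \<Phi> (cut_preimage s (?w \<eta>)) *
      jac_G ?l \<alpha> \<beta> (exp (2 * \<i> * cut_preimage s (?w \<eta>)))) \<longlongrightarrow>
      jac_scale \<nu> \<alpha> \<beta> * \<Phi> z0 * jac_Gb ?l \<alpha> \<beta> q0) (at_right 0)"
    by (intro tendsto_mult tendsto_const l\<Phi> lG)
  moreover have "eventually (\<lambda>\<eta>. jac_scale \<nu> \<alpha> \<beta> * \<Phi> (cut_preimage s (?w \<eta>)) *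
      jac_G ?l \<alpha> \<beta> (exp (2 * \<i> * cut_preimage s (?w \<eta>))) = jacobi_Q \<nu> \<alpha> \<beta> (?w \<eta>)) (at_right 0)"
    using ev
  proof eventually_elim
    case (elim \<eta>)
    thus ?case using jacobi_Q_eq_jac_G[of "cut_preimage s (?w \<eta>)" \<nu> \<alpha> \<beta>] l unfolding \<Phi>_def by simp
  qed
  moreover have "jac_scale \<nu> \<alpha> \<beta> * \<Phi> z0 * jac_Gb ?l \<alpha> \<beta> q0 = jacobi_Q_bdry \<nu> \<alpha> \<beta> \<zeta> s"
    unfolding jacobi_Q_bdry_def \<Phi>_def Ls Lc unfolding q0_def z0_def ..
  ultimately show ?thesis by (auto dest: Lim_transform_eventually)
qed

text \<open>Dividing by s i turns the approach to the negative axis into an approach to s i t0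
  through the right half-plane, where \<open>Ln\<close> is continuous; the quarter turn then adds s
  i pi/2.\<close>

lemma Ln_tendsto_negative_axis:
  assumes t0: "t0 > 0" and s: "s = 1 \<or> s = -1"
  shows "((\<lambda>\<eta>::real. Ln (- of_real t0 + of_real s * \<i> * of_real \<eta> / 2)) \<longlongrightarrow>
     of_real (ln t0) + of_real s * \<i> * of_real pi) (at_right 0)"
proof -
  define u where "u = (\<lambda>\<eta>::real. of_real s * \<i> * of_real t0 + of_real \<eta> / 2 :: complex)"
  have lu: "(u \<longlongrightarrow> of_real s * \<i> * of_real t0 + of_real 0 / 2) (at_right 0)"
    unfolding u_def by (intro tendsto_intros) auto
  have es: "exp (of_real s * \<i> * of_real (pi / 2)) = of_real s * \<i>"
    using s by (auto simp: complex_eq_iff Re_exp Im_exp)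
  have L0: "Ln (of_real s * \<i> * of_real t0) = of_real (ln t0) + of_real s * \<i> * of_real (pi / 2)"
  proof -
    have e: "of_real s * \<i> * of_real t0 = exp (of_real (ln t0) + of_real s * \<i> * of_real (pi / 2))"
      unfolding exp_add es using t0 by (simp add: exp_of_real)
    show ?thesis unfolding e by (rule Ln_exp) (use s in auto)
  qed
  have "isCont Ln (of_real s * \<i> * of_real t0)"
    by (rule continuous_at_Ln) (use s t0 in \<open>auto simp: complex_nonpos_Reals_iff\<close>)
  from isCont_tendsto_compose[OF this] lu
  have "((\<lambda>\<eta>. Ln (u \<eta>) + of_real s * \<i> * of_real (pi / 2)) \<longlongrightarrow>
     (of_real (ln t0) + of_real s * \<i> * of_real (pi / 2)) + of_real s * \<i> * of_real (pi / 2)) (at_right 0)"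
    unfolding L0[symmetric] by (intro tendsto_add tendsto_const) simp
  moreover have "eventually (\<lambda>\<eta>. Ln (u \<eta>) + of_real s * \<i> * of_real (pi / 2) = Ln (- of_real t0 + of_real s
      * \<i> * of_real \<eta> / 2)) (at_right 0)"
    unfolding eventually_at_right_field
  proof (intro exI[of _ 1] conjI allI impI)
    fix \<eta> :: real assume \<eta>: "0 < \<eta>"
    have "Re (u \<eta>) > 0" using \<eta> by (simp add: u_def)
    hence b: "\<bar>Im (Ln (u \<eta>))\<bar> < pi / 2" "u \<eta> \<noteq> 0" using Im_Ln_right_half by auto
    have "- of_real t0 + of_real s * \<i> * of_real \<eta> / 2 = exp (Ln (u \<eta>)) * exp (of_real s * \<i> * of_real (pi / 2))"
      unfolding es exp_Ln[OF b(2)] using s by (auto simp: u_def algebra_simps)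
    hence e: "- of_real t0 + of_real s * \<i> * of_real \<eta> / 2 = exp (Ln (u \<eta>) + of_real s * \<i> * of_real (pi / 2))"
      by (simp only: exp_add)
    show "Ln (u \<eta>) + of_real s * \<i> * of_real (pi / 2) = Ln (- of_real t0 + of_real s * \<i> * of_real \<eta> / 2)"
      unfolding e by (rule Ln_exp[symmetric]) (use s b in auto)
  qed simp
  ultimately have "((\<lambda>\<eta>. Ln (- of_real t0 + of_real s * \<i> * of_real \<eta> / 2)) \<longlongrightarrow>
     (of_real (ln t0) + of_real s * \<i> * of_real (pi / 2)) + of_real s * \<i> * of_real (pi / 2)) (at_right 0)"
    by (rule Lim_transform_eventually)
  thus ?thesis by (simp add: algebra_simps)
qed

lemma hyp_F_series_commute: "hyp_F_series a b c = hyp_F_series b a c"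
  by (simp add: hyp_F_series_def fun_eq_iff mult.commute)

text \<open>Across the cut \<open>conn_1\<close> is continuous, while \<open>conn_2\<close> acquires
  e^(-i pi \<alpha>) from above and e^(i pi \<alpha>) from below; the weights equalise these phases.
  What remains is the \<open>conn_1\<close> part times 2 i sin (pi \<alpha>), and the sine cancels
  the one in \<open>conn_A\<close>, leaving the series of \<open>jacobi_P\<close>.\<close>

lemma jacobi_P_eq_bdry:
  assumes \<zeta>: "0 < \<zeta>" "\<zeta> < pi / 2" and l: "2 * \<nu> + \<alpha> + \<beta> + 1 \<notin> neg_ints"
    and bd: "\<And>s. s = 1 \<or> s = -1 \<Longrightarrow> jac_bounded_near (2 * \<nu> + \<alpha> + \<beta> + 1) \<alpha> \<beta> (cut_point s \<zeta>)"
    and \<alpha>: "\<alpha> \<notin> \<int>" and b: "\<nu> + \<beta> + 1 \<notin> \<int>\<^sub>\<le>\<^sub>0"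
    and conn: "conn_holds (\<nu> + \<alpha> + \<beta> + 1) (\<nu> + \<alpha> + 1) (2 * \<nu> + \<alpha> + \<beta> + 2)"
  shows "exp (\<i> * of_real pi * \<alpha>) * jacobi_Q_bdry \<nu> \<alpha> \<beta> \<zeta> 1 - exp (- (\<i> * of_real pi * \<alpha>)) * jacobi_Q_bdry \<nu> \<alpha> \<beta> \<zeta> (-1)
     = - (\<i> * of_real pi) * jacobi_P \<nu> \<alpha> \<beta> (of_real (cos (2 * \<zeta>)))"
proof -
  define a b' c where "a = \<nu> + \<alpha> + \<beta> + 1" and "b' = \<nu> + \<alpha> + 1" and "c = 2 * \<nu> + \<alpha> + \<beta> + 2"
  have cab: "c - a - b' = - \<alpha>" "a + b' - c = \<alpha>" "c - a = \<nu> + 1" "c - b' = \<nu> + \<beta> + 1" "a - c + 1 = - \<nu>" "a +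
      b' - c + 1 = \<alpha> + 1"
    by (simp_all add: a_def b'_def c_def)
  define KK where "KK = 1/2 * (Gamma (\<nu> + \<alpha> + 1) * Gamma (\<nu> + \<beta> + 1))"
  obtain B where B: "\<And>t. norm t < 1 \<Longrightarrow> - t \<notin> \<real>\<^sub>\<le>\<^sub>0 \<Longrightarrow> conn_f a b' c t = conn_A a b' c * conn_1 a b' c t + B * conn_2 a b' c t"
    using conn_formula[OF conn] unfolding a_def b'_def c_def by blast
  define x where "x = cos (2 * \<zeta>)"
  have x: "\<bar>x\<bar> < 1"
  proof -
    have "cos (2 * \<zeta>) < cos 0" "cos pi < cos (2 * \<zeta>)" using \<zeta> by (intro cos_monotone_0_pi; simp)+
    thus ?thesis by (auto simp: x_def)
  qed
  define t0 where "t0 = (1 - x) / 2"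
  have t0: "0 < t0" "t0 < 1" using x by (auto simp: t0_def)
  have n0: "complex_of_real t0 \<in> ball 0 1" using t0 by simp
  define g2 where "g2 = hyp_F_series (c - b') (1 - b') (c - a - b' + 1)"
  have isC: "isCont (hyp_F_series p q r) (of_real t0)" for p q r
    using holomorphic_on_imp_continuous_on[OF hyp_F_series_holomorphic] n0
      continuous_on_eq_continuous_at[OF open_ball] by blast
  have ic: "isCont (conn_1 a b' c) (of_real t0)" "isCont g2 (of_real t0)"
    unfolding conn_1_def[abs_def] g2_def by (rule isC)+
  have lim: "KK * (conn_A a b' c * conn_1 a b' c (of_real t0) + B *
      (exp (- \<alpha> * (of_real (ln t0) + of_real s * \<i> * of_real pi)) * g2 (of_real t0)))
      = jacobi_Q_bdry \<nu> \<alpha> \<beta> \<zeta> s" if s: "s = 1 \<or> s = -1" for s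
  proof -
    define T where "T = (\<lambda>\<eta>::real. of_real t0 - of_real s * \<i> * of_real \<eta> / 2 :: complex)"
    have "(T \<longlongrightarrow> of_real t0 - of_real s * \<i> * of_real 0 / 2) (at_right 0)" unfolding T_def by (intro tendsto_intros) auto
    hence lT: "(T \<longlongrightarrow> of_real t0) (at_right 0)" by simp
    have mT: "- T \<eta> = - of_real t0 + of_real s * \<i> * of_real \<eta> / 2" for \<eta> by (simp add: T_def)
    have "((\<lambda>\<eta>. conn_2 a b' c (T \<eta>)) \<longlongrightarrow> exp (- \<alpha> * (of_real (ln t0) + of_real s * \<i> * of_real pi)) * g2
        (of_real t0)) (at_right 0)"
      unfolding conn_2_def cab(1) g2_def[unfolded cab(1), symmetric] mT
      by (intro tendsto_mult tendsto_exp tendsto_const Ln_tendsto_negative_axis t0 s isCont_tendsto_compose[OF ic(2) lT])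
    hence "((\<lambda>\<eta>. KK * (conn_A a b' c * conn_1 a b' c (T \<eta>) + B * conn_2 a b' c (T \<eta>))) \<longlongrightarrow>
      KK * (conn_A a b' c * conn_1 a b' c (of_real t0) + B * (exp (- \<alpha> * (of_real (ln t0) + of_real s * \<i> *
          of_real pi)) * g2 (of_real t0)))) (at_right 0)"
      by (intro tendsto_mult tendsto_add tendsto_const isCont_tendsto_compose[OF ic(1) lT])
    moreover have "eventually (\<lambda>\<eta>. KK * (conn_A a b' c * conn_1 a b' c (T \<eta>) + B * conn_2 a b' c (T \<eta>))
        = jacobi_Q \<nu> \<alpha> \<beta> (of_real x + of_real s * \<i> * of_real \<eta>)) (at_right 0)"
    proof -
      have "eventually (\<lambda>\<eta>. norm (T \<eta>) < 1) (at_right 0)"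
        using order_tendstoD(2)[OF tendsto_norm[OF lT], of 1] t0 by simp
      moreover have "eventually (\<lambda>\<eta>::real. \<eta> > 0) (at_right 0)" by (rule eventually_at_right_less)
      ultimately show ?thesis
      proof eventually_elim
        case (elim \<eta>)
        let ?w = "of_real x + of_real s * \<i> * of_real \<eta> :: complex"
        have "- T \<eta> \<notin> \<real>\<^sub>\<le>\<^sub>0" using elim(2) s by (auto simp: T_def complex_nonpos_Reals_iff)
        from B[OF elim(1) this] have 1: "conn_f a b' c (T \<eta>) = conn_A a b' c * conn_1 a b' c (T \<eta>) + B *
            conn_2 a b' c (T \<eta>)" .
        have 2: "T \<eta> = (1 - ?w) / 2" by (simp add: T_def t0_def field_simps)
        have "\<bar>Re ?w\<bar> < 1" "Im ?w \<noteq> 0" using x elim(2) s by auto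
        from jacobi_Q_eq_conn_f[OF this l] show ?case
          unfolding 1[symmetric] unfolding 2 KK_def a_def b'_def c_def by simp
      qed
    qed
    ultimately have "((\<lambda>\<eta>. jacobi_Q \<nu> \<alpha> \<beta> (of_real x + of_real s * \<i> * of_real \<eta>)) \<longlongrightarrow>
       KK * (conn_A a b' c * conn_1 a b' c (of_real t0) + B * (exp (- \<alpha> * (of_real (ln t0) + of_real s * \<i> *
           of_real pi)) * g2 (of_real t0)))) (at_right 0)"
      by (rule Lim_transform_eventually)
    from tendsto_unique[OF _ this jacobi_Q_tendsto_bdry[OF \<zeta> s l bd[OF s], folded x_def]] show ?thesis by simp
  qed
  define E where "E = exp (- \<alpha> * of_real (ln t0))"
  define e1 e2 where "e1 = exp (\<i> * of_real pi * \<alpha>)" and "e2 = exp (- (\<i> * of_real pi * \<alpha>))"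
  have x1: "exp (- \<alpha> * (of_real (ln t0) + of_real 1 * \<i> * of_real pi)) = E * e2"
    "exp (- \<alpha> * (of_real (ln t0) + of_real (-1) * \<i> * of_real pi)) = E * e1"
    unfolding E_def e1_def e2_def exp_add[symmetric] by (rule arg_cong[where f = exp]; simp add: algebra_simps)+
  \<comment> \<open>Both sides carry the coefficient B with the same product of phases, so it drops
    out of the difference.\<close>
  have g: "e1 * (k * (A * p + B * (E * e2 * g))) - e2 * (k * (A * p + B * (E * e1 * g))) = k * A * p * (e1 - e2)"
    for k A p g :: complex by (simp add: algebra_simps)
  have "e1 * jacobi_Q_bdry \<nu> \<alpha> \<beta> \<zeta> 1 - e2 * jacobi_Q_bdry \<nu> \<alpha> \<beta> \<zeta> (-1) = KK * conn_A a b' c * conn_1 a b' c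
      (of_real t0) * (e1 - e2)"
    unfolding lim[of 1, simplified, symmetric] lim[of "-1", simplified, symmetric]
    using x1 g[of KK "conn_A a b' c" "conn_1 a b' c (of_real t0)" "g2 (of_real t0)"] by simp
  also have "e1 - e2 = 2 * \<i> * sin (of_real pi * \<alpha>)"
    unfolding e1_def e2_def sin_exp_eq by (simp add: mult_ac)
  also have "KK * conn_A a b' c * conn_1 a b' c (of_real t0) * (2 * \<i> * sin (of_real pi * \<alpha>)) =
     - (\<i> * of_real pi) * (Gamma (\<nu> + \<alpha> + 1) * rGamma (\<nu> + 1) * conn_1 a b' c (of_real t0))"
  proof -
    have "sin (of_real pi * \<alpha>) \<noteq> 0"
    proof
      assume "sin (of_real pi * \<alpha>) = 0"
      then obtain n :: int where "of_real pi * \<alpha> = complex_of_real (of_int n * pi)" by (auto simp: sin_eq_0)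
      hence "\<alpha> = of_int n" by simp
      thus False using \<alpha> by simp
    qed
    moreover have "Gamma (\<nu> + \<beta> + 1) * rGamma (\<nu> + \<beta> + 1) = 1" using b by (simp add: rGamma_inverse_Gamma
        Gamma_eq_zero_iff)
    moreover have "(1/2 * (G1 * G2)) * (- pp / S * r1 * r2) * p * (2 * \<i> * S) = - (\<i> * pp) * (G1 * r1 * p) * (G2 * r2)"
      if "S \<noteq> 0" for G1 G2 pp S r1 r2 p :: complex using that by (simp add: field_simps)
    ultimately show ?thesis unfolding KK_def conn_A_def cab by simp
  qed
  also have "conn_1 a b' c (of_real t0) = hyp_F (- \<nu>) (\<nu> + \<alpha> + \<beta> + 1) (\<alpha> + 1) ((1 - of_real x) / 2)"
  proof -
    have "(1 - of_real x) / 2 = complex_of_real t0" by (simp add: t0_def)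
    moreover have "hyp_F (- \<nu>) (\<nu> + \<alpha> + \<beta> + 1) (\<alpha> + 1) (of_real t0) = hyp_F_series (- \<nu>) (\<nu> + \<alpha> + \<beta> + 1)
        (\<alpha> + 1) (of_real t0)"
      by (rule hyp_F_eq_series) (use n0 in simp)
    ultimately show ?thesis unfolding conn_1_def cab hyp_F_series_commute[of a] by (simp add: a_def)
  qed
  finally show ?thesis unfolding e1_def e2_def jacobi_P_def x_def .
qed

section \<open>Continuity of the hypergeometric series in its parameters\<close>

lemma norm_pochhammer_le: "norm (pochhammer (z::complex) n) \<le> pochhammer (norm z) n"
  unfolding pochhammer_prod prod_norm[symmetric]
proof (rule prod_mono)
  fix i :: nat
  show "0 \<le> norm (z + of_nat i) \<and> norm (z + of_nat i) \<le> norm z + of_nat i"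
    using norm_triangle_ineq[of z "of_nat i"] by simp
qed

lemma pochhammer_mono_real:
  assumes "0 \<le> (x::real)" "x \<le> y" shows "pochhammer x n \<le> pochhammer y n"
  unfolding pochhammer_prod by (intro prod_mono) (use assms in auto)

lemma tendsto_pochhammer:
  fixes f :: "'b \<Rightarrow> complex"
  assumes "(f \<longlongrightarrow> a) F" shows "((\<lambda>x. pochhammer (f x) n) \<longlongrightarrow> pochhammer a n) F"
  unfolding pochhammer_prod by (intro tendsto_intros assms)

text \<open>Dominated convergence for series. Regularisation makes every term continuous in c,
  including at the nonpositive integers that integer \<alpha> can produce.\<close>

lemma tendsto_hyp_F_series_params:
  assumes f: "(f \<longlongrightarrow> b) F" and g: "(g \<longlongrightarrow> c) F" and t: "norm t < 1" and F: "F \<noteq> bot"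
  shows "((\<lambda>x. hyp_F_series a (f x) (g x) t) \<longlongrightarrow> hyp_F_series a b c t) F"
proof -
  define Bd where "Bd = norm b + 1"
  define Cd where "Cd = norm c + 1"
  \<comment> \<open>Adding n0 moves every lower parameter in play into Re \<ge> 1, where the
    Pochhammer symbol of length k is at least k! in modulus.\<close>
  obtain n0 where n0: "real n0 \<ge> Cd + 1" using real_arch_simple by blast
  have evf: "eventually (\<lambda>x. norm (f x) \<le> Bd) F"
    using order_tendstoD(2)[OF tendsto_norm[OF f], of Bd] by (auto simp: Bd_def elim: eventually_mono)
  have evg: "eventually (\<lambda>x. norm (g x) \<le> Cd) F"
    using order_tendstoD(2)[OF tendsto_norm[OF g], of Cd] by (auto simp: Cd_def elim: eventually_mono)
  have "bounded ((\<lambda>z. rGamma (z + of_nat n0 :: complex)) ` cball 0 Cd)"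
    by (intro compact_imp_bounded compact_continuous_image
        continuous_on_compose2[OF continuous_on_rGamma[of UNIV]] continuous_intros) auto
  then obtain K where K: "\<forall>z\<in>cball 0 Cd. norm (rGamma (z + of_nat n0 :: complex)) \<le> K"
    unfolding bounded_iff by blast
  have rG: "norm (rGamma (z + of_nat (n0 + k))) \<le> K / fact k" if z: "norm z \<le> Cd" for z :: complex and k
  proof -
    let ?w = "z + of_nat n0"
    have "Re z \<ge> - Cd" using abs_Re_le_cmod[of z] z by linarith
    hence re: "Re ?w \<ge> 1" using n0 by simp
    have "norm (of_nat (Suc i) :: complex) \<le> norm (?w + of_nat i)" for i
    proof -
      have "real (Suc i) \<le> Re (?w + of_nat i)" using re by simp
      also have "\<dots> \<le> norm (?w + of_nat i)" by (rule complex_Re_le_cmod)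
      finally show ?thesis by (simp only: norm_of_nat)
    qed
    hence "(\<Prod>i=0..<k. norm (of_nat (Suc i) :: complex)) \<le> (\<Prod>i=0..<k. norm (?w + of_nat i))"
      by (intro prod_mono) simp
    also have "(\<Prod>i=0..<k. norm (of_nat (Suc i) :: complex)) = fact k"
      unfolding norm_of_nat by (simp add: fact_prod_Suc)
    finally have p: "fact k \<le> norm (pochhammer ?w k)" unfolding pochhammer_prod prod_norm by simp
    have "rGamma ?w = pochhammer ?w k * rGamma (?w + of_nat k)" using pochhammer_rGamma[of ?w k] by simp
    hence "norm (pochhammer ?w k) * norm (rGamma (?w + of_nat k)) = norm (rGamma ?w)" by (simp add: norm_mult)
    moreover have "fact k * norm (rGamma (?w + of_nat k)) \<le> norm (pochhammer ?w k) * norm (rGamma (?w + of_nat k))"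
      by (intro mult_right_mono p) simp
    moreover have "norm (rGamma ?w) \<le> K" using K z by simp
    ultimately have "fact k * norm (rGamma (?w + of_nat k)) \<le> K" by linarith
    hence "norm (rGamma (?w + of_nat k)) \<le> K / fact k" by (simp add: field_simps)
    thus ?thesis by (simp add: add.assoc)
  qed
  define A where "A = complex_of_real (norm a)"
  \<comment> \<open>The majorant is itself a hypergeometric series: with lower parameter 1 - n0 its
    regularising factor at index n0 + k is 1/k!, exactly the decay shown in
    \<open>rG\<close>.\<close>
  define M where "M = (\<lambda>n. K * norm (fps_nth (hyp_fps A (of_real Bd) (1 - of_nat n0)) n * t ^ n))"
  have sM: "summable M" unfolding M_def
    by (intro summable_mult norm_summable_fps norm_lt_conv_radius_hyp t)
  have bnd: "norm (pochhammer a n * pochhammer b' n * rGamma (c' + of_nat n) / fact n * t ^ n) \<le> M n"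
    if "n \<ge> n0" "norm b' \<le> Bd" "norm c' \<le> Cd" for n b' c'
  proof -
    note n = that(1)
    obtain k where k: "n = n0 + k" using le_Suc_ex[OF n] by blast
    have e: "1 - of_nat n0 + of_nat n = (1 + of_nat k :: complex)" by (simp add: k)
    have "rGamma (1 + of_nat k :: complex) = inverse (fact k)" by (simp add: rGamma_inverse_Gamma Gamma_fact)
    hence r: "norm (rGamma (1 - of_nat n0 + of_nat n :: complex)) = 1 / fact k" unfolding e by
        (simp add: norm_inverse divide_inverse)
    have "Bd \<ge> 0" by (simp add: Bd_def)
    have pr: "norm (pochhammer (complex_of_real y) n) = pochhammer y n" if "y \<ge> 0" for y
      using pochhammer_nonneg[of y n] that by (cases "y = 0") (auto simp: pochhammer_of_real pochhammer_0_left)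
    have "norm (pochhammer a n * pochhammer b' n * rGamma (c' + of_nat n) / fact n * t ^ n) =
      norm (pochhammer a n) * norm (pochhammer b' n) * norm (rGamma (c' + of_nat n)) * (norm (t ^ n) / fact n)"
      by (simp add: norm_mult norm_divide)
    also have "\<dots> \<le> pochhammer (norm a) n * pochhammer Bd n * (K / fact k) * (norm (t ^ n) / fact n)"
    proof -
      have A1: "norm (pochhammer a n) \<le> pochhammer (norm a) n" by (rule norm_pochhammer_le)
      have A2: "norm (pochhammer b' n) \<le> pochhammer Bd n"
        by (rule order.trans[OF norm_pochhammer_le pochhammer_mono_real]) (use that in auto)
      have A3: "norm (rGamma (c' + of_nat n)) \<le> K / fact k" using rG[OF that(3), of k] unfolding k .
      have p1: "0 \<le> pochhammer (norm a) n" by (rule order.trans[OF norm_ge_zero A1])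
      have p2: "0 \<le> pochhammer Bd n" by (rule order.trans[OF norm_ge_zero A2])
      have "norm (pochhammer a n) * norm (pochhammer b' n) \<le> pochhammer (norm a) n * pochhammer Bd n"
        by (rule mult_mono[OF A1 A2 p1 norm_ge_zero])
      from mult_mono[OF this A3 mult_nonneg_nonneg[OF p1 p2] norm_ge_zero]
      show ?thesis by (rule mult_right_mono) simp
    qed
    also have "\<dots> = M n"
      unfolding M_def hyp_fps_def fps_nth_Abs_fps norm_mult norm_divide r pr[OF \<open>Bd \<ge> 0\<close>] A_def pr[OF norm_ge_zero]
      by (simp add: mult_ac)
    finally show ?thesis .
  qed
  have ev: "eventually (\<lambda>(n, x). norm (pochhammer a n * pochhammer (f x) n * rGamma (g x + of_nat n) / fact
      n * t ^ n) \<le> M n) (at_top \<times>\<^sub>F F)"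
    unfolding case_prod_beta
  proof (rule eventually_mono[OF eventually_prodI[OF eventually_ge_at_top[of n0] eventually_conj[OF evf evg]]])
    fix p :: "nat \<times> 'a" assume "n0 \<le> fst p \<and> norm (f (snd p)) \<le> Bd \<and> norm (g (snd p)) \<le> Cd"
    thus "norm (pochhammer a (fst p) * pochhammer (f (snd p)) (fst p) * rGamma (g (snd p) + of_nat (fst p))
        / fact (fst p) * t ^ fst p) \<le> M (fst p)"
      by (elim conjE) (rule bnd)
  qed
  have lim: "((\<lambda>x. pochhammer a n * pochhammer (f x) n * rGamma (g x + of_nat n) / fact n * t ^ n) \<longlongrightarrow>
      pochhammer a n * pochhammer b n * rGamma (c + of_nat n) / fact n * t ^ n) F" for n
  proof -
    have "isCont rGamma (c + of_nat n)" using continuous_on_rGamma[of UNIV]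
        continuous_on_eq_continuous_at[OF open_UNIV] by blast
    hence "((\<lambda>x. rGamma (g x + of_nat n)) \<longlongrightarrow> rGamma (c + of_nat n)) F"
      by (rule isCont_tendsto_compose) (intro tendsto_add g tendsto_const)
    thus ?thesis by (intro tendsto_mult tendsto_divide tendsto_const tendsto_pochhammer f) auto
  qed
  from tannerys_theorem[OF lim ev sM F] show ?thesis
    unfolding hyp_F_series_def by (elim conjE)
qed

section \<open>Uniform asymptotics\<close>

text \<open>Turning by minus half the argument splits it evenly: \<omega> and \<nu> \<omega> both
  have argument at most pi/2 - \<delta>/2 in modulus, whence \<kappa> = sin (\<delta>/2). The
  minimum with pi keeps \<kappa> positive for large \<delta>, where the sector is empty.\<close>

lemma sector_rotation:
  assumes "\<delta> > 0"
  shows "\<exists>\<kappa>>0. \<forall>\<nu>. \<bar>Arg \<nu>\<bar> \<le> pi - \<delta> \<longrightarrow> (\<exists>\<omega>. norm \<omega> = 1 \<and> \<kappa> \<le> Re \<omega> \<and> \<kappa> * norm \<nu> \<le> Re (\<nu> * \<omega>))"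
proof (intro exI[of _ "sin (min \<delta> pi / 2)"] conjI allI impI)
  let ?\<kappa> = "sin (min \<delta> pi / 2)"
  show "?\<kappa> > 0" using assms pi_gt_zero by (intro sin_gt_zero) (auto simp: min_def)
  fix \<nu> assume A: "\<bar>Arg \<nu>\<bar> \<le> pi - \<delta>"
  define \<omega> where "\<omega> = cis (- (Arg \<nu> / 2))"
  have "cos (pi / 2 - min \<delta> pi / 2) \<le> cos \<bar>Arg \<nu> / 2\<bar>"
    using A assms by (intro cos_monotone_0_pi_le) (auto simp: min_def)
  hence c: "?\<kappa> \<le> cos (Arg \<nu> / 2)" unfolding cos_abs_real by (simp add: cos_diff)
  have "Re (\<nu> * \<omega>) = norm \<nu> * cos (Arg \<nu> / 2)"
  proof (cases "\<nu> = 0")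
    case False
    have "\<nu> * \<omega> = of_real (norm \<nu>) * (cis (Arg \<nu>) * \<omega>)"
      using Arg_eq[OF False] by (simp add: cis_conv_exp mult.assoc)
    also have "cis (Arg \<nu>) * \<omega> = cis (Arg \<nu> / 2)" by (simp add: \<omega>_def cis_mult)
    finally show ?thesis by simp
  qed simp
  moreover have "?\<kappa> * norm \<nu> \<le> cos (Arg \<nu> / 2) * norm \<nu>" by (intro mult_right_mono c) simp
  ultimately show "\<exists>\<omega>. norm \<omega> = 1 \<and> ?\<kappa> \<le> Re \<omega> \<and> ?\<kappa> * norm \<nu> \<le> Re (\<nu> * \<omega>)"
    using c by (intro exI[of _ \<omega>]) (auto simp: \<omega>_def mult.commute)
qed

text \<open>The direction \<open>\<omega>\<close> turns the path of integration into a spiral on which \<open>Re (\<lambda> \<omega>) \<ge> 0\<close> for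
  \<open>\<lambda> = 2 \<nu> + \<alpha> + \<beta> + 1\<close>; this replaces the condition \<open>Re \<nu> > 0\<close> throughout the sector.\<close>

definition jac_params :: "real \<Rightarrow> real \<Rightarrow> complex \<Rightarrow> complex \<Rightarrow> complex \<Rightarrow> complex \<Rightarrow> bool" where
  "jac_params \<kappa> M \<nu> \<alpha> \<beta> \<omega> \<longleftrightarrow> 0 < \<kappa> \<and> norm \<omega> = 1 \<and> \<kappa> \<le> Re \<omega> \<and> \<kappa> * norm \<nu> \<le> Re (\<nu> * \<omega>) \<and>
     norm \<alpha> \<le> M \<and> norm \<beta> \<le> M \<and> 4 * M + 10 \<le> \<kappa> * norm \<nu>"

text \<open>The margin 4 M + 10 outweighs \<alpha>, \<beta> and the constants in each combination.
  Since \<kappa> \<le> 1 it also bounds |\<nu>| from below, and positivity of Re ((\<nu> + \<gamma>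
  + 1) \<omega>) excludes the poles of \<Gamma>.\<close>

lemma jac_params_D:
  assumes "jac_params \<kappa> M \<nu> \<alpha> \<beta> \<omega>"
  shows "0 \<le> Re ((2 * \<nu> + \<alpha> + \<beta> + 1) * \<omega>)" "2 * \<nu> + \<alpha> + \<beta> + 1 \<notin> neg_ints"
    "2 * \<nu> + \<alpha> + \<beta> + 2 \<notin> \<int>\<^sub>\<le>\<^sub>0" "norm \<nu> \<le> norm (2 * \<nu> + \<alpha> + \<beta> + 1)" "norm \<nu> > 0" 
    "\<nu> + \<alpha> + 1 \<notin> \<int>\<^sub>\<le>\<^sub>0" "\<nu> + \<beta> + 1 \<notin> \<int>\<^sub>\<le>\<^sub>0" "M + 3 < norm (\<nu> + \<alpha> + \<beta> + 1)" "M \<ge> 0"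
proof -
  have p: "0 < \<kappa>" "norm \<omega> = 1" "\<kappa> \<le> Re \<omega>" "\<kappa> * norm \<nu> \<le> Re (\<nu> * \<omega>)" "norm \<alpha> \<le> M" "norm \<beta> \<le> M"
    "4 * M + 10 \<le> \<kappa> * norm \<nu>" using assms by (auto simp: jac_params_def)
  show M: "M \<ge> 0" using p(5) norm_ge_zero order_trans by blast
  have "\<kappa> \<le> 1" using p(2,3) complex_Re_le_cmod[of \<omega>] by linarith
  hence "\<kappa> * norm \<nu> \<le> 1 * norm \<nu>" by (intro mult_right_mono) auto
  hence n: "4 * M + 10 \<le> norm \<nu>" using p(7) by linarith
  thus "norm \<nu> > 0" using M by linarith
  have re: "Re (z * \<omega>) \<ge> - norm z" for z
    using abs_Re_le_cmod[of "z * \<omega>"] p(2) by (simp add: norm_mult)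
  have "Re ((2 * \<nu> + \<alpha> + \<beta> + 1) * \<omega>) = 2 * Re (\<nu> * \<omega>) + Re (\<alpha> * \<omega>) + Re (\<beta> * \<omega>) + Re (1 * \<omega>)"
    by (simp add: algebra_simps)
  thus R: "0 \<le> Re ((2 * \<nu> + \<alpha> + \<beta> + 1) * \<omega>)" using re[of \<alpha>] re[of \<beta>] re[of 1] p M by simp
  show l: "2 * \<nu> + \<alpha> + \<beta> + 1 \<notin> neg_ints" by (rule not_neg_ints_rotated[OF R]) (use p in linarith)
  have "(2 * \<nu> + \<alpha> + \<beta> + 2) - 1 \<notin> neg_ints" using l by (simp add: algebra_simps)
  thus "2 * \<nu> + \<alpha> + \<beta> + 2 \<notin> \<int>\<^sub>\<le>\<^sub>0" using nonpos_Ints_iff_neg_ints by blast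
  have "norm (2 * \<nu>) \<le> norm (2 * \<nu> + \<alpha> + \<beta> + 1) + norm \<alpha> + norm \<beta> + norm (1::complex)"
    using norm_triangle_ineq4[of "2 * \<nu> + \<alpha> + \<beta> + 1" 1] norm_triangle_ineq4[of "2 * \<nu> + \<alpha> + \<beta>" \<beta>]
        norm_triangle_ineq4[of "2 * \<nu> + \<alpha>" \<alpha>] by simp
  thus "norm \<nu> \<le> norm (2 * \<nu> + \<alpha> + \<beta> + 1)" using n p M by (simp add: norm_mult)
  have "norm \<nu> \<le> norm (\<nu> + \<alpha> + \<beta> + 1) + norm \<alpha> + norm \<beta> + norm (1::complex)"
    using norm_triangle_ineq4[of "\<nu> + \<alpha> + \<beta> + 1" 1] norm_triangle_ineq4[of "\<nu> + \<alpha> + \<beta>" \<beta>]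
        norm_triangle_ineq4[of "\<nu> + \<alpha>" \<alpha>] by simp
  thus "M + 3 < norm (\<nu> + \<alpha> + \<beta> + 1)" using n p M by simp
  have np: "\<nu> + \<gamma> + 1 \<notin> \<int>\<^sub>\<le>\<^sub>0" if \<gamma>: "norm \<gamma> \<le> M" for \<gamma>
  proof
    assume "\<nu> + \<gamma> + 1 \<in> \<int>\<^sub>\<le>\<^sub>0"
    then obtain k where "\<nu> + \<gamma> + 1 = - of_nat k" by (auto elim: nonpos_Ints_cases')
    hence "Re ((\<nu> + \<gamma> + 1) * \<omega>) = - (real k * Re \<omega>)" by simp
    also have "\<dots> \<le> 0" using p by simp
    finally have "Re (\<nu> * \<omega>) + Re (\<gamma> * \<omega>) + Re (1 * \<omega>) \<le> 0" by (simp add: algebra_simps)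
    thus False using re[of \<gamma>] re[of 1] \<gamma> p M by simp
  qed
  show "\<nu> + \<alpha> + 1 \<notin> \<int>\<^sub>\<le>\<^sub>0" "\<nu> + \<beta> + 1 \<notin> \<int>\<^sub>\<le>\<^sub>0" using np p by auto
qed

text \<open>Points of the disc close to the boundary point have a logarithm whose imaginary part
  differs from 2 \<zeta> in modulus by less than \<epsilon>. As 2 \<zeta> lies in
  [2 \<epsilon>, pi - 2 \<epsilon>] they are admissible with margin \<epsilon>, and the estimate
  passes to the limit.\<close>

lemma jac_Gb_expansion:
  assumes \<epsilon>: "\<epsilon> > 0" and \<kappa>: "\<kappa> > 0"
  shows "\<exists>C R. \<forall>\<nu> \<alpha> \<beta> \<omega> \<zeta> s. jac_params \<kappa> M \<nu> \<alpha> \<beta> \<omega> \<longrightarrow> R \<le> norm \<nu> \<longrightarrow> \<epsilon> \<le> \<zeta> \<longrightarrow> \<zeta> \<le> pi / 2 - \<epsilon> \<longrightarrow> s = 1 \<or> s = -1 \<longrightarrow>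
     jac_bounded_near (2 * \<nu> + \<alpha> + \<beta> + 1) \<alpha> \<beta> (cut_point s \<zeta>) \<and>
     norm (jac_Gb (2 * \<nu> + \<alpha> + \<beta> + 1) \<alpha> \<beta> (cut_point s \<zeta>)
        - jac_S (2 * \<nu> + \<alpha> + \<beta> + 1) \<alpha> \<beta> N (cut_point s \<zeta>)) \<le> C / norm \<nu> ^ N"
proof (cases "\<epsilon> < pi")
  case False
  have "\<not> (\<epsilon> \<le> \<zeta> \<and> \<zeta> \<le> pi / 2 - \<epsilon>)" for \<zeta> using False pi_gt_zero by linarith
  thus ?thesis by blast
next
  case True
  obtain C1 R1 where 1: "\<And>l \<alpha> \<beta> \<omega> w. jac_admissible \<epsilon> \<kappa> M l \<alpha> \<beta> \<omega> w \<Longrightarrow> R1 \<le> norm l \<Longrightarrow>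
     norm (jac_G l \<alpha> \<beta> (exp w) - jac_S l \<alpha> \<beta> N (exp w)) \<le> C1 / norm l ^ N"
    using jac_G_expansion[OF \<epsilon> True \<kappa>, of M N] by blast
  \<comment> \<open>Order 0 is invoked as well: it is the boundedness that makes the boundary limit
    exist.\<close>
  obtain C0 R0 where 0: "\<And>l \<alpha> \<beta> \<omega> w. jac_admissible \<epsilon> \<kappa> M l \<alpha> \<beta> \<omega> w \<Longrightarrow> R0 \<le> norm l \<Longrightarrow>
     norm (jac_G l \<alpha> \<beta> (exp w) - jac_S l \<alpha> \<beta> 0 (exp w)) \<le> C0 / norm l ^ 0"
    using jac_G_expansion[OF \<epsilon> True \<kappa>, of M 0] by blast
  have "jac_bounded_near (2 * \<nu> + \<alpha> + \<beta> + 1) \<alpha> \<beta> (cut_point s \<zeta>) \<and>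
     norm (jac_Gb (2 * \<nu> + \<alpha> + \<beta> + 1) \<alpha> \<beta> (cut_point s \<zeta>)
        - jac_S (2 * \<nu> + \<alpha> + \<beta> + 1) \<alpha> \<beta> N (cut_point s \<zeta>)) \<le> \<bar>C1\<bar> / norm \<nu> ^ N"
    if par: "jac_params \<kappa> M \<nu> \<alpha> \<beta> \<omega>" and R: "max R0 R1 \<le> norm \<nu>" and \<zeta>: "\<epsilon> \<le> \<zeta>" "\<zeta> \<le> pi / 2 - \<epsilon>" and s: "s = 1 \<or> s = -1"
    for \<nu> \<alpha> \<beta> \<omega> \<zeta> s
  proof -
    define l where "l = 2 * \<nu> + \<alpha> + \<beta> + 1"
    note d = jac_params_D[OF par, folded l_def]
    have \<zeta>': "0 < \<zeta>" "\<zeta> < pi / 2" using \<epsilon> \<zeta> by auto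
    define z0 where "z0 = 2 * \<i> * (- of_real s * of_real \<zeta> :: complex)"
    define q0 where "q0 = exp z0"
    have q0: "norm q0 = 1" "q0 \<noteq> 1" "q0 \<noteq> -1" unfolding q0_def z0_def by (rule exp_2i_zeta_neq[OF \<zeta>' s])+
    have Iz: "Im z0 = - 2 * s * \<zeta>" by (simp add: z0_def)
    have Lq: "Ln q0 = z0" unfolding q0_def by (rule Ln_exp) (use s \<zeta>' Iz in auto)
    have "q0 \<notin> \<real>\<^sub>\<le>\<^sub>0"
    proof
      assume "q0 \<in> \<real>\<^sub>\<le>\<^sub>0"
      hence "\<bar>Re q0\<bar> = 1" "Im q0 = 0" "Re q0 \<le> 0" using q0(1) by (auto simp: complex_nonpos_Reals_iff cmod_def)
      thus False using q0(3) by (auto simp: complex_eq_iff)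
    qed
    hence "isCont Ln q0" by (rule continuous_at_Ln)
    then obtain r where r: "r > 0" "\<And>q. dist q q0 < r \<Longrightarrow> dist (Ln q) (Ln q0) < \<epsilon>"
      using \<epsilon> unfolding continuous_at_eps_delta by blast
    define \<rho> where "\<rho> = min r 1"
    have \<rho>: "\<rho> > 0" using r by (simp add: \<rho>_def)
    have adm: "q = exp (Ln q) \<and> jac_admissible \<epsilon> \<kappa> M l \<alpha> \<beta> \<omega> (Ln q)" if q: "norm q < 1" "dist q q0 < \<rho>" for q
    proof -
      have "q \<noteq> 0" using q(2) q0(1) by (auto simp: \<rho>_def dist_norm)
      have "\<bar>Im (Ln q) - Im z0\<bar> < \<epsilon>" using r(2)[of q] q(2) abs_Im_le_cmod[of "Ln q - z0"] by
          (simp add: \<rho>_def Lq dist_norm)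
      moreover have "\<bar>Im z0\<bar> = 2 * \<zeta>" using s \<zeta>' by (auto simp: Iz abs_mult)
      ultimately have "\<epsilon> \<le> \<bar>Im (Ln q)\<bar>" "\<bar>Im (Ln q)\<bar> \<le> pi - \<epsilon>" using \<zeta> \<epsilon> by linarith+
      moreover have "Re (Ln q) < 0" using \<open>q \<noteq> 0\<close> q(1) by simp
      ultimately show ?thesis using \<open>q \<noteq> 0\<close> par d(1) by (auto simp: jac_admissible_def jac_params_def)
    qed
    have Rl: "R1 \<le> norm l" "R0 \<le> norm l" using R d(4) by auto
    have b0: "norm (jac_G l \<alpha> \<beta> q) \<le> C0" if "norm q < 1" "dist q q0 < \<rho>" for q
      using 0[OF conjunct2[OF adm[OF that]] Rl(2)] conjunct1[OF adm[OF that]] by (simp add: jac_S_def)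
    have bn: "jac_bounded_near l \<alpha> \<beta> q0"
      unfolding jac_bounded_near_def using \<rho> b0 by (intro exI[of _ \<rho>] conjI exI[of _ C0]) (auto simp: dist_commute)
    have b1: "norm (jac_G l \<alpha> \<beta> q - jac_S l \<alpha> \<beta> N q) \<le> \<bar>C1\<bar> / norm \<nu> ^ N" if "norm q < 1" "dist q q0 < \<rho>" for q
    proof -
      have "norm (jac_G l \<alpha> \<beta> q - jac_S l \<alpha> \<beta> N q) \<le> C1 / norm l ^ N"
        using 1[OF conjunct2[OF adm[OF that]] Rl(1)] conjunct1[OF adm[OF that]] by simp
      also have "\<dots> \<le> \<bar>C1\<bar> / norm \<nu> ^ N" using d(4,5) by (intro frac_le power_mono) auto
      finally show ?thesis .
    qed
    have "isCont (jac_S l \<alpha> \<beta> N) q0" by (rule isCont_jac_S[OF q0(2,3)])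
    hence lS: "(jac_S l \<alpha> \<beta> N \<longlongrightarrow> jac_S l \<alpha> \<beta> N q0) (at q0 within ball 0 1)"
      using continuous_at_imp_continuous_at_within continuous_within by blast
    have "((\<lambda>q. norm (jac_G l \<alpha> \<beta> q - jac_S l \<alpha> \<beta> N q)) \<longlongrightarrow> norm (jac_Gb l \<alpha> \<beta> q0 - jac_S l \<alpha> \<beta> N q0))
        (at q0 within ball 0 1)"
      by (intro tendsto_norm tendsto_diff jac_G_tendsto_jac_Gb lS d(2) q0 bn)
    hence "norm (jac_Gb l \<alpha> \<beta> q0 - jac_S l \<alpha> \<beta> N q0) \<le> \<bar>C1\<bar> / norm \<nu> ^ N"
      by (rule tendsto_upperbound)
         (use b1 \<rho> at_within_ball_nontrivial[OF q0(1)] in \<open>auto simp: eventually_at\<close>)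
    with bn show ?thesis unfolding l_def q0_def z0_def by blast
  qed
  thus ?thesis by (intro exI[of _ "\<bar>C1\<bar>"] exI[of _ "max R0 R1"]) blast
qed

section \<open>Boundary sums in trigonometric form\<close>

text \<open>The common shape of all three series, with the oscillating factor left as a parameter,
  so that linear combinations of series become linear combinations of these factors.\<close>

definition trig_term :: "(nat \<Rightarrow> complex) \<Rightarrow> nat \<Rightarrow> complex \<Rightarrow> complex \<Rightarrow> complex \<Rightarrow> real \<Rightarrow> complex" where
  "trig_term g n \<nu> \<alpha> \<beta> \<zeta> = (-1) ^ n *
     (\<Sum>l=0..n. jacobi_coeff l \<alpha> * jacobi_coeff (n - l) \<beta> / (of_real (sin \<zeta>) ^ l * of_real (cos \<zeta>) ^ (n - l)) * g l) *
     (Gamma (2 * \<nu> + \<alpha> + \<beta> + 2) / Gamma (2 * \<nu> + \<alpha> + \<beta> + of_nat n + 2))"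

text \<open>The contribution of the side s of the cut, a single exponential; the cosines and sines
  arise by combining s = 1 with s = -1.\<close>

definition bdry_term :: "real \<Rightarrow> nat \<Rightarrow> complex \<Rightarrow> complex \<Rightarrow> complex \<Rightarrow> real \<Rightarrow> complex" where
  "bdry_term s n \<nu> \<alpha> \<beta> \<zeta> = trig_term (\<lambda>l. exp (- (of_real s * \<i> * zeta4 \<nu> \<alpha> \<beta> \<zeta> n l))) n \<nu> \<alpha> \<beta> \<zeta>"

definition bdry_fac :: "complex \<Rightarrow> complex \<Rightarrow> real \<Rightarrow> complex" where
  "bdry_fac \<alpha> \<beta> \<zeta> = 1 / (of_real (sin \<zeta>) powr (\<alpha> + 1/2) * of_real (cos \<zeta>) powr (\<beta> + 1/2))"

lemma bdry_fac_eq_exp: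
  assumes "sin \<zeta> > 0" "cos \<zeta> > 0"
  shows "bdry_fac \<alpha> \<beta> \<zeta> = exp (- (\<alpha> + 1/2) * of_real (ln (sin \<zeta>)) - (\<beta> + 1/2) * of_real (ln (cos \<zeta>)))"
proof -
  have "bdry_fac \<alpha> \<beta> \<zeta> = 1 / exp ((\<alpha> + 1/2) * of_real (ln (sin \<zeta>)) + (\<beta> + 1/2) * of_real (ln (cos \<zeta>)))"
    unfolding bdry_fac_def powr_def exp_add using assms by (simp add: Ln_of_real)
  also have "\<dots> = exp (- ((\<alpha> + 1/2) * of_real (ln (sin \<zeta>)) + (\<beta> + 1/2) * of_real (ln (cos \<zeta>))))"
    by (simp only: exp_minus inverse_eq_divide)
  finally show ?thesis by (simp add: algebra_simps)
qed

text \<open>At the boundary point X = i s e^(-is\<zeta>) / sin \<zeta> and Y = e^(-is\<zeta>) / cos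
  \<zeta>. A product of l factors X and n - l factors Y thus shifts the phase by -s n \<zeta> + s l
  pi/2, which completes \<open>zeta4\<close>.\<close>

lemma jac_S_eq_bdry_term:
  assumes \<zeta>: "0 < \<zeta>" "\<zeta> < pi / 2" and s: "s = 1 \<or> s = -1" and c: "2 * \<nu> + \<alpha> + \<beta> + 2 \<notin> \<int>\<^sub>\<le>\<^sub>0"
  shows "exp (- (of_real s * \<i> * ((\<alpha> + 1/2) * of_real (pi / 2) + (2 * \<nu> + \<alpha> + \<beta> + 1) * of_real \<zeta>))) *
     jac_S (2 * \<nu> + \<alpha> + \<beta> + 1) \<alpha> \<beta> N (cut_point s \<zeta>) = (\<Sum>n<N. bdry_term s n \<nu> \<alpha> \<beta> \<zeta>)"
proof -
  define z0 where "z0 = (- of_real s * of_real \<zeta> :: complex)"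
  define q0 where "q0 = exp (2 * \<i> * z0)"
  define x y where "x = complex_of_real (sin \<zeta>)" and "y = complex_of_real (cos \<zeta>)"
  have xy: "x \<noteq> 0" "y \<noteq> 0" using \<zeta> sin_gt_zero[of \<zeta>] cos_gt_zero_pi[of \<zeta>] by (auto simp: x_def y_def)
  have sz: "sin z0 = - of_real s * x" "cos z0 = y" using s by (auto simp: z0_def x_def y_def sin_of_real cos_of_real)
  have q: "1 - q0 = 2 * exp (\<i> * z0) * (\<i> * of_real s * x)" "1 + q0 = 2 * exp (\<i> * z0) * y"
    using exp_2iz_eq[of z0] unfolding q0_def sz by simp_all
  have qq: "q0 = exp (\<i> * z0) * exp (\<i> * z0)" by (simp add: q0_def mult.assoc flip: exp_add)
  have X: "jac_X q0 = exp (\<i> * z0) * (\<i> * of_real s) / x" "jac_Y q0 = exp (\<i> * z0) / y"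
    unfolding jac_X_def jac_Y_def q using s xy by (auto simp: qq field_simps)
  have isl: "(\<i> * of_real s) ^ l = exp (of_real s * \<i> * of_nat l * of_real (pi / 2))" for l
  proof -
    have "\<i> * of_real s = exp (of_real s * \<i> * of_real (pi / 2))" using s by (auto simp: complex_eq_iff Re_exp Im_exp)
    hence "(\<i> * of_real s) ^ l = exp (of_nat l * (of_real s * \<i> * of_real (pi / 2)))" by (simp only: exp_of_nat_mult)
    thus ?thesis by (simp add: mult_ac)
  qed
  let ?E = "exp (- (of_real s * \<i> * ((\<alpha> + 1/2) * of_real (pi / 2) + (2 * \<nu> + \<alpha> + \<beta> + 1) * of_real \<zeta>)))"
  have XYl: "?E * (jac_X q0 ^ l * jac_Y q0 ^ (n - l)) = exp (- (of_real s * \<i> * zeta4 \<nu> \<alpha> \<beta> \<zeta> n l)) /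
      (x ^ l * y ^ (n - l))"
    if "l \<le> n" for n l
  proof -
    have "jac_X q0 ^ l * jac_Y q0 ^ (n - l) = (exp (\<i> * z0) ^ l * exp (\<i> * z0) ^ (n - l)) * (\<i> * of_real s)
        ^ l / (x ^ l * y ^ (n - l))"
      unfolding X by (simp add: power_divide power_mult_distrib mult_ac)
    also have "exp (\<i> * z0) ^ l * exp (\<i> * z0) ^ (n - l) = exp (of_nat n * (\<i> * z0))"
      using that by (simp add: exp_of_nat_mult flip: power_add)
    finally have "?E * (jac_X q0 ^ l * jac_Y q0 ^ (n - l)) =
       (?E * exp (of_nat n * (\<i> * z0)) * exp (of_real s * \<i> * of_nat l * of_real (pi / 2))) / (x ^ l * y ^ (n - l))"
      unfolding isl by (simp add: mult_ac)
    also have "?E * exp (of_nat n * (\<i> * z0)) * exp (of_real s * \<i> * of_nat l * of_real (pi / 2)) = exp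
        (- (of_real s * \<i> * zeta4 \<nu> \<alpha> \<beta> \<zeta> n l))"
      unfolding exp_add[symmetric] by (rule arg_cong[where f = exp]) (simp add: zeta4_def z0_def algebra_simps)
    finally show ?thesis .
  qed
  have g: "1 / pochhammer (2 * \<nu> + \<alpha> + \<beta> + 1 + 1) n = Gamma (2 * \<nu> + \<alpha> + \<beta> + 2) / Gamma (2 * \<nu> + \<alpha> + \<beta> +
      of_nat n + 2)" for n
  proof -
    have e1: "2 * \<nu> + \<alpha> + \<beta> + 1 + 1 = 2 * \<nu> + \<alpha> + \<beta> + 2"
      and e2: "2 * \<nu> + \<alpha> + \<beta> + of_nat n + 2 = 2 * \<nu> + \<alpha> + \<beta> + 2 + of_nat n" by simp_all
    show ?thesis unfolding e1 e2 pochhammer_Gamma[OF c] by simp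
  qed
  have "?E * ((-1) ^ n * jac_C \<alpha> \<beta> n q0 / pochhammer (2 * \<nu> + \<alpha> + \<beta> + 1 + 1) n) = bdry_term s n \<nu> \<alpha> \<beta> \<zeta>" for n
  proof -
    have "?E * jac_C \<alpha> \<beta> n q0 = (\<Sum>l=0..n. jacobi_coeff l \<alpha> * jacobi_coeff (n - l) \<beta> / (x ^ l * y ^ (n - l)) *
        exp (- (of_real s * \<i> * zeta4 \<nu> \<alpha> \<beta> \<zeta> n l)))"
      unfolding jac_C_def sum_distrib_left
    proof (rule sum.cong[OF refl])
      fix l assume "l \<in> {0..n}"
      hence "l \<le> n" by simp
      have "?E * (jacobi_coeff l \<alpha> * jacobi_coeff (n - l) \<beta> * (jac_X q0 ^ l * jac_Y q0 ^ (n - l))) =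
        jacobi_coeff l \<alpha> * jacobi_coeff (n - l) \<beta> * (?E * (jac_X q0 ^ l * jac_Y q0 ^ (n - l)))" by (simp only: mult_ac)
      thus "?E * (jacobi_coeff l \<alpha> * jacobi_coeff (n - l) \<beta> * (jac_X q0 ^ l * jac_Y q0 ^ (n - l))) =
        jacobi_coeff l \<alpha> * jacobi_coeff (n - l) \<beta> / (x ^ l * y ^ (n - l)) * exp (- (of_real s * \<i> * zeta4 \<nu> \<alpha> \<beta> \<zeta> n l))"
        unfolding XYl[OF \<open>l \<le> n\<close>] by simp
    qed
    moreover have "?E * ((-1) ^ n * jac_C \<alpha> \<beta> n q0 / pochhammer (2 * \<nu> + \<alpha> + \<beta> + 1 + 1) n)
      = (-1) ^ n * (?E * jac_C \<alpha> \<beta> n q0) * (1 / pochhammer (2 * \<nu> + \<alpha> + \<beta> + 1 + 1) n)" by simp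
    ultimately show ?thesis unfolding bdry_term_def trig_term_def g x_def y_def by (simp only:)
  qed
  thus ?thesis unfolding jac_S_def q0_def[unfolded z0_def, symmetric] sum_distrib_left by (simp only: q0_def z0_def)
qed

lemma jacobi_Q_bdry_normalized:
  assumes \<zeta>: "0 < \<zeta>" "\<zeta> < pi / 2" and s: "s = 1 \<or> s = -1" and par: "jac_params \<kappa> M \<nu> \<alpha> \<beta> \<omega>"
  shows "jac_scale \<nu> \<alpha> \<beta> \<noteq> 0"
    "jacobi_Q_bdry \<nu> \<alpha> \<beta> \<zeta> s / jac_scale \<nu> \<alpha> \<beta> =
       bdry_fac \<alpha> \<beta> \<zeta> * (exp (- (of_real s * \<i> * ((\<alpha> + 1/2) * of_real (pi / 2) + (2 * \<nu> + \<alpha> + \<beta> + 1) * of_real \<zeta>))) *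
       jac_Gb (2 * \<nu> + \<alpha> + \<beta> + 1) \<alpha> \<beta> (cut_point s \<zeta>))"
proof -
  note d = jac_params_D[OF par]
  have e: "\<nu> + \<alpha> + 1 + (\<nu> + \<beta> + 1) = 2 * \<nu> + \<alpha> + \<beta> + 2" by simp
  show nz: "jac_scale \<nu> \<alpha> \<beta> \<noteq> 0"
    unfolding Beta_eq_rGamma e using d(3,6,7) by (simp add: Gamma_eq_zero_iff rGamma_eq_zero_iff)
  have sc: "sin \<zeta> > 0" "cos \<zeta> > 0" using \<zeta> by (auto intro: sin_gt_zero cos_gt_zero_pi)
  have "exp (- (\<alpha> + 1/2) * (of_real (ln (sin \<zeta>)) + of_real s * \<i> * of_real (pi / 2)) - (\<beta> + 1/2) * of_real (ln (cos \<zeta>))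
        + \<i> * (2 * \<nu> + \<alpha> + \<beta> + 1) * (- of_real s * of_real \<zeta>)) =
    bdry_fac \<alpha> \<beta> \<zeta> * exp (- (of_real s * \<i> * ((\<alpha> + 1/2) * of_real (pi / 2) + (2 * \<nu> + \<alpha> + \<beta> + 1) * of_real \<zeta>)))"
    unfolding bdry_fac_eq_exp[OF sc] exp_add[symmetric] by (rule arg_cong[where f = exp]) (simp add: field_simps)
  thus "jacobi_Q_bdry \<nu> \<alpha> \<beta> \<zeta> s / jac_scale \<nu> \<alpha> \<beta> =
       bdry_fac \<alpha> \<beta> \<zeta> * (exp (- (of_real s * \<i> * ((\<alpha> + 1/2) * of_real (pi / 2) + (2 * \<nu> + \<alpha> + \<beta> + 1) * of_real \<zeta>))) *
       jac_Gb (2 * \<nu> + \<alpha> + \<beta> + 1) \<alpha> \<beta> (cut_point s \<zeta>))"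
    unfolding jacobi_Q_bdry_def using nz by (simp add: field_simps)
qed

text \<open>Only the factor e^(-2is\<nu>\<zeta>) grows with \<nu>, and it gives exp (2 \<zeta> |Im
  \<nu>|). The rest is bounded because sin \<zeta> and cos \<zeta> are at least sin
  \<epsilon>.\<close>

lemma norm_bdry_fac_exp_le:
  assumes \<epsilon>: "0 < \<epsilon>" and \<zeta>: "\<epsilon> \<le> \<zeta>" "\<zeta> \<le> pi / 2 - \<epsilon>" and s: "s = 1 \<or> s = -1" and ab: "norm \<alpha> \<le> M" "norm \<beta> \<le> M"
  shows "norm (bdry_fac \<alpha> \<beta> \<zeta> * exp (- (of_real s * \<i> * ((\<alpha> + 1/2) * of_real (pi / 2) + (2 * \<nu> + \<alpha> + \<beta> + 1)
      * of_real \<zeta>))))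
     \<le> exp (2 * (M + 1) * \<bar>ln (sin \<epsilon>)\<bar> + M * (3 * pi)) * exp (2 * \<zeta> * \<bar>Im \<nu>\<bar>)"
proof -
  have z: "0 < \<zeta>" "\<zeta> < pi / 2" using \<epsilon> \<zeta> by auto
  have M: "M \<ge> 0" using ab norm_ge_zero order_trans by blast
  have sc: "sin \<zeta> > 0" "cos \<zeta> > 0" using z by (auto intro: sin_gt_zero cos_gt_zero_pi)
  have se: "sin \<epsilon> > 0" using \<epsilon> \<zeta> by (intro sin_gt_zero) auto
  have "sin \<epsilon> \<le> sin \<zeta>" using \<epsilon> \<zeta> z by (intro sin_monotone_2pi_le) auto
  moreover have "sin \<epsilon> \<le> cos \<zeta>"
  proof -
    have "sin \<epsilon> \<le> sin (pi / 2 - \<zeta>)" using \<epsilon> \<zeta> z by (intro sin_monotone_2pi_le) auto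
    thus ?thesis by (simp add: sin_diff)
  qed
  ultimately have ls: "ln (sin \<epsilon>) \<le> ln (sin \<zeta>)" "ln (sin \<epsilon>) \<le> ln (cos \<zeta>)" using se sc by simp_all
  moreover have "ln (sin \<zeta>) \<le> 0" "ln (cos \<zeta>) \<le> 0" using sc by (simp_all add: ln_le_zero_iff)
  ultimately have la: "\<bar>ln (sin \<zeta>)\<bar> \<le> \<bar>ln (sin \<epsilon>)\<bar>" "\<bar>ln (cos \<zeta>)\<bar> \<le> \<bar>ln (sin \<epsilon>)\<bar>" by linarith+
  have t1: "- ((Re \<gamma> + 1/2) * L) \<le> (M + 1) * \<bar>ln (sin \<epsilon>)\<bar>" if "norm \<gamma> \<le> M" "\<bar>L\<bar> \<le> \<bar>ln (sin \<epsilon>)\<bar>" for \<gamma> L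
  proof -
    have "\<bar>Re \<gamma> + 1/2\<bar> \<le> M + 1" using abs_Re_le_cmod[of \<gamma>] that by linarith
    hence "\<bar>Re \<gamma> + 1/2\<bar> * \<bar>L\<bar> \<le> (M + 1) * \<bar>ln (sin \<epsilon>)\<bar>" using that M by (intro mult_mono) auto
    thus ?thesis unfolding abs_mult[symmetric] by linarith
  qed
  have im: "\<bar>Im \<alpha>\<bar> \<le> M" "\<bar>Im \<beta>\<bar> \<le> M" using abs_Im_le_cmod[of \<alpha>] abs_Im_le_cmod[of \<beta>] ab by linarith+
  have t2: "s * (Im \<alpha> * (pi / 2) + (2 * Im \<nu> + Im \<alpha> + Im \<beta>) * \<zeta>) \<le> M * (3 * pi) + 2 * \<zeta> * \<bar>Im \<nu>\<bar>"
  proof -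
    have "s * (Im \<alpha> * (pi / 2) + (2 * Im \<nu> + Im \<alpha> + Im \<beta>) * \<zeta>) \<le> \<bar>Im \<alpha> * (pi / 2) + (2 * Im \<nu> + Im \<alpha> + Im \<beta>) * \<zeta>\<bar>"
      using s by auto
    also have "\<dots> \<le> \<bar>Im \<alpha>\<bar> * (pi / 2) + (2 * \<bar>Im \<nu>\<bar> + \<bar>Im \<alpha>\<bar> + \<bar>Im \<beta>\<bar>) * \<zeta>"
    proof -
      have "\<bar>(2 * Im \<nu> + Im \<alpha> + Im \<beta>) * \<zeta>\<bar> \<le> (2 * \<bar>Im \<nu>\<bar> + \<bar>Im \<alpha>\<bar> + \<bar>Im \<beta>\<bar>) * \<zeta>"
        unfolding abs_mult using z by (auto intro!: mult_mono)
      moreover have "\<bar>Im \<alpha> * (pi / 2)\<bar> = \<bar>Im \<alpha>\<bar> * (pi / 2)" by (simp add: abs_mult)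
      ultimately show ?thesis by linarith
    qed
    also have "\<dots> \<le> M * (pi / 2) + ((2 * \<bar>Im \<nu>\<bar>) * \<zeta> + (M + M) * pi)"
    proof -
      have "(\<bar>Im \<alpha>\<bar> + \<bar>Im \<beta>\<bar>) * \<zeta> \<le> (M + M) * pi" using im z M by (intro mult_mono) auto
      moreover have "\<bar>Im \<alpha>\<bar> * (pi / 2) \<le> M * (pi / 2)" using im by (intro mult_right_mono) auto
      moreover have "(2 * \<bar>Im \<nu>\<bar> + \<bar>Im \<alpha>\<bar> + \<bar>Im \<beta>\<bar>) * \<zeta> = (2 * \<bar>Im \<nu>\<bar>) * \<zeta> + (\<bar>Im \<alpha>\<bar> + \<bar>Im \<beta>\<bar>) * \<zeta>"
        by (simp add: algebra_simps)
      ultimately show ?thesis by linarith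
    qed
    also have "\<dots> \<le> M * (3 * pi) + 2 * \<zeta> * \<bar>Im \<nu>\<bar>" using M by (simp add: algebra_simps)
    finally show ?thesis .
  qed
  have "norm (bdry_fac \<alpha> \<beta> \<zeta> * exp (- (of_real s * \<i> * ((\<alpha> + 1/2) * of_real (pi / 2) + (2 * \<nu> + \<alpha> + \<beta> + 1) * of_real \<zeta>))))
    = exp (- ((Re \<alpha> + 1/2) * ln (sin \<zeta>)) + - ((Re \<beta> + 1/2) * ln (cos \<zeta>)) + s * (Im \<alpha> * (pi / 2) +
        (2 * Im \<nu> + Im \<alpha> + Im \<beta>) * \<zeta>))"
    unfolding bdry_fac_eq_exp[OF sc] norm_mult norm_exp_eq_Re exp_add[symmetric] by
        (rule arg_cong[where f = exp]) (simp add: algebra_simps)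
  also have "\<dots> \<le> exp ((M + 1) * \<bar>ln (sin \<epsilon>)\<bar> + (M + 1) * \<bar>ln (sin \<epsilon>)\<bar> + (M * (3 * pi) + 2 * \<zeta> * \<bar>Im \<nu>\<bar>))"
    unfolding exp_le_cancel_iff by (intro add_mono t1 t2 ab la)
  also have "\<dots> = exp (2 * (M + 1) * \<bar>ln (sin \<epsilon>)\<bar> + M * (3 * pi)) * exp (2 * \<zeta> * \<bar>Im \<nu>\<bar>)"
    unfolding exp_add[symmetric] by (rule arg_cong[where f = exp]) (simp add: algebra_simps)
  finally show ?thesis .
qed

lemma jacobi_Q_bdry_expansion:
  assumes \<epsilon>: "\<epsilon> > 0" and \<kappa>: "\<kappa> > 0"
  shows "\<exists>C\<ge>0. \<exists>R. \<forall>\<nu> \<alpha> \<beta> \<omega> \<zeta> s. jac_params \<kappa> M \<nu> \<alpha> \<beta> \<omega> \<longrightarrow> R \<le> norm \<nu> \<longrightarrow> \<epsilon> \<le> \<zeta> \<longrightarrow> \<zeta> \<le> pi / 2 - \<epsilon> \<longrightarrow> s = 1 \<or> s = -1 \<longrightarrow>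
     jac_bounded_near (2 * \<nu> + \<alpha> + \<beta> + 1) \<alpha> \<beta> (cut_point s \<zeta>) \<and>
     norm (jacobi_Q_bdry \<nu> \<alpha> \<beta> \<zeta> s / jac_scale \<nu> \<alpha> \<beta>
        - bdry_fac \<alpha> \<beta> \<zeta> * (\<Sum>n<N. bdry_term s n \<nu> \<alpha> \<beta> \<zeta>)) \<le> C * (exp (2 * \<zeta> * \<bar>Im \<nu>\<bar>) / norm \<nu> ^ N)"
proof -
  obtain C R where C: "\<And>\<nu> \<alpha> \<beta> \<omega> \<zeta> s. jac_params \<kappa> M \<nu> \<alpha> \<beta> \<omega> \<Longrightarrow> R \<le> norm \<nu> \<Longrightarrow> \<epsilon> \<le> \<zeta> \<Longrightarrow> \<zeta> \<le> pi / 2 - \<epsilon> \<Longrightarrow> s = 1 \<or> s = -1 \<Longrightarrow>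
     jac_bounded_near (2 * \<nu> + \<alpha> + \<beta> + 1) \<alpha> \<beta> (cut_point s \<zeta>) \<and>
     norm (jac_Gb (2 * \<nu> + \<alpha> + \<beta> + 1) \<alpha> \<beta> (cut_point s \<zeta>)
        - jac_S (2 * \<nu> + \<alpha> + \<beta> + 1) \<alpha> \<beta> N (cut_point s \<zeta>)) \<le> C / norm \<nu> ^ N"
    using jac_Gb_expansion[OF \<epsilon> \<kappa>, of M N] by blast
  define K where "K = exp (2 * (M + 1) * \<bar>ln (sin \<epsilon>)\<bar> + M * (3 * pi))"
  have K0: "K * \<bar>C\<bar> \<ge> 0" by (simp add: K_def)
  show ?thesis
  proof (rule exI[of _ "K * \<bar>C\<bar>"], rule conjI[OF K0], rule exI[of _ R], intro allI impI conjI)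
    fix \<nu> \<alpha> \<beta> \<omega> and \<zeta> s :: real
    assume par: "jac_params \<kappa> M \<nu> \<alpha> \<beta> \<omega>" and R: "R \<le> norm \<nu>" and \<zeta>: "\<epsilon> \<le> \<zeta>" "\<zeta> \<le> pi / 2 - \<epsilon>" and s: "s = 1 \<or> s = -1"
    note C = C[OF par R \<zeta> s]
    show "jac_bounded_near (2 * \<nu> + \<alpha> + \<beta> + 1) \<alpha> \<beta> (cut_point s \<zeta>)" using C by blast
    have z: "0 < \<zeta>" "\<zeta> < pi / 2" using \<epsilon> \<zeta> by auto
    have ab: "norm \<alpha> \<le> M" "norm \<beta> \<le> M" using par by (auto simp: jac_params_def)
    note d = jac_params_D[OF par]
    let ?E = "exp (- (of_real s * \<i> * ((\<alpha> + 1/2) * of_real (pi / 2) + (2 * \<nu> + \<alpha> + \<beta> + 1) * of_real \<zeta>)))"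
    let ?q = "cut_point s \<zeta>"
    have "jacobi_Q_bdry \<nu> \<alpha> \<beta> \<zeta> s / jac_scale \<nu> \<alpha> \<beta>
        - bdry_fac \<alpha> \<beta> \<zeta> * (\<Sum>n<N. bdry_term s n \<nu> \<alpha> \<beta> \<zeta>)
      = (bdry_fac \<alpha> \<beta> \<zeta> * ?E) * (jac_Gb (2 * \<nu> + \<alpha> + \<beta> + 1) \<alpha> \<beta> ?q - jac_S (2 * \<nu> + \<alpha> + \<beta> + 1) \<alpha> \<beta> N ?q)"
      unfolding jacobi_Q_bdry_normalized(2)[OF z s par] jac_S_eq_bdry_term[OF z s d(3), of N, symmetric]
      by (simp only: right_diff_distrib mult.assoc)
    hence "norm (jacobi_Q_bdry \<nu> \<alpha> \<beta> \<zeta> s / jac_scale \<nu> \<alpha> \<beta>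
        - bdry_fac \<alpha> \<beta> \<zeta> * (\<Sum>n<N. bdry_term s n \<nu> \<alpha> \<beta> \<zeta>))
      = norm (bdry_fac \<alpha> \<beta> \<zeta> * ?E) * norm (jac_Gb (2 * \<nu> + \<alpha> + \<beta> + 1) \<alpha> \<beta> ?q - jac_S (2 * \<nu> + \<alpha> + \<beta> + 1) \<alpha> \<beta> N ?q)"
      by (simp only: norm_mult)
    also have "\<dots> \<le> (K * exp (2 * \<zeta> * \<bar>Im \<nu>\<bar>)) * (\<bar>C\<bar> / norm \<nu> ^ N)"
    proof (rule mult_mono)
      show "norm (bdry_fac \<alpha> \<beta> \<zeta> * ?E) \<le> K * exp (2 * \<zeta> * \<bar>Im \<nu>\<bar>)"
        unfolding K_def by (rule norm_bdry_fac_exp_le[OF \<epsilon> \<zeta> s ab])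
      have "C / norm \<nu> ^ N \<le> \<bar>C\<bar> / norm \<nu> ^ N" by (intro divide_right_mono) auto
      thus "norm (jac_Gb (2 * \<nu> + \<alpha> + \<beta> + 1) \<alpha> \<beta> ?q - jac_S (2 * \<nu> + \<alpha> + \<beta> + 1) \<alpha> \<beta> N ?q) \<le> \<bar>C\<bar> / norm \<nu> ^ N"
        using C by linarith
    qed (simp_all add: K_def)
    also have "\<dots> = K * \<bar>C\<bar> * (exp (2 * \<zeta> * \<bar>Im \<nu>\<bar>) / norm \<nu> ^ N)" by simp
    finally show "norm (jacobi_Q_bdry \<nu> \<alpha> \<beta> \<zeta> s / jac_scale \<nu> \<alpha> \<beta>
        - bdry_fac \<alpha> \<beta> \<zeta> * (\<Sum>n<N. bdry_term s n \<nu> \<alpha> \<beta> \<zeta>)) \<le> K * \<bar>C\<bar> * (exp (2 * \<zeta> * \<bar>Im \<nu>\<bar>) / norm \<nu> ^ N)" .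
  qed
qed

lemma trig_term_lincomb:
  "u * trig_term g n \<nu> \<alpha> \<beta> \<zeta> + v * trig_term h n \<nu> \<alpha> \<beta> \<zeta> = trig_term (\<lambda>l. u * g l + v * h l) n \<nu> \<alpha> \<beta> \<zeta>"
proof -
  define S where "S = (\<lambda>g. \<Sum>l=0..n. jacobi_coeff l \<alpha> * jacobi_coeff (n - l) \<beta> / (of_real (sin \<zeta>) ^ l *
      of_real (cos \<zeta>) ^ (n - l)) * g l)"
  have "u * S g + v * S h = S (\<lambda>l. u * g l + v * h l)"
    unfolding S_def sum_distrib_left sum.distrib[symmetric]
  proof (intro sum.cong refl)
    have "u * (c * a) + v * (c * b) = c * (u * a + v * b)" for a b c by (simp add: algebra_simps)
    thus "u * (jacobi_coeff l \<alpha> * jacobi_coeff (n - l) \<beta> / (of_real (sin \<zeta>) ^ l * of_real (cos \<zeta>) ^ (n - l)) * g l) +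
        v * (jacobi_coeff l \<alpha> * jacobi_coeff (n - l) \<beta> / (of_real (sin \<zeta>) ^ l * of_real (cos \<zeta>) ^ (n - l)) * h l) =
        jacobi_coeff l \<alpha> * jacobi_coeff (n - l) \<beta> / (of_real (sin \<zeta>) ^ l * of_real (cos \<zeta>) ^ (n - l)) *
            (u * g l + v * h l)" for l .
  qed
  moreover have "u * (p * x * r) + v * (p * y * r) = p * (u * x + v * y) * r" for p x y r by (simp add: algebra_simps)
  ultimately show ?thesis unfolding trig_term_def S_def by (simp only:)
qed

lemma trig_term_cong: "(\<And>l. g l = h l) \<Longrightarrow> trig_term g n \<nu> \<alpha> \<beta> \<zeta> = trig_term h n \<nu> \<alpha> \<beta> \<zeta>"
  by presburger

lemma trig_term_minus: "trig_term (\<lambda>l. - g l) n \<nu> \<alpha> \<beta> \<zeta> = - trig_term g n \<nu> \<alpha> \<beta> \<zeta>"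
  by (simp add: trig_term_def sum_negf)

text \<open>This shift explains the two kinds of phase: the weights e^(i pi \<alpha>) and e^(-i pi
  \<alpha>) remove pi \<alpha>, and the remaining quarter turn exchanges cosine and sine.\<close>

lemma zeta4_eq_zeta3: "zeta4 \<nu> \<alpha> \<beta> \<zeta> n l = zeta3 \<nu> \<alpha> \<beta> \<zeta> n l + of_real pi * \<alpha> + of_real pi / 2"
  by (simp add: zeta3_def zeta4_def field_simps)

lemma bdry_term_cos_zeta4:
  "1/2 * bdry_term 1 n \<nu> \<alpha> \<beta> \<zeta> + 1/2 * bdry_term (-1) n \<nu> \<alpha> \<beta> \<zeta> = trig_term (\<lambda>l. cos (zeta4 \<nu> \<alpha> \<beta> \<zeta> n l)) n \<nu> \<alpha> \<beta> \<zeta>"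
  unfolding bdry_term_def trig_term_lincomb by (rule trig_term_cong) (simp add: cos_exp_eq add.commute)

lemma exp_zeta4_phase:
  "exp (\<i> * of_real pi * \<alpha>) * exp (- (of_real 1 * \<i> * zeta4 \<nu> \<alpha> \<beta> \<zeta> n l)) = - \<i> * exp (- (\<i> * zeta3 \<nu> \<alpha> \<beta> \<zeta> n l))"
  "exp (- (\<i> * of_real pi * \<alpha>)) * exp (- (of_real (-1) * \<i> * zeta4 \<nu> \<alpha> \<beta> \<zeta> n l)) = \<i> * exp (\<i> * zeta3 \<nu> \<alpha> \<beta> \<zeta> n l)"
proof -
  define z where "z = zeta3 \<nu> \<alpha> \<beta> \<zeta> n l"
  have i: "exp (\<i> * (of_real pi / 2)) = \<i>" using cis_conv_exp[of "pi / 2"] cis_pi_half by simp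
  hence i': "exp (- (\<i> * (of_real pi / 2))) = - \<i>" by (simp add: exp_minus)
  have "exp (\<i> * of_real pi * \<alpha>) * exp (- (of_real 1 * \<i> * (z + of_real pi * \<alpha> + of_real pi / 2))) = exp
      (- (\<i> * (of_real pi / 2))) * exp (- (\<i> * z))"
    unfolding exp_add[symmetric] by (rule arg_cong[where f = exp]) (simp add: algebra_simps)
  thus "exp (\<i> * of_real pi * \<alpha>) * exp (- (of_real 1 * \<i> * zeta4 \<nu> \<alpha> \<beta> \<zeta> n l)) = - \<i> * exp (- (\<i> * zeta3 \<nu> \<alpha> \<beta> \<zeta> n l))"
    unfolding zeta4_eq_zeta3 z_def i' .
  have "exp (- (\<i> * of_real pi * \<alpha>)) * exp (- (of_real (-1) * \<i> * (z + of_real pi * \<alpha> + of_real pi / 2))) =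
      exp (\<i> * (of_real pi / 2)) * exp (\<i> * z)"
    unfolding exp_add[symmetric] by (rule arg_cong[where f = exp]) (simp add: algebra_simps)
  thus "exp (- (\<i> * of_real pi * \<alpha>)) * exp (- (of_real (-1) * \<i> * zeta4 \<nu> \<alpha> \<beta> \<zeta> n l)) = \<i> * exp (\<i> * zeta3 \<nu> \<alpha> \<beta> \<zeta> n l)"
    unfolding zeta4_eq_zeta3 z_def i .
qed

lemma bdry_term_sin_zeta3:
  "1/2 * exp (\<i> * of_real pi * \<alpha>) * bdry_term 1 n \<nu> \<alpha> \<beta> \<zeta> + 1/2 * exp (- (\<i> * of_real pi * \<alpha>)) * bdry_term (-1) n \<nu> \<alpha> \<beta> \<zeta>
     = - trig_term (\<lambda>l. sin (zeta3 \<nu> \<alpha> \<beta> \<zeta> n l)) n \<nu> \<alpha> \<beta> \<zeta>"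
  unfolding bdry_term_def trig_term_lincomb trig_term_minus[symmetric]
proof (rule trig_term_cong)
  fix l
  show "1/2 * exp (\<i> * of_real pi * \<alpha>) * exp (- (of_real 1 * \<i> * zeta4 \<nu> \<alpha> \<beta> \<zeta> n l)) +
     1/2 * exp (- (\<i> * of_real pi * \<alpha>)) * exp (- (of_real (-1) * \<i> * zeta4 \<nu> \<alpha> \<beta> \<zeta> n l)) = - sin (zeta3 \<nu> \<alpha> \<beta> \<zeta> n l)"
    unfolding mult.assoc[of "1/2"] exp_zeta4_phase sin_exp_eq by (simp add: field_simps)
qed

lemma bdry_term_cos_zeta3:
  "\<i>/2 * exp (\<i> * of_real pi * \<alpha>) * bdry_term 1 n \<nu> \<alpha> \<beta> \<zeta> + - \<i>/2 * exp (- (\<i> * of_real pi * \<alpha>)) * bdry_term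
      (-1) n \<nu> \<alpha> \<beta> \<zeta>
     = trig_term (\<lambda>l. cos (zeta3 \<nu> \<alpha> \<beta> \<zeta> n l)) n \<nu> \<alpha> \<beta> \<zeta>"
  unfolding bdry_term_def trig_term_lincomb
proof (rule trig_term_cong)
  fix l
  show "\<i>/2 * exp (\<i> * of_real pi * \<alpha>) * exp (- (of_real 1 * \<i> * zeta4 \<nu> \<alpha> \<beta> \<zeta> n l)) +
     - \<i>/2 * exp (- (\<i> * of_real pi * \<alpha>)) * exp (- (of_real (-1) * \<i> * zeta4 \<nu> \<alpha> \<beta> \<zeta> n l)) = cos (zeta3 \<nu> \<alpha> \<beta> \<zeta> n l)"
    unfolding mult.assoc[of "\<i>/2"] mult.assoc[of "- \<i>/2"] exp_zeta4_phase cos_exp_eq by (simp add: field_simps)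
qed

section \<open>Assembling the three expansions\<close>

lemma norm_lincomb_diff_le:
  fixes u v :: complex
  assumes "norm (q - A * S) \<le> E" "norm (q' - A * S') \<le> E" "norm u \<le> K" "norm v \<le> K"
  shows "norm (u * q + v * q' - A * (u * S + v * S')) \<le> 2 * K * E"
proof -
  have "u * q + v * q' - A * (u * S + v * S') = u * (q - A * S) + v * (q' - A * S')" by (simp add: algebra_simps)
  also have "norm \<dots> \<le> norm u * norm (q - A * S) + norm v * norm (q' - A * S')"
    by (metis norm_mult norm_triangle_ineq)
  also have "\<dots> \<le> K * E + K * E"
    using order.trans[OF norm_ge_zero assms(3)] by (intro add_mono mult_mono assms) auto
  also have "\<dots> = 2 * K * E" by simp
  finally show ?thesis .
qed

text \<open>All three functions are such combinations of the two sides of the cut: the weights are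
  1/2 for the plain average, half of e^(i pi \<alpha>) and e^(-i pi \<alpha>) for the phased one,
  and i/2 and -i/2 times these phases for P.\<close>

lemma jacobi_Q_bdry_lincomb_expansion:
  assumes \<epsilon>: "\<epsilon> > 0" and \<kappa>: "\<kappa> > 0" 
    and uv: "\<forall>\<alpha>. norm \<alpha> \<le> M \<longrightarrow> norm (u \<alpha>) \<le> K \<and> norm (v \<alpha>) \<le> K"
  shows "\<exists>C R. \<forall>\<nu> \<alpha> \<beta> \<omega> \<zeta>. jac_params \<kappa> M \<nu> \<alpha> \<beta> \<omega> \<longrightarrow> R \<le> norm \<nu> \<longrightarrow> \<epsilon> \<le> \<zeta> \<longrightarrow> \<zeta> \<le> pi / 2 - \<epsilon> \<longrightarrow>
     (\<forall>s. s = 1 \<or> s = -1 \<longrightarrow> jac_bounded_near (2 * \<nu> + \<alpha> + \<beta> + 1) \<alpha> \<beta> (cut_point s \<zeta>)) \<and>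
     norm ((u \<alpha> * jacobi_Q_bdry \<nu> \<alpha> \<beta> \<zeta> 1 + v \<alpha> * jacobi_Q_bdry \<nu> \<alpha> \<beta> \<zeta> (-1)) / jac_scale \<nu> \<alpha> \<beta>
        - bdry_fac \<alpha> \<beta> \<zeta> * (\<Sum>n<N. u \<alpha> * bdry_term 1 n \<nu> \<alpha> \<beta> \<zeta> + v \<alpha> * bdry_term (-1) n \<nu> \<alpha> \<beta> \<zeta>))
       \<le> C * (exp (2 * \<zeta> * \<bar>Im \<nu>\<bar>) / norm \<nu> ^ N)"
proof -
  obtain C R where C: "C \<ge> 0" and CR: "\<And>\<nu> \<alpha> \<beta> \<omega> \<zeta> s. jac_params \<kappa> M \<nu> \<alpha> \<beta> \<omega> \<Longrightarrow> R \<le> norm \<nu> \<Longrightarrow> \<epsilon> \<le> \<zeta> \<Longrightarrow> \<zeta> \<le> pi /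
      2 - \<epsilon> \<Longrightarrow> s = 1 \<or> s = -1 \<Longrightarrow>
     jac_bounded_near (2 * \<nu> + \<alpha> + \<beta> + 1) \<alpha> \<beta> (cut_point s \<zeta>) \<and>
     norm (jacobi_Q_bdry \<nu> \<alpha> \<beta> \<zeta> s / jac_scale \<nu> \<alpha> \<beta>
        - bdry_fac \<alpha> \<beta> \<zeta> * (\<Sum>n<N. bdry_term s n \<nu> \<alpha> \<beta> \<zeta>)) \<le> C * (exp (2 * \<zeta> * \<bar>Im \<nu>\<bar>) / norm \<nu> ^ N)"
    using jacobi_Q_bdry_expansion[OF \<epsilon> \<kappa>, of M N] by (elim exE conjE) blast
  show ?thesis
  proof (rule exI[of _ "2 * K * C"], rule exI[of _ R], intro allI impI conjI)
    fix \<nu> \<alpha> \<beta> \<omega> :: complex and \<zeta> :: real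
    assume A: "jac_params \<kappa> M \<nu> \<alpha> \<beta> \<omega>" "R \<le> norm \<nu>" "\<epsilon> \<le> \<zeta>" "\<zeta> \<le> pi / 2 - \<epsilon>"
    show "jac_bounded_near (2 * \<nu> + \<alpha> + \<beta> + 1) \<alpha> \<beta> (cut_point s \<zeta>)" if "s = 1 \<or> s = -1" for s
      using CR[OF A that] by (rule conjunct1)
    have n: "norm (u \<alpha>) \<le> K" "norm (v \<alpha>) \<le> K" using A(1) uv by (auto simp: jac_params_def)
    note * = norm_lincomb_diff_le[OF conjunct2[OF CR[OF A, of 1]] conjunct2[OF CR[OF A, of "-1"]] n]
    show "norm ((u \<alpha> * jacobi_Q_bdry \<nu> \<alpha> \<beta> \<zeta> 1 + v \<alpha> * jacobi_Q_bdry \<nu> \<alpha> \<beta> \<zeta> (-1)) / jac_scale \<nu> \<alpha> \<beta>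
        - bdry_fac \<alpha> \<beta> \<zeta> * (\<Sum>n<N. u \<alpha> * bdry_term 1 n \<nu> \<alpha> \<beta> \<zeta> + v \<alpha> * bdry_term (-1) n \<nu> \<alpha> \<beta> \<zeta>))
       \<le> 2 * K * C * (exp (2 * \<zeta> * \<bar>Im \<nu>\<bar>) / norm \<nu> ^ N)"
      using * unfolding sum.distrib sum_distrib_left[symmetric] add_divide_distrib
          times_divide_eq_right[symmetric] mult.assoc[of "2 * K"] by simp
  qed
qed

text \<open>The parameter condition is formulated with M + 1 although |\<alpha>| \<le> M: the slack
  leaves room to move \<alpha> off the integers. The lower bound (4 (M + 1) + 10) / \<kappa> on
  |\<nu>| is the margin built into \<open>jac_params\<close>.\<close>

lemma uniform_expansionI:
  assumes \<delta>: "\<delta> > 0"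
    and *: "\<And>N \<kappa>. \<kappa> > 0 \<Longrightarrow> \<exists>C R. \<forall>\<nu> \<alpha> \<beta> \<omega> \<zeta>. jac_params \<kappa> (M + 1) \<nu> \<alpha> \<beta> \<omega> \<longrightarrow> R \<le> norm \<nu> \<longrightarrow> norm \<alpha> \<le> M \<longrightarrow>
       \<epsilon> \<le> \<zeta> \<longrightarrow> \<zeta> \<le> pi / 2 - \<epsilon> \<longrightarrow>
       norm (L \<nu> \<alpha> \<beta> \<zeta> - A \<alpha> \<beta> \<zeta> * (\<Sum>n<N. T n \<nu> \<alpha> \<beta> \<zeta>)) \<le> C * (exp (2 * \<zeta> * \<bar>Im \<nu>\<bar>) / norm \<nu> ^ N)"
  shows "uniform_expansion \<epsilon> \<delta> M L A T"
  unfolding uniform_expansion_def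
proof
  fix N
  obtain \<kappa> where \<kappa>: "\<kappa> > 0" "\<And>\<nu>. \<bar>Arg \<nu>\<bar> \<le> pi - \<delta> \<Longrightarrow> \<exists>\<omega>. norm \<omega> = 1 \<and> \<kappa> \<le> Re \<omega> \<and> \<kappa> * norm \<nu> \<le> Re (\<nu> * \<omega>)"
    using sector_rotation[OF \<delta>] by blast
  obtain C R where CR: "\<And>\<nu> \<alpha> \<beta> \<omega> \<zeta>. jac_params \<kappa> (M + 1) \<nu> \<alpha> \<beta> \<omega> \<Longrightarrow> R \<le> norm \<nu> \<Longrightarrow> norm \<alpha> \<le> M \<Longrightarrow>
       \<epsilon> \<le> \<zeta> \<Longrightarrow> \<zeta> \<le> pi / 2 - \<epsilon> \<Longrightarrow>
       norm (L \<nu> \<alpha> \<beta> \<zeta> - A \<alpha> \<beta> \<zeta> * (\<Sum>n<N. T n \<nu> \<alpha> \<beta> \<zeta>)) \<le> C * (exp (2 * \<zeta> * \<bar>Im \<nu>\<bar>) / norm \<nu> ^ N)"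
    using *[OF \<kappa>(1), of N] by blast
  show "\<exists>C R. \<forall>\<nu> \<alpha> \<beta> \<zeta>. R \<le> norm \<nu> \<and> \<bar>Arg \<nu>\<bar> \<le> pi - \<delta> \<and> norm \<alpha> \<le> M \<and> norm \<beta> \<le> M \<and> \<epsilon> \<le> \<zeta> \<and> \<zeta> \<le> pi / 2 - \<epsilon> \<longrightarrow>
        norm (L \<nu> \<alpha> \<beta> \<zeta> - A \<alpha> \<beta> \<zeta> * (\<Sum>n<N. T n \<nu> \<alpha> \<beta> \<zeta>)) \<le> C * (exp (2 * \<zeta> * \<bar>Im \<nu>\<bar>) / norm \<nu> ^ N)"
  proof (rule exI[of _ C], rule exI[of _ "max R ((4 * (M + 1) + 10) / \<kappa>)"], intro allI impI, elim conjE)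
    fix \<nu> \<alpha> \<beta> :: complex and \<zeta> :: real
    assume H: "max R ((4 * (M + 1) + 10) / \<kappa>) \<le> norm \<nu>" "\<bar>Arg \<nu>\<bar> \<le> pi - \<delta>" "norm \<alpha> \<le> M" "norm \<beta> \<le> M" "\<epsilon> \<le> \<zeta>"
        "\<zeta> \<le> pi / 2 - \<epsilon>"
    have "(4 * (M + 1) + 10) / \<kappa> \<le> norm \<nu>" using H(1) by simp
    hence "4 * (M + 1) + 10 \<le> \<kappa> * norm \<nu>" using \<kappa>(1) by (simp add: field_simps)
    moreover obtain \<omega> where "norm \<omega> = 1 \<and> \<kappa> \<le> Re \<omega> \<and> \<kappa> * norm \<nu> \<le> Re (\<nu> * \<omega>)" using \<kappa>(2)[OF H(2)] by blast
    ultimately have "jac_params \<kappa> (M + 1) \<nu> \<alpha> \<beta> \<omega>" using H \<kappa>(1) by (simp add: jac_params_def)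
    from CR[OF this _ H(3,5,6)] H(1)
    show "norm (L \<nu> \<alpha> \<beta> \<zeta> - A \<alpha> \<beta> \<zeta> * (\<Sum>n<N. T n \<nu> \<alpha> \<beta> \<zeta>)) \<le> C * (exp (2 * \<zeta> * \<bar>Im \<nu>\<bar>) / norm \<nu> ^ N)" by simp
  qed
qed

lemma jacobi_Q_average_limit:
  assumes \<zeta>: "0 < \<zeta>" "\<zeta> < pi / 2" and l: "2 * \<nu> + \<alpha> + \<beta> + 1 \<notin> neg_ints"
    and bd: "\<And>s. s = 1 \<or> s = -1 \<Longrightarrow> jac_bounded_near (2 * \<nu> + \<alpha> + \<beta> + 1) \<alpha> \<beta> (cut_point s \<zeta>)"
  shows "Lim (at_right 0) (\<lambda>\<eta>::real. 1/2 * (u * jacobi_Q \<nu> \<alpha> \<beta> (of_real (cos (2 * \<zeta>)) + \<i> * of_real \<eta>) +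
      v * jacobi_Q \<nu> \<alpha> \<beta> (of_real (cos (2 * \<zeta>)) - \<i> * of_real \<eta>))) =
      1/2 * u * jacobi_Q_bdry \<nu> \<alpha> \<beta> \<zeta> 1 + 1/2 * v * jacobi_Q_bdry \<nu> \<alpha> \<beta> \<zeta> (-1)"
proof -
  have p: "((\<lambda>\<eta>::real. jacobi_Q \<nu> \<alpha> \<beta> (of_real (cos (2 * \<zeta>)) + \<i> * of_real \<eta>)) \<longlongrightarrow> jacobi_Q_bdry \<nu> \<alpha> \<beta> \<zeta> 1) (at_right 0)"
    using jacobi_Q_tendsto_bdry[OF \<zeta> _ l bd, of 1] by simp
  have m: "((\<lambda>\<eta>::real. jacobi_Q \<nu> \<alpha> \<beta> (of_real (cos (2 * \<zeta>)) - \<i> * of_real \<eta>)) \<longlongrightarrow> jacobi_Q_bdry \<nu> \<alpha> \<beta> \<zeta> (-1)) (at_right 0)"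
    using jacobi_Q_tendsto_bdry[OF \<zeta> _ l bd, of "-1"] by simp
  have "((\<lambda>\<eta>::real. 1/2 * (u * jacobi_Q \<nu> \<alpha> \<beta> (of_real (cos (2 * \<zeta>)) + \<i> * of_real \<eta>) +
      v * jacobi_Q \<nu> \<alpha> \<beta> (of_real (cos (2 * \<zeta>)) - \<i> * of_real \<eta>))) \<longlongrightarrow>
      1/2 * (u * jacobi_Q_bdry \<nu> \<alpha> \<beta> \<zeta> 1 + v * jacobi_Q_bdry \<nu> \<alpha> \<beta> \<zeta> (-1))) (at_right 0)"
    by (intro tendsto_intros p m)
  from tendsto_Lim[OF _ this] show ?thesis by (simp add: ring_distribs)
qed

lemma norm_exp_phase_le:
  assumes "norm \<alpha> \<le> M"
  shows "norm (exp (\<i> * of_real pi * \<alpha>)) \<le> exp (pi * M)" "norm (exp (- (\<i> * of_real pi * \<alpha>))) \<le> exp (pi * M)"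
proof -
  have "\<bar>Im \<alpha>\<bar> \<le> M" using abs_Im_le_cmod[of \<alpha>] assms by linarith
  hence "pi * \<bar>Im \<alpha>\<bar> \<le> pi * M" by simp
  moreover have "- (pi * Im \<alpha>) \<le> pi * \<bar>Im \<alpha>\<bar>" "pi * Im \<alpha> \<le> pi * \<bar>Im \<alpha>\<bar>" by (simp_all add: abs_if)
  ultimately have "- (pi * Im \<alpha>) \<le> pi * M" "pi * Im \<alpha> \<le> pi * M" by linarith+
  thus "norm (exp (\<i> * of_real pi * \<alpha>)) \<le> exp (pi * M)" "norm (exp (- (\<i> * of_real pi * \<alpha>))) \<le> exp (pi * M)"
    by simp_all
qed

lemma jacobi_Q_cut_expansion:
  assumes "\<epsilon> > 0" "\<delta> > 0"
  shows "uniform_expansion \<epsilon> \<delta> M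
    (\<lambda>\<nu> \<alpha> \<beta> \<zeta>. jacobi_Q_cut \<nu> \<alpha> \<beta> (cos (2 * \<zeta>)) / jac_scale \<nu> \<alpha> \<beta>)
    bdry_fac (\<lambda>n \<nu> \<alpha> \<beta> \<zeta>. trig_term (\<lambda>l. cos (zeta4 \<nu> \<alpha> \<beta> \<zeta> n l)) n \<nu> \<alpha> \<beta> \<zeta>)"
proof (rule uniform_expansionI[OF assms(2)])
  fix N \<kappa> assume "\<kappa> > (0::real)"
  moreover have "\<forall>\<alpha>. norm \<alpha> \<le> M + 1 \<longrightarrow> norm ((\<lambda>_::complex. 1/2::complex) \<alpha>) \<le> 1/2 \<and> norm
      ((\<lambda>_::complex. 1/2::complex) \<alpha>) \<le> 1/2"
    by simp
  ultimately obtain C R where CR: "\<And>\<nu> \<alpha> \<beta> \<omega> \<zeta>. jac_params \<kappa> (M + 1) \<nu> \<alpha> \<beta> \<omega> \<Longrightarrow> R \<le> norm \<nu> \<Longrightarrow> \<epsilon> \<le> \<zeta> \<Longrightarrow> \<zeta> \<le> pi / 2 - \<epsilon> \<Longrightarrow>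
     (\<forall>s. s = 1 \<or> s = -1 \<longrightarrow> jac_bounded_near (2 * \<nu> + \<alpha> + \<beta> + 1) \<alpha> \<beta> (cut_point s \<zeta>)) \<and>
     norm ((1/2 * jacobi_Q_bdry \<nu> \<alpha> \<beta> \<zeta> 1 + 1/2 * jacobi_Q_bdry \<nu> \<alpha> \<beta> \<zeta> (-1)) / jac_scale \<nu> \<alpha> \<beta>
        - bdry_fac \<alpha> \<beta> \<zeta> * (\<Sum>n<N. 1/2 * bdry_term 1 n \<nu> \<alpha> \<beta> \<zeta> + 1/2 * bdry_term (-1) n \<nu> \<alpha> \<beta> \<zeta>))
       \<le> C * (exp (2 * \<zeta> * \<bar>Im \<nu>\<bar>) / norm \<nu> ^ N)"
    using jacobi_Q_bdry_lincomb_expansion[OF assms(1), of \<kappa> "M + 1" "\<lambda>_. 1/2" "1/2" "\<lambda>_. 1/2" N] by blast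
  show "\<exists>C R. \<forall>\<nu> \<alpha> \<beta> \<omega> \<zeta>. jac_params \<kappa> (M + 1) \<nu> \<alpha> \<beta> \<omega> \<longrightarrow> R \<le> norm \<nu> \<longrightarrow> norm \<alpha> \<le> M \<longrightarrow> \<epsilon> \<le> \<zeta> \<longrightarrow> \<zeta> \<le> pi / 2 - \<epsilon> \<longrightarrow>
       norm (jacobi_Q_cut \<nu> \<alpha> \<beta> (cos (2 * \<zeta>)) / jac_scale \<nu> \<alpha> \<beta> -
         bdry_fac \<alpha> \<beta> \<zeta> * (\<Sum>n<N. trig_term (\<lambda>l. cos (zeta4 \<nu> \<alpha> \<beta> \<zeta> n l)) n \<nu> \<alpha> \<beta> \<zeta>)) \<le> C *
             (exp (2 * \<zeta> * \<bar>Im \<nu>\<bar>) / norm \<nu> ^ N)"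
  proof (rule exI[of _ C], rule exI[of _ R], intro allI impI)
    fix \<nu> \<alpha> \<beta> \<omega> :: complex and \<zeta> :: real
    assume H: "jac_params \<kappa> (M + 1) \<nu> \<alpha> \<beta> \<omega>" "R \<le> norm \<nu>" "norm \<alpha> \<le> M" "\<epsilon> \<le> \<zeta>" "\<zeta> \<le> pi / 2 - \<epsilon>"
    note * = CR[OF H(1,2,4,5)]
    have \<zeta>: "0 < \<zeta>" "\<zeta> < pi / 2" using H(4,5) assms(1) by linarith+
    have "jacobi_Q_cut \<nu> \<alpha> \<beta> (cos (2 * \<zeta>)) = 1/2 * jacobi_Q_bdry \<nu> \<alpha> \<beta> \<zeta> 1 + 1/2 * jacobi_Q_bdry \<nu> \<alpha> \<beta> \<zeta> (-1)"
      using jacobi_Q_average_limit[OF \<zeta> jac_params_D(2)[OF H(1)] conjunct1[OF *, rule_format], of 1 1]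
      unfolding jacobi_Q_cut_def mult_1_right mult_1_left .
    with conjunct2[OF *] show "norm (jacobi_Q_cut \<nu> \<alpha> \<beta> (cos (2 * \<zeta>)) / jac_scale \<nu> \<alpha> \<beta> -
         bdry_fac \<alpha> \<beta> \<zeta> * (\<Sum>n<N. trig_term (\<lambda>l. cos (zeta4 \<nu> \<alpha> \<beta> \<zeta> n l)) n \<nu> \<alpha> \<beta> \<zeta>)) \<le> C *
             (exp (2 * \<zeta> * \<bar>Im \<nu>\<bar>) / norm \<nu> ^ N)"
      unfolding bdry_term_cos_zeta4 by (simp only:)
  qed
qed

lemma jacobi_Q_cut_phase_expansion:
  assumes "\<epsilon> > 0" "\<delta> > 0"
  shows "uniform_expansion \<epsilon> \<delta> M
    (\<lambda>\<nu> \<alpha> \<beta> \<zeta>. jacobi_Q_cut_phase \<nu> \<alpha> \<beta> (cos (2 * \<zeta>)) / jac_scale \<nu> \<alpha> \<beta>)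
    (\<lambda>\<alpha> \<beta> \<zeta>. - bdry_fac \<alpha> \<beta> \<zeta>) (\<lambda>n \<nu> \<alpha> \<beta> \<zeta>. trig_term (\<lambda>l. sin (zeta3 \<nu> \<alpha> \<beta> \<zeta> n l)) n \<nu> \<alpha> \<beta> \<zeta>)"
proof (rule uniform_expansionI[OF assms(2)])
  fix N \<kappa> assume \<kappa>: "\<kappa> > (0::real)"
  have b: "\<forall>\<alpha>. norm \<alpha> \<le> M + 1 \<longrightarrow> norm (1/2 * exp (\<i> * of_real pi * \<alpha>)) \<le> exp (pi * (M + 1)) \<and>
      norm (1/2 * exp (- (\<i> * of_real pi * \<alpha>))) \<le> exp (pi * (M + 1))"
  proof (intro allI impI)
    fix \<alpha> :: complex assume that: "norm \<alpha> \<le> M + 1"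
    show "norm (1/2 * exp (\<i> * of_real pi * \<alpha>)) \<le> exp (pi * (M + 1)) \<and> norm
        (1/2 * exp (- (\<i> * of_real pi * \<alpha>))) \<le> exp (pi * (M + 1))"
    using norm_exp_phase_le[OF that] norm_ge_zero[of "exp (\<i> * of_real pi * \<alpha>)"] norm_ge_zero[of "exp
        (- (\<i> * of_real pi * \<alpha>))"]
    unfolding norm_mult norm_divide norm_one norm_numeral by linarith
  qed
  obtain C R where CR: "\<And>\<nu> \<alpha> \<beta> \<omega> \<zeta>. jac_params \<kappa> (M + 1) \<nu> \<alpha> \<beta> \<omega> \<Longrightarrow> R \<le> norm \<nu> \<Longrightarrow> \<epsilon> \<le> \<zeta> \<Longrightarrow> \<zeta> \<le> pi / 2 - \<epsilon> \<Longrightarrow>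
     (\<forall>s. s = 1 \<or> s = -1 \<longrightarrow> jac_bounded_near (2 * \<nu> + \<alpha> + \<beta> + 1) \<alpha> \<beta> (cut_point s \<zeta>)) \<and>
     norm ((1/2 * exp (\<i> * of_real pi * \<alpha>) * jacobi_Q_bdry \<nu> \<alpha> \<beta> \<zeta> 1 + 1/2 * exp (- (\<i> * of_real pi * \<alpha>)) *
         jacobi_Q_bdry \<nu> \<alpha> \<beta> \<zeta> (-1)) / jac_scale \<nu> \<alpha> \<beta>
        - bdry_fac \<alpha> \<beta> \<zeta> * (\<Sum>n<N. 1/2 * exp (\<i> * of_real pi * \<alpha>) * bdry_term 1 n \<nu> \<alpha> \<beta> \<zeta> + 1/2 * exp
            (- (\<i> * of_real pi * \<alpha>)) * bdry_term (-1) n \<nu> \<alpha> \<beta> \<zeta>))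
       \<le> C * (exp (2 * \<zeta> * \<bar>Im \<nu>\<bar>) / norm \<nu> ^ N)"
    using jacobi_Q_bdry_lincomb_expansion[OF assms(1) \<kappa>, of "M + 1" "\<lambda>\<alpha>. 1/2 * exp (\<i> * of_real pi * \<alpha>)" _
        "\<lambda>\<alpha>. 1/2 * exp (- (\<i> * of_real pi * \<alpha>))" N, OF b]
    by (elim exE) blast
  show "\<exists>C R. \<forall>\<nu> \<alpha> \<beta> \<omega> \<zeta>. jac_params \<kappa> (M + 1) \<nu> \<alpha> \<beta> \<omega> \<longrightarrow> R \<le> norm \<nu> \<longrightarrow> norm \<alpha> \<le> M \<longrightarrow> \<epsilon> \<le> \<zeta> \<longrightarrow> \<zeta> \<le> pi / 2 - \<epsilon> \<longrightarrow>
       norm (jacobi_Q_cut_phase \<nu> \<alpha> \<beta> (cos (2 * \<zeta>)) / jac_scale \<nu> \<alpha> \<beta> -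
         - bdry_fac \<alpha> \<beta> \<zeta> * (\<Sum>n<N. trig_term (\<lambda>l. sin (zeta3 \<nu> \<alpha> \<beta> \<zeta> n l)) n \<nu> \<alpha> \<beta> \<zeta>)) \<le> C *
             (exp (2 * \<zeta> * \<bar>Im \<nu>\<bar>) / norm \<nu> ^ N)"
  proof (rule exI[of _ C], rule exI[of _ R], intro allI impI)
    fix \<nu> \<alpha> \<beta> \<omega> :: complex and \<zeta> :: real
    assume H: "jac_params \<kappa> (M + 1) \<nu> \<alpha> \<beta> \<omega>" "R \<le> norm \<nu>" "norm \<alpha> \<le> M" "\<epsilon> \<le> \<zeta>" "\<zeta> \<le> pi / 2 - \<epsilon>"
    note * = CR[OF H(1,2,4,5)]
    have \<zeta>: "0 < \<zeta>" "\<zeta> < pi / 2" using H(4,5) assms(1) by linarith+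
    have i: "of_real pi * \<alpha> * \<i> = \<i> * of_real pi * \<alpha>" by (simp add: mult_ac)
    have "jacobi_Q_cut_phase \<nu> \<alpha> \<beta> (cos (2 * \<zeta>)) = 1/2 * exp (\<i> * of_real pi * \<alpha>) * jacobi_Q_bdry \<nu> \<alpha> \<beta> \<zeta> 1
        + 1/2 * exp (- (\<i> * of_real pi * \<alpha>)) * jacobi_Q_bdry \<nu> \<alpha> \<beta> \<zeta> (-1)"
      unfolding jacobi_Q_cut_phase_def i
      by (rule jacobi_Q_average_limit[OF \<zeta> jac_params_D(2)[OF H(1)] conjunct1[OF *, rule_format]])
    moreover have "x - (- A * (\<Sum>n<N. t n)) = x - A * (\<Sum>n<N. - t n)" for x A :: complex and t by (simp add: sum_negf)
    ultimately show "norm (jacobi_Q_cut_phase \<nu> \<alpha> \<beta> (cos (2 * \<zeta>)) / jac_scale \<nu> \<alpha> \<beta> -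
         - bdry_fac \<alpha> \<beta> \<zeta> * (\<Sum>n<N. trig_term (\<lambda>l. sin (zeta3 \<nu> \<alpha> \<beta> \<zeta> n l)) n \<nu> \<alpha> \<beta> \<zeta>)) \<le> C *
             (exp (2 * \<zeta> * \<bar>Im \<nu>\<bar>) / norm \<nu> ^ N)"
      using conjunct2[OF *] unfolding bdry_term_sin_zeta3 by (simp only:)
  qed
qed

abbreviation (input) jacobi_P_remainder :: "nat \<Rightarrow> complex \<Rightarrow> complex \<Rightarrow> complex \<Rightarrow> real \<Rightarrow> complex" where
  "jacobi_P_remainder N \<nu> \<alpha> \<beta> \<zeta> \<equiv>
     of_real pi * jacobi_P \<nu> \<alpha> \<beta> (of_real (cos (2 * \<zeta>))) /
       (2 powr (2 * \<nu> + \<alpha> + \<beta> + 1) * Beta (\<nu> + \<alpha> + 1) (\<nu> + \<beta> + 1)) -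
     bdry_fac \<alpha> \<beta> \<zeta> * (\<Sum>n<N. trig_term (\<lambda>l. cos (zeta3 \<nu> \<alpha> \<beta> \<zeta> n l)) n \<nu> \<alpha> \<beta> \<zeta>)"

lemma jacobi_P_expansion_aux:
  assumes "\<epsilon> > 0" "\<kappa> > 0"
  shows "\<exists>C R. \<forall>\<nu> \<alpha> \<beta> \<omega> \<zeta>. jac_params \<kappa> M \<nu> \<alpha> \<beta> \<omega> \<longrightarrow> R \<le> norm \<nu> \<longrightarrow> \<alpha> \<notin> \<int> \<longrightarrow> \<epsilon> \<le> \<zeta> \<longrightarrow> \<zeta> \<le> pi / 2 - \<epsilon> \<longrightarrow>
       norm (jacobi_P_remainder N \<nu> \<alpha> \<beta> \<zeta>) \<le> C * (exp (2 * \<zeta> * \<bar>Im \<nu>\<bar>) / norm \<nu> ^ N)"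
proof -
  have b: "\<forall>\<alpha>. norm \<alpha> \<le> M \<longrightarrow> norm (\<i>/2 * exp (\<i> * of_real pi * \<alpha>)) \<le> exp (pi * M) \<and>
      norm (- \<i>/2 * exp (- (\<i> * of_real pi * \<alpha>))) \<le> exp (pi * M)"
  proof (intro allI impI)
    fix \<alpha> :: complex assume that: "norm \<alpha> \<le> M"
    show "norm (\<i>/2 * exp (\<i> * of_real pi * \<alpha>)) \<le> exp (pi * M) \<and> norm (- \<i>/2 * exp (- (\<i> * of_real pi * \<alpha>)))
        \<le> exp (pi * M)"
    using norm_exp_phase_le[OF that] norm_ge_zero[of "exp (\<i> * of_real pi * \<alpha>)"] norm_ge_zero[of "exp
        (- (\<i> * of_real pi * \<alpha>))"]
    unfolding norm_mult norm_divide norm_minus_cancel norm_ii norm_numeral by linarith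
  qed
  obtain C R where CR: "\<And>\<nu> \<alpha> \<beta> \<omega> \<zeta>. jac_params \<kappa> M \<nu> \<alpha> \<beta> \<omega> \<Longrightarrow> R \<le> norm \<nu> \<Longrightarrow> \<epsilon> \<le> \<zeta> \<Longrightarrow> \<zeta> \<le> pi / 2 - \<epsilon> \<Longrightarrow>
     (\<forall>s. s = 1 \<or> s = -1 \<longrightarrow> jac_bounded_near (2 * \<nu> + \<alpha> + \<beta> + 1) \<alpha> \<beta> (cut_point s \<zeta>)) \<and>
     norm ((\<i>/2 * exp (\<i> * of_real pi * \<alpha>) * jacobi_Q_bdry \<nu> \<alpha> \<beta> \<zeta> 1 + - \<i>/2 * exp (- (\<i> * of_real pi * \<alpha>))
         * jacobi_Q_bdry \<nu> \<alpha> \<beta> \<zeta> (-1)) / jac_scale \<nu> \<alpha> \<beta>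
        - bdry_fac \<alpha> \<beta> \<zeta> * (\<Sum>n<N. \<i>/2 * exp (\<i> * of_real pi * \<alpha>) * bdry_term 1 n \<nu> \<alpha> \<beta> \<zeta> + - \<i>/2 * exp
            (- (\<i> * of_real pi * \<alpha>)) * bdry_term (-1) n \<nu> \<alpha> \<beta> \<zeta>))
       \<le> C * (exp (2 * \<zeta> * \<bar>Im \<nu>\<bar>) / norm \<nu> ^ N)"
    using jacobi_Q_bdry_lincomb_expansion[OF assms, of M "\<lambda>\<alpha>. \<i>/2 * exp (\<i> * of_real pi * \<alpha>)" _ "\<lambda>\<alpha>. - \<i>/2 *
        exp (- (\<i> * of_real pi * \<alpha>))" N, OF b]
    by (elim exE) blast
  show ?thesis
  proof (rule exI[of _ C], rule exI[of _ R], intro allI impI)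
    fix \<nu> \<alpha> \<beta> \<omega> :: complex and \<zeta> :: real
    assume H: "jac_params \<kappa> M \<nu> \<alpha> \<beta> \<omega>" "R \<le> norm \<nu>" "\<alpha> \<notin> \<int>" "\<epsilon> \<le> \<zeta>" "\<zeta> \<le> pi / 2 - \<epsilon>"
    note * = CR[OF H(1,2,4,5)]
    note par = jac_params_D[OF H(1)]
    have \<zeta>: "0 < \<zeta>" "\<zeta> < pi / 2" using H(4,5) assms(1) by linarith+
    have ab: "(\<nu> + \<alpha> + \<beta> + 1) + (\<nu> + \<alpha> + 1) - (2 * \<nu> + \<alpha> + \<beta> + 2) = \<alpha>" by simp
    \<comment> \<open>The number of shifts of a: since M < m, they carry Re \<alpha> below 0, and
      since m \<le> M + 1 < |\<nu> + \<alpha> + \<beta> + 1| none of them meets a = 0.\<close>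
    define m where "m = nat \<lfloor>M\<rfloor> + 1"
    have m: "M < real m" "real m \<le> M + 1" unfolding m_def using par(9) by (simp_all add: of_nat_nat) linarith
    have "norm \<alpha> \<le> M" using H(1) by (simp add: jac_params_def)
    hence "Re \<alpha> \<le> M" using complex_Re_le_cmod[of \<alpha>] by linarith
    hence "Re \<alpha> < real m" "norm (\<nu> + \<alpha> + \<beta> + 1) > real m" using m par(8) by linarith+
    hence "conn_holds (\<nu> + \<alpha> + \<beta> + 1) (\<nu> + \<alpha> + 1) (2 * \<nu> + \<alpha> + \<beta> + 2)"
      by (intro conn_holds_general[where n = m]) (use H(3) par(3) in \<open>simp_all only: ab not_False_eq_True\<close>)
    from jacobi_P_eq_bdry[OF \<zeta> par(2) conjunct1[OF *, rule_format] H(3) par(7) this]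
    have P: "exp (\<i> * of_real pi * \<alpha>) * jacobi_Q_bdry \<nu> \<alpha> \<beta> \<zeta> 1 - exp (- (\<i> * of_real pi * \<alpha>)) *
        jacobi_Q_bdry \<nu> \<alpha> \<beta> \<zeta> (-1)
        = - (\<i> * of_real pi) * jacobi_P \<nu> \<alpha> \<beta> (of_real (cos (2 * \<zeta>)))" .
    have "\<i>/2 * exp (\<i> * of_real pi * \<alpha>) * jacobi_Q_bdry \<nu> \<alpha> \<beta> \<zeta> 1 + - \<i>/2 * exp (- (\<i> * of_real pi * \<alpha>)) *
        jacobi_Q_bdry \<nu> \<alpha> \<beta> \<zeta> (-1)
        = \<i>/2 * (exp (\<i> * of_real pi * \<alpha>) * jacobi_Q_bdry \<nu> \<alpha> \<beta> \<zeta> 1 - exp (- (\<i> * of_real pi * \<alpha>)) *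
            jacobi_Q_bdry \<nu> \<alpha> \<beta> \<zeta> (-1))"
      by (simp add: right_diff_distrib mult.assoc)
    also have "\<dots> = of_real pi * jacobi_P \<nu> \<alpha> \<beta> (of_real (cos (2 * \<zeta>))) / 2" unfolding P by (simp flip: mult.assoc)
    finally have e: "\<i>/2 * exp (\<i> * of_real pi * \<alpha>) * jacobi_Q_bdry \<nu> \<alpha> \<beta> \<zeta> 1 + - \<i>/2 * exp
        (- (\<i> * of_real pi * \<alpha>)) * jacobi_Q_bdry \<nu> \<alpha> \<beta> \<zeta> (-1)
        = of_real pi * jacobi_P \<nu> \<alpha> \<beta> (of_real (cos (2 * \<zeta>))) / 2" .
    \<comment> \<open>The scale for P has one more factor 2 than that for Q; it matches the 1/2 in
      \<open>e\<close>.\<close>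
    have p: "(2::complex) powr (2 * \<nu> + \<alpha> + \<beta> + 1) * B = 2 * (2 powr (2 * \<nu> + \<alpha> + \<beta>) * B)" for B
      by (simp add: powr_add)
    from conjunct2[OF *]
    show "norm (jacobi_P_remainder N \<nu> \<alpha> \<beta> \<zeta>) \<le> C * (exp (2 * \<zeta> * \<bar>Im \<nu>\<bar>) / norm \<nu> ^ N)"
      unfolding bdry_term_cos_zeta3 e p divide_divide_eq_left .
  qed
qed

lemma tendsto_jacobi_P_remainder:
  fixes f :: "'b \<Rightarrow> complex"
  assumes f: "(f \<longlongrightarrow> \<alpha>) F" and F: "F \<noteq> bot" and par: "jac_params \<kappa> M \<nu> \<alpha> \<beta> \<omega>" and \<zeta>: "0 < \<zeta>" "\<zeta> < pi / 2"
  shows "((\<lambda>x. jacobi_P_remainder N \<nu> (f x) \<beta> \<zeta>) \<longlongrightarrow>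
      jacobi_P_remainder N \<nu> \<alpha> \<beta> \<zeta>) F"
proof -
  note p = jac_params_D[OF par]
  have sc: "sin \<zeta> > 0" "cos \<zeta> > 0" using \<zeta> by (simp_all add: sin_gt_zero2 cos_gt_zero)
  have rG: "((\<lambda>x. rGamma (g x)) \<longlongrightarrow> rGamma c) F" if "(g \<longlongrightarrow> c) F" for g :: "'b \<Rightarrow> complex" and c
  proof -
    have "isCont rGamma c" using continuous_on_rGamma[of UNIV] continuous_on_eq_continuous_at[OF open_UNIV] by blast
    thus ?thesis by (rule isCont_tendsto_compose) (rule that)
  qed
  have "(1 - complex_of_real (cos (2 * \<zeta>))) / 2 = of_real ((sin \<zeta>)\<^sup>2)" by (simp add: cos_double_sin)
  moreover have "(sin \<zeta>)\<^sup>2 < 1" using sc sin_cos_squared_add[of \<zeta>] zero_less_power[OF sc(2), of 2] by linarith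
  ultimately have t: "norm ((1 - complex_of_real (cos (2 * \<zeta>))) / 2) < 1" by (simp add: norm_power)
  have P: "((\<lambda>x. jacobi_P \<nu> (f x) \<beta> (of_real (cos (2 * \<zeta>)))) \<longlongrightarrow> jacobi_P \<nu> \<alpha> \<beta> (of_real (cos (2 * \<zeta>)))) F"
    unfolding jacobi_P_def hyp_F_eq_series[OF t]
    by (intro tendsto_mult tendsto_hyp_F_series_params tendsto_Gamma tendsto_add tendsto_const f t F p(6))
  have B: "((\<lambda>x. Beta (\<nu> + f x + 1) (\<nu> + \<beta> + 1)) \<longlongrightarrow> Beta (\<nu> + \<alpha> + 1) (\<nu> + \<beta> + 1)) F"
    unfolding Beta_altdef by (intro tendsto_mult tendsto_Gamma rG tendsto_add tendsto_const f p(6))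
  have W: "((\<lambda>x. (2::complex) powr (2 * \<nu> + f x + \<beta> + 1)) \<longlongrightarrow> 2 powr (2 * \<nu> + \<alpha> + \<beta> + 1)) F"
    by (intro tendsto_powr_complex tendsto_add tendsto_const f) auto
  have d: "(2::complex) powr (2 * \<nu> + \<alpha> + \<beta> + 1) * Beta (\<nu> + \<alpha> + 1) (\<nu> + \<beta> + 1) \<noteq> 0"
    using jacobi_Q_bdry_normalized(1)[OF \<zeta> _ par, of 1] by (auto simp: powr_def)
  have "((\<lambda>x. bdry_fac (f x) \<beta> \<zeta>) \<longlongrightarrow> bdry_fac \<alpha> \<beta> \<zeta>) F"
    unfolding bdry_fac_eq_exp[OF sc] by (intro tendsto_intros f)
  moreover have co: "((\<lambda>x. jacobi_coeff l (f x)) \<longlongrightarrow> jacobi_coeff l \<alpha>) F" for l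
    unfolding jacobi_coeff_def by (intro tendsto_divide tendsto_mult tendsto_pochhammer tendsto_add
        tendsto_diff tendsto_const f) simp
  have z: "((\<lambda>x. zeta3 \<nu> (f x) \<beta> \<zeta> n l) \<longlongrightarrow> zeta3 \<nu> \<alpha> \<beta> \<zeta> n l) F" for n l
    unfolding zeta3_def by (intro tendsto_intros f) simp_all
  have np: "2 * \<nu> + \<alpha> + \<beta> + of_nat n + 2 \<notin> \<int>\<^sub>\<le>\<^sub>0" for n
  proof
    assume "2 * \<nu> + \<alpha> + \<beta> + of_nat n + 2 \<in> \<int>\<^sub>\<le>\<^sub>0"
    hence "2 * \<nu> + \<alpha> + \<beta> + of_nat n + 2 - of_nat n \<in> \<int>\<^sub>\<le>\<^sub>0" by (rule nonpos_Ints_diff_Nats) simp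
    moreover have "2 * \<nu> + \<alpha> + \<beta> + of_nat n + 2 - of_nat n = 2 * \<nu> + \<alpha> + \<beta> + 2" by simp
    ultimately show False using p(3) by (simp only:)
  qed
  have "((\<lambda>x. trig_term (\<lambda>l. cos (zeta3 \<nu> (f x) \<beta> \<zeta> n l)) n \<nu> (f x) \<beta> \<zeta>) \<longlongrightarrow> trig_term
      (\<lambda>l. cos (zeta3 \<nu> \<alpha> \<beta> \<zeta> n l)) n \<nu> \<alpha> \<beta> \<zeta>) F" for n
    unfolding trig_term_def
    using sc by (intro tendsto_mult tendsto_divide tendsto_sum tendsto_const tendsto_Gamma tendsto_add co
        isCont_tendsto_compose[OF isCont_cos] z f p(3) np)
      (auto simp: Gamma_eq_zero_iff np)
  ultimately show ?thesis
    by (intro tendsto_diff tendsto_mult tendsto_divide tendsto_sum tendsto_const P B W d)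
qed

lemma jacobi_P_expansion:
  assumes "\<epsilon> > 0" "\<delta> > 0"
  shows "uniform_expansion \<epsilon> \<delta> M
    (\<lambda>\<nu> \<alpha> \<beta> \<zeta>. of_real pi * jacobi_P \<nu> \<alpha> \<beta> (of_real (cos (2 * \<zeta>))) / (2 powr (2 * \<nu> + \<alpha> + \<beta> + 1) * Beta
        (\<nu> + \<alpha> + 1) (\<nu> + \<beta> + 1)))
    bdry_fac (\<lambda>n \<nu> \<alpha> \<beta> \<zeta>. trig_term (\<lambda>l. cos (zeta3 \<nu> \<alpha> \<beta> \<zeta> n l)) n \<nu> \<alpha> \<beta> \<zeta>)"
proof (rule uniform_expansionI[OF assms(2)])
  fix N \<kappa> assume "\<kappa> > (0::real)"
  from jacobi_P_expansion_aux[OF assms(1) this, of "M + 1" N]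
  obtain C R where CR: "\<And>\<nu> \<alpha> \<beta> \<omega> \<zeta>. jac_params \<kappa> (M + 1) \<nu> \<alpha> \<beta> \<omega> \<Longrightarrow> R \<le> norm \<nu> \<Longrightarrow> \<alpha> \<notin> \<int> \<Longrightarrow> \<epsilon> \<le> \<zeta> \<Longrightarrow> \<zeta> \<le> pi / 2 - \<epsilon> \<Longrightarrow>
       norm (jacobi_P_remainder N \<nu> \<alpha> \<beta> \<zeta>) \<le> C * (exp (2 * \<zeta> * \<bar>Im \<nu>\<bar>) / norm \<nu> ^ N)"
    by (elim exE) blast
  show "\<exists>C R. \<forall>\<nu> \<alpha> \<beta> \<omega> \<zeta>. jac_params \<kappa> (M + 1) \<nu> \<alpha> \<beta> \<omega> \<longrightarrow> R \<le> norm \<nu> \<longrightarrow> norm \<alpha> \<le> M \<longrightarrow> \<epsilon> \<le> \<zeta> \<longrightarrow> \<zeta> \<le> pi / 2 - \<epsilon> \<longrightarrow>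
       norm (jacobi_P_remainder N \<nu> \<alpha> \<beta> \<zeta>) \<le> C * (exp (2 * \<zeta> * \<bar>Im \<nu>\<bar>) / norm \<nu> ^ N)"
  proof (rule exI[of _ C], rule exI[of _ R], intro allI impI)
    fix \<nu> \<alpha> \<beta> \<omega> :: complex and \<zeta> :: real
    assume H: "jac_params \<kappa> (M + 1) \<nu> \<alpha> \<beta> \<omega>" "R \<le> norm \<nu>" "norm \<alpha> \<le> M" "\<epsilon> \<le> \<zeta>" "\<zeta> \<le> pi / 2 - \<epsilon>"
    have \<zeta>: "0 < \<zeta>" "\<zeta> < pi / 2" using H(4,5) assms(1) by linarith+
    \<comment> \<open>C depends on neither \<alpha> nor h, so the estimate at \<alpha> + h passes to
      h = 0 by continuity of the remainder with \<nu> and \<zeta> fixed.\<close>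
    define f where "f = (\<lambda>h::real. \<alpha> + of_real h)"
    have "(f \<longlongrightarrow> \<alpha> + of_real 0) (at_right 0)" unfolding f_def by (intro tendsto_intros)
    hence f: "(f \<longlongrightarrow> \<alpha>) (at_right 0)" by simp
    \<comment> \<open>At most one h in (0, 1) makes \<alpha> + h an integer, so none does for small
      h > 0.\<close>
    have gap: False if "f h \<in> \<int>" "f h' \<in> \<int>" "0 < h" "h < h'" "h' < 1" for h h'
    proof -
      from Ints_diff[OF that(2,1)] have "complex_of_real (h' - h) \<in> \<int>" by (simp add: f_def)
      then obtain k where "complex_of_real (h' - h) = of_int k" by (elim Ints_cases)
      hence "h' - h = of_int k" by (metis of_real_eq_iff of_real_of_int_eq)
      with that(3-5) have "0 < k" "k < 1" by linarith+
      thus False by simp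
    qed
    have "\<exists>d>0. \<forall>h>0. h < d \<longrightarrow> f h \<notin> \<int>"
    proof (cases "\<exists>h'>0. h' < 1 \<and> f h' \<in> \<int>")
      case True
      thus ?thesis using gap by blast
    next
      case False
      thus ?thesis by (intro exI[of _ 1]) auto
    qed
    hence nI: "eventually (\<lambda>h. f h \<notin> \<int>) (at_right 0)" by (auto simp: eventually_at_right_field)
    have M1: "eventually (\<lambda>h. norm (f h) \<le> M + 1) (at_right 0)"
    proof -
      have "norm \<alpha> < M + 1" using H(3) by simp
      from order_tendstoD(2)[OF tendsto_norm[OF f] this] show ?thesis by (rule eventually_mono) simp
    qed
    have "eventually (\<lambda>h. norm (jacobi_P_remainder N \<nu> (f h) \<beta> \<zeta>) \<le> C * (exp (2 * \<zeta> * \<bar>Im \<nu>\<bar>) / norm \<nu> ^ N)) (at_right 0)"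
      using nI M1
    proof eventually_elim
      case (elim h)
      have "jac_params \<kappa> (M + 1) \<nu> (f h) \<beta> \<omega>" using H(1) elim(2) by (simp add: jac_params_def)
      from CR[OF this H(2) elim(1) H(4,5)] show ?case .
    qed
    thus "norm (jacobi_P_remainder N \<nu> \<alpha> \<beta> \<zeta>) \<le> C * (exp (2 * \<zeta> * \<bar>Im \<nu>\<bar>) / norm \<nu> ^ N)"
      by (rule tendsto_upperbound[OF tendsto_norm[OF tendsto_jacobi_P_remainder[OF f
          trivial_limit_at_right_real H(1) \<zeta>]] _ trivial_limit_at_right_real])
  qed
qed

theorem theorem1p4:
  fixes \<epsilon> \<delta> M :: real
  assumes "\<epsilon> > 0" and "\<delta> > 0"
  shows
    "uniform_expansion \<epsilon> \<delta> M
       (\<lambda>\<nu> \<alpha> \<beta> \<zeta>. of_real pi * jacobi_P \<nu> \<alpha> \<beta> (of_real (cos (2 * \<zeta>))) /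
          (2 powr (2 * \<nu> + \<alpha> + \<beta> + 1) * Beta (\<nu> + \<alpha> + 1) (\<nu> + \<beta> + 1)))
       (\<lambda>\<alpha> \<beta> \<zeta>. 1 / (of_real (sin \<zeta>) powr (\<alpha> + 1/2) * of_real (cos \<zeta>) powr (\<beta> + 1/2)))
       (\<lambda>n \<nu> \<alpha> \<beta> \<zeta>. (-1) ^ n *
          (\<Sum>l=0..n. jacobi_coeff l \<alpha> * jacobi_coeff (n - l) \<beta> /
             (of_real (sin \<zeta>) ^ l * of_real (cos \<zeta>) ^ (n - l)) * cos (zeta3 \<nu> \<alpha> \<beta> \<zeta> n l)) *
          (Gamma (2 * \<nu> + \<alpha> + \<beta> + 2) / Gamma (2 * \<nu> + \<alpha> + \<beta> + of_nat n + 2)))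
   \<and> uniform_expansion \<epsilon> \<delta> M
       (\<lambda>\<nu> \<alpha> \<beta> \<zeta>. jacobi_Q_cut \<nu> \<alpha> \<beta> (cos (2 * \<zeta>)) /
          (2 powr (2 * \<nu> + \<alpha> + \<beta>) * Beta (\<nu> + \<alpha> + 1) (\<nu> + \<beta> + 1)))
       (\<lambda>\<alpha> \<beta> \<zeta>. 1 / (of_real (sin \<zeta>) powr (\<alpha> + 1/2) * of_real (cos \<zeta>) powr (\<beta> + 1/2)))
       (\<lambda>n \<nu> \<alpha> \<beta> \<zeta>. (-1) ^ n *
          (\<Sum>l=0..n. jacobi_coeff l \<alpha> * jacobi_coeff (n - l) \<beta> /
             (of_real (sin \<zeta>) ^ l * of_real (cos \<zeta>) ^ (n - l)) * cos (zeta4 \<nu> \<alpha> \<beta> \<zeta> n l)) *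
          (Gamma (2 * \<nu> + \<alpha> + \<beta> + 2) / Gamma (2 * \<nu> + \<alpha> + \<beta> + of_nat n + 2)))
   \<and> uniform_expansion \<epsilon> \<delta> M
       (\<lambda>\<nu> \<alpha> \<beta> \<zeta>. jacobi_Q_cut_phase \<nu> \<alpha> \<beta> (cos (2 * \<zeta>)) /
          (2 powr (2 * \<nu> + \<alpha> + \<beta>) * Beta (\<nu> + \<alpha> + 1) (\<nu> + \<beta> + 1)))
       (\<lambda>\<alpha> \<beta> \<zeta>. -1 / (of_real (sin \<zeta>) powr (\<alpha> + 1/2) * of_real (cos \<zeta>) powr (\<beta> + 1/2)))
       (\<lambda>n \<nu> \<alpha> \<beta> \<zeta>. (-1) ^ n *
          (\<Sum>l=0..n. jacobi_coeff l \<alpha> * jacobi_coeff (n - l) \<beta> /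
             (of_real (sin \<zeta>) ^ l * of_real (cos \<zeta>) ^ (n - l)) * sin (zeta3 \<nu> \<alpha> \<beta> \<zeta> n l)) *
          (Gamma (2 * \<nu> + \<alpha> + \<beta> + 2) / Gamma (2 * \<nu> + \<alpha> + \<beta> + of_nat n + 2)))"
proof -
  have minus: "- 1 / (of_real (sin \<zeta>) powr (\<alpha> + 1/2) * of_real (cos \<zeta>) powr (\<beta> + 1/2)) = - bdry_fac \<alpha> \<beta> \<zeta>" for \<alpha> \<beta> \<zeta>
    by (simp add: bdry_fac_def)
  show ?thesis
    unfolding minus
    using jacobi_P_expansion[OF assms, of M] jacobi_Q_cut_expansion[OF assms, of M]
        jacobi_Q_cut_phase_expansion[OF assms, of M]
    unfolding trig_term_def bdry_fac_def[abs_def] by (intro conjI)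
qed

end
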